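(* Let $F$ be a field with $\mathrm{char}(F)\neq 2$, let $\ell\ge 1$ be an integer, and let $\pi:X\to\mathbb{P}^1$ be a (smooth projective) hyperelliptic curve of genus $g$ defined over $F$, ramified in $\infty_X=\pi^{-1}(\infty)$. Let $L=\mathcal{O}_X(2\ell\infty_X)$, and assume that the number of $\overline{F}$-inflection points of the complete linear series $|L|$ is finite. Then there is a well-defined arithmetic $F$-inflection class of $|L|$ in $\mathrm{GW}(F)$, given by $$[\mathrm{Inf}_F(|L|)]_{\mathbb{A}^1}=\frac{\gamma_{\mathbb{C}}}{2}\cdot\mathbb{H},\qquad\text{where}\qquad \gamma_{\mathbb{C}}:=\begin{cases}\ell(\ell+1)(g+1)&\text{if }\ell\le g\\ g(2\ell-g+1)^2&\text{if }\ell>g\end{cases}$$ is the $\mathbb{C}$-inflectionary degree computed by the usual Plücker formula (i.e. the degree of the line bundle $L^{\otimes(r+1)}\otimes K_X^{\otimes\binom{r+1}{2}}$, where $r+1=h^0(X,L)$).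
   Context: The curve $X$ is given away from $\infty_X$ by an affine equation $y^2=f(x)$ with $f\in F[x]$ of degree $2g+1$, $g\ge1$, and $\pi$ is $(x,y)\mapsto x$; $\infty_X$ is $F$-rational. $\mathrm{GW}(F)$ is the Grothendieck--Witt group (group completion of isometry classes of nondegenerate symmetric bilinear forms over $F$), $\langle a\rangle$ is the class of the rank one form $(u,v)\mapsto auv$, and $\mathbb{H}=\langle1\rangle+\langle-1\rangle$. Principal parts. If $z$ is a regular function on an open $U\subset X$ with $dz$ nowhere vanishing, the Hasse derivatives $\frac{D^k}{dz}:\mathcal{O}_U\to\mathcal{O}_U$ ($k\ge0$) are the unique $F$-linear maps with $D^0=\mathrm{id}$, satisfying $\frac{D^k(\phi\psi)}{dz}=\sum_{i}\frac{D^i\phi}{dz}\frac{D^{k-i}\psi}{dz}$ and $\frac{D^k z^n}{dz}=\binom nk z^{n-k}$. The bundle of principal parts $J^{r+1}(L)$ is the rank $r+1$ bundle whose local sections record Taylor expansions of sections of $L$ to order $r$ (fibers $H^0(L/L(-(r+1)p))$); given an open $U\subset X$, a generator $s$ of $L|_U$ and a regular function $z$ on $U$ with $dz$ nowhere vanishing, it is trivialized over $U$ so that the evaluation map $\mathrm{ev}:H^0(L)\otimes\mathcal{O}_X\to J^{r+1}(L)$ sends $v=\phi s$ to $(\frac{D^i\phi}{dz})_{0\le i\le r}$. Here $r+1=h^0(L)$. An $\overline F$-inflection point is a geometric point of $X$ where $\mathrm{ev}$ is not surjective. Choosing a basis $\lambda$ of $H^0(L)$, the determinant of $\mathrm{ev}$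 is a section $w(\lambda)$ (the Hasse Wronskian) of $\mathcal{E}:=\det J^{r+1}(L)$ whose zeros are the inflection points. Relative orientation and Euler class. A line bundle $\mathcal{E}$ on $X$ is relatively oriented if one fixes an isomorphism $\mathcal{H}om(T_X,\mathcal{E})\cong\mathcal{N}^{\otimes2}$ with $\mathcal{N}$ a line bundle. A Nisnevich chart at a closed point $p$ is an étale map $t:U\to\mathbb{A}^1_F$ from an open neighborhood of $p$ inducing an isomorphism $k(t(p))\cong k(p)$; a trivialization of $\mathcal{E}|_U$ with generator $e$ is compatible with $t$ if the element of $\mathcal{H}om(T_U,\mathcal{E}|_U)$ sending the vector field dual to $dt$ to $e$ is a square in $H^0(\mathcal{N}|_U^{\otimes 2})$. If $\sigma\in H^0(\mathcal{E})$ has an isolated zero at $p$, let $\phi=\sigma/e$ for a compatible trivialization, let $\mathfrak{m}_p^n\subset(\phi)$, choose $G\in F[t]$ with $G-\phi\in\mathfrak{m}_p^{2n}$, and put $A=\mathcal{O}_{X,p}/(\phi)\cong F[t]_{t(p)}/(G)$. Write the image of $\frac{G(t_1)-G(t_2)}{t_1-t_2}$ in $A\otimes_FA$ as $\sum a_i\otimes b_i$; there is a unique $F$-linear $\eta:A\to F$ with $\sum_i\eta(a_i)b_i=1$, and the local Euler index $\mathrm{ind}_p(\sigma)\in\mathrm{GW}(F)$ is the class of the form $(a,b)\mapsto\eta(ab)$ on $A$. The $\mathbb{A}^1$-Euler class is $e(\mathcal{E})=\sum_{p:\sigma(p)=0}\mathrm{ind}_p(\sigma)$ for any section $\sigma$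 with isolated zeros (it is known to be independent of $\sigma$). The arithmetic $F$-inflection class $[\mathrm{Inf}_F(|L|)]_{\mathbb{A}^1}$ is $e(\det J^{r+1}(L))$. *)

theory Defs
  imports
    "HOL-Algebra.Ideal"
    "HOL-Algebra.Algebraic_Closure_Type"
    "Jordan_Normal_Form.Determinant"
begin

section \<open>The Grothendieck--Witt group of a field\<close>

text \<open>
  A nondegenerate symmetric bilinear form on \<open>F^n\<close> is given by its Gram matrix; every
  finite-dimensional form is isometric to one of these.  The case \<open>n = 0\<close> is allowed.
\<close>

definition nondeg_sym :: "'a::field mat \<Rightarrow> bool" where
  "nondeg_sym A \<longleftrightarrow> square_mat A \<and> transpose_mat A = A \<and> det A \<noteq> 0"

definition isometric :: "'a::field mat \<Rightarrow> 'a mat \<Rightarrow> bool" where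
  "isometric A B \<longleftrightarrow> nondeg_sym A \<and> nondeg_sym B \<and> dim_row A = dim_row B \<and>
     (\<exists>P \<in> carrier_mat (dim_row A) (dim_row A). det P \<noteq> 0 \<and> B = transpose_mat P * A * P)"

definition orth_sum :: "'a::field mat \<Rightarrow> 'a mat \<Rightarrow> 'a mat" where
  "orth_sum A B = four_block_mat A (0\<^sub>m (dim_row A) (dim_col B)) (0\<^sub>m (dim_row B) (dim_col A)) B"

lemma nondeg_symI:
  assumes "A \<in> carrier_mat n n" "transpose_mat A = A" "det A \<noteq> 0"
  shows "nondeg_sym A"
  unfolding nondeg_sym_def using assms(2,3) carrier_matD[OF assms(1)] by simp

lemma nondeg_symE:
  assumes "nondeg_sym A"
  obtains n where "A \<in> carrier_mat n n" "transpose_mat A = A" "det A \<noteq> 0"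
  using assms unfolding nondeg_sym_def square_mat.simps by (metis carrier_matI)

lemma isometricI:
  assumes "nondeg_sym A" "nondeg_sym B" "A \<in> carrier_mat n n" "B \<in> carrier_mat n n"
    "P \<in> carrier_mat n n" "det P \<noteq> 0" "B = transpose_mat P * A * P"
  shows "isometric A B"
  unfolding isometric_def carrier_matD[OF assms(3)] carrier_matD[OF assms(4)]
  using assms by blast

lemma isometricE:
  assumes "isometric A B"
  obtains n P where "nondeg_sym A" "nondeg_sym B" "A \<in> carrier_mat n n" "B \<in> carrier_mat n n"
    "P \<in> carrier_mat n n" "det P \<noteq> 0" "B = transpose_mat P * A * P"
proof -
  from assms have A: "nondeg_sym A" and B: "nondeg_sym B" and d: "dim_row A = dim_row B"
    unfolding isometric_def by blast+
  obtain n where n: "A \<in> carrier_mat n n" using A by (rule nondeg_symE)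
  obtain m where m: "B \<in> carrier_mat m m" using B by (rule nondeg_symE)
  have "m = n" using d carrier_matD(1)[OF n] carrier_matD(1)[OF m] by simp
  hence Bn: "B \<in> carrier_mat n n" using m by simp
  from assms obtain P where "P \<in> carrier_mat n n" "det P \<noteq> 0" "B = transpose_mat P * A * P"
    unfolding isometric_def carrier_matD(1)[OF n] by blast
  thus ?thesis using that A B n Bn by blast
qed

lemma isometric_refl:
  assumes "nondeg_sym A" shows "isometric A A"
proof -
  obtain n where n: "A \<in> carrier_mat n n" using assms by (rule nondeg_symE)
  have "A = transpose_mat (1\<^sub>m n) * A * 1\<^sub>m n" using n by simp
  thus ?thesis using isometricI[OF assms assms n n, of "1\<^sub>m n"] by simp
qed

lemma isometric_sym:
  assumes "isometric A B" shows "isometric B A"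
proof -
  from assms obtain n P where A: "nondeg_sym A" and B: "nondeg_sym B"
    and Ac: "A \<in> carrier_mat n n" and Bc: "B \<in> carrier_mat n n"
    and P: "P \<in> carrier_mat n n" and dP: "det P \<noteq> 0" and BP: "B = transpose_mat P * A * P"
    by (rule isometricE)
  from det_non_zero_imp_unit[OF P dP]
  obtain Q where Q: "Q \<in> carrier_mat n n" and PQ: "P * Q = 1\<^sub>m n"
    unfolding Units_def ring_mat_simps by blast
  have tP: "transpose_mat P \<in> carrier_mat n n" and tQ: "transpose_mat Q \<in> carrier_mat n n"
    using P Q by auto
  have AP: "A * P \<in> carrier_mat n n" using Ac P by auto
  have tt: "transpose_mat Q * transpose_mat P = 1\<^sub>m n"
    using transpose_mult[OF P Q] PQ by simp
  have "transpose_mat Q * B * Q = transpose_mat Q * (transpose_mat P * (A * P)) * Q"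
    unfolding BP assoc_mult_mat[OF tP Ac P] ..
  also have "\<dots> = (transpose_mat Q * transpose_mat P) * (A * P) * Q"
    unfolding assoc_mult_mat[OF tQ tP AP] ..
  also have "\<dots> = (A * P) * Q" unfolding tt left_mult_one_mat[OF AP] ..
  also have "\<dots> = A * (P * Q)" by (rule assoc_mult_mat[OF Ac P Q])
  also have "\<dots> = A" unfolding PQ by (rule right_mult_one_mat[OF Ac])
  finally have AB: "A = transpose_mat Q * B * Q" by (rule sym)
  have dQ: "det Q \<noteq> 0" using det_mult[OF P Q] PQ by auto
  show ?thesis by (rule isometricI[OF B A Bc Ac Q dQ AB])
qed

lemma isometric_trans:
  assumes "isometric A B" "isometric B C" shows "isometric A C"
proof -
  from assms(1) obtain n P where A: "nondeg_sym A" and Ac: "A \<in> carrier_mat n n"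
    and Bc: "B \<in> carrier_mat n n"
    and P: "P \<in> carrier_mat n n" and dP: "det P \<noteq> 0" and BP: "B = transpose_mat P * A * P"
    by (rule isometricE)
  from assms(2) obtain m Q where C: "nondeg_sym C" and Bm: "B \<in> carrier_mat m m"
    and Cm: "C \<in> carrier_mat m m"
    and Qm: "Q \<in> carrier_mat m m" and dQ: "det Q \<noteq> 0" and CQ: "C = transpose_mat Q * B * Q"
    by (rule isometricE)
  have "m = n" using carrier_matD(1)[OF Bc] carrier_matD(1)[OF Bm] by simp
  hence Cc: "C \<in> carrier_mat n n" and Q: "Q \<in> carrier_mat n n" using Cm Qm by auto
  have tP: "transpose_mat P \<in> carrier_mat n n" and tQ: "transpose_mat Q \<in> carrier_mat n n"
    using P Q by auto
  have PQ: "P * Q \<in> carrier_mat n n" and tPA: "transpose_mat P * A \<in> carrier_mat n n"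
    using P Q tP Ac by auto
  have tQPA: "transpose_mat Q * (transpose_mat P * A) \<in> carrier_mat n n" using tQ tPA by auto
  have "transpose_mat (P * Q) * A * (P * Q) = transpose_mat Q * transpose_mat P * A * (P * Q)"
    unfolding transpose_mult[OF P Q] ..
  also have "\<dots> = transpose_mat Q * (transpose_mat P * A) * (P * Q)"
    unfolding assoc_mult_mat[OF tQ tP Ac] ..
  also have "\<dots> = transpose_mat Q * (transpose_mat P * A) * P * Q"
    by (rule assoc_mult_mat[OF tQPA P Q, symmetric])
  also have "\<dots> = transpose_mat Q * (transpose_mat P * A * P) * Q"
    unfolding assoc_mult_mat[OF tQ tPA P] ..
  finally have CPQ: "C = transpose_mat (P * Q) * A * (P * Q)" unfolding CQ BP by (rule sym)
  have dPQ: "det (P * Q) \<noteq> 0" using det_mult[OF P Q] dP dQ by simp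
  show ?thesis by (rule isometricI[OF A C Ac Cc PQ dPQ CPQ])
qed

lemma nondeg_sym_empty: "nondeg_sym (0\<^sub>m 0 0)"
  by (rule nondeg_symI[of _ 0]) (auto simp: det_dim_zero)

lemma orth_sum_altdef:
  assumes "A \<in> carrier_mat n n" "B \<in> carrier_mat m m"
  shows "orth_sum A B = four_block_mat A (0\<^sub>m n m) (0\<^sub>m m n) B"
  unfolding orth_sum_def using carrier_matD[OF assms(1)] carrier_matD[OF assms(2)] by simp

lemma orth_sum_carrier:
  assumes "A \<in> carrier_mat n n" "B \<in> carrier_mat m m"
  shows "orth_sum A B \<in> carrier_mat (n + m) (n + m)"
  unfolding orth_sum_altdef[OF assms] using assms by (rule four_block_carrier_mat)

lemma det_orth_sum:
  assumes "A \<in> carrier_mat n n" "B \<in> carrier_mat m m"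
  shows "det (orth_sum A B) = det A * det B"
  unfolding orth_sum_altdef[OF assms]
  by (rule det_four_block_mat_upper_right_zero[OF assms(1) refl _ assms(2)]) simp

lemma transpose_orth_sum:
  assumes "A \<in> carrier_mat n n" "B \<in> carrier_mat m m"
  shows "transpose_mat (orth_sum A B) = orth_sum (transpose_mat A) (transpose_mat B)"
proof -
  have t: "transpose_mat A \<in> carrier_mat n n" "transpose_mat B \<in> carrier_mat m m"
    using assms by auto
  show ?thesis
    unfolding orth_sum_altdef[OF assms] orth_sum_altdef[OF t]
    using transpose_four_block_mat[OF assms(1) zero_carrier_mat zero_carrier_mat assms(2)] by simp
qed

lemma mult_orth_sum:
  assumes "A \<in> carrier_mat n n" "B \<in> carrier_mat m m" "C \<in> carrier_mat n n" "D \<in> carrier_mat m m"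
  shows "orth_sum A B * orth_sum C D = orth_sum (A * C) (B * D)"
proof -
  have c: "A * C \<in> carrier_mat n n" "B * D \<in> carrier_mat m m" using assms by auto
  show ?thesis
    unfolding orth_sum_altdef[OF assms(1,2)] orth_sum_altdef[OF assms(3,4)] orth_sum_altdef[OF c]
      mult_four_block_mat[OF assms(1) zero_carrier_mat zero_carrier_mat assms(2)
        assms(3) zero_carrier_mat zero_carrier_mat assms(4)]
    using assms c by simp
qed

lemma nondeg_sym_orth_sum:
  assumes "nondeg_sym A" "nondeg_sym B" shows "nondeg_sym (orth_sum A B)"
proof -
  obtain n where A: "A \<in> carrier_mat n n" "transpose_mat A = A" "det A \<noteq> 0"
    using assms(1) by (rule nondeg_symE)
  obtain m where B: "B \<in> carrier_mat m m" "transpose_mat B = B" "det B \<noteq> 0"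
    using assms(2) by (rule nondeg_symE)
  show ?thesis
    by (rule nondeg_symI[OF orth_sum_carrier[OF A(1) B(1)]])
       (simp_all only: transpose_orth_sum[OF A(1) B(1)] det_orth_sum[OF A(1) B(1)] A(2,3) B(2,3)
         mult_eq_0_iff simp_thms)
qed

lemma isometric_orth_sum:
  assumes "isometric A A'" "isometric B B'"
  shows "isometric (orth_sum A B) (orth_sum A' B')"
proof -
  from assms(1) obtain n P where A: "nondeg_sym A" "nondeg_sym A'"
    "A \<in> carrier_mat n n" "A' \<in> carrier_mat n n"
    and P: "P \<in> carrier_mat n n" "det P \<noteq> 0" "A' = transpose_mat P * A * P"
    by (rule isometricE)
  from assms(2) obtain m Q where B: "nondeg_sym B" "nondeg_sym B'"
    "B \<in> carrier_mat m m" "B' \<in> carrier_mat m m"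
    and Q: "Q \<in> carrier_mat m m" "det Q \<noteq> 0" "B' = transpose_mat Q * B * Q"
    by (rule isometricE)
  have t: "transpose_mat P \<in> carrier_mat n n" "transpose_mat Q \<in> carrier_mat m m"
    using P(1) Q(1) by auto
  have t2: "transpose_mat P * A \<in> carrier_mat n n" "transpose_mat Q * B \<in> carrier_mat m m"
    using t A(3) B(3) by auto
  have eq: "orth_sum A' B' = transpose_mat (orth_sum P Q) * orth_sum A B * orth_sum P Q"
    unfolding P(3) Q(3) transpose_orth_sum[OF P(1) Q(1)] mult_orth_sum[OF t A(3) B(3)]
      mult_orth_sum[OF t2 P(1) Q(1)] ..
  have d: "det (orth_sum P Q) \<noteq> 0" using det_orth_sum[OF P(1) Q(1)] P(2) Q(2) by simp
  show ?thesis
    by (rule isometricI[OF nondeg_sym_orth_sum[OF A(1) B(1)] nondeg_sym_orth_sum[OF A(2) B(2)]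
          orth_sum_carrier[OF A(3) B(3)] orth_sum_carrier[OF A(4) B(4)]
          orth_sum_carrier[OF P(1) Q(1)] d eq])
qed

lemma orth_sum_assoc: "orth_sum (orth_sum A B) C = orth_sum A (orth_sum B C)"
  unfolding orth_sum_def by (rule assoc_four_block_mat[symmetric])

lemma orth_sum_empty: "orth_sum (0\<^sub>m 0 0) A = A"
  unfolding orth_sum_def by (rule eq_matI) auto

lemma isometric_orth_sum_commute:
  assumes "nondeg_sym A" "nondeg_sym B"
  shows "isometric (orth_sum A B) (orth_sum B A)"
proof -
  obtain n where A: "A \<in> carrier_mat n n" using assms(1) by (rule nondeg_symE)
  obtain m where B: "B \<in> carrier_mat m m" using assms(2) by (rule nondeg_symE)
  note z = zero_carrier_mat and o = one_carrier_mat
  define P :: "'a mat" where "P = four_block_mat (0\<^sub>m n m) (1\<^sub>m n) (1\<^sub>m m) (0\<^sub>m m n)"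
  have P': "P \<in> carrier_mat (n + m) (m + n)"
    unfolding P_def by (auto intro!: carrier_matI)
  hence P: "P \<in> carrier_mat (n + m) (n + m)" by (simp add: add.commute)
  have tP: "transpose_mat P = four_block_mat (0\<^sub>m m n) (1\<^sub>m m) (1\<^sub>m n) (0\<^sub>m n m)"
    unfolding P_def transpose_four_block_mat[OF z o o z] by simp
  have "transpose_mat P * P = four_block_mat (1\<^sub>m m) (0\<^sub>m m n) (0\<^sub>m n m) (1\<^sub>m n)"
    unfolding tP unfolding P_def mult_four_block_mat[OF z o o z z o o z] by simp
  also have "\<dots> = 1\<^sub>m (m + n)" by (rule eq_matI) auto
  finally have PP: "transpose_mat P * P = 1\<^sub>m (m + n)" .
  have tPc: "transpose_mat P \<in> carrier_mat (n + m) (n + m)" using P by simp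
  have "det (transpose_mat P) * det P = 1"
    using det_mult[OF tPc P] unfolding PP by simp
  hence dP: "det P \<noteq> 0" by auto
  have "transpose_mat P * orth_sum A B * P = four_block_mat (0\<^sub>m m n) B A (0\<^sub>m n m) * P"
    unfolding tP orth_sum_altdef[OF A B] mult_four_block_mat[OF z o o z A z z B]
    using A B by simp
  also have "\<dots> = orth_sum B A"
    unfolding P_def orth_sum_altdef[OF B A] mult_four_block_mat[OF z B A z z o o z]
    using A B by simp
  finally have eq: "orth_sum B A = transpose_mat P * orth_sum A B * P" by (rule sym)
  have BA: "orth_sum B A \<in> carrier_mat (n + m) (n + m)"
    using orth_sum_carrier[OF B A] by (simp add: add.commute)
  show ?thesis
    by (rule isometricI[OF nondeg_sym_orth_sum[OF assms] nondeg_sym_orth_sum[OF assms(2,1)]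
          orth_sum_carrier[OF A B] BA P dP eq])
qed

quotient_type (overloaded) 'a form_class = "'a::field mat" / partial: isometric
  morphisms rep_form_class form_class
  by (rule part_equivpI)
     (use isometric_refl nondeg_sym_empty isometric_sym isometric_trans
       in \<open>auto intro!: sympI transpI\<close>)

lemma isometric_self: "isometric A A \<longleftrightarrow> nondeg_sym A"
  using isometric_refl isometric_def by blast

instantiation form_class :: (field) comm_monoid_add
begin

lift_definition zero_form_class :: "'a form_class" is "0\<^sub>m 0 0"
  by (simp add: isometric_self nondeg_sym_empty)

lift_definition plus_form_class :: "'a form_class \<Rightarrow> 'a form_class \<Rightarrow> 'a form_class" is orth_sum
  by (rule isometric_orth_sum)

instance
proof
  fix a b c :: "'a form_class"
  show "a + b + c = a + (b + c)"
    by transfer (simp add: orth_sum_assoc isometric_self nondeg_sym_orth_sum)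
  show "a + b = b + a"
    by transfer (simp add: isometric_self isometric_orth_sum_commute)
  show "0 + a = a"
    by transfer (simp add: orth_sum_empty)
qed

end

text \<open>The group completion of a commutative monoid; \<open>(a, b)\<close> stands for \<open>a - b\<close>.\<close>

definition groth_rel :: "'m::comm_monoid_add \<times> 'm \<Rightarrow> 'm \<times> 'm \<Rightarrow> bool" where
  "groth_rel p q \<longleftrightarrow> (\<exists>c. fst p + snd q + c = fst q + snd p + c)"

lemma groth_rel_trans:
  assumes "groth_rel p q" "groth_rel q s" shows "groth_rel p s"
proof -
  obtain a1 a2 b1 b2 c1 c2 where pqs: "p = (a1, a2)" "q = (b1, b2)" "s = (c1, c2)"
    by (metis surj_pair)
  from assms pqs obtain u v where u: "a1 + b2 + u = b1 + a2 + u" and v: "b1 + c2 + v = c1 + b2 + v"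
    unfolding groth_rel_def by auto
  have "a1 + c2 + (b2 + u + v) = (a1 + b2 + u) + (c2 + v)" by (simp add: ac_simps)
  also have "\<dots> = (b1 + c2 + v) + (a2 + u)" unfolding u by (simp add: ac_simps)
  also have "\<dots> = c1 + a2 + (b2 + u + v)" unfolding v by (simp add: ac_simps)
  finally show ?thesis unfolding groth_rel_def pqs by auto
qed

quotient_type (overloaded) 'm groth = "'m::comm_monoid_add \<times> 'm" / groth_rel
  by (rule equivpI)
     (auto intro!: reflpI sympI transpI dest: groth_rel_trans simp: groth_rel_def, metis)

instantiation groth :: (comm_monoid_add) ab_group_add
begin

lift_definition zero_groth :: "'a groth" is "(0, 0)" .

lift_definition plus_groth :: "'a groth \<Rightarrow> 'a groth \<Rightarrow> 'a groth"
  is "\<lambda>p q. (fst p + fst q, snd p + snd q)"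
proof -
  fix p p' q q' :: "'a \<times> 'a"
  assume "groth_rel p p'" "groth_rel q q'"
  then obtain u v where u: "fst p + snd p' + u = fst p' + snd p + u"
    and v: "fst q + snd q' + v = fst q' + snd q + v" unfolding groth_rel_def by auto
  have "(fst p + fst q) + (snd p' + snd q') + (u + v)
      = (fst p + snd p' + u) + (fst q + snd q' + v)" by (simp add: ac_simps)
  also have "\<dots> = (fst p' + fst q') + (snd p + snd q) + (u + v)"
    unfolding u v by (simp add: ac_simps)
  finally show "groth_rel (fst p + fst q, snd p + snd q) (fst p' + fst q', snd p' + snd q')"
    unfolding groth_rel_def by auto
qed

lift_definition uminus_groth :: "'a groth \<Rightarrow> 'a groth" is "\<lambda>p. (snd p, fst p)"
  unfolding groth_rel_def by (metis add.commute fst_conv snd_conv)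

definition minus_groth :: "'a groth \<Rightarrow> 'a groth \<Rightarrow> 'a groth" where
  "minus_groth a b = a + - b"

instance
proof
  fix a b c :: "'a groth"
  show "a + b + c = a + (b + c)" by transfer (simp add: groth_rel_def ac_simps)
  show "a + b = b + a" by transfer (simp add: groth_rel_def ac_simps)
  show "0 + a = a" by transfer (simp add: groth_rel_def)
  show "- a + a = 0" by transfer (simp add: groth_rel_def ac_simps)
  show "a - b = a + - b" by (simp add: minus_groth_def)
qed

end

type_synonym 'a gw = "'a form_class groth"

definition gw_class :: "'a::field mat \<Rightarrow> 'a gw" where
  "gw_class A = abs_groth (form_class A, 0)"

definition gw_rank_one :: "'a::field \<Rightarrow> 'a gw" where
  "gw_rank_one a = gw_class (mat 1 1 (\<lambda>_. a))"

definition hyperbolic :: "'a::field gw" where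
  "hyperbolic = gw_rank_one 1 + gw_rank_one (- 1)"


section \<open>Hyperelliptic curves and their closed points\<close>

text \<open>
  The curve is described inside its function field, which is the whole type \<open>'k\<close>: \<open>emb\<close> is the
  inclusion of the constant field \<open>F\<close> (the type \<open>'a\<close>), \<open>xf\<close> and \<open>yf\<close> are the two affine
  coordinate functions and \<open>rhs\<close> is the polynomial \<open>f\<close> of the equation \<open>y^2 = f(x)\<close>.
  Since \<open>x\<close> is transcendental, \<open>deg f\<close> is odd and \<open>x, y\<close> generate \<open>'k\<close> over \<open>F\<close>, the field \<open>'k\<close>
  is the fraction field of \<open>F[x,y]/(y^2 - f(x))\<close>.  Smoothness is the Jacobian criterion at the
  geometric points of the affine part; the point at infinity is smooth in any case, because in
  the coordinates \<open>u = 1/x\<close>, \<open>v = y/x^(g+1)\<close> it is the origin of \<open>v^2 = u^(2g+2) f(1/u)\<close>, whose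
  right-hand side has a simple zero at \<open>u = 0\<close>.
\<close>

record (overloaded) ('a, 'k) hyp_curve =
  emb :: "'a \<Rightarrow> 'k"
  xf :: 'k
  yf :: 'k
  rhs :: "'a poly"
  genus :: nat

definition evalp :: "('a::field, 'k::field) hyp_curve \<Rightarrow> 'a poly \<Rightarrow> 'k \<Rightarrow> 'k" where
  "evalp C q h = poly (map_poly (emb C) q) h"

definition hyperelliptic_curve :: "('a::field, 'k::field) hyp_curve \<Rightarrow> bool" where
  "hyperelliptic_curve C \<longleftrightarrow>
     1 \<le> genus C \<and>
     Polynomial.degree (rhs C) = 2 * genus C + 1 \<and>
     emb C 1 = 1 \<and>
     (\<forall>a b. emb C (a + b) = emb C a + emb C b) \<and>
     (\<forall>a b. emb C (a * b) = emb C a * emb C b) \<and>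
     (\<forall>q. q \<noteq> 0 \<longrightarrow> evalp C q (xf C) \<noteq> 0) \<and>
     yf C ^ 2 = evalp C (rhs C) (xf C) \<and>
     (\<forall>h. \<exists>a b c. c \<noteq> 0 \<and>
        h = (evalp C a (xf C) + evalp C b (xf C) * yf C) / evalp C c (xf C)) \<and>
     (\<forall>a b :: 'a alg_closure. b ^ 2 = poly (map_poly to_ac (rhs C)) a \<longrightarrow>
        2 * b \<noteq> 0 \<or> poly (pderiv (map_poly to_ac (rhs C))) a \<noteq> 0)"

text \<open>
  Closed points are identified with their local rings in the function field.  The curve is glued
  from the spectra of \<open>F[x,y]\<close> and \<open>F[u,v]\<close>, and the origin of the second chart is the only
  point outside the first one.
\<close>

definition ring_on :: "'k::field set \<Rightarrow> 'k ring" where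
  "ring_on R = \<lparr>carrier = R, monoid.mult = (*), one = 1, ring.zero = 0, add = (+)\<rparr>"

definition loc_at :: "'k::field set \<Rightarrow> 'k set \<Rightarrow> 'k set" where
  "loc_at R I = {a / s | a s. a \<in> R \<and> s \<in> R - I}"

definition affine_ring :: "('a::field, 'k::field) hyp_curve \<Rightarrow> 'k set" where
  "affine_ring C = {evalp C a (xf C) + evalp C b (xf C) * yf C | a b. True}"

definition uf :: "('a::field, 'k::field) hyp_curve \<Rightarrow> 'k" where
  "uf C = inverse (xf C)"

definition vf :: "('a::field, 'k::field) hyp_curve \<Rightarrow> 'k" where
  "vf C = yf C / xf C ^ (genus C + 1)"

definition infty_pt :: "('a::field, 'k::field) hyp_curve \<Rightarrow> 'k set" where
  "infty_pt C = loc_at {evalp C a (uf C) + evalp C b (uf C) * vf C | a b. True}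
                       {evalp C a (uf C) + evalp C b (uf C) * vf C | a b. poly a 0 = 0}"

definition closed_points :: "('a::field, 'k::field) hyp_curve \<Rightarrow> 'k set set" where
  "closed_points C =
     insert (infty_pt C)
       {loc_at (affine_ring C) I | I. maximalideal I (ring_on (affine_ring C))}"

text \<open>Nonempty Zariski open subsets, given by their closed points.\<close>

definition open_subset :: "('a::field, 'k::field) hyp_curve \<Rightarrow> 'k set set \<Rightarrow> bool" where
  "open_subset C U \<longleftrightarrow> U \<subseteq> closed_points C \<and> finite (closed_points C - U)"

definition max_ideal :: "'k::field set \<Rightarrow> 'k set" where
  "max_ideal p = {a \<in> p. \<not> (\<exists>b \<in> p. a * b = 1)}"

definition submod_closed :: "'k::field set \<Rightarrow> 'k set \<Rightarrow> bool" where
  "submod_closed R M \<longleftrightarrow> 0 \<in> M \<and> (\<forall>a\<in>M. \<forall>b\<in>M. a + b \<in> M) \<and> (\<forall>c\<in>R. \<forall>a\<in>M. c * a \<in> M)"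

definition rspan :: "'k::field set \<Rightarrow> 'k set \<Rightarrow> 'k set" where
  "rspan R S = submod_closed R hull S"

fun max_pow :: "'k::field set \<Rightarrow> nat \<Rightarrow> 'k set" where
  "max_pow p 0 = p"
| "max_pow p (Suc n) = rspan p {a * b | a b. a \<in> max_ideal p \<and> b \<in> max_pow p n}"

text \<open>
  \<open>basis_mod C V W bs\<close>: the classes of \<open>bs\<close> form an \<open>F\<close>-basis of the quotient \<open>V/W\<close> of \<open>F\<close>-subspaces
  of the function field.
\<close>

definition basis_mod :: "('a::field, 'k::field) hyp_curve \<Rightarrow> 'k set \<Rightarrow> 'k set \<Rightarrow> 'k list \<Rightarrow> bool" where
  "basis_mod C V W bs \<longleftrightarrow> set bs \<subseteq> V \<and>
     (\<forall>v \<in> V. \<exists>!c. c \<in> carrier_vec (length bs) \<and>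
        v - (\<Sum>i<length bs. emb C (c $ i) * bs ! i) \<in> W)"

definition dim_mod :: "('a::field, 'k::field) hyp_curve \<Rightarrow> 'k set \<Rightarrow> 'k set \<Rightarrow> nat" where
  "dim_mod C V W = (THE n. \<exists>bs. length bs = n \<and> basis_mod C V W bs)"


section \<open>Line bundles\<close>

text \<open>
  On an integral curve every line bundle is isomorphic to an invertible \<open>O\<close>-submodule of the
  constant sheaf of rational functions.  Such a submodule \<open>M\<close> is given by its stalks \<open>M p\<close>.
  In terms of these, tensor products are products, \<open>Hom(M, N)\<close> is the colon module, and an
  isomorphism is multiplication by a nonzero rational function.
\<close>

type_synonym 'k subsheaf = "'k set \<Rightarrow> 'k set"

definition sections_on :: "'k subsheaf \<Rightarrow> 'k set set \<Rightarrow> 'k set" where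
  "sections_on M U = (\<Inter>p\<in>U. M p)"

definition H0 :: "('a::field, 'k::field) hyp_curve \<Rightarrow> 'k subsheaf \<Rightarrow> 'k set" where
  "H0 C M = sections_on M (closed_points C)"

definition h0 :: "('a::field, 'k::field) hyp_curve \<Rightarrow> 'k subsheaf \<Rightarrow> nat" where
  "h0 C M = dim_mod C (H0 C M) {0}"

definition generates_on :: "'k::field subsheaf \<Rightarrow> 'k set set \<Rightarrow> 'k \<Rightarrow> bool" where
  "generates_on M U s \<longleftrightarrow> s \<noteq> 0 \<and> (\<forall>p\<in>U. M p = {s * a | a. a \<in> p})"

definition line_bundle :: "('a::field, 'k::field) hyp_curve \<Rightarrow> 'k subsheaf \<Rightarrow> bool" where
  "line_bundle C M \<longleftrightarrow>
     (\<forall>p \<in> closed_points C. \<exists>U s. open_subset C U \<and> p \<in> U \<and> generates_on M U s)"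

definition tensor :: "'k::field subsheaf \<Rightarrow> 'k subsheaf \<Rightarrow> 'k subsheaf" where
  "tensor M N p = rspan p {a * b | a b. a \<in> M p \<and> b \<in> N p}"

fun tensor_pow :: "'k::field subsheaf \<Rightarrow> nat \<Rightarrow> 'k subsheaf" where
  "tensor_pow M 0 = (\<lambda>p. p)"
| "tensor_pow M (Suc n) = tensor M (tensor_pow M n)"

definition hom_sheaf :: "'k::field subsheaf \<Rightarrow> 'k subsheaf \<Rightarrow> 'k subsheaf" where
  "hom_sheaf M N p = {h. \<forall>a \<in> M p. h * a \<in> N p}"

definition bundle_iso :: "('a::field, 'k::field) hyp_curve \<Rightarrow> 'k subsheaf \<Rightarrow> 'k subsheaf \<Rightarrow> 'k \<Rightarrow> bool" where
  "bundle_iso C M N c \<longleftrightarrow> c \<noteq> 0 \<and> (\<forall>p \<in> closed_points C. (\<lambda>h. c * h) ` M p = N p)"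

definition O_infty :: "('a::field, 'k::field) hyp_curve \<Rightarrow> nat \<Rightarrow> 'k subsheaf" where
  "O_infty C n p =
     (if p = infty_pt C then {h. \<forall>a \<in> max_pow p n. h * a \<in> p} else p)"

definition order_at :: "'k::field set \<Rightarrow> 'k \<Rightarrow> int" where
  "order_at p h = (THE n. \<exists>t u. max_ideal p = {t * a | a. a \<in> p} \<and>
     u \<in> p - max_ideal p \<and> h = u * t powi n)"

text \<open>The order at \<open>p\<close> of the rational section \<open>1\<close>; the degree is that of its divisor.\<close>

definition order_of_one :: "'k::field subsheaf \<Rightarrow> 'k set \<Rightarrow> int" where
  "order_of_one M p = (THE n. \<exists>s. s \<noteq> 0 \<and> M p = {s * a | a. a \<in> p} \<and> n = order_at p (1 / s))"

definition bundle_degree :: "('a::field, 'k::field) hyp_curve \<Rightarrow> 'k subsheaf \<Rightarrow> int" where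
  "bundle_degree C M =
     (\<Sum>p | p \<in> closed_points C \<and> order_of_one M p \<noteq> 0.
        order_of_one M p * int (dim_mod C p (max_ideal p)))"

text \<open>
  The tangent bundle is the sheaf of derivations; a rational vector field \<open>D\<close> is identified with
  the rational function \<open>D x\<close> (possible since \<open>dx\<close> is a nonzero rational differential when
  the characteristic is not 2).  Dually, in the canonical bundle the rational function \<open>h\<close> stands
  for \<open>h dx\<close>.
\<close>

definition derivations :: "('a::field, 'k::field) hyp_curve \<Rightarrow> ('k \<Rightarrow> 'k) set" where
  "derivations C = {D. (\<forall>a b. D (a + b) = D a + D b) \<and> (\<forall>a. D (emb C a) = 0) \<and>
     (\<forall>a b. D (a * b) = a * D b + b * D a)}"

definition tangent :: "('a::field, 'k::field) hyp_curve \<Rightarrow> 'k subsheaf" where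
  "tangent C p = {D (xf C) | D. D \<in> derivations C \<and> D ` p \<subseteq> p}"

definition canonical :: "('a::field, 'k::field) hyp_curve \<Rightarrow> 'k subsheaf" where
  "canonical C = hom_sheaf (tangent C) (\<lambda>p. p)"

text \<open>\<open>dz\<close> does not vanish at \<open>p\<close>: its value on some local vector field is not zero at \<open>p\<close>.\<close>

definition d_nonzero_at :: "('a::field, 'k::field) hyp_curve \<Rightarrow> 'k \<Rightarrow> 'k set \<Rightarrow> bool" where
  "d_nonzero_at C z p \<longleftrightarrow> (\<exists>D \<in> derivations C. D ` p \<subseteq> p \<and> D z \<notin> max_ideal p)"


section \<open>Principal parts and inflection points\<close>

text \<open>
  The Hasse derivatives with respect to \<open>z\<close> are used on the whole function field, to which the
  sheaf maps on \<open>O_U\<close> extend uniquely.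
\<close>

definition hasse_family :: "('a::field, 'k::field) hyp_curve \<Rightarrow> 'k \<Rightarrow> (nat \<Rightarrow> 'k \<Rightarrow> 'k) \<Rightarrow> bool" where
  "hasse_family C z D \<longleftrightarrow>
     (\<forall>k a b. D k (a + b) = D k a + D k b) \<and>
     (\<forall>k c a. D k (emb C c * a) = emb C c * D k a) \<and>
     (\<forall>a. D 0 a = a) \<and>
     (\<forall>k a b. D k (a * b) = (\<Sum>i\<le>k. D i a * D (k - i) b)) \<and>
     (\<forall>k n. D k (z ^ n) = of_nat (n choose k) * z ^ (n - k))"

definition hasse :: "('a::field, 'k::field) hyp_curve \<Rightarrow> 'k \<Rightarrow> nat \<Rightarrow> 'k \<Rightarrow> 'k" where
  "hasse C z = (THE D. hasse_family C z D)"

text \<open>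
  \<open>jet_chart C L U s z\<close>: the data trivializing the bundle of principal parts of \<open>L\<close> over \<open>U\<close>, in
  which a rational section \<open>v\<close> of \<open>L\<close> has the Taylor coefficients \<open>hasse C z i (v / s)\<close>.
\<close>

definition jet_chart ::
    "('a::field, 'k::field) hyp_curve \<Rightarrow> 'k subsheaf \<Rightarrow> 'k set set \<Rightarrow> 'k \<Rightarrow> 'k \<Rightarrow> bool" where
  "jet_chart C L U s z \<longleftrightarrow> open_subset C U \<and> generates_on L U s \<and>
     z \<in> sections_on (\<lambda>p. p) U \<and> (\<forall>p\<in>U. d_nonzero_at C z p)"

text \<open>
  The bundle of principal parts of rank \<open>n\<close> (order \<open>n - 1\<close>) is generated as an \<open>O\<close>-module by the
  Taylor expansions of the local sections of \<open>L\<close>.  It is realised inside \<open>K^n\<close> (\<open>K\<close> the function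
  field) by writing Taylor expansions over the generic point in the chart \<open>s = 1\<close>, \<open>z = x\<close>.
  In the coordinates of a jet chart \<open>(s, z)\<close> at \<open>p\<close> its stalk is \<open>p^n\<close>, the jets of
  \<open>s z^k\<close> for \<open>k < n\<close> forming a unitriangular matrix there.
  Its determinant is the span in \<open>K\<close> (the top exterior power of \<open>K^n\<close>) of the determinants of
  \<open>n\<close>-tuples of local sections.  The Hasse Wronskian is \<open>det (mat n n (\<lambda>(i,j). hasse C (xf C) i
  (lam ! j)))\<close> for a basis \<open>lam\<close> of \<open>H^0(L)\<close>.
\<close>

definition principal_parts ::
    "('a::field, 'k::field) hyp_curve \<Rightarrow> nat \<Rightarrow> 'k subsheaf \<Rightarrow> 'k set \<Rightarrow> 'k vec set" where
  "principal_parts C n L p =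
     {vec n (\<lambda>i. \<Sum>v\<in>S. c v * hasse C (xf C) i v) | S c. finite S \<and> S \<subseteq> L p \<and> c ` S \<subseteq> p}"

definition det_principal_parts ::
    "('a::field, 'k::field) hyp_curve \<Rightarrow> nat \<Rightarrow> 'k subsheaf \<Rightarrow> 'k subsheaf" where
  "det_principal_parts C n L p =
     rspan p {det (mat_of_cols n js) | js. length js = n \<and> set js \<subseteq> principal_parts C n L p}"

text \<open>
  A geometric point over the closed point \<open>p\<close> is a local homomorphism from \<open>p\<close> to the algebraic
  closure of \<open>F\<close> over \<open>F\<close>, here normalised to be zero outside \<open>p\<close>.
\<close>

definition geometric_points ::
    "('a::field, 'k::field) hyp_curve \<Rightarrow> ('k set \<times> ('k \<Rightarrow> 'a alg_closure)) set" where
  "geometric_points C = {(p, \<theta>). p \<in> closed_points C \<and>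
     (\<forall>a\<in>p. \<forall>b\<in>p. \<theta> (a + b) = \<theta> a + \<theta> b \<and> \<theta> (a * b) = \<theta> a * \<theta> b) \<and>
     (\<forall>c. \<theta> (emb C c) = to_ac c) \<and>
     (\<forall>a\<in>p. \<theta> a = 0 \<longleftrightarrow> a \<in> max_ideal p) \<and>
     (\<forall>a. a \<notin> p \<longrightarrow> \<theta> a = 0)}"

text \<open>Surjectivity, on the fibre over a geometric point, of the evaluation map into the bundle of
  principal parts of rank \<open>h^0(L)\<close>.\<close>

definition ev_surjective_at ::
    "('a::field, 'k::field) hyp_curve \<Rightarrow> 'k subsheaf \<Rightarrow> 'k set \<times> ('k \<Rightarrow> 'a alg_closure) \<Rightarrow> bool" where
  "ev_surjective_at C L P \<longleftrightarrow>
     (\<exists>U s z. jet_chart C L U s z \<and> fst P \<in> U \<and>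
       (\<forall>\<tau> :: nat \<Rightarrow> 'a alg_closure. \<exists>S q. finite S \<and> S \<subseteq> H0 C L \<and>
          (\<forall>i < h0 C L. \<tau> i = (\<Sum>v\<in>S. q v * snd P (hasse C z i (v / s))))))"

definition inflection_points ::
    "('a::field, 'k::field) hyp_curve \<Rightarrow> 'k subsheaf \<Rightarrow> ('k set \<times> ('k \<Rightarrow> 'a alg_closure)) set" where
  "inflection_points C L = {P \<in> geometric_points C. \<not> ev_surjective_at C L P}"


section \<open>Relative orientations and the Euler class\<close>

definition relative_orientation ::
    "('a::field, 'k::field) hyp_curve \<Rightarrow> 'k subsheaf \<Rightarrow> 'k subsheaf \<Rightarrow> 'k \<Rightarrow> bool" where
  "relative_orientation C E N c \<longleftrightarrow> line_bundle C N \<and>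
     bundle_iso C (hom_sheaf (tangent C) E) (tensor N N) c"

text \<open>
  A morphism \<open>t\<close> from an open subset of the (smooth) curve to the affine line is etale exactly
  where \<open>dt\<close> generates the differentials.
\<close>

definition nisnevich_chart ::
    "('a::field, 'k::field) hyp_curve \<Rightarrow> 'k set \<Rightarrow> 'k set set \<Rightarrow> 'k \<Rightarrow> bool" where
  "nisnevich_chart C p U t \<longleftrightarrow> open_subset C U \<and> p \<in> U \<and>
     t \<in> sections_on (\<lambda>q. q) U \<and> (\<forall>q\<in>U. d_nonzero_at C t q) \<and>
     (\<forall>a\<in>p. \<exists>Q. a - evalp C Q t \<in> max_ideal p)"

text \<open>
  The generator \<open>e\<close> of \<open>E\<close> over \<open>U\<close> is compatible with \<open>t\<close>.  If \<open>D\<close> is the vector field dual to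
  \<open>dt\<close>, identified with \<open>D x\<close>, the homomorphism sending it to \<open>e\<close> is \<open>e / D x\<close>.
\<close>

definition compatible_triv ::
    "('a::field, 'k::field) hyp_curve \<Rightarrow> 'k subsheaf \<Rightarrow> 'k subsheaf \<Rightarrow> 'k \<Rightarrow>
     'k set set \<Rightarrow> 'k \<Rightarrow> 'k \<Rightarrow> bool" where
  "compatible_triv C E N c U t e \<longleftrightarrow> generates_on E U e \<and>
     (\<exists>D \<in> derivations C. D t = 1 \<and>
        (\<exists>\<nu> \<in> sections_on N U. c * (e / D (xf C)) = \<nu> * \<nu>))"

text \<open>
  For \<open>G = \<Sum>k. G_k t^k\<close> one has \<open>(G(t1) - G(t2)) / (t1 - t2) = \<Sum>i. t1^i * (\<Sum>k>i. G_k t2^(k-1-i))\<close>,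
  which gives the \<open>a_i = t^i\<close> and \<open>b_i\<close> of the definition of \<open>\<eta>\<close>.  Functionals on
  \<open>A = O_p/(\<phi>)\<close> are functionals on \<open>O_p\<close> that vanish on \<open>(\<phi>)\<close>.
\<close>

definition bezout_coeff :: "('a::field, 'k::field) hyp_curve \<Rightarrow> 'a poly \<Rightarrow> 'k \<Rightarrow> nat \<Rightarrow> 'k" where
  "bezout_coeff C G t i =
     (\<Sum>k \<in> {i<..Polynomial.degree G}. emb C (Polynomial.coeff G k) * t ^ (k - 1 - i))"

definition principal_ideal :: "'k::field set \<Rightarrow> 'k \<Rightarrow> 'k set" where
  "principal_ideal p \<phi> = {\<phi> * a | a. a \<in> p}"

definition scheja_storch_functional ::
    "('a::field, 'k::field) hyp_curve \<Rightarrow> 'k set \<Rightarrow> 'k \<Rightarrow> 'k \<Rightarrow> 'a poly \<Rightarrow> ('k \<Rightarrow> 'a) \<Rightarrow> bool" where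
  "scheja_storch_functional C p \<phi> t G \<eta> \<longleftrightarrow>
     (\<forall>a\<in>p. \<forall>b\<in>p. \<eta> (a + b) = \<eta> a + \<eta> b) \<and>
     (\<forall>c. \<forall>a\<in>p. \<eta> (emb C c * a) = c * \<eta> a) \<and>
     (\<forall>a \<in> principal_ideal p \<phi>. \<eta> a = 0) \<and>
     (\<Sum>i < Polynomial.degree G. emb C (\<eta> (t ^ i)) * bezout_coeff C G t i) - 1 \<in> principal_ideal p \<phi>"

definition is_local_index ::
    "('a::field, 'k::field) hyp_curve \<Rightarrow> 'k subsheaf \<Rightarrow> 'k subsheaf \<Rightarrow> 'k \<Rightarrow>
     'k \<Rightarrow> 'k set \<Rightarrow> 'a gw \<Rightarrow> bool" where
  "is_local_index C E N c \<sigma> p \<beta> \<longleftrightarrow>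
     (\<exists>U t e \<phi> n G \<eta> bs.
        nisnevich_chart C p U t \<and>
        compatible_triv C E N c U t e \<and>
        \<phi> = \<sigma> / e \<and>
        max_pow p n \<subseteq> principal_ideal p \<phi> \<and>
        evalp C G t - \<phi> \<in> max_pow p (2 * n) \<and>
        scheja_storch_functional C p \<phi> t G \<eta> \<and>
        basis_mod C p (principal_ideal p \<phi>) bs \<and>
        \<beta> = gw_class (mat (length bs) (length bs) (\<lambda>(i, j). \<eta> (bs ! i * bs ! j))))"

definition local_index ::
    "('a::field, 'k::field) hyp_curve \<Rightarrow> 'k subsheaf \<Rightarrow> 'k subsheaf \<Rightarrow> 'k \<Rightarrow>
     'k \<Rightarrow> 'k set \<Rightarrow> 'a gw" where
  "local_index C E N c \<sigma> p = (THE \<beta>. is_local_index C E N c \<sigma> p \<beta>)"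

definition zeros :: "('a::field, 'k::field) hyp_curve \<Rightarrow> 'k subsheaf \<Rightarrow> 'k \<Rightarrow> 'k set set" where
  "zeros C E \<sigma> = {p \<in> closed_points C. \<sigma> \<in> tensor max_ideal E p}"

text \<open>On a curve, the zeros of a section are isolated iff there are finitely many of them.\<close>

definition isolated_section :: "('a::field, 'k::field) hyp_curve \<Rightarrow> 'k subsheaf \<Rightarrow> 'k \<Rightarrow> bool" where
  "isolated_section C E \<sigma> \<longleftrightarrow> \<sigma> \<in> H0 C E \<and> finite (zeros C E \<sigma>)"

text \<open>
  \<open>\<beta>\<close> is the Euler class of \<open>E\<close>, relatively oriented by \<open>(N, c)\<close>.  The predicate includes
  well-definedness: sections with isolated zeros exist, each of their zeros has exactly one local
  index, whatever choices are made in computing it, and the sum does not depend on the section.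
\<close>

definition is_euler_class ::
    "('a::field, 'k::field) hyp_curve \<Rightarrow> 'k subsheaf \<Rightarrow> 'k subsheaf \<Rightarrow> 'k \<Rightarrow> 'a gw \<Rightarrow> bool" where
  "is_euler_class C E N c \<beta> \<longleftrightarrow>
     (\<exists>\<sigma>. isolated_section C E \<sigma>) \<and>
     (\<forall>\<sigma>. isolated_section C E \<sigma> \<longrightarrow>
        (\<forall>p \<in> zeros C E \<sigma>. \<exists>!\<alpha>. is_local_index C E N c \<sigma> p \<alpha>) \<and>
        (\<Sum>p \<in> zeros C E \<sigma>. local_index C E N c \<sigma> p) = \<beta>)"

definition inflection_bundle :: "('a::field, 'k::field) hyp_curve \<Rightarrow> 'k subsheaf \<Rightarrow> 'k subsheaf" where
  "inflection_bundle C L = det_principal_parts C (h0 C L) L"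

text \<open>\<open>\<beta>\<close> is the arithmetic inflection class: the bundle can be relatively oriented, and its Euler
  class is \<open>\<beta>\<close> for every relative orientation.\<close>

definition is_inflection_class :: "('a::field, 'k::field) hyp_curve \<Rightarrow> 'k subsheaf \<Rightarrow> 'a gw \<Rightarrow> bool" where
  "is_inflection_class C L \<beta> \<longleftrightarrow>
     (\<exists>N c. relative_orientation C (inflection_bundle C L) N c) \<and>
     (\<forall>N c. relative_orientation C (inflection_bundle C L) N c \<longrightarrow>
        is_euler_class C (inflection_bundle C L) N c \<beta>)"

definition gamma_C :: "nat \<Rightarrow> nat \<Rightarrow> nat" where
  "gamma_C g l = (if l \<le> g then l * (l + 1) * (g + 1) else g * (2 * l - g + 1) ^ 2)"

end

theory Submission
 imports Defs "HOL-Library.Function_Algebras"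
begin

text \<open>
 Normalise a derivation \<open>D\<close> of the function field by \<open>D x = 2 y\<close>, \<open>D y = f'\<close>.  Every closed point \<open>p\<close>
 carries a residue functional, constructed in Tate's style from the commutators of a projection
 with multiplications, and \<open>a \<mapsto> res_p (a D t / G(t))\<close> is the Scheja--Storch functional \<open>\<eta>\<close> of
 \<open>F[t]/(G)\<close>.  Hence the local index at \<open>p\<close> of a section \<open>\<sigma>\<close>, relatively oriented by
 \<open>N^2 = Hom(T, E)\<close>, is the form \<open>(a, b) \<mapsto> res_p (w a b)\<close> on \<open>N_p\<close> modulo its dual lattice, where \<open>w\<close>
 is a single rational function, a constant multiple of \<open>y / \<sigma>\<close>, independent of \<open>p\<close> and of charts.
 By the residue theorem and strong approximation, the global sections of a larger lattice \<open>M\<close> give a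
 Lagrangian of the corresponding forms on \<open>M\<close>; isotropic reduction from \<open>M\<close> to \<open>N\<close> turns it into a
 Lagrangian of the orthogonal sum of the local forms, so the Euler class is
 a multiple of the hyperbolic plane.  The multiple is half the rank, and the rank is the degree of
 the bundle since a function regular on the affine curve has as many zeros there as it has poles
 at infinity.  No section has to be computed: the section is arbitrary, the Wronskian included.
\<close>

unbundle no fps_syntax

section \<open>Bases of quotient spaces\<close>

text \<open>For \<open>N\<close> itself, self-orthogonality of the global sections would be Serre
  duality. The detour through \<open>M\<close>, which is \<open>O(2k infinity) / h\<close> with
  \<open>k\<close> large, replaces it by two elementary facts: strong approximation on the affine
  ring moves the whole error to infinity, and there it is tested against powers of \<open>x\<close>
  and their multiples by \<open>y\<close>. The normalisation \<open>D x = 2 y\<close> makes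
  \<open>D\<close> dual to \<open>dx/(2y)\<close>, a differential without zeros or poles on the
  affine part; its zero of order \<open>2g - 2\<close> at infinity is the origin of the factor
  \<open>u ^ (g - 1)\<close>. Residues are not defined by Laurent coefficients and traces, because
  closed points may have inseparable residue fields, where the trace vanishes identically. The
  commutator of a projection with \<open>t\<close> fits instead: its telescoping identity is that of
  the Bezoutian \<open>(G(t1) - G(t2)) / (t1 - t2)\<close>, which defines \<open>\<eta>\<close>. The
  orientation removes the choice of chart: compatibility provides a square root \<open>s\<close>
  with \<open>s^2 = c e / D' x\<close>, where \<open>D'\<close> is dual to \<open>dt\<close>, and
  multiplication by \<open>s\<close> carries the local algebra isometrically to \<open>N_p\<close>
  modulo its dual.\<close>

definition lc :: "('f => 'v => 'v::comm_monoid_add) => 'v list => (nat => 'f) => 'v" where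
 "lc sc bs c = (\<Sum>i<length bs. sc (c i) (bs ! i))"

text \<open>Coefficient families are functions on the naturals of which only the values below
  \<open>length bs\<close> count, so that concatenating bases needs no vectors of fixed dimension.
  \<open>quot_basis_alt\<close> returns to the form with unique coefficients used by
  \<open>basis_mod\<close>.\<close>

definition quot_basis :: "('f::field => 'v => 'v::ab_group_add) => 'v set => 'v set => 'v list => bool" where
 "quot_basis sc V W bs \<longleftrightarrow> set bs \<subseteq> V \<and> (\<forall>v\<in>V. \<exists>c. v - lc sc bs c \<in> W) \<and>
   (\<forall>c. lc sc bs c \<in> W \<longrightarrow> (\<forall>i<length bs. c i = 0))"

definition gram :: "('v => 'v => 'f) => 'v list => 'f mat" where
 "gram B bs = mat (length bs) (length bs) (\<lambda>(i, j). B (bs ! i) (bs ! j))"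

lemma lc_Nil [simp]: "lc sc [] c = 0"
 by (simp add: lc_def)

lemma lc_Cons: "lc sc (b # bs) c = sc (c 0) b + lc sc bs (\<lambda>i. c (Suc i))"
 unfolding lc_def by (simp add: sum.lessThan_Suc_shift del: sum.lessThan_Suc)

lemma lc_append: "lc sc (as @ bs) c = lc sc as c + lc sc bs (\<lambda>i. c (i + length as))"
 by (induction as arbitrary: c) (simp_all add: lc_Cons add.assoc)

lemma lc_cong: "(\<And>i. i < length bs ==> c i = d i) ==> lc sc bs c = lc sc bs d"
 unfolding lc_def by (rule sum.cong) auto

context Vector_Spaces.vector_space
begin

lemma lc_mem: "subspace U ==> set bs \<subseteq> U ==> lc scale bs c \<in> U"
 unfolding lc_def by (intro subspace_sum subspace_scale) auto

lemma lc_zero: "(\<And>i. i < length bs ==> c i = 0) ==> lc scale bs c = 0"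
 unfolding lc_def by (intro sum.neutral) auto

lemma lc_diff: "lc scale bs (\<lambda>i. c i - d i) = lc scale bs c - lc scale bs d"
 unfolding lc_def by (simp add: scale_left_diff_distrib sum_subtractf)

lemma span_set_eq: "span (set bs) = range (lc scale bs)"
proof (induction bs)
 case (Cons b bs)
 have "x \<in> span (set (b # bs)) \<longleftrightarrow> (\<exists>k c. x = scale k b + lc scale bs c)" for x
 proof -
  have "x \<in> span (set (b # bs)) \<longleftrightarrow> (\<exists>k c. x - scale k b = lc scale bs c)"
   unfolding list.set span_insert Cons by (simp add: image_iff)
  thus ?thesis by (simp only: diff_eq_eq add.commute)
 qed
 moreover have "(\<exists>k c. x = scale k b + lc scale bs c) \<longleftrightarrow> x \<in> range (lc scale (b # bs))" for x
 proof
  assume "\<exists>k c. x = scale k b + lc scale bs c"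
  then obtain k c where "x = scale k b + lc scale bs c" by blast
  hence "x = lc scale (b # bs) (case_nat k c)" by (simp add: lc_Cons)
  thus "x \<in> range (lc scale (b # bs))" by blast
 qed (auto simp: lc_Cons)
 ultimately show ?case by blast
qed (auto simp: lc_def)

text \<open>A relation modulo \<open>W\<close> is first read modulo \<open>U\<close>, which kills
  the coefficients of \<open>as\<close>, and then involves \<open>bs\<close> only. The dimension
  counts below rest on such chains.\<close>

lemma quot_basis_tower:
 assumes "subspace U" "quot_basis scale V U as" "quot_basis scale U W bs" "W \<subseteq> U" "U \<subseteq> V" "subspace W"
 shows "quot_basis scale V W (as @ bs)"
 unfolding quot_basis_def
proof (intro conjI ballI allI impI)
 show "set (as @ bs) \<subseteq> V" using assms unfolding quot_basis_def by auto
next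
 fix v assume "v \<in> V"
 then obtain c where c: "v - lc scale as c \<in> U" using assms unfolding quot_basis_def by blast
 then obtain d where d: "v - lc scale as c - lc scale bs d \<in> W"
  using assms unfolding quot_basis_def by blast
 let ?e = "\<lambda>i. if i < length as then c i else d (i - length as)"
 have "lc scale (as @ bs) ?e = lc scale as c + lc scale bs d"
  unfolding lc_append by (intro arg_cong2[where f = "(+)"] lc_cong) auto
 hence "v - lc scale (as @ bs) ?e \<in> W" using d by (simp add: diff_diff_eq)
 thus "\<exists>c. v - lc scale (as @ bs) c \<in> W" by blast
next
 fix c i assume c: "lc scale (as @ bs) c \<in> W" and i: "i < length (as @ bs)"
 let ?d = "\<lambda>i. c (i + length as)"
 have bsU: "lc scale bs ?d \<in> U"
  using assms(1,3) unfolding quot_basis_def by (intro lc_mem) auto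
 have "lc scale as c + lc scale bs ?d \<in> U" using c assms(4) unfolding lc_append by auto
 from subspace_diff[OF assms(1) this bsU] have "lc scale as c \<in> U" by simp
 hence c0: "\<forall>i<length as. c i = 0" using assms(2) unfolding quot_basis_def by blast
 hence "lc scale as c = 0" by (intro lc_zero) auto
 hence "lc scale bs ?d \<in> W" using c unfolding lc_append by simp
 hence d0: "\<forall>i<length bs. ?d i = 0" using assms(3) unfolding quot_basis_def by blast
 show "c i = 0"
 proof (cases "i < length as")
  case False
  thus ?thesis using d0[rule_format, of "i - length as"] i by auto
 qed (use c0 in auto)
qed

lemma quot_basis_Nil: "subspace W ==> quot_basis scale W W []"
 unfolding quot_basis_def by auto

text \<open>Induction on the finite generating set: one more generator enlarges
  \<open>V \<inter> span (W \<union> S)\<close> by at most one dimension, so each step adds one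
  vector or none.\<close>

lemma quot_basis_exists:
 assumes "finite S" "subspace V" "subspace W" "W \<subseteq> V" "V \<subseteq> span (W \<union> S)"
 shows "\<exists>bs. quot_basis scale V W bs"
proof -
 have "\<exists>bs. quot_basis scale (V \<inter> span (W \<union> S)) W bs" using assms(1)
 proof (induction S)
  case empty
  have "V \<inter> span (W \<union> {}) = W" using assms(3,4) by (simp add: span_eq_iff[THEN iffD2]) blast
  thus ?case using quot_basis_Nil[OF assms(3)] by auto
 next
  case (insert s S)
  let ?U = "V \<inter> span (W \<union> S)" and ?U' = "V \<inter> span (W \<union> insert s S)"
  have sub: "subspace ?U" by (intro subspace_inter assms subspace_span)
  have UU: "?U \<subseteq> ?U'" using span_mono[of "W \<union> S" "W \<union> insert s S"] by blast
  have WU: "W \<subseteq> ?U" using assms(4) span_superset[of "W \<union> S"] by blast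
  obtain bs where bs: "quot_basis scale ?U W bs" using insert by blast
  show ?case
  proof (cases "?U' \<subseteq> ?U")
   case True
   hence "?U' = ?U" using UU by blast
   thus ?thesis using bs by auto
  next
   case False
   then obtain x where x: "x \<in> ?U'" "x \<notin> ?U" by blast
   have ins: "W \<union> insert s S = insert s (W \<union> S)" by auto
   from x(1) obtain k where k: "x - scale k s \<in> span (W \<union> S)" unfolding ins span_insert by blast
   have k0: "k ~= 0" using x k by auto
   have "quot_basis scale ?U' ?U [x]" unfolding quot_basis_def
   proof (intro conjI ballI allI impI)
    fix v assume v: "v \<in> ?U'"
    then obtain m where m: "v - scale m s \<in> span (W \<union> S)" unfolding ins span_insert by blast
    \<comment> \<open>\<open>k\<close> and \<open>m\<close> are the components of \<open>x\<close>
      and \<open>v\<close> along the new generator \<open>s\<close>; this multiple of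
      \<open>x\<close> cancels it.\<close>
    have eq: "v - scale (m / k) x = (v - scale m s) - scale (m / k) (x - scale k s)"
     using k0 by (simp add: scale_right_diff_distrib)
    have "v - scale (m / k) x \<in> span (W \<union> S)"
     unfolding eq by (intro span_diff span_scale m k)
    moreover have "v - scale (m / k) x \<in> V"
     using v x assms(2) by (intro subspace_diff subspace_scale) auto
    ultimately show "\<exists>c. v - lc scale [x] c \<in> ?U"
     by (intro exI[of _ "\<lambda>_. m / k"]) (simp add: lc_def)
   next
    fix c i assume c: "lc scale [x] c \<in> ?U" and i: "i < length [x]"
    have cx: "scale (c 0) x \<in> ?U" using c by (simp add: lc_def)
    show "c i = 0"
    proof (rule ccontr)
     assume "c i ~= 0"
     hence "c 0 ~= 0" using i by simp
     hence "x = scale (1 / c 0) (scale (c 0) x)" by simp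
     hence "x \<in> ?U" using subspace_scale[OF sub cx] by metis
     thus False using x by blast
    qed
   qed (use x in auto)
   from quot_basis_tower[OF sub this bs WU UU assms(3)] show ?thesis by blast
  qed
 qed
 moreover have "V \<inter> span (W \<union> S) = V" using assms(5) by blast
 ultimately show ?thesis by simp
qed

lemma quot_basis_span:
 assumes "quot_basis scale V W bs"
 shows "V \<subseteq> span (W \<union> set bs)"
proof
 fix v assume "v \<in> V"
 then obtain c where c: "v - lc scale bs c \<in> W" using assms unfolding quot_basis_def by blast
 have "v - lc scale bs c \<in> span (W \<union> set bs)" using c span_superset by blast
 moreover have "lc scale bs c \<in> span (W \<union> set bs)"
  by (rule lc_mem[OF subspace_span]) (use span_superset[of "W \<union> set bs"] in blast)
 ultimately show "v \<in> span (W \<union> set bs)" using span_add by fastforce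
qed

lemma lc_independent:
 assumes "\<And>c. lc scale bs c = 0 ==> \<forall>i<length bs. c i = 0"
 shows "distinct bs \<and> independent (set bs)"
 using assms
proof (induction bs)
 case (Cons b bs)
 have "\<forall>i<length bs. c i = 0" if "lc scale bs c = 0" for c
  using Cons.prems[of "case_nat 0 c"] that by (auto simp: lc_Cons)
 hence IH: "distinct bs" "independent (set bs)" using Cons.IH by auto
 have b: "b \<notin> span (set bs)"
 proof
  assume "b \<in> span (set bs)"
  then obtain c where "b = lc scale bs c" unfolding span_set_eq by blast
  hence "lc scale (b # bs) (case_nat 1 (\<lambda>i. - c i)) = 0"
   by (simp add: lc_Cons) (simp add: lc_def sum_negf)
  from Cons.prems[OF this] show False by auto
 qed
 hence "b \<notin> set bs" using span_superset by blast
 thus ?case using IH b by (auto simp: independent_insert)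
qed (auto simp: independent_empty)

text \<open>Modulo \<open>W\<close> each vector of \<open>bs\<close> can be traded for a combination
  of \<open>as\<close>. The traded list is still independent and now lies in
  \<open>span (set as)\<close>, so the exchange bound applies.\<close>

lemma quot_basis_length_le:
 assumes "subspace W" "quot_basis scale V W as" "quot_basis scale V W bs"
 shows "length bs \<le> length as"
proof -
 have "\<exists>c. v - lc scale as c \<in> W" if "v \<in> V" for v using assms(2) that unfolding quot_basis_def by blast
 then obtain C where C: "\<And>v. v \<in> V ==> v - lc scale as (C v) \<in> W" by metis
 define bs' where "bs' = map (\<lambda>b. lc scale as (C b)) bs"
 have bsV: "set bs \<subseteq> V" using assms(3) unfolding quot_basis_def by blast
 have len: "length bs' = length bs" by (simp add: bs'_def)
 have "\<forall>i<length bs'. d i = 0" if "lc scale bs' d = 0" for d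
 proof -
  have "lc scale bs d - lc scale bs' d = (\<Sum>i<length bs. scale (d i) (bs ! i - bs' ! i))"
   unfolding lc_def len by (simp add: scale_right_diff_distrib sum_subtractf)
  also have "\<dots> \<in> W" using C bsV
   by (intro subspace_sum assms subspace_scale) (auto simp: bs'_def subset_iff)
  finally have "lc scale bs d \<in> W" using that by simp
  thus ?thesis using assms(3) len unfolding quot_basis_def by auto
 qed
 from lc_independent[OF this] have ind: "distinct bs'" "independent (set bs')" by auto
 have "set bs' \<subseteq> span (set as)" unfolding bs'_def span_set_eq by auto
 from independent_span_bound[OF finite_set ind(2) this] have "card (set bs') \<le> card (set as)" by simp
 thus ?thesis using distinct_card[OF ind(1)] card_length[of as] len by simp
qed

lemma quot_basis_length:
 assumes "subspace W" "quot_basis scale V W as" "quot_basis scale V W bs"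
 shows "length as = length bs"
 using quot_basis_length_le[OF assms(1)] assms(2,3) by (meson order_antisym)

lemma quot_basis_alt:
 assumes "subspace W"
 shows "quot_basis scale V W bs \<longleftrightarrow> set bs \<subseteq> V \<and>
  (\<forall>v \<in> V. \<exists>!c. c \<in> carrier_vec (length bs) \<and> v - (\<Sum>i<length bs. scale (c $ i) (bs ! i)) \<in> W)"
  (is "_ \<longleftrightarrow> _ \<and> (\<forall>v\<in>V. \<exists>!c. ?Q v c)")
proof (intro iffI conjI)
 assume q: "quot_basis scale V W bs"
 show "set bs \<subseteq> V" using q unfolding quot_basis_def by auto
 show "\<forall>v\<in>V. \<exists>!c. ?Q v c"
 proof
  fix v assume "v \<in> V"
  then obtain c where c: "v - lc scale bs c \<in> W" using q unfolding quot_basis_def by blast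
  let ?c = "vec (length bs) c"
  have "(\<Sum>i<length bs. scale (?c $ i) (bs ! i)) = lc scale bs c"
   unfolding lc_def by (intro sum.cong) auto
  hence "?Q v ?c" using c by simp
  moreover have "c' = ?c" if c': "?Q v c'" for c'
  proof (rule eq_vecI)
   fix i assume i: "i < dim_vec ?c"
   have "v - lc scale bs (\<lambda>i. c' $ i) \<in> W" using c' unfolding lc_def by simp
   from subspace_diff[OF assms c this]
   have "lc scale bs (\<lambda>i. c' $ i - c i) \<in> W" by (simp add: lc_diff)
   hence "\<forall>i<length bs. c' $ i - c i = 0" using q unfolding quot_basis_def by blast
   thus "c' $ i = ?c $ i" using i by simp
  qed (use c' in auto)
  ultimately show "\<exists>!c. ?Q v c" by blast
 qed
next
 assume a: "set bs \<subseteq> V \<and> (\<forall>v\<in>V. \<exists>!c. ?Q v c)"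
 show "quot_basis scale V W bs" unfolding quot_basis_def
 proof (intro conjI ballI allI impI)
  fix v assume "v \<in> V"
  then obtain c where "?Q v c" using a by blast
  thus "\<exists>c. v - lc scale bs c \<in> W" unfolding lc_def by blast
 next
  fix c i assume c: "lc scale bs c \<in> W" and i: "i < length bs"
  have bV: "bs ! i \<in> V" using a i by auto
  then obtain d where d: "?Q (bs ! i) d" "\<And>d'. ?Q (bs ! i) d' ==> d' = d" using a by blast
  \<comment> \<open>Uniqueness is exploited on a basis vector: adding the relation \<open>c\<close>
    to its coefficients gives a second expansion.\<close>
  let ?d = "vec (length bs) (\<lambda>j. d $ j + c j)"
  have "(\<Sum>i<length bs. scale (?d $ i) (bs ! i)) = (\<Sum>i<length bs. scale (d $ i) (bs ! i)) + lc scale bs c"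
   unfolding lc_def by (simp add: scale_left_distrib sum.distrib)
  hence "?Q (bs ! i) ?d" using subspace_diff[OF assms conjunct2[OF d(1)] c] by (simp add: diff_diff_eq)
  hence "?d = d" by (rule d(2))
  hence "?d $ i = d $ i" by simp
  thus "c i = 0" using i by simp
 qed (use a in auto)
qed

end

text \<open>The hypotheses say that \<open>T\<close> induces an isomorphism of \<open>V/W\<close>
  onto \<open>V'/W'\<close>; \<open>T\<close> may reach \<open>V'\<close> only up to
  \<open>W'\<close>.\<close>

lemma quot_basis_map:
 assumes "Vector_Spaces.linear sc sc' T" "\<And>x. x \<in> V ==> T x \<in> V'" "\<And>y. y \<in> V' ==> \<exists>x\<in>V. y - T x \<in> W'"
  "\<And>x. x \<in> V ==> T x \<in> W' \<longleftrightarrow> x \<in> W" "module.subspace sc V" "module.subspace sc' W'"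
  "quot_basis sc V W bs"
 shows "quot_basis sc' V' W' (map T bs)"
proof -
 interpret Vector_Spaces.linear sc sc' T by (rule assms)
 have T: "T (lc sc bs c) = lc sc' (map T bs) c" for c
  unfolding lc_def by (simp add: sum scale)
 have bV: "set bs \<subseteq> V" using assms(7) unfolding quot_basis_def by blast
 have lcV: "lc sc bs c \<in> V" for c by (rule vs1.lc_mem[OF assms(5) bV])
 show ?thesis unfolding quot_basis_def
 proof (intro conjI ballI allI impI)
  show "set (map T bs) \<subseteq> V'" using bV assms(2) by auto
 next
  fix y assume "y \<in> V'"
  then obtain x where x: "x \<in> V" "y - T x \<in> W'" using assms(3) by blast
  then obtain c where c: "x - lc sc bs c \<in> W" using assms(7) unfolding quot_basis_def by blast
  have "x - lc sc bs c \<in> V" using x lcV assms(5) by (simp add: vs1.subspace_diff)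
  hence "T (x - lc sc bs c) \<in> W'" using c assms(4) by blast
  from vs2.subspace_add[OF assms(6) x(2) this]
  show "\<exists>c. y - lc sc' (map T bs) c \<in> W'" by (intro exI[of _ c]) (simp add: diff T)
 next
  fix c i assume "lc sc' (map T bs) c \<in> W'" "i < length (map T bs)"
  hence "lc sc bs c \<in> W" using assms(4) lcV T by metis
  thus "c i = 0" using assms(7) \<open>i < length (map T bs)\<close> unfolding quot_basis_def by simp
 qed
qed

section \<open>Bilinear forms with a Lagrangian\<close>

lemma gw_class_orth_sum:
 assumes "nondeg_sym A" "nondeg_sym B"
 shows "gw_class (orth_sum A B) = gw_class A + gw_class B"
proof -
 have "form_class A + form_class B = form_class (orth_sum A B)"
  by (rule plus_form_class.abs_eq) (simp_all add: isometric_self assms)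
 thus ?thesis unfolding gw_class_def plus_groth.abs_eq by simp
qed

lemma gw_class_isometric: "isometric A B ==> gw_class A = gw_class B"
proof -
 assume "isometric A B"
 hence "form_class A = form_class B"
  using Quotient3_rel_abs[OF Quotient3_form_class] by blast
 thus ?thesis unfolding gw_class_def by simp
qed

lemma gw_class_empty: "gw_class (0\<^sub>m 0 0) = 0"
 unfolding gw_class_def zero_groth_def zero_form_class_def by simp

lemma gram_carrier [simp]: "gram B bs \<in> carrier_mat (length bs) (length bs)"
 by (simp add: gram_def)

lemma gram_append:
 assumes "\<And>a b. a \<in> set as ==> b \<in> set bs ==> B a b = 0 \<and> B b a = (0::'f::field)"
 shows "gram B (as @ bs) = orth_sum (gram B as) (gram B bs)"
 unfolding gram_def orth_sum_def
 by (rule eq_matI) (use assms in "auto simp: nth_append")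

lemma gram_map: "(\<And>x y. x \<in> set bs ==> y \<in> set bs ==> B' (T x) (T y) = B x y) ==> gram B' (map T bs) = gram B bs"
 unfolding gram_def by (rule eq_matI) auto

text \<open>The form is kept on representatives: \<open>rad\<close> and \<open>nondeg\<close>
  together make \<open>W\<close> the radical, so this is a nondegenerate form on \<open>V/W\<close>
  for which no quotient type is formed. In the application \<open>V\<close> is a lattice and
  \<open>W\<close> its dual.\<close>

locale bilinear_form = Vector_Spaces.vector_space scale
 for scale :: "'f::field => 'v::ab_group_add => 'v" +
 fixes V W :: "'v set" and B :: "'v => 'v => 'f"
 assumes subV: "subspace V" and subW: "subspace W" and WV: "W \<subseteq> V"
  and sym: "\<And>x y. x \<in> V ==> y \<in> V ==> B x y = B y x"
  and add_left: "\<And>x y z. x \<in> V ==> y \<in> V ==> z \<in> V ==> B (x + y) z = B x z + B y z"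
  and scale_left: "\<And>c x z. x \<in> V ==> z \<in> V ==> B (scale c x) z = c * B x z"
  and rad: "\<And>x y. x \<in> W ==> y \<in> V ==> B x y = 0"
  and nondeg: "\<And>x. x \<in> V ==> (\<And>y. y \<in> V ==> B x y = 0) ==> x \<in> W"
begin

lemma rad': "x \<in> W ==> y \<in> V ==> B y x = 0"
 using rad sym WV by (metis subsetD)

lemma zero_left: "z \<in> V ==> B 0 z = 0"
 using rad subspace_0[OF subW] by blast

lemma add_right: "x \<in> V ==> y \<in> V ==> z \<in> V ==> B z (x + y) = B z x + B z y"
 using add_left sym subspace_add[OF subV] by metis

lemma scale_right: "x \<in> V ==> z \<in> V ==> B z (scale c x) = c * B z x"
 using scale_left sym subspace_scale[OF subV] by metis

lemma diff_left: "x \<in> V ==> y \<in> V ==> z \<in> V ==> B (x - y) z = B x z - B y z"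
 using add_left[of x "scale (-1) y" z] scale_left[of y z "-1"] subspace_scale[OF subV, of y "-1"]
 by (simp add: scale_minus_left)

lemma diff_right: "x \<in> V ==> y \<in> V ==> z \<in> V ==> B z (x - y) = B z x - B z y"
 using diff_left sym subspace_diff[OF subV] by metis

lemma sum_left:
 assumes "finite I" "\<And>i. i \<in> I ==> g i \<in> V" "z \<in> V"
 shows "B (\<Sum>i\<in>I. g i) z = (\<Sum>i\<in>I. B (g i) z)"
 using assms(1,2)
proof (induction I)
 case (insert i I)
 have "(\<Sum>i\<in>I. g i) \<in> V" using insert by (intro subspace_sum[OF subV]) auto
 thus ?case using insert add_left assms(3) by simp
qed (simp add: zero_left assms)

lemma lc_left: "set bs \<subseteq> V ==> z \<in> V ==> B (lc scale bs c) z = (\<Sum>i<length bs. c i * B (bs ! i) z)"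
 unfolding lc_def
 by (subst sum_left) (auto intro!: subspace_scale[OF subV] sum.cong scale_left)

lemma lc_right: "set bs \<subseteq> V ==> z \<in> V ==> B z (lc scale bs c) = (\<Sum>i<length bs. c i * B z (bs ! i))"
proof -
 assume a: "set bs \<subseteq> V" "z \<in> V"
 have "B z (lc scale bs c) = B (lc scale bs c) z" using a lc_mem[OF subV] sym by blast
 also have "\<dots> = (\<Sum>i<length bs. c i * B (bs ! i) z)" by (rule lc_left[OF a])
 also have "\<dots> = (\<Sum>i<length bs. c i * B z (bs ! i))"
  using a by (intro sum.cong refl arg_cong2[where f = "(*)"] sym) auto
 finally show ?thesis .
qed

lemma nondeg_sym_gram:
 assumes "quot_basis scale V W bs"
 shows "nondeg_sym (gram B bs)"
proof (rule nondeg_symI)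
 let ?n = "length bs"
 have bV: "set bs \<subseteq> V" using assms unfolding quot_basis_def by blast
 show "gram B bs \<in> carrier_mat ?n ?n" by simp
 show "transpose_mat (gram B bs) = gram B bs"
  unfolding gram_def by (rule eq_matI) (use bV sym in "auto simp: subset_iff")
 show "det (gram B bs) ~= 0"
 proof
  assume "det (gram B bs) = 0"
  then obtain v where v: "v \<in> carrier_vec ?n" "v ~= 0\<^sub>v ?n" "gram B bs *\<^sub>v v = 0\<^sub>v ?n"
   using det_0_iff_vec_prod_zero[of "gram B bs" ?n] by auto
  let ?x = "lc scale bs (\<lambda>i. v $ i)"
  have x: "?x \<in> V" using lc_mem[OF subV bV] .
  have 0: "B (bs ! i) ?x = 0" if "i < ?n" for i
  proof -
   have "B (bs ! i) ?x = (\<Sum>j<?n. v $ j * B (bs ! i) (bs ! j))" using bV that by (intro lc_right) auto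
   also have "\<dots> = (gram B bs *\<^sub>v v) $ i"
    using that v(1) by (simp add: gram_def scalar_prod_def mult.commute atLeast0LessThan)
   also have "\<dots> = 0" using v(3) that by simp
   finally show ?thesis .
  qed
  have "?x \<in> W"
  proof (rule nondeg[OF x])
   fix y assume y: "y \<in> V"
   then obtain c where c: "y - lc scale bs c \<in> W" using assms unfolding quot_basis_def by blast
   have "B ?x (lc scale bs c) = B (lc scale bs c) ?x" using sym x lc_mem[OF subV bV] by blast
   also have "\<dots> = 0" unfolding lc_left[OF bV x] using 0 by simp
   finally have 1: "B ?x (lc scale bs c) = 0" .
   have "B ?x (y - lc scale bs c) = 0" using rad' c x by blast
   thus "B ?x y = 0" using 1 diff_right[OF y lc_mem[OF subV bV] x] by simp
  qed
  hence "\<forall>i<?n. v $ i = 0" using assms unfolding quot_basis_def by blast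
  hence "v = 0\<^sub>v ?n" using v(1) by (intro eq_vecI) auto
  thus False using v by blast
 qed
qed

lemma isometric_gram:
 assumes as: "quot_basis scale V W as" and bs: "quot_basis scale V W bs"
 shows "isometric (gram B as) (gram B bs)"
proof -
 define n where "n = length as"
 have len: "length bs = n" using quot_basis_length[OF subW as bs] n_def by simp
 have aV: "set as \<subseteq> V" and bV: "set bs \<subseteq> V" using as bs unfolding quot_basis_def by blast+
 have "\<exists>c. v - lc scale as c \<in> W" if "v \<in> V" for v using as that unfolding quot_basis_def by blast
 then obtain C where C: "\<And>v. v \<in> V ==> v - lc scale as (C v) \<in> W" by metis
 define P where "P = mat n n (\<lambda>(i, j). C (bs ! j) i)"
 have P: "P \<in> carrier_mat n n" by (simp add: P_def)
 have ga: "gram B as \<in> carrier_mat n n" and gb: "gram B bs \<in> carrier_mat n n"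
  by (simp_all add: gram_def n_def len)
 have B_eq: "B x y = B (lc scale as (C x)) (lc scale as (C y))" if "x \<in> V" "y \<in> V" for x y
 proof -
  have m: "lc scale as (C x) \<in> V" "lc scale as (C y) \<in> V" using lc_mem[OF subV aV] by blast+
  have "B (x - lc scale as (C x)) y = 0" using rad C that by blast
  moreover have "B (lc scale as (C x)) (y - lc scale as (C y)) = 0" using rad' C that m by blast
  ultimately show ?thesis using diff_left diff_right that m by simp
 qed
 have eq: "gram B bs = transpose_mat P * gram B as * P"
 proof (rule eq_matI)
  fix i j assume "i < dim_row (transpose_mat P * gram B as * P)" "j < dim_col (transpose_mat P * gram B as * P)"
  hence ij: "i < n" "j < n" using P by auto
  have bij: "bs ! i \<in> V" "bs ! j \<in> V" using ij len bV by auto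
  have "(transpose_mat P * gram B as * P) $$ (i, j)
   = (\<Sum>l<n. (\<Sum>k<n. C (bs ! i) k * B (as ! k) (as ! l)) * C (bs ! j) l)"
   using ij by (simp add: P_def gram_def n_def[symmetric] scalar_prod_def atLeast0LessThan)
  also have "\<dots> = (\<Sum>l<n. C (bs ! j) l * B (lc scale as (C (bs ! i))) (as ! l))"
   using aV by (intro sum.cong refl) (subst lc_left, auto simp: n_def mult.commute)
  also have "\<dots> = B (lc scale as (C (bs ! i))) (lc scale as (C (bs ! j)))"
   using lc_right[OF aV lc_mem[OF subV aV]] n_def by simp
  also have "\<dots> = gram B bs $$ (i, j)" using B_eq bij ij len by (simp add: gram_def)
  finally show "gram B bs $$ (i, j) = (transpose_mat P * gram B as * P) $$ (i, j)" by simp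
 qed (use P in "auto simp: gram_def len")
 \<comment> \<open>Invertibility of the change-of-basis matrix is read off from the new Gram
   determinant, which contains \<open>det P\<close> as a factor.\<close>
 have "det (gram B bs) ~= 0" using nondeg_sym_gram[OF bs] unfolding nondeg_sym_def by blast
 moreover have tP: "transpose_mat P \<in> carrier_mat n n" using P by simp
 hence "det (gram B bs) = det (transpose_mat P) * det (gram B as) * det P"
  unfolding eq using det_mult[OF mult_carrier_mat[OF tP ga] P] det_mult[OF tP ga] by simp
 ultimately have "det P ~= 0" by auto
 from isometricI[OF nondeg_sym_gram[OF as] nondeg_sym_gram[OF bs] ga gb P this eq] show ?thesis .
qed

lemma gw_class_gram_unique:
 "quot_basis scale V W as ==> quot_basis scale V W bs ==> gw_class (gram B as) = gw_class (gram B bs)"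
 using isometric_gram gw_class_isometric by blast

end

text \<open>Maximality is expressed by orthogonality instead of half the dimension, because residue
  duality verifies orthogonality directly.\<close>

locale lagrangian = bilinear_form scale V W B
 for scale :: "'f::field => 'v::ab_group_add => 'v" and V W B +
 fixes L :: "'v set"
 assumes subL: "subspace L" and WL: "W \<subseteq> L" and LV: "L \<subseteq> V"
  and isotropic: "\<And>x y. x \<in> L ==> y \<in> L ==> B x y = 0"
  and self_perp: "\<And>x. x \<in> V ==> (\<And>y. y \<in> L ==> B x y = 0) ==> x \<in> L"

text \<open>The projection of \<open>v\<close> to the plane is
  \<open>B(v,g1) g1 - B(v,g2) g2\<close>; the sign is due to \<open>B g2 g2 = - 1\<close>.\<close>

lemma (in bilinear_form) split_plane:
 assumes "g1 \<in> V" "g2 \<in> V" "B g1 g1 = 1" "B g2 g2 = - 1" "B g1 g2 = 0"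
 defines "V1 \<equiv> {v \<in> V. B v g1 = 0 \<and> B v g2 = 0}"
 shows "bilinear_form scale V1 W B" "quot_basis scale V V1 [g1, g2]" "subspace V1"
proof -
 have g21: "B g2 g1 = 0" using assms sym by metis
 show sub: "subspace V1" unfolding V1_def
  using assms(1,2) subV by (intro subspaceI)
   (auto simp: subspace_0 subspace_add subspace_scale zero_left add_left scale_left)
 have proj: "\<exists>c d. v - (scale c g1 + scale d g2) \<in> V1" if v: "v \<in> V" for v
  using v assms(1-5) g21 subV unfolding V1_def
  by (intro exI[of _ "B v g1"] exI[of _ "- B v g2"])
    (auto simp: subspace_add subspace_scale subspace_diff diff_left add_left scale_left subspace_neg)
 show "quot_basis scale V V1 [g1, g2]"
  unfolding quot_basis_def
 proof (intro conjI ballI allI impI)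
  show "set [g1, g2] \<subseteq> V" using assms by auto
 next
  fix v assume "v \<in> V"
  from proj[OF this] obtain c d where "v - (scale c g1 + scale d g2) \<in> V1" by blast
  thus "\<exists>c. v - lc scale [g1, g2] c \<in> V1"
   by (intro exI[of _ "\<lambda>i. if i = 0 then c else d"]) (simp add: lc_Cons)
 next
  fix c :: "nat => 'f" and i assume c: "lc scale [g1, g2] c \<in> V1" and i: "i < length [g1, g2]"
  have v: "lc scale [g1, g2] c = scale (c 0) g1 + scale (c 1) g2" by (simp add: lc_Cons)
  have "B (scale (c 0) g1 + scale (c 1) g2) g1 = 0" "B (scale (c 0) g1 + scale (c 1) g2) g2 = 0"
   using c unfolding v V1_def by auto
  hence "c 0 = 0" "c 1 = 0" using assms(1-5) g21 subV
   by (auto simp: add_left scale_left subspace_scale)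
  thus "c i = 0" using i by (cases i) auto
 qed
 show "bilinear_form scale V1 W B"
 proof unfold_locales
  show "W \<subseteq> V1" unfolding V1_def using WV rad assms(1,2) by auto
  fix x assume x: "x \<in> V1" and 0: "\<And>y. y \<in> V1 ==> B x y = 0"
  show "x \<in> W"
  proof (rule nondeg)
   show xV: "x \<in> V" using x unfolding V1_def by blast
   fix y assume y: "y \<in> V"
   from proj[OF this] obtain c d where cd: "y - (scale c g1 + scale d g2) \<in> V1" by blast
   have "B x (scale c g1 + scale d g2) = 0"
    using x xV assms(1,2) subV unfolding V1_def by (simp add: add_right scale_right subspace_scale)
   thus "B x y = 0" using 0[OF cd] diff_right[of y "scale c g1 + scale d g2" x] y xV assms(1,2) subV
    by (simp add: subspace_add subspace_scale)
  qed
 qed (use sub subW sym add_left scale_left rad V1_def in auto)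
qed

text \<open>A vector of \<open>L\<close> outside the radical has an isotropic partner. The plane
  they span is split off in its diagonal form with entries \<open>1\<close> and \<open>- 1\<close>,
  since \<open>hyperbolic\<close> is the sum of these two rank one classes. \<open>L\<close> cut
  down to the complement is Lagrangian again, and the length drops by two.\<close>

lemma lagrangian_hyperbolic:
 fixes scale :: "'f::field => 'v::ab_group_add => 'v"
 assumes "(2 :: 'f) ~= 0" "lagrangian scale V W B L" "quot_basis scale V W bs"
 shows "even (length bs) \<and> gw_class (gram B bs) = (\<Sum>i < length bs div 2. hyperbolic)"
 using assms(2,3)
proof (induction "length bs" arbitrary: V L bs rule: less_induct)
 case less
 interpret lagrangian scale V W B L by (rule less.prems)
 show ?case
 proof (cases "L \<subseteq> W")
  case True
  hence "L = W" using WL by blast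
  hence "V = W" using self_perp rad' WV by blast
  hence "bs = []" using quot_basis_length[OF subW less.prems(2)] quot_basis_Nil[OF subW] by fastforce
  thus ?thesis by (simp add: gram_def gw_class_empty[symmetric]) (rule arg_cong[of _ _ gw_class], auto)
 next
  case False
  then obtain e where e: "e \<in> L" "e \<notin> W" by blast
  have eV: "e \<in> V" using e LV by blast
  obtain f0 where f0: "f0 \<in> V" "B e f0 ~= 0" using nondeg[OF eV] e by blast
  define f1 where "f1 = scale (1 / B e f0) f0"
  have f1: "f1 \<in> V" "B e f1 = 1" unfolding f1_def
   using f0 eV subV by (auto simp: subspace_scale scale_right)
  \<comment> \<open>The multiple of \<open>e\<close> removes the square of \<open>f1\<close> without
    changing the pairing with \<open>e\<close>; it requires division by 2.\<close>
  define f where "f = f1 - scale (B f1 f1 / 2) e"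
  have ee: "B e e = 0" using isotropic e by blast
  have f1e: "B f1 e = 1" using f1 eV sym by metis
  have fV: "f \<in> V" unfolding f_def using f1 eV subV by (simp add: subspace_diff subspace_scale)
  have ef: "B e f = 1" unfolding f_def using f1 eV ee subV
   by (simp add: diff_right scale_right subspace_scale)
  have fe: "B f e = 1" using ef fV eV sym by metis
  have ff: "B f f = 0"
  proof -
   have "B f f = B f1 f - B f1 f1 / 2 * B e f" unfolding f_def[of]
    by (subst (1) diff_left) (use f1 eV fV subV in "auto simp: scale_left subspace_scale f_def[symmetric]")
   also have "B f1 f = B f1 f1 - B f1 f1 / 2 * B f1 e" unfolding f_def
    by (subst diff_right) (use f1 eV subV in "auto simp: scale_right subspace_scale")
   finally show ?thesis using f1e ef assms(1) by simp
  qed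
  \<comment> \<open>As \<open>e\<close> and \<open>f\<close> are isotropic with
    \<open>B e f = 1\<close>, the vectors \<open>e + f/2\<close> and \<open>e - f/2\<close> are
    orthogonal with squares \<open>1\<close> and \<open>- 1\<close>.\<close>
  define g1 where "g1 = e + scale (1/2) f"
  define g2 where "g2 = e - scale (1/2) f"
  have h: "scale (1/2) f \<in> V" using fV subV subspace_scale by blast
  have gV: "g1 \<in> V" "g2 \<in> V" unfolding g1_def g2_def using eV h subV by (auto simp: subspace_add subspace_diff)
  have half: "(1/2 :: 'f) + 1/2 = 1" using assms(1) by (simp add: field_simps)
  have half': "- (1/2 :: 'f) - 1/2 = - 1" using arg_cong[OF half, of uminus] by simp
  have g: "B g1 g1 = 1" "B g2 g2 = - 1" "B g1 g2 = 0"
   unfolding g1_def g2_def using eV fV h subV ee ff ef fe half half'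
   by (simp_all add: add_left diff_left add_right diff_right scale_left scale_right subspace_add subspace_diff)
  define V1 where "V1 = {v \<in> V. B v g1 = 0 \<and> B v g2 = 0}"
  note sp = split_plane[OF gV g, folded V1_def]
  interpret V1: bilinear_form scale V1 W B by (rule sp)
  have V1_alt: "v \<in> V1 \<longleftrightarrow> v \<in> V \<and> B v e = 0 \<and> B v f = 0" for v
  proof (cases "v \<in> V")
   case True
   have "B v g1 = B v e + B v f / 2" "B v g2 = B v e - B v f / 2"
    unfolding g1_def g2_def using True eV h fV subV by (simp_all add: add_right diff_right scale_right)
   moreover have "a + b / 2 = 0 \<and> a - b / 2 = 0 \<longleftrightarrow> a = 0 \<and> b = 0" for a b :: 'f
   proof
    assume a: "a + b / 2 = 0 \<and> a - b / 2 = 0"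
    have "2 * a = (a + b / 2) + (a - b / 2)" by simp
    also have "\<dots> = 0" using a by simp
    finally have "2 * a = 0" .
    hence "a = 0" using assms(1) by simp
    thus "a = 0 \<and> b = 0" using a assms(1) by simp
   qed simp
   ultimately show ?thesis using True V1_def by simp
  qed (simp add: V1_def)
  have "lagrangian scale V1 W B (L \<inter> V1)"
  proof unfold_locales
   show "subspace (L \<inter> V1)" using subL sp(3) by (rule subspace_inter)
   show "W \<subseteq> L \<inter> V1" using WL V1.WV by blast
   show "\<And>x y. x \<in> L \<inter> V1 ==> y \<in> L \<inter> V1 ==> B x y = 0" using isotropic by blast
   fix x assume x: "x \<in> V1" and 0: "\<And>y. y \<in> L \<inter> V1 ==> B x y = 0"
   have xV: "x \<in> V" using x V1_def by blast
   have "x \<in> L"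
   proof (rule self_perp[OF xV])
    fix y assume y: "y \<in> L"
    hence yV: "y \<in> V" using LV by blast
    \<comment> \<open>The component of \<open>y\<close> orthogonal to the plane. It stays in
      \<open>L\<close> because only a multiple of \<open>e\<close> is subtracted.\<close>
    let ?y = "y - scale (B y f) e"
    have se: "scale (B y f) e \<in> L" "scale (B y f) e \<in> V"
     using e eV subspace_scale subL subV by blast+
    have "?y \<in> L \<inter> V1" unfolding Int_iff V1_alt
     using y yV se isotropic[OF y e(1)] eV fV subV subL ee ef
     by (auto simp: subspace_diff diff_left scale_left)
    from 0[OF this] have "B x y = B x (scale (B y f) e)" using diff_right xV yV se by simp
    also have "\<dots> = 0" using x xV eV unfolding V1_alt by (simp add: scale_right)
    finally show "B x y = 0" .
   qed
   thus "x \<in> L \<inter> V1" using x by blast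
  qed auto
  have "V1 \<subseteq> span (W \<union> set bs)" using quot_basis_span[OF less.prems(2)] V1_def by blast
  from quot_basis_exists[OF finite_set sp(3) subW V1.WV this]
  obtain bs1 where bs1: "quot_basis scale V1 W bs1" by blast
  have q: "quot_basis scale V W ([g1, g2] @ bs1)"
   by (rule quot_basis_tower[OF sp(3,2) bs1 V1.WV _ subW]) (auto simp: V1_def)
  have len: "length bs = 2 + length bs1" using quot_basis_length[OF subW less.prems(2) q] by simp
  have IH: "even (length bs1)" "gw_class (gram B bs1) = (\<Sum>i < length bs1 div 2. hyperbolic)"
   using less.hyps[of bs1 V1 "L \<inter> V1"] len \<open>lagrangian scale V1 W B (L \<inter> V1)\<close> bs1 by auto
  have bsV1: "set bs1 \<subseteq> V1" using bs1 unfolding quot_basis_def by blast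
  have "gram B ([g1] @ ([g2] @ bs1)) = orth_sum (gram B [g1]) (gram B ([g2] @ bs1))"
   using bsV1 g gV sym by (intro gram_append) (auto simp: V1_def subset_iff)
  also have "gram B ([g2] @ bs1) = orth_sum (gram B [g2]) (gram B bs1)"
   using bsV1 g gV sym by (intro gram_append) (auto simp: V1_def subset_iff)
  also have "gram B [g1] = mat 1 1 (\<lambda>_. 1)" unfolding gram_def by (rule eq_matI) (auto simp: g)
  also have "gram B [g2] = mat 1 1 (\<lambda>_. - 1)" unfolding gram_def by (rule eq_matI) (auto simp: g)
  finally have gr: "gram B ([g1, g2] @ bs1) = orth_sum (mat 1 1 (\<lambda>_. 1)) (orth_sum (mat 1 1 (\<lambda>_. - 1)) (gram B bs1))"
   by simp
  have nd: "nondeg_sym (mat 1 1 (\<lambda>_. a))" if "a ~= 0" for a :: 'f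
   by (rule nondeg_symI[of _ 1]) (use that in "auto simp: det_single intro!: eq_matI")
  have "gw_class (gram B bs) = gw_class (gram B ([g1, g2] @ bs1))"
   by (rule gw_class_gram_unique[OF less.prems(2) q])
  also have "\<dots> = hyperbolic + gw_class (gram B bs1)"
   unfolding gr hyperbolic_def gw_rank_one_def
   using nd[of 1] nd[of "-1"] V1.nondeg_sym_gram[OF bs1]
   by (simp add: gw_class_orth_sum nondeg_sym_orth_sum add.assoc)
  finally show ?thesis using IH len by (simp add: add.commute)
 qed
qed

text \<open>Testing only against the part of \<open>A\<close> orthogonal to \<open>i\<close> loses
  one linear functional, and a multiple of \<open>i\<close> makes up for it.
  \<open>reduce_one\<close> uses this for \<open>V\<close> with its radical and for \<open>L\<close>
  with itself.\<close>

lemma (in bilinear_form) perp_hyperplane: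
 assumes A: "subspace A" "A \<subseteq> V" and perp: "\<And>x. x \<in> V ==> (\<And>y. y \<in> A ==> B x y = 0) ==> x \<in> A'"
  and i: "i \<in> V" and x: "x \<in> V" "B x i = 0" "\<And>y. y \<in> A ==> B y i = 0 ==> B x y = 0"
 shows "\<exists>k. x - scale k i \<in> A'"
proof (cases "\<forall>y\<in>A. B i y = 0")
 case True
 hence "B x y = 0" if "y \<in> A" for y using that A(2) x(3) sym[OF i] by (metis subsetD)
 thus ?thesis using perp[OF x(1)] by (intro exI[of _ 0]) simp
next
 case False
 then obtain u0 where u0: "u0 \<in> A" "u0 \<in> V" "B i u0 ~= 0" using A(2) by blast
 let ?u = "scale (1 / B i u0) u0"
 have u: "?u \<in> A" "?u \<in> V" "B ?u i = 1"
  using u0 i A subV sym[of u0 i] by (auto simp: subspace_scale scale_left)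
 have "x - scale (B x ?u) i \<in> A'"
 proof (rule perp)
  show "x - scale (B x ?u) i \<in> V" using x i subV by (simp add: subspace_diff subspace_scale)
  fix y assume y: "y \<in> A"
  hence yV: "y \<in> V" using A(2) by blast
  have "y - scale (B y i) ?u \<in> A" using y u subspace_diff[OF A(1)] subspace_scale[OF A(1)] by blast
  moreover have "B (y - scale (B y i) ?u) i = 0" using yV u i subspace_scale[OF subV u(2)]
   by (simp add: diff_left scale_left[OF u(2)] del: scale_scale)
  ultimately have "B x y = B y i * B x ?u" using x(3) x(1) yV u subspace_scale[OF subV u(2)]
   by (fastforce simp: diff_right scale_right[OF u(2)] simp del: scale_scale)
  thus "B (x - scale (B x ?u) i) y = 0"
   using x(1) yV i sym[of i y] subV by (simp add: diff_left scale_left subspace_scale del: scale_scale)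
 qed
 thus ?thesis by blast
qed

text \<open>The complement of an isotropic \<open>i\<close> modulo \<open>i\<close> inherits a
  Lagrangian: the elements of the complement that lie in \<open>L\<close> up to a multiple of
  \<open>i\<close>.\<close>

lemma (in lagrangian) reduce_one:
 assumes i: "i \<in> V" "B i i = 0"
 shows "\<exists>L'. lagrangian scale {v \<in> V. B v i = 0} (span (insert i W)) B L'"
proof -
 let ?V = "{v \<in> V. B v i = 0}" and ?W = "span (insert i W)"
 let ?L = "{x \<in> ?V. \<exists>k. x - scale k i \<in> L}"
 have sV: "subspace ?V"
  using i subV by (intro subspaceI) (auto simp: subspace_0 subspace_add subspace_scale zero_left add_left scale_left)
 have W_alt: "x \<in> ?W \<longleftrightarrow> (\<exists>k. x - scale k i \<in> W)" for x
  unfolding span_insert span_eq_iff[THEN iffD2, OF subW] by blast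
 have sL: "subspace ?L"
 proof (rule subspaceI)
  show "0 \<in> ?L" using subspace_0[OF sV] subspace_0[OF subL] by (auto intro!: exI[of _ 0])
 next
  fix x y assume x: "x \<in> ?L" and y: "y \<in> ?L"
  then obtain k l where kl: "x - scale k i \<in> L" "y - scale l i \<in> L" by blast
  have "x + y - scale (k + l) i = (x - scale k i) + (y - scale l i)"
   by (simp add: scale_left_distrib algebra_simps)
  hence "x + y - scale (k + l) i \<in> L" using subspace_add[OF subL kl] by metis
  thus "x + y \<in> ?L" using subspace_add[OF sV] x y by blast
 next
  fix c x assume x: "x \<in> ?L"
  then obtain k where k: "x - scale k i \<in> L" by blast
  have "scale c x - scale (c * k) i = scale c (x - scale k i)" by (simp add: scale_right_diff_distrib)
  hence "scale c x - scale (c * k) i \<in> L" using subspace_scale[OF subL k] by simp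
  thus "scale c x \<in> ?L" using subspace_scale[OF sV] x by blast
 qed
 have WV': "?W \<subseteq> ?V"
  by (rule span_minimal[OF _ sV]) (use i WV rad in auto)
 have dec: "x = (x - scale k i) + scale k i" for x k by simp
 have "lagrangian scale ?V ?W B ?L"
 proof unfold_locales
  show "subspace ?V" by (rule sV)
  show "subspace ?W" by (rule subspace_span)
  show "?W \<subseteq> ?V" by (rule WV')
  show "subspace ?L" by (rule sL)
  show "?W \<subseteq> ?L" using WV' W_alt WL by blast
  show "?L \<subseteq> ?V" by blast
  show "\<And>x y. x \<in> ?V ==> y \<in> ?V ==> B x y = B y x" using sym by blast
  show "\<And>x y z. x \<in> ?V ==> y \<in> ?V ==> z \<in> ?V ==> B (x + y) z = B x z + B y z" using add_left by blast
  show "\<And>c x z. x \<in> ?V ==> z \<in> ?V ==> B (scale c x) z = c * B x z" using scale_left by blast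
 next
  fix x y assume x: "x \<in> ?W" and y: "y \<in> ?V"
  then obtain k where k: "x - scale k i \<in> W" using W_alt by blast
  have "B (x - scale k i) y = 0" using rad k y by blast
  moreover have "x \<in> V" "scale k i \<in> V" using x WV' subspace_scale[OF subV i(1)] by blast+
  ultimately have "B x y = k * B i y" using y i by (simp add: diff_left scale_left)
  thus "B x y = 0" using y i sym by fastforce
 next
  fix x assume "x \<in> ?V" "\<And>y. y \<in> ?V ==> B x y = 0"
  thus "x \<in> ?W" unfolding W_alt using i(1) nondeg by (intro perp_hyperplane[OF subV order_refl]) auto
 next
  fix x y assume x: "x \<in> ?L" and y: "y \<in> ?L"
  then obtain k l where kl: "x - scale k i \<in> L" "y - scale l i \<in> L" by blast
  have m: "x - scale k i \<in> V" "y - scale l i \<in> V" "scale k i \<in> V" "scale l i \<in> V" "x \<in> V" "y \<in> V"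
   using kl LV subspace_scale[OF subV i(1)] x y by auto
  have "B (x - scale k i) (y - scale l i) = 0" using isotropic kl by blast
  moreover have "B (x - scale k i) (y - scale l i) = B x y"
   using m x y i sym[of i y] by (simp add: diff_left diff_right scale_left scale_right)
  ultimately show "B x y = 0" by simp
 next
  fix x assume x: "x \<in> ?V" and 0: "\<And>y. y \<in> ?L ==> B x y = 0"
  have "y \<in> ?L" if "y \<in> L" "B y i = 0" for y using that LV by (auto intro!: exI[of _ 0])
  hence "\<exists>k. x - scale k i \<in> L" using x i(1) 0 self_perp by (intro perp_hyperplane[OF subL LV]) auto
  thus "x \<in> ?L" using x by blast
 qed
 thus ?thesis by blast
qed

text \<open>This is the descent from a lattice to a smaller one: \<open>S\<close> will be a basis of
  the dual of the smaller lattice modulo the dual of the larger one.\<close>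

lemma (in lagrangian) reduce:
 assumes "finite S" "S \<subseteq> V" "\<And>s t. s \<in> S ==> t \<in> S ==> B s t = 0"
 shows "\<exists>L'. lagrangian scale {v \<in> V. \<forall>s\<in>S. B v s = 0} (span (W \<union> S)) B L'"
 using assms
proof (induction S)
 case empty
 have "span W = W" using subW by (rule span_eq_iff[THEN iffD2])
 hence "lagrangian scale {v \<in> V. \<forall>s\<in>{}. B v s = 0} (span (W \<union> {})) B L"
  using lagrangian_axioms by (simp only: Un_empty_right ball_empty simp_thms Collect_mem_eq)
 thus ?case by blast
next
 case (insert i S)
 then obtain L' where "lagrangian scale {v \<in> V. \<forall>s\<in>S. B v s = 0} (span (W \<union> S)) B L'" by auto
 then interpret r: lagrangian scale "{v \<in> V. \<forall>s\<in>S. B v s = 0}" "span (W \<union> S)" B L' .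
 have "\<exists>L''. lagrangian scale {v \<in> {v \<in> V. \<forall>s\<in>S. B v s = 0}. B v i = 0} (span (insert i (span (W \<union> S)))) B L''"
  using insert.prems by (intro r.reduce_one) auto
 moreover have "{v \<in> {v \<in> V. \<forall>s\<in>S. B v s = 0}. B v i = 0} = {v \<in> V. \<forall>s\<in>insert i S. B v s = 0}" by auto
 moreover have "span (insert i (span (W \<union> S))) = span (W \<union> insert i S)"
  by (simp add: span_insert span_span)
 ultimately show ?case by simp
qed

section \<open>Discrete valuation rings and residues\<close>

text \<open>Besides the ring axioms the demand is that every nonzero element of the field is a unit
  times a power of the nonunit \<open>pu\<close>. Ideals and fractional ideals are then compared by
  \<open>vord\<close> alone.\<close>

locale dvr =
 fixes p :: "'k::field set" and pu :: 'k
 assumes one_mem: "1 \<in> p"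
  and add_mem: "a \<in> p ==> b \<in> p ==> a + b \<in> p"
  and minus_mem: "a \<in> p ==> - a \<in> p"
  and mult_mem: "a \<in> p ==> b \<in> p ==> a * b \<in> p"
  and pi_mem: "pu \<in> p" and pi_nonzero: "pu ~= 0" and pi_nonunit: "inverse pu \<notin> p"
  and unif: "h ~= 0 ==> \<exists>n w. w \<in> p \<and> inverse w \<in> p \<and> h = w * pu powi n"
begin

lemma zero_mem: "0 \<in> p"
 using add_mem[OF one_mem minus_mem[OF one_mem]] by simp

lemma diff_mem: "a \<in> p ==> b \<in> p ==> a - b \<in> p"
 using add_mem[OF _ minus_mem, of a b] by simp

lemma power_mem: "a \<in> p ==> a ^ n \<in> p"
 by (induction n) (auto intro: one_mem mult_mem)

lemma sum_mem: "(\<And>i. i \<in> I ==> g i \<in> p) ==> (\<Sum>i\<in>I. g i) \<in> p"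
 by (induction I rule: infinite_finite_induct) (auto intro: zero_mem add_mem)

lemma powi_mem: "n \<ge> 0 ==> pu powi n \<in> p"
 by (simp add: power_int_def power_mem pi_mem)

lemma unit_neg_powi:
 assumes "w \<in> p" "inverse w \<in> p" "w ~= 0" "n < 0"
 shows "w * pu powi n \<notin> p"
proof
 assume a: "w * pu powi n \<in> p"
 have "pu powi n * pu powi (- n - 1) = pu powi (- 1)"
  using power_int_add[of pu n "- n - 1"] pi_nonzero by simp
 hence "inverse w * (w * pu powi n) * pu powi (- n - 1) = inverse pu"
  using assms(3) by (simp add: mult.assoc[symmetric])
 moreover have "inverse w * (w * pu powi n) * pu powi (- n - 1) \<in> p"
  using assms by (intro mult_mem assms a powi_mem) auto
 ultimately show False using pi_nonunit by simp
qed

definition vord :: "'k => int" where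
 "vord h = (THE n. \<exists>w. w \<in> p \<and> inverse w \<in> p \<and> h = w * pu powi n)"

lemma unif_unique:
 assumes "h ~= 0" "w \<in> p" "inverse w \<in> p" "h = w * pu powi n" "w' \<in> p" "inverse w' \<in> p" "h = w' * pu powi m"
 shows "n \<le> m"
proof (rule ccontr)
 assume "\<not> n \<le> m"
 hence nm: "m - n < 0" by simp
 have w0: "w ~= 0" "w' ~= 0" using assms by auto
 have "w' * pu powi (m - n) = w"
  using assms(4,7) pi_nonzero by (simp add: power_int_diff field_simps)
 thus False using unit_neg_powi[OF assms(5,6) w0(2) nm] assms(2) by simp
qed

lemma vord_eqI: "h ~= 0 ==> w \<in> p ==> inverse w \<in> p ==> h = w * pu powi n ==> vord h = n"
 unfolding vord_def
 by (rule the_equality, blast) (metis unif_unique order_antisym)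

lemma vordE:
 assumes "h ~= 0" obtains w where "w \<in> p" "inverse w \<in> p" "w ~= 0" "h = w * pu powi (vord h)"
proof -
 obtain n w where "w \<in> p" "inverse w \<in> p" "h = w * pu powi n" using unif[OF assms] by blast
 moreover from this have "vord h = n" using vord_eqI assms by blast
 ultimately show ?thesis using that assms by fastforce
qed

lemma vord_mult:
 assumes "a ~= 0" "b ~= 0" shows "vord (a * b) = vord a + vord b"
proof -
 obtain w where w: "w \<in> p" "inverse w \<in> p" "a = w * pu powi (vord a)" by (rule vordE[OF assms(1)])
 obtain v where v: "v \<in> p" "inverse v \<in> p" "b = v * pu powi (vord b)" by (rule vordE[OF assms(2)])
 have "a * b = (w * v) * pu powi (vord a + vord b)"
  using arg_cong2[OF w(3) v(3), of "(*)"] by (simp only: power_int_add[OF disjI1[OF pi_nonzero]] mult.assoc mult.left_commute)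
 from vord_eqI[OF _ _ _ this] show ?thesis
  using assms mult_mem[OF w(1) v(1)] mult_mem[OF w(2) v(2)] by simp
qed

lemma vord_inverse: "a ~= 0 ==> vord (inverse a) = - vord a"
 using vord_mult[of a "inverse a"] vord_eqI[of 1 1 0] one_mem by simp

lemma vord_divide: "a ~= 0 ==> b ~= 0 ==> vord (a / b) = vord a - vord b"
 using vord_mult[of a "inverse b"] vord_inverse by (simp add: divide_inverse)

lemma vord_power: "a ~= 0 ==> vord (a ^ n) = int n * vord a"
 by (induction n) (auto simp: vord_mult algebra_simps vord_eqI[of 1 1 0] one_mem)

lemma vord_pi: "vord pu = 1"
 by (rule vord_eqI[of _ 1]) (auto simp: one_mem pi_nonzero)

lemma mem_iff_vord: "h ~= 0 ==> h \<in> p \<longleftrightarrow> vord h \<ge> 0"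
proof -
 assume h: "h ~= 0"
 from vordE[OF h] obtain w where w: "w \<in> p" "inverse w \<in> p" "w ~= 0" "h = w * pu powi (vord h)" .
 show ?thesis
 proof
  assume "h \<in> p"
  hence "w * pu powi (vord h) \<in> p" by (simp only: w(4)[symmetric])
  thus "vord h \<ge> 0" using unit_neg_powi[OF w(1-3)] by (meson not_le)
 next
  assume "vord h \<ge> 0"
  hence "w * pu powi (vord h) \<in> p" using mult_mem w(1) powi_mem by blast
  thus "h \<in> p" by (simp only: w(4)[symmetric])
 qed
qed

lemma mem_or_inverse: "h \<in> p \<or> inverse h \<in> p"
 using mem_iff_vord[of h] mem_iff_vord[of "inverse h"] vord_inverse[of h] zero_mem by (cases "h = 0") auto

lemma max_ideal_iff: "a \<in> max_ideal p \<longleftrightarrow> a \<in> p \<and> (a = 0 \<or> inverse a \<notin> p)"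
proof -
 have "(\<exists>b\<in>p. a * b = 1) \<longleftrightarrow> a ~= 0 \<and> inverse a \<in> p"
  by (metis inverse_unique mult_zero_left right_inverse zero_neq_one)
 thus ?thesis unfolding max_ideal_def by auto
qed

lemma max_ideal_iff_vord: "a ~= 0 ==> a \<in> max_ideal p \<longleftrightarrow> vord a > 0"
 unfolding max_ideal_iff using mem_iff_vord[of a] mem_iff_vord[of "inverse a"] vord_inverse[of a] by auto

lemma unit_iff_vord: "a ~= 0 ==> a \<in> p \<and> a \<notin> max_ideal p \<longleftrightarrow> vord a = 0"
 using max_ideal_iff_vord mem_iff_vord by fastforce

lemma principal_ideal_iff: "s ~= 0 ==> h \<in> principal_ideal p s \<longleftrightarrow> h / s \<in> p"
 unfolding principal_ideal_def by (auto intro: exI[of _ "h / s"])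

lemma principal_ideal_vord: "s ~= 0 ==> h \<in> principal_ideal p s \<longleftrightarrow> h = 0 \<or> vord h \<ge> vord s"
 unfolding principal_ideal_iff using mem_iff_vord[of "h / s"] vord_divide[of h s] zero_mem by (cases "h = 0") auto

lemma principal_ideal_subset: "s ~= 0 ==> t ~= 0 ==> principal_ideal p s \<subseteq> principal_ideal p t \<longleftrightarrow> vord t \<le> vord s"
 using principal_ideal_vord[of s s] principal_ideal_vord[of t] principal_ideal_vord[of s] by (auto intro: order_trans)

lemma principal_ideal_eq: "s ~= 0 ==> t ~= 0 ==> principal_ideal p s = principal_ideal p t \<longleftrightarrow> vord t = vord s"
 using principal_ideal_subset[of s t] principal_ideal_subset[of t s] by auto

lemma principal_ideal_one: "principal_ideal p 1 = p"
 unfolding principal_ideal_def by simp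

lemma max_ideal_eq: "max_ideal p = principal_ideal p pu"
proof (rule Set.set_eqI)
 fix a
 show "a \<in> max_ideal p \<longleftrightarrow> a \<in> principal_ideal p pu"
 proof (cases "a = 0")
  case False
  thus ?thesis using max_ideal_iff_vord principal_ideal_vord[OF pi_nonzero] vord_pi by auto
 qed (auto simp: max_ideal_iff zero_mem principal_ideal_iff[OF pi_nonzero])
qed

lemma max_ideal_eq_iff:
 "t ~= 0 ==> max_ideal p = principal_ideal p t \<longleftrightarrow> vord t = 1"
 unfolding max_ideal_eq using principal_ideal_eq[OF pi_nonzero] vord_pi by simp

lemma principal_submod: "submod_closed p (principal_ideal p s)"
proof -
 have "\<exists>c. s * a + s * b = s * c \<and> c \<in> p" if "a \<in> p" "b \<in> p" for a b
  using that by (intro exI[of _ "a + b"]) (simp add: algebra_simps add_mem)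
 moreover have "\<exists>b. c * (s * a) = s * b \<and> b \<in> p" if "a \<in> p" "c \<in> p" for a c
  using that by (intro exI[of _ "c * a"]) (simp add: algebra_simps mult_mem)
 moreover have "\<exists>a. 0 = s * a \<and> a \<in> p" using zero_mem by (intro exI[of _ 0]) simp
 ultimately show ?thesis unfolding submod_closed_def principal_ideal_def by blast
qed

lemma rspan_eqI:
 assumes "S \<subseteq> principal_ideal p s" "s \<in> S" shows "rspan p S = principal_ideal p s"
 unfolding rspan_def
proof (rule hull_unique)
 fix T assume "S \<subseteq> T" "submod_closed p T"
 thus "principal_ideal p s \<subseteq> T" using assms(2) unfolding principal_ideal_def submod_closed_def
  by (auto simp: mult.commute)
qed (use assms principal_submod in auto)

lemma principal_prod:
 "rspan p {a * b |a b. a \<in> principal_ideal p s \<and> b \<in> principal_ideal p t} = principal_ideal p (s * t)"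
proof (rule rspan_eqI)
 have m: "s * a * (t * b) = s * t * (a * b)" for a b by simp
 show "{a * b |a b. a \<in> principal_ideal p s \<and> b \<in> principal_ideal p t} \<subseteq> principal_ideal p (s * t)"
  unfolding principal_ideal_def using mult_mem m by blast
 have "c \<in> principal_ideal p c" for c
  unfolding principal_ideal_def using one_mem by (auto intro: exI[of _ 1])
 thus "s * t \<in> {a * b |a b. a \<in> principal_ideal p s \<and> b \<in> principal_ideal p t}" by blast
qed

lemma max_pow_eq: "max_pow p n = principal_ideal p (pu ^ n)"
 by (induction n) (simp_all add: principal_ideal_one max_ideal_eq principal_prod)

lemma tensor_principal:
 "M p = principal_ideal p s ==> N p = principal_ideal p t ==> tensor M N p = principal_ideal p (s * t)"
 unfolding tensor_def by (simp add: principal_prod)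

lemma tensor_pow_principal:
 "M p = principal_ideal p s ==> tensor_pow M n p = principal_ideal p (s ^ n)"
 by (induction n) (simp_all add: principal_ideal_one tensor_principal)

lemma hom_sheaf_principal:
 assumes "M p = principal_ideal p s" "N p = principal_ideal p t" "s ~= 0" "t ~= 0"
 shows "hom_sheaf M N p = principal_ideal p (t / s)"
proof (rule Set.set_eqI)
 fix h
 have "h \<in> hom_sheaf M N p \<longleftrightarrow> (\<forall>a\<in>p. h * (s * a) \<in> principal_ideal p t)"
  unfolding hom_sheaf_def assms(1,2) unfolding principal_ideal_def by blast
 also have "\<dots> \<longleftrightarrow> (\<forall>a\<in>p. (h * s / t) * a \<in> p)"
  by (simp add: principal_ideal_iff[OF assms(4)] ac_simps)
 also have "\<dots> \<longleftrightarrow> h * s / t \<in> p" using one_mem mult_mem by (metis mult.right_neutral)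
 also have "\<dots> \<longleftrightarrow> h \<in> principal_ideal p (t / s)" using assms by (simp add: principal_ideal_iff)
 finally show "h \<in> hom_sheaf M N p \<longleftrightarrow> h \<in> principal_ideal p (t / s)" .
qed

lemma image_principal: "(\<lambda>h. c * h) ` principal_ideal p s = principal_ideal p (c * s)"
 unfolding principal_ideal_def by (auto simp: mult.assoc image_iff)

text \<open>\<open>order_at\<close> admits any uniformizer; another one is \<open>pu\<close> times a
  unit, and powers of units have valuation zero.\<close>

lemma order_at_eq:
 assumes "h ~= 0" shows "order_at p h = vord h"
 unfolding order_at_def
proof (rule the_equality)
 obtain w where w: "w \<in> p" "inverse w \<in> p" "w ~= 0" "h = w * pu powi (vord h)" using vordE[OF assms] .
 have "w \<in> p - max_ideal p" using w(1-3) by (simp add: max_ideal_iff)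
 thus "\<exists>t u. max_ideal p = {t * a |a. a \<in> p} \<and> u \<in> p - max_ideal p \<and> h = u * t powi vord h"
  using w max_ideal_eq unfolding principal_ideal_def by blast
next
 fix n assume "\<exists>t u. max_ideal p = {t * a |a. a \<in> p} \<and> u \<in> p - max_ideal p \<and> h = u * t powi n"
 then obtain t u where tu: "max_ideal p = principal_ideal p t" "u \<in> p" "u \<notin> max_ideal p" "h = u * t powi n"
  unfolding principal_ideal_def by blast
 have t0: "t ~= 0"
 proof
  assume "t = 0"
  hence "max_ideal p = {0}" using tu(1) zero_mem by (auto simp: principal_ideal_def)
  thus False using pi_nonzero pi_nonunit pi_mem max_ideal_iff by blast
 qed
 have "vord t = 1" using tu(1) max_ideal_eq_iff[OF t0] by blast
 then obtain w where w: "w \<in> p" "inverse w \<in> p" "w ~= 0" "t = w * pu" using vordE[OF t0] by auto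
 have u0: "u ~= 0" "vord u = 0" using tu(4) assms unit_iff_vord[of u] tu(2,3) by auto
 have w0: "vord (w powi n) = 0"
 proof (rule vord_eqI[of _ "w powi n"])
  show "w powi n \<in> p" "inverse (w powi n) \<in> p"
   using w by (simp_all add: power_int_def power_mem power_inverse[symmetric])
 qed (use w in auto)
 have pn: "vord (pu powi n) = n" by (rule vord_eqI[of _ 1]) (auto simp: pi_nonzero one_mem)
 have "vord h = n" unfolding tu(4) w(4) power_int_mult_distrib
  using u0 w0 pn w pi_nonzero by (simp add: vord_mult)
 thus "n = vord h" by simp
qed

text \<open>The section \<open>1\<close> is \<open>1 / s\<close> times the generator
  \<open>s\<close>, hence the sign.\<close>

lemma order_of_one_eq:
 assumes "M p = principal_ideal p s" "s ~= 0" shows "order_of_one M p = - vord s"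
 unfolding order_of_one_def
proof (rule the_equality)
 show "\<exists>s'. s' ~= 0 \<and> M p = {s' * a |a. a \<in> p} \<and> - vord s = order_at p (1 / s')"
  using assms order_at_eq[of "1 / s"] vord_inverse[of s]
  unfolding principal_ideal_def by (intro exI[of _ s]) (simp add: divide_inverse)
next
 fix n assume "\<exists>s'. s' ~= 0 \<and> M p = {s' * a |a. a \<in> p} \<and> n = order_at p (1 / s')"
 then obtain s' where s': "s' ~= 0" "M p = principal_ideal p s'" "n = order_at p (1 / s')"
  unfolding principal_ideal_def by blast
 have "vord s' = vord s" using s'(1,2) assms principal_ideal_eq by metis
 thus "n = - vord s" using s' order_at_eq[of "1 / s'"] vord_inverse[of s'] by (simp add: divide_inverse)
qed

end

section \<open>Derivations, evaluation of polynomials and the Bezoutian\<close>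

definition derivation :: "('a => 'k::field) => ('k => 'k) => bool" where
 "derivation em D \<longleftrightarrow> (\<forall>a b. D (a + b) = D a + D b) \<and> (\<forall>a. D (em a) = 0) \<and>
   (\<forall>a b. D (a * b) = a * D b + b * D a)"

lemma derivations_eq: "derivations C = Collect (derivation (emb C))"
 unfolding derivations_def derivation_def ..

locale field_ext =
 fixes em :: "'a::field => 'k::field"
 assumes em_one [simp]: "em 1 = 1" and em_add: "em (a + b) = em a + em b" and em_mult: "em (a * b) = em a * em b"
begin

lemma em_zero [simp]: "em 0 = 0"
 using em_add[of 0 0] by (metis add_0 add_cancel_right_right)

lemma em_minus: "em (- a) = - em a"
 using em_add[of a "- a"] by (simp add: eq_neg_iff_add_eq_0 add.commute)

lemma em_diff: "em (a - b) = em a - em b"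
 using em_add[of a "- b"] em_minus by simp

lemma em_eq_0_iff [simp]: "em a = 0 \<longleftrightarrow> a = 0"
proof
 assume "em a = 0"
 show "a = 0"
 proof (rule ccontr)
  assume "a ~= 0"
  hence "em a * em (inverse a) = 1" by (simp flip: em_mult)
  thus False using \<open>em a = 0\<close> by simp
 qed
qed simp

lemma em_eq_iff: "em a = em b \<longleftrightarrow> a = b"
 using em_eq_0_iff[of "a - b"] by (simp add: em_diff)

lemma em_sum: "em (\<Sum>i\<in>I. g i) = (\<Sum>i\<in>I. em (g i))"
 by (induction I rule: infinite_finite_induct) (auto simp: em_add)

lemma em_inverse: "em (inverse a) = inverse (em a)"
proof (cases "a = 0")
 case False
 hence "em a * em (inverse a) = 1" by (simp flip: em_mult)
 thus ?thesis by (metis inverse_unique)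
qed simp

abbreviation sc :: "'a => 'k => 'k" where "sc c a \<equiv> em c * a"

sublocale vs: Vector_Spaces.vector_space sc
 by unfold_locales (simp_all add: algebra_simps em_add em_mult)

definition ev :: "'a poly => 'k => 'k" where "ev q t = poly (map_poly em q) t"

lemma ev_eq: "ev q t = (\<Sum>k\<le>degree q. em (coeff q k) * t ^ k)"
proof -
 have "degree (map_poly em q) = degree q" by (rule degree_map_poly) simp
 thus ?thesis unfolding ev_def poly_altdef by (simp add: coeff_map_poly)
qed

lemma ev_pCons [simp]: "ev (pCons a q) t = em a + t * ev q t"
 unfolding ev_def by (simp add: map_poly_pCons)

lemma ev_0 [simp]: "ev 0 t = 0"
 by (simp add: ev_def)

lemma ev_add: "ev (q + r) t = ev q t + ev r t"
proof -
 have "map_poly em (q + r) = map_poly em q + map_poly em r"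
  by (rule poly_eqI) (simp add: coeff_map_poly em_add)
 thus ?thesis unfolding ev_def by simp
qed

lemma ev_smult: "ev (smult c q) t = em c * ev q t"
proof -
 have "map_poly em (smult c q) = smult (em c) (map_poly em q)"
  by (rule poly_eqI) (simp add: coeff_map_poly em_mult)
 thus ?thesis unfolding ev_def by simp
qed

lemma ev_minus: "ev (- q) t = - ev q t"
 using ev_smult[of "-1" q t] by (simp add: em_minus)

lemma ev_diff: "ev (q - r) t = ev q t - ev r t"
 using ev_add[of q "- r" t] ev_minus by simp

lemma ev_mult: "ev (q * r) t = ev q t * ev r t"
 by (induction q) (simp_all add: ev_add ev_smult algebra_simps)

lemma ev_1 [simp]: "ev 1 t = 1"
 by (simp add: one_pCons)

lemma ev_power: "ev (q ^ n) t = ev q t ^ n"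
 by (induction n) (simp_all add: ev_mult)

lemma ev_monom: "ev (monom c n) t = em c * t ^ n"
 by (induction n) (simp_all add: monom_0 monom_Suc algebra_simps)

lemma ev_pcompose: "ev (q \<circ>\<^sub>p r) t = ev q (ev r t)"
 by (induction q) (simp_all add: pcompose_pCons ev_add ev_mult)

lemma derivation_0: "derivation em D ==> D 0 = 0"
 unfolding derivation_def by (metis em_zero)

lemma derivation_minus: "derivation em D ==> D (- a) = - D a"
 using derivation_0[of D] unfolding derivation_def
 by (metis add.right_inverse add_eq_0_iff)

lemma derivation_diff: "derivation em D ==> D (a - b) = D a - D b"
 using derivation_minus[of D b] unfolding derivation_def by (metis add_uminus_conv_diff)

lemma derivation_ev:
 assumes "derivation em D" shows "D (ev q t) = ev (pderiv q) t * D t"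
proof (induction q)
 case 0
 thus ?case using derivation_0[OF assms] by simp
next
 case (pCons a q)
 thus ?case using assms unfolding derivation_def
  by (simp add: pderiv_pCons ev_add algebra_simps)
qed

lemma derivation_inverse:
 assumes "derivation em D" "a ~= 0" shows "D (inverse a) = - (inverse a * inverse a * D a)"
proof -
 have "D 1 = 0" using assms(1) unfolding derivation_def by (metis em_one)
 hence "0 = D (a * inverse a)" using assms(2) by simp
 also have "\<dots> = a * D (inverse a) + inverse a * D a" using assms(1) unfolding derivation_def by blast
 finally have "a * D (inverse a) = - (inverse a * D a)" by (simp add: eq_neg_iff_add_eq_0)
 hence "inverse a * (a * D (inverse a)) = - (inverse a * inverse a * D a)" by simp
 thus ?thesis using assms(2) by (simp flip: mult.assoc)
qed

lemma derivation_divide: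
 assumes "derivation em D" "b ~= 0" shows "D (a / b) = (D a - (a / b) * D b) / b"
proof -
 have "D (a * inverse b) = a * D (inverse b) + inverse b * D a" using assms(1) unfolding derivation_def by blast
 also have "D (inverse b) = - (inverse b * inverse b * D b)" by (rule derivation_inverse[OF assms])
 finally show ?thesis using assms(2) by (simp add: field_simps)
qed

lemma derivation_scale: "derivation em D ==> derivation em (\<lambda>a. h * D a)"
 unfolding derivation_def by (simp add: algebra_simps)

definition bez :: "'a poly => 'k => nat => 'k" where
 "bez G t i = (\<Sum>k \<in> {i<..degree G}. em (coeff G k) * t ^ (k - 1 - i))"

lemma bez_sum:
 "(\<Sum>i<degree G. bez G t i * g i) = (\<Sum>k\<le>degree G. em (coeff G k) * (\<Sum>i<k. t ^ (k - 1 - i) * g i))"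
proof -
 let ?d = "degree G"
 let ?f = "\<lambda>i k. em (coeff G k) * t ^ (k - 1 - i) * g i"
 have "(\<Sum>i<?d. bez G t i * g i) = (\<Sum>i\<in>{..<?d}. \<Sum>k\<in>{k \<in> {..?d}. i < k}. ?f i k)"
  unfolding bez_def sum_distrib_right by (intro sum.cong) auto
 also have "\<dots> = (\<Sum>k\<in>{..?d}. \<Sum>i\<in>{i \<in> {..<?d}. i < k}. ?f i k)"
  by (rule sum.swap_restrict) auto
 also have "\<dots> = (\<Sum>k\<le>?d. em (coeff G k) * (\<Sum>i<k. t ^ (k - 1 - i) * g i))"
  unfolding sum_distrib_left by (intro sum.cong) (auto simp: mult.assoc)
 finally show ?thesis .
qed

text \<open>With \<open>m i\<close> in the role of \<open>t1 ^ i\<close> and \<open>t\<close> in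
  that of \<open>t2\<close> this is \<open>(t1 - t2)\<close> times the Bezoutian equals
  \<open>G(t1) - G(t2)\<close>. The sequence is arbitrary because values of functionals and of a
  projection at powers of \<open>t\<close> will be inserted, which are not powers
  themselves.\<close>

lemma bez_telescope:
 "(\<Sum>i<degree G. bez G t i * (m (Suc i) - t * m i)) = (\<Sum>k\<le>degree G. em (coeff G k) * m k) - ev G t * m 0"
proof -
 have tel: "(\<Sum>i<k. t ^ (k - 1 - i) * (m (Suc i) - t * m i)) = m k - t ^ k * m 0" for k
 proof (induction k)
  case (Suc k)
  have "(\<Sum>i<k. t ^ (k - i) * (m (Suc i) - t * m i)) = t * (\<Sum>i<k. t ^ (k - 1 - i) * (m (Suc i) - t * m i))"
   unfolding sum_distrib_left
  proof (rule sum.cong)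
   fix i assume "i \<in> {..<k}"
   hence "k - i = Suc (k - 1 - i)" by auto
   thus "t ^ (k - i) * (m (Suc i) - t * m i) = t * (t ^ (k - 1 - i) * (m (Suc i) - t * m i))" by simp
  qed simp
  hence "(\<Sum>i<Suc k. t ^ (Suc k - 1 - i) * (m (Suc i) - t * m i))
   = t * (\<Sum>i<k. t ^ (k - 1 - i) * (m (Suc i) - t * m i)) + (m (Suc k) - t * m k)" by simp
  thus ?case unfolding Suc by (simp add: right_diff_distrib mult.assoc)
 qed simp
 show ?thesis unfolding bez_sum tel ev_eq
  by (simp add: algebra_simps sum_subtractf sum_distrib_left)
qed

end

section \<open>Residue functionals from commutators with a projection\<close>

locale residue_pre = field_ext em + dvr p pu
 for em :: "'a::field => 'k::field" and p :: "'k set" and pu :: 'k +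
 fixes P :: "'k => 'k" and lam :: "'k => 'a" and D :: "'k => 'k"
 assumes em_mem: "em c \<in> p"
  and P_add: "P (a + b) = P a + P b" and P_scale: "P (em c * a) = em c * P a"
  and P_id: "a \<in> p ==> P a = a" and P_mem: "P a \<in> p"
  and lam_add: "lam (a + b) = lam a + lam b" and lam_scale: "lam (em c * a) = c * lam a"
  and lam_zero: "a \<in> p ==> lam a = 0"
  and deriv: "derivation em D"
begin

text \<open>Tate's finite rank condition. The commutator of \<open>P\<close> with \<open>ta\<close>
  is a sum of rank one operators, and the trace of its product with \<open>h\<close> is the sum of
  the \<open>lam (h * r * s)\<close>. Prescribing the diagonal sum makes this trace
  \<open>lam (h * D ta)\<close>, which is Tate's residue of \<open>h d(ta)\<close>.\<close>

definition comm_ok :: "'k => bool" where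
 "comm_ok ta \<longleftrightarrow> (\<exists>rs. set rs \<subseteq> p \<times> p \<and>
   (\<forall>b. P (ta * b) - ta * P b = (\<Sum>(r, s)\<leftarrow>rs. r * em (lam (s * b)))) \<and> (\<Sum>(r, s)\<leftarrow>rs. r * s) = D ta)"

lemma comm_ok_em: "comm_ok (em c)"
 unfolding comm_ok_def using deriv by (intro exI[of _ "[]"]) (auto simp: P_scale derivation_def)

lemma comm_ok_add:
 assumes "comm_ok a" "comm_ok b" shows "comm_ok (a + b)"
proof -
 from assms obtain rs rs' where *: "set rs \<subseteq> p \<times> p" "set rs' \<subseteq> p \<times> p"
  "\<And>c. P (a * c) - a * P c = (\<Sum>(r, s)\<leftarrow>rs. r * em (lam (s * c)))" "(\<Sum>(r, s)\<leftarrow>rs. r * s) = D a"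
  "\<And>c. P (b * c) - b * P c = (\<Sum>(r, s)\<leftarrow>rs'. r * em (lam (s * c)))" "(\<Sum>(r, s)\<leftarrow>rs'. r * s) = D b"
  unfolding comm_ok_def by blast
 have "P ((a + b) * c) - (a + b) * P c = (P (a * c) - a * P c) + (P (b * c) - b * P c)" for c
  by (simp add: algebra_simps P_add)
 thus ?thesis unfolding comm_ok_def using *(1,2,4,6) deriv
  by (intro exI[of _ "rs @ rs'"]) (auto simp: *(3,5) derivation_def)
qed

text \<open>\<open>[P, ab] = [P, a] b + a [P, b]\<close>, and the diagonal sums combine by the
  Leibniz rule.\<close>

lemma comm_ok_mult:
 assumes "comm_ok a" "comm_ok b" "a \<in> p" "b \<in> p" shows "comm_ok (a * b)"
proof -
 from assms obtain rs rs' where *: "set rs \<subseteq> p \<times> p" "set rs' \<subseteq> p \<times> p"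
  "\<And>c. P (a * c) - a * P c = (\<Sum>(r, s)\<leftarrow>rs. r * em (lam (s * c)))" "(\<Sum>(r, s)\<leftarrow>rs. r * s) = D a"
  "\<And>c. P (b * c) - b * P c = (\<Sum>(r, s)\<leftarrow>rs'. r * em (lam (s * c)))" "(\<Sum>(r, s)\<leftarrow>rs'. r * s) = D b"
  unfolding comm_ok_def by blast
 let ?rs = "map (\<lambda>(r, s). (r, s * b)) rs @ map (\<lambda>(r, s). (a * r, s)) rs'"
 have 1: "P (a * b * c) - a * b * P c = (P (a * (b * c)) - a * P (b * c)) + a * (P (b * c) - b * P c)" for c
  by (simp add: algebra_simps)
 have 2: "(\<Sum>(r, s)\<leftarrow>map (\<lambda>(r, s). (r, s * b)) rs. f r s) = (\<Sum>(r, s)\<leftarrow>rs. f r (s * b))" for f :: "'k => 'k => 'k"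
  by (induction rs) auto
 have 3: "(\<Sum>(r, s)\<leftarrow>map (\<lambda>(r, s). (a * r, s)) rs'. f r s) = (\<Sum>(r, s)\<leftarrow>rs'. f (a * r) s)" for f :: "'k => 'k => 'k"
  by (induction rs') auto
 have 4: "(\<Sum>(r, s)\<leftarrow>rs. r * (s * b)) = (\<Sum>(r, s)\<leftarrow>rs. r * s) * b" by (induction rs) (auto simp: algebra_simps)
 have 5: "(\<Sum>(r, s)\<leftarrow>rs'. a * r * f s) = a * (\<Sum>(r, s)\<leftarrow>rs'. r * f s)" for f by (induction rs') (auto simp: algebra_simps)
 have "set ?rs \<subseteq> p \<times> p" using *(1,2) assms(3,4) by (auto intro: mult_mem)
 moreover have "(\<Sum>(r, s)\<leftarrow>?rs. r * s) = D (a * b)"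
  unfolding map_append sum_list_append 2 3 4 5 using *(4,6) 5[of "\<lambda>s. s"] deriv
  by (simp add: derivation_def algebra_simps)
 moreover have "P (a * b * c) - a * b * P c = (\<Sum>(r, s)\<leftarrow>?rs. r * em (lam (s * c)))" for c
  unfolding map_append sum_list_append 1 2 3 5 *(3,5) by (simp add: mult.assoc)
 ultimately show ?thesis unfolding comm_ok_def by blast
qed

text \<open>\<open>[P, 1/a] = - (1/a) [P, a] (1/a)\<close>, in agreement with the derivative of
  \<open>1/a\<close>.\<close>

lemma comm_ok_inverse:
 assumes "comm_ok a" "inverse a \<in> p" shows "comm_ok (inverse a)"
proof (cases "a = 0")
 case True
 thus ?thesis using comm_ok_em[of 0] by simp
next
 case False
 from assms obtain rs where *: "set rs \<subseteq> p \<times> p"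
  "\<And>c. P (a * c) - a * P c = (\<Sum>(r, s)\<leftarrow>rs. r * em (lam (s * c)))" "(\<Sum>(r, s)\<leftarrow>rs. r * s) = D a"
  unfolding comm_ok_def by blast
 let ?i = "inverse a"
 let ?rs = "map (\<lambda>(r, s). (- ?i * r, s * ?i)) rs"
 have 1: "P (?i * c) - ?i * P c = - ?i * (P (a * (?i * c)) - a * P (?i * c))" for c
  using False by (simp add: right_diff_distrib mult.assoc[symmetric])
 have 2: "(\<Sum>(r, s)\<leftarrow>?rs. f r s) = (\<Sum>(r, s)\<leftarrow>rs. f (- ?i * r) (s * ?i))" for f :: "'k => 'k => 'k"
  by (induction rs) auto
 have 3: "(\<Sum>(r, s)\<leftarrow>rs. - ?i * r * (s * ?i)) = - (?i * ?i * (\<Sum>(r, s)\<leftarrow>rs. r * s))"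
  by (induction rs) (auto simp: algebra_simps)
 have 4: "(\<Sum>(r, s)\<leftarrow>rs. - ?i * r * f s) = - ?i * (\<Sum>(r, s)\<leftarrow>rs. r * f s)" for f by (induction rs) (auto simp: algebra_simps)
 have "set ?rs \<subseteq> p \<times> p" using *(1) assms(2) by (auto intro!: mult_mem minus_mem)
 moreover have "(\<Sum>(r, s)\<leftarrow>?rs. r * s) = D ?i"
  unfolding 2 3 *(3) using derivation_inverse[OF deriv False] by simp
 moreover have "P (?i * c) - ?i * P c = (\<Sum>(r, s)\<leftarrow>?rs. r * em (lam (s * c)))" for c
  unfolding 1 2 4 *(2) by (simp add: mult.assoc)
 ultimately show ?thesis unfolding comm_ok_def by blast
qed

end

locale residue_datum = residue_pre +
 assumes comm: "ta \<in> p ==> comm_ok ta"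
begin

lemma lam_diff: "lam (a - b) = lam a - lam b"
 using lam_add[of "a - b" b] by simp

text \<open>If \<open>b\<close> were outside \<open>p\<close>, then \<open>b - P b\<close> would be
  killed by \<open>P\<close> and have its inverse in \<open>p\<close>. The commutator of that
  inverse sends \<open>b - P b\<close> to \<open>1\<close>; written with values
  \<open>lam (s * (b - P b))\<close>, it sends it to \<open>0\<close>.\<close>

lemma lam_nondeg:
 assumes "\<And>a. a \<in> p ==> lam (b * a) = 0" shows "b \<in> p"
proof (rule ccontr)
 assume b: "b \<notin> p"
 let ?b = "b - P b"
 have b': "?b \<notin> p" using b add_mem[OF _ P_mem[of b], of ?b] by auto
 hence i: "inverse ?b \<in> p" using mem_or_inverse by blast
 have b0: "?b ~= 0" using b' zero_mem by metis
 from comm[OF i] obtain rs where rs: "set rs \<subseteq> p \<times> p"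
  "P (inverse ?b * ?b) - inverse ?b * P ?b = (\<Sum>(r, s)\<leftarrow>rs. r * em (lam (s * ?b)))"
  unfolding comm_ok_def by blast
 have "P b = P ?b + P (P b)" using P_add[of ?b "P b"] by simp
 hence "P ?b = 0" using P_id[OF P_mem] by simp
 hence "1 = (\<Sum>(r, s)\<leftarrow>rs. r * em (lam (s * ?b)))"
  using rs(2) b0 P_id[OF one_mem] by simp
 also have "\<dots> = (\<Sum>(r, s)\<leftarrow>rs. 0)"
 proof (intro arg_cong[of _ _ sum_list] map_cong refl, safe)
  fix r s assume "(r, s) \<in> set rs"
  hence s: "s \<in> p" using rs by auto
  have "lam (s * ?b) = lam (b * s) - lam (s * P b)" by (simp add: algebra_simps lam_diff)
  also have "\<dots> = 0" using assms[OF s] lam_zero[OF mult_mem[OF s P_mem]] by simp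
  finally show "r * em (lam (s * ?b)) = 0" by simp
 qed
 finally show False by (simp add: case_prod_unfold)
qed

end

context residue_pre
begin

lemma P_sum: "P (\<Sum>i\<in>I. g i) = (\<Sum>i\<in>I. P (g i))"
proof -
 have "P 0 = 0" using P_id zero_mem by blast
 thus ?thesis by (induction I rule: infinite_finite_induct) (auto simp: P_add)
qed

lemma ev_mem: "t \<in> p ==> ev Q t \<in> p"
 unfolding ev_eq by (intro sum_mem mult_mem em_mem power_mem)

lemma bez_mem: "t \<in> p ==> bez Q t i \<in> p"
 unfolding bez_def by (intro sum_mem mult_mem em_mem power_mem)

end

text \<open>The Scheja--Storch condition on a functional on \<open>p/(g)\<close>, where \<open>g = G(t)\<close>.\<close>

locale bezoutian = residue_pre +
 fixes t :: 'b and G :: "'a poly" and g :: 'b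
 assumes t_mem: "t \<in> p" and g_def: "g = ev G t" and g_nonzero: "g ~= 0"
  and t_surj: "\<And>a. a \<in> p ==> \<exists>Q. a - ev Q t \<in> principal_ideal p g"
begin

definition functional :: "('b => 'a) => bool" where
 "functional ze \<longleftrightarrow> (\<forall>a\<in>p. \<forall>b\<in>p. ze (a + b) = ze a + ze b) \<and> (\<forall>c. \<forall>a\<in>p. ze (em c * a) = c * ze a) \<and>
   (\<forall>a\<in>principal_ideal p g. ze a = 0)"

lemma g_mem: "g \<in> p"
 unfolding g_def using t_mem by (rule ev_mem)

lemma ideal_simps:
 "0 \<in> principal_ideal p g"
 "a \<in> principal_ideal p g ==> b \<in> principal_ideal p g ==> a + b \<in> principal_ideal p g"
 "a \<in> principal_ideal p g ==> b \<in> principal_ideal p g ==> a - b \<in> principal_ideal p g"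
 "a \<in> principal_ideal p g ==> c \<in> p ==> c * a \<in> principal_ideal p g"
 "a \<in> principal_ideal p g ==> c \<in> p ==> a * c \<in> principal_ideal p g"
 "a \<in> principal_ideal p g ==> a \<in> p"
 "c \<in> p ==> g * c \<in> principal_ideal p g"
 using add_mem[of "a / g" "b / g"] diff_mem[of "a / g" "b / g"] mult_mem[of c "a / g"] zero_mem
  mult_mem[of g "a / g"] g_mem g_nonzero
 by (auto simp: principal_ideal_iff add_divide_distrib diff_divide_distrib mult.commute)

lemma functional_sum:
 assumes "functional ze" "\<And>i. i \<in> I ==> h i \<in> p"
 shows "ze (\<Sum>i\<in>I. h i) = (\<Sum>i\<in>I. ze (h i))"
proof -
 have z: "ze 0 = 0" using assms(1) ideal_simps(1) unfolding functional_def by blast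
 show ?thesis using assms(2)
 proof (induction I rule: infinite_finite_induct)
  case (insert i I)
  hence "h i \<in> p" "(\<Sum>i\<in>I. h i) \<in> p" by (auto intro: sum_mem)
  thus ?case using insert assms(1) unfolding functional_def by simp
 qed (simp_all add: z)
qed

text \<open>Multiplication by \<open>r\<close> may be moved between the two factors of \<open>(G(t1) - G(t2)) / (t1 - t2)\<close>
 modulo \<open>(G(t1), G(t2))\<close>; for \<open>r = t\<close> this is the defining equation of that quotient.\<close>

lemma bez_swap:
 assumes ze: "functional ze" and r: "r \<in> p" and s: "s \<in> p"
 shows "(\<Sum>i<degree G. bez G t i * (r * em (ze (t ^ i * s)) - em (ze (r * t ^ i * s)))) \<in> principal_ideal p g"
proof -
 define S where "S r s = (\<Sum>i<degree G. bez G t i * (r * em (ze (t ^ i * s)) - em (ze (r * t ^ i * s))))" for r s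
 have zea: "ze (a + b) = ze a + ze b" if "a \<in> p" "b \<in> p" for a b using ze that unfolding functional_def by blast
 have zes: "ze (em c * a) = c * ze a" if "a \<in> p" for a c using ze that unfolding functional_def by blast
 have tis: "r * t ^ i * s \<in> p" if "r \<in> p" "s \<in> p" for r s i
  using that by (intro mult_mem power_mem t_mem)
 \<comment> \<open>For \<open>r = t\<close> the sum telescopes to a multiple of \<open>g\<close>
   minus \<open>ze (g * s)\<close>, which vanishes.\<close>
 have St: "S t s \<in> principal_ideal p g" if s: "s \<in> p" for s
 proof -
  define m where "m i = em (ze (t ^ i * s))" for i
  have ts: "t ^ i * s \<in> p" for i using s by (intro mult_mem power_mem t_mem)
  have "S t s = - (\<Sum>i<degree G. bez G t i * (m (Suc i) - t * m i))"
   unfolding S_def m_def by (simp add: sum_negf[symmetric] algebra_simps)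
  also have "\<dots> = ev G t * m 0 - (\<Sum>k\<le>degree G. em (coeff G k) * m k)"
   by (simp only: bez_telescope minus_diff_eq)
  also have "(\<Sum>k\<le>degree G. em (coeff G k) * m k) = em (\<Sum>k\<le>degree G. coeff G k * ze (t ^ k * s))"
   unfolding m_def by (simp add: em_sum em_mult)
  also have "(\<Sum>k\<le>degree G. coeff G k * ze (t ^ k * s)) = ze (\<Sum>k\<le>degree G. em (coeff G k) * (t ^ k * s))"
   using ts by (subst functional_sum[OF ze]) (auto simp: zes intro: mult_mem em_mem)
  also have "(\<Sum>k\<le>degree G. em (coeff G k) * (t ^ k * s)) = g * s"
   unfolding g_def ev_eq sum_distrib_right by (simp add: mult.assoc)
  also have "ze (g * s) = 0" using ze ideal_simps(7)[OF s] unfolding functional_def by blast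
  finally show ?thesis using ideal_simps(7)[OF em_mem] by (simp add: m_def g_def)
 qed
 have Sadd: "S (a + b) s = S a s + S b s" if "a \<in> p" "b \<in> p" "s \<in> p" for a b s
 proof -
  have "ze ((a + b) * t ^ i * s) = ze (a * t ^ i * s) + ze (b * t ^ i * s)" for i
   using zea[OF tis tis, of a s b s i i] that by (simp add: distrib_right)
  thus ?thesis unfolding S_def sum.distrib[symmetric]
   by (intro sum.cong refl) (simp add: em_add algebra_simps)
 qed
 have Semb: "S (em c) s = 0" if "s \<in> p" for c s
  unfolding S_def using that zes[OF mult_mem[OF power_mem[OF t_mem] that]]
  by (simp add: mult.assoc em_mult)
 have Smult: "S (a * b) s = a * S b s + S a (b * s)" if "a \<in> p" "b \<in> p" "s \<in> p" for a b s
  unfolding S_def sum_distrib_left sum.distrib[symmetric]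
  by (intro sum.cong refl) (simp add: algebra_simps)
 have Sev: "\<forall>s\<in>p. S (ev Q t) s \<in> principal_ideal p g" for Q
 proof (induction Q)
  case 0
  show ?case using Semb[of _ 0] ideal_simps(1) by simp
 next
  case (pCons a Q)
  show ?case
  proof
   fix s assume s: "s \<in> p"
   have "S (ev (pCons a Q) t) s = S (em a) s + (t * S (ev Q t) s + S t (ev Q t * s))"
    using s by (simp add: Sadd em_mem mult_mem t_mem ev_mem Smult)
   also have "\<dots> = t * S (ev Q t) s + S t (ev Q t * s)" using Semb s by simp
   also have "\<dots> \<in> principal_ideal p g"
    by (intro ideal_simps(2) ideal_simps(4)[OF _ t_mem] St mult_mem ev_mem t_mem s)
     (use pCons s in blast)
   finally show "S (ev (pCons a Q) t) s \<in> principal_ideal p g" .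
  qed
 qed
 obtain Q where Q: "r - ev Q t \<in> principal_ideal p g" using t_surj[OF r] by blast
 have d: "r - ev Q t \<in> p" using Q ideal_simps(6) by blast
 have "S (r - ev Q t) s \<in> principal_ideal p g"
 proof -
  have "ze ((r - ev Q t) * t ^ i * s) = 0" for i
   using ze Q s unfolding functional_def
   by (metis ideal_simps(5) power_mem t_mem)
  hence "S (r - ev Q t) s = (r - ev Q t) * (\<Sum>i<degree G. bez G t i * em (ze (t ^ i * s)))"
   unfolding S_def sum_distrib_left by (simp add: algebra_simps)
  also have "\<dots> \<in> principal_ideal p g"
   by (intro ideal_simps Q sum_mem mult_mem em_mem bez_mem t_mem)
  finally show ?thesis .
 qed
 moreover have "S r s = S (r - ev Q t) s + S (ev Q t) s"
  using Sadd[OF d ev_mem[OF t_mem] s, of Q] by simp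
 ultimately have "S r s \<in> principal_ideal p g" using ideal_simps(2) Sev s by metis
 thus ?thesis unfolding S_def .
qed

text \<open>For the difference \<open>dl\<close> of two solutions the defining sum lies in the ideal
  of \<open>g\<close>. Multiplication by \<open>s\<close>, \<open>bez_swap\<close> and an
  application of \<open>et\<close> give zero; by the symmetry of the Bezoutian in its two variables
  the same expression is \<open>dl s\<close>.\<close>

lemma scheja_storch_unique:
 assumes et: "functional et" "(\<Sum>i<degree G. em (et (t ^ i)) * bez G t i) - 1 \<in> principal_ideal p g"
  and et': "functional et'" "(\<Sum>i<degree G. em (et' (t ^ i)) * bez G t i) - 1 \<in> principal_ideal p g"
  and s: "s \<in> p"
 shows "et' s = et s"
proof -
 define dl where "dl a = et' a - et a" for a
 have dl: "functional dl" using et(1) et'(1) unfolding functional_def dl_def by (auto simp: algebra_simps)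
 have lin: "ze (em c * a) = c * ze a" if "functional ze" "a \<in> p" for ze c a
  using that unfolding functional_def by blast
 define U where "U = (\<Sum>i<degree G. em (dl (t ^ i)) * bez G t i)"
 have "U = ((\<Sum>i<degree G. em (et' (t ^ i)) * bez G t i) - 1) - ((\<Sum>i<degree G. em (et (t ^ i)) * bez G t i) - 1)"
  unfolding U_def dl_def by (simp add: em_diff sum_subtractf algebra_simps)
 also have "\<dots> \<in> principal_ideal p g" by (rule ideal_simps(3)[OF et'(2) et(2)])
 finally have U: "U \<in> principal_ideal p g" .
 define U' where "U' = (\<Sum>i<degree G. em (dl (t ^ i * s)) * bez G t i)"
 have "s * U - U' = (\<Sum>i<degree G. bez G t i * (s * em (dl (t ^ i * 1)) - em (dl (s * t ^ i * 1))))"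
  unfolding U_def U'_def sum_distrib_left sum_subtractf[symmetric]
  by (intro sum.cong refl) (simp add: algebra_simps)
 also have "\<dots> \<in> principal_ideal p g" by (rule bez_swap[OF dl s one_mem])
 finally have "s * U - (s * U - U') \<in> principal_ideal p g" using ideal_simps(3) ideal_simps(4)[OF U s] by blast
 hence "U' \<in> principal_ideal p g" by simp
 hence "0 = et U'" using et(1) unfolding functional_def by simp
 also have "\<dots> = (\<Sum>i<degree G. dl (t ^ i * s) * et (bez G t i))"
  unfolding U'_def
  by (subst functional_sum[OF et(1)])
   (simp_all add: mult_mem em_mem bez_mem[OF t_mem] lin[OF et(1) bez_mem[OF t_mem]])
 also have "\<dots> = (\<Sum>i<degree G. et (t ^ i) * dl (bez G t i * s))"
 proof -
  define d where "d = degree G"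
  have "ze (bez G t i * u) = (\<Sum>k\<in>{k \<in> {..d}. i < k}. coeff G k * ze (t ^ (k - 1 - i) * u))"
   if "functional ze" "u \<in> p" for ze i u
   unfolding bez_def sum_distrib_right d_def
   by (subst functional_sum[OF that(1)])
    (auto intro!: mult_mem em_mem power_mem t_mem that sum.cong
     simp: mult.assoc lin[OF that(1) mult_mem[OF power_mem[OF t_mem] that(2)]])
  from this[OF et(1) one_mem] this[OF dl s]
  have e: "et (bez G t i) = (\<Sum>k\<in>{k \<in> {..d}. i < k}. coeff G k * et (t ^ (k - 1 - i)))"
   "dl (bez G t i * s) = (\<Sum>k\<in>{k \<in> {..d}. i < k}. coeff G k * dl (t ^ (k - 1 - i) * s))" for i
   by simp_all
  have "(\<Sum>i<d. dl (t ^ i * s) * et (bez G t i))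
   = (\<Sum>i\<in>{..<d}. \<Sum>k\<in>{k \<in> {..d}. i < k}. coeff G k * (dl (t ^ i * s) * et (t ^ (k - 1 - i))))"
   unfolding e sum_distrib_left by (simp add: algebra_simps)
  also have "\<dots> = (\<Sum>k\<in>{..d}. \<Sum>i\<in>{i \<in> {..<d}. i < k}. coeff G k * (dl (t ^ i * s) * et (t ^ (k - 1 - i))))"
   by (rule sum.swap_restrict) auto
  also have "\<dots> = (\<Sum>k\<in>{..d}. \<Sum>i<k. coeff G k * (dl (t ^ i * s) * et (t ^ (k - 1 - i))))"
   by (intro sum.cong) auto
  \<comment> \<open>Replacing \<open>i\<close> by \<open>k - 1 - i\<close> is the symmetry of
    \<open>(t1^k - t2^k) / (t1 - t2)\<close>.\<close>
  also have "\<dots> = (\<Sum>k\<in>{..d}. \<Sum>i<k. coeff G k * (dl (t ^ (k - 1 - i) * s) * et (t ^ i)))"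
   by (subst (1) sum.nat_diff_reindex[symmetric]) (auto intro!: sum.cong)
  also have "\<dots> = (\<Sum>k\<in>{..d}. \<Sum>i\<in>{i \<in> {..<d}. i < k}. coeff G k * (dl (t ^ (k - 1 - i) * s) * et (t ^ i)))"
   by (intro sum.cong) auto
  also have "\<dots> = (\<Sum>i\<in>{..<d}. \<Sum>k\<in>{k \<in> {..d}. i < k}. coeff G k * (dl (t ^ (k - 1 - i) * s) * et (t ^ i)))"
   by (rule sum.swap_restrict) auto
  also have "\<dots> = (\<Sum>i<d. et (t ^ i) * dl (bez G t i * s))"
   unfolding e sum_distrib_left by (simp add: algebra_simps)
  finally show ?thesis unfolding d_def .
 qed
 also have "\<dots> = dl ((\<Sum>i<degree G. em (et (t ^ i)) * bez G t i) * s)"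
  unfolding sum_distrib_right
  by (subst functional_sum[OF dl])
   (auto intro!: mult_mem em_mem bez_mem t_mem s sum.cong
    simp: mult.assoc lin[OF dl mult_mem[OF bez_mem[OF t_mem] s]])
 also have "\<dots> = dl (((\<Sum>i<degree G. em (et (t ^ i)) * bez G t i) - 1) * s) + dl s"
  using dl et(2) s ideal_simps(5,6) unfolding functional_def
  by (metis (no_types, lifting) diff_add_cancel distrib_right mult_1)
 also have "dl (((\<Sum>i<degree G. em (et (t ^ i)) * bez G t i) - 1) * s) = 0"
  using dl ideal_simps(5)[OF et(2) s] unfolding functional_def by blast
 finally show ?thesis unfolding dl_def by simp
qed

lemma functional_residue:
 assumes "w \<in> p" shows "functional (\<lambda>a. lam (a * w / g))"
 unfolding functional_def
proof (intro conjI ballI allI)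
 fix a assume "a \<in> principal_ideal p g"
 hence "a / g \<in> p" using g_nonzero by (simp add: principal_ideal_iff)
 from lam_zero[OF mult_mem[OF this assms]] show "lam (a * w / g) = 0" by simp
next
 fix a b show "lam ((a + b) * w / g) = lam (a * w / g) + lam (b * w / g)"
  by (simp add: distrib_right add_divide_distrib lam_add)
next
 fix c a show "lam (em c * a * w / g) = c * lam (a * w / g)"
  using lam_scale[of c "a * w / g"] by (simp add: mult.assoc)
qed

text \<open>The sequence \<open>P (t ^ k / g)\<close> is telescoped. As \<open>P 1 = 1\<close>, the
  commutators of \<open>P\<close> with \<open>t\<close> at the elements \<open>t ^ i / g\<close> add
  up to \<open>1 - g P(1/g)\<close>. Each is a sum of terms \<open>r\<close> times a residue, and
  \<open>bez_swap\<close> moves the \<open>r\<close> inside modulo \<open>g\<close>, where the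
  products \<open>r s\<close> add up to \<open>D t\<close>.\<close>

lemma scheja_storch_residue:
 assumes "comm_ok t"
 shows "(\<Sum>i<degree G. em (lam (t ^ i * D t / g)) * bez G t i) - 1 \<in> principal_ideal p g"
proof -
 from assms obtain rs where rs: "set rs \<subseteq> p \<times> p"
  "\<And>b. P (t * b) - t * P b = (\<Sum>(r, s)\<leftarrow>rs. r * em (lam (s * b)))" "(\<Sum>(r, s)\<leftarrow>rs. r * s) = D t"
  unfolding comm_ok_def by blast
 define ze where "ze a = lam (a * 1 / g)" for a
 have ze: "functional ze" unfolding ze_def by (rule functional_residue[OF one_mem])
 have ti: "t ^ i \<in> p" for i using t_mem by (rule power_mem)
 have "1 - g * P (1 / g) = P (g * (1 / g)) - g * P (1 / g)" using g_nonzero P_id[OF one_mem] by simp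
 also have "P (g * (1 / g)) = (\<Sum>k\<le>degree G. em (coeff G k) * P (t ^ k * (1 / g)))"
 proof -
  have "g * (1 / g) = (\<Sum>k\<le>degree G. em (coeff G k) * (t ^ k * (1 / g)))"
   by (subst (1) g_def) (simp add: ev_eq sum_divide_distrib)
  thus ?thesis by (simp only: P_sum P_scale)
 qed
 also have "\<dots> - g * P (1 / g) = (\<Sum>i<degree G. bez G t i * (P (t ^ Suc i * (1 / g)) - t * P (t ^ i * (1 / g))))"
  using bez_telescope[of G t "\<lambda>k. P (t ^ k * (1 / g))"] g_def by simp
 also have "\<dots> = (\<Sum>i<degree G. bez G t i * (\<Sum>(r, s)\<leftarrow>rs. r * em (ze (t ^ i * s))))"
  using rs(2)[of "t ^ _ * (1 / g)"] by (intro sum.cong refl) (simp add: ze_def mult.assoc mult.commute mult.left_commute)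
 finally have 1: "1 - g * P (1 / g) = (\<Sum>i<degree G. bez G t i * (\<Sum>(r, s)\<leftarrow>rs. r * em (ze (t ^ i * s))))" .
 \<comment> \<open>Stated for all lists of pairs, so that the factors \<open>r\<close> are moved
   inside one pair at a time.\<close>
 have 2: "(\<Sum>i<degree G. bez G t i * ((\<Sum>(r, s)\<leftarrow>rs'. r * em (ze (t ^ i * s))) - em (ze (t ^ i * (\<Sum>(r, s)\<leftarrow>rs'. r * s))))) \<in> principal_ideal p g
  \<and> (\<Sum>(r, s)\<leftarrow>rs'. r * s) \<in> p" if "set rs' \<subseteq> p \<times> p" for rs'
  using that
 proof (induction rs')
  case Nil
  have "ze 0 = 0" using ze ideal_simps(1) unfolding functional_def by blast
  thus ?case using ideal_simps(1) zero_mem by simp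
 next
  case (Cons x rs')
  obtain r s where x: "x = (r, s)" by (cases x)
  have m: "r \<in> p" "s \<in> p" using Cons.prems x by auto
  let ?A = "\<lambda>i. \<Sum>(r, s)\<leftarrow>rs'. r * em (ze (t ^ i * s))" and ?B = "\<Sum>(r, s)\<leftarrow>rs'. r * s"
  have IH: "(\<Sum>i<degree G. bez G t i * (?A i - em (ze (t ^ i * ?B)))) \<in> principal_ideal p g" "?B \<in> p"
   using Cons by auto
  have "ze (t ^ i * (r * s + ?B)) = ze (t ^ i * (r * s)) + ze (t ^ i * ?B)" for i
   using ze mult_mem[OF ti IH(2)] mult_mem[OF ti mult_mem[OF m]]
   unfolding functional_def by (simp add: distrib_left)
  hence "(\<Sum>i<degree G. bez G t i * ((r * em (ze (t ^ i * s)) + ?A i) - em (ze (t ^ i * (r * s + ?B)))))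
   = (\<Sum>i<degree G. bez G t i * (r * em (ze (t ^ i * s)) - em (ze (r * t ^ i * s))))
    + (\<Sum>i<degree G. bez G t i * (?A i - em (ze (t ^ i * ?B))))"
   by (simp add: sum.distrib[symmetric] em_add algebra_simps)
  also have "\<dots> \<in> principal_ideal p g" by (rule ideal_simps(2)[OF bez_swap[OF ze m] IH(1)])
  finally show ?case using IH(2) m by (simp add: x add_mem mult_mem)
 qed
 have "(\<Sum>i<degree G. em (lam (t ^ i * D t / g)) * bez G t i) - 1
  = - (g * P (1 / g)) - (\<Sum>i<degree G. bez G t i * ((\<Sum>(r, s)\<leftarrow>rs. r * em (ze (t ^ i * s))) - em (ze (t ^ i * D t))))"
  using 1 unfolding ze_def by (simp add: algebra_simps sum_subtractf)
 also have "\<dots> \<in> principal_ideal p g"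
  using 2[OF rs(1)] ideal_simps(7)[OF minus_mem[OF P_mem]] unfolding rs(3) by (intro ideal_simps(3)) auto
 finally show ?thesis .
qed

end

section \<open>Affine charts\<close>

text \<open>Used twice: for \<open>x\<close>, \<open>y\<close>, \<open>f\<close> on the affine part
  and for \<open>u\<close>, \<open>v\<close>, \<open>Finf\<close> around infinity, so that the local
  theory is developed once.\<close>

locale chart = field_ext em for em :: "'a::field => 'k::field" +
 fixes xc yc :: 'k and f :: "'a poly"
 assumes transc: "q ~= 0 ==> ev q xc ~= 0"
  and Y_sq: "yc ^ 2 = ev f xc"
  and gen: "\<exists>a b c. c ~= 0 \<and> h = (ev a xc + ev b xc * yc) / ev c xc"
  and two: "(2::'a) ~= 0"
  and indep: "ev a xc + ev b xc * yc = 0 ==> a = 0 \<and> b = 0"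
begin

definition R :: "'k set" where "R = {ev a xc + ev b xc * yc |a b. True}"

lemma R_I: "h = ev a xc + ev b xc * yc ==> h \<in> R"
 unfolding R_def by blast

lemma R_E: assumes "h \<in> R" obtains a b where "h = ev a xc + ev b xc * yc"
 using assms unfolding R_def by blast

lemma YY: "yc * yc = ev f xc"
 using Y_sq by (simp add: power2_eq_square)

lemma two_k: "(2::'k) ~= 0"
 using two em_eq_0_iff[of 2] em_add[of 1 1] by (metis em_one one_add_one)

lemma Y_nonzero: "yc ~= 0"
 using indep[of 0 1] by auto

lemma ev_R: "ev a xc \<in> R"
 by (rule R_I[of _ a 0]) simp

lemma Y_R: "yc \<in> R"
 by (rule R_I[of _ 0 1]) simp

lemma X_R: "xc \<in> R"
 using ev_R[of "[:0, 1:]"] by simp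

lemma em_R: "em c \<in> R"
 using ev_R[of "[:c:]"] by simp

lemma zero_R: "0 \<in> R" and one_R: "1 \<in> R"
 using em_R[of 0] em_R[of 1] by simp_all

lemma add_R: "a \<in> R ==> b \<in> R ==> a + b \<in> R"
proof -
 assume "a \<in> R" "b \<in> R"
 then obtain a1 a2 b1 b2 where "a = ev a1 xc + ev a2 xc * yc" "b = ev b1 xc + ev b2 xc * yc" by (meson R_E)
 thus ?thesis by (intro R_I[of _ "a1 + b1" "a2 + b2"]) (simp add: ev_add algebra_simps)
qed

lemma mult_R: "a \<in> R ==> b \<in> R ==> a * b \<in> R"
proof -
 assume "a \<in> R" "b \<in> R"
 then obtain a1 a2 b1 b2 where *: "a = ev a1 xc + ev a2 xc * yc" "b = ev b1 xc + ev b2 xc * yc" by (meson R_E)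
 have "a * b = ev a1 xc * ev b1 xc + ev a2 xc * ev b2 xc * (yc * yc) + (ev a1 xc * ev b2 xc + ev a2 xc * ev b1 xc) * yc"
  unfolding * by (simp add: algebra_simps)
 thus ?thesis by (intro R_I[of _ "a1 * b1 + a2 * b2 * f" "a1 * b2 + a2 * b1"]) (simp add: ev_add ev_mult YY)
qed

lemma minus_R: "a \<in> R ==> - a \<in> R"
 using mult_R[OF em_R[of "-1"]] by (simp add: em_minus)

lemma diff_R: "a \<in> R ==> b \<in> R ==> a - b \<in> R"
 using add_R[OF _ minus_R, of a b] by simp

lemma power_R: "a \<in> R ==> a ^ n \<in> R"
 by (induction n) (auto intro: one_R mult_R)

lemma prod_R: "(\<And>i. i \<in> J ==> g i \<in> R) ==> (\<Prod>i\<in>J. g i) \<in> R"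
 by (induction J rule: infinite_finite_induct) (auto intro: one_R mult_R)

lemma subspace_R: "vs.subspace R"
 by (rule vs.subspaceI) (auto intro: zero_R add_R mult_R em_R)

lemma ev_eq_0_iff: "ev a xc = 0 \<longleftrightarrow> a = 0"
 using transc[of a] by auto

text \<open>The conjugate \<open>a - b y\<close> turns an element into its norm
  \<open>a^2 - b^2 f\<close>, which reduces questions on \<open>R\<close> to polynomials in
  \<open>x\<close>.\<close>

lemma R_norm:
 assumes "r \<in> R" "r ~= 0"
 obtains r' N where "r' \<in> R" "N ~= 0" "r * r' = ev N xc"
proof -
 from assms(1) obtain a b where r: "r = ev a xc + ev b xc * yc" by (rule R_E)
 let ?r' = "ev a xc + ev (- b) xc * yc"
 have eq: "r * ?r' = ev (a * a - b * b * f) xc"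
  unfolding r by (simp add: ev_minus ev_diff ev_mult algebra_simps flip: YY)
 have "?r' ~= 0" using indep[of a "- b"] assms(2) unfolding r by auto
 hence "a * a - b * b * f ~= 0" using eq assms(2) by (metis ev_0 mult_eq_0_iff)
 thus ?thesis using that[of ?r' "a * a - b * b * f"] eq R_I by blast
qed

lemma frac:
 obtains r c where "r \<in> R" "c ~= 0" "h = r / ev c xc"
 using gen[of h] that R_I by blast

text \<open>Differentiating \<open>y^2 = f(x)\<close> determines the value at \<open>y\<close> from
  that at \<open>x\<close>, because \<open>2 y\<close> is nonzero.\<close>

lemma derivation_eqI:
 assumes "derivation em D" "derivation em E" "D xc = E xc" shows "D = E"
proof
 have DY: "D' yc = ev (pderiv f) xc * D' xc / (2 * yc)" if D: "derivation em D'" for D'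
 proof -
  have "D' (yc * yc) = 2 * yc * D' yc" using D unfolding derivation_def by simp
  moreover have "D' (yc * yc) = ev (pderiv f) xc * D' xc" unfolding YY by (rule derivation_ev[OF D])
  ultimately show ?thesis using Y_nonzero two_k by (simp add: field_simps)
 qed
 fix h
 from gen[of h] obtain a b c where c: "c ~= 0" and h: "h = (ev a xc + ev b xc * yc) / ev c xc" by blast
 have Dh: "D' h = (ev (pderiv a) xc * D' xc + (ev b xc * D' yc + yc * (ev (pderiv b) xc * D' xc)) - h * (ev (pderiv c) xc * D' xc)) / ev c xc"
  if D: "derivation em D'" for D'
  unfolding h derivation_divide[OF D transc[OF c]] derivation_ev[OF D, symmetric]
  using D by (simp add: derivation_def)
 show "D h = E h"
  by (simp only: Dh[OF assms(1)] Dh[OF assms(2)] DY[OF assms(1)] DY[OF assms(2)] assms(3))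
qed

lemma R_span_mod:
 assumes "N ~= 0"
 shows "R \<subseteq> vs.span ((\<lambda>r. ev N xc * r) ` R \<union> ((\<lambda>i. xc ^ i) ` {..<degree N} \<union> (\<lambda>i. xc ^ i * yc) ` {..<degree N}))"
  (is "_ \<subseteq> vs.span (?A \<union> (?S \<union> ?T))")
proof
 fix r assume "r \<in> R"
 then obtain a b where r: "r = ev a xc + ev b xc * yc" by (rule R_E)
 have dm: "ev a xc = ev N xc * ev (a div N) xc + ev (a mod N) xc" for a
  by (metis ev_add ev_mult mult_div_mod_eq)
 have "ev (a mod N) xc = (\<Sum>k<degree N. em (coeff (a mod N) k) * xc ^ k)" for a
 proof (cases "degree N = 0")
  case True
  hence "a mod N = 0" using assms by (metis degree_mod_less' less_nat_zero_code)
  thus ?thesis by simp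
 next
  case False
  have "degree (a mod N) < degree N" using degree_mod_less[OF assms, of a] False by auto
  thus ?thesis unfolding ev_eq by (intro sum.mono_neutral_left) (auto simp: coeff_eq_0)
 qed
 hence eq: "r = ev N xc * (ev (a div N) xc + ev (b div N) xc * yc)
  + ((\<Sum>k<degree N. sc (coeff (a mod N) k) (xc ^ k)) + (\<Sum>k<degree N. sc (coeff (b mod N) k) (xc ^ k * yc)))"
  unfolding r using dm[of a] dm[of b] by (simp add: algebra_simps sum_distrib_left sum_distrib_right)
 have "ev N xc * (ev (a div N) xc + ev (b div N) xc * yc) \<in> ?A" using R_I by blast
 thus "r \<in> vs.span (?A \<union> (?S \<union> ?T))"
  unfolding eq by (intro vs.span_add vs.span_sum vs.span_scale; intro vs.span_base) auto
qed

end

section \<open>The local rings of a chart are discrete valuation rings\<close>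

locale chart_point = chart em xc yc f for em :: "'a::field => 'k::field" and xc yc f +
 fixes I :: "'k set"
 assumes I_sub: "I \<subseteq> R" and I_zero: "0 \<in> I"
  and I_add: "a \<in> I ==> b \<in> I ==> a + b \<in> I"
  and I_mult: "a \<in> I ==> r \<in> R ==> r * a \<in> I"
  and I_one: "1 \<notin> I"
  and I_comax: "r \<in> R ==> r \<notin> I ==> \<exists>c\<in>R. 1 - c * r \<in> I"
  and smooth: "yc \<in> I ==> ev (pderiv f) xc \<notin> I"
begin

definition p :: "'k set" where "p = loc_at R I"

lemma I_mult': "a \<in> I ==> r \<in> R ==> a * r \<in> I"
 using I_mult by (simp add: mult.commute)

lemma I_diff: "a \<in> I ==> b \<in> I ==> a - b \<in> I"
 using I_add[of a "- b"] I_mult[of b "-1"] minus_R[OF one_R] by simp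

lemma I_prime: assumes "a \<in> R" "b \<in> R" "a * b \<in> I" "a \<notin> I" shows "b \<in> I"
proof -
 obtain c where c: "c \<in> R" "1 - c * a \<in> I" using I_comax assms by blast
 have "b = b * (1 - c * a) + c * (a * b)" by (simp add: algebra_simps)
 also have "\<dots> \<in> I" using c assms I_mult I_add by blast
 finally show ?thesis .
qed

lemma I_prime_power: "a \<in> R ==> a ^ n \<in> I ==> a \<in> I"
 using I_one I_prime power_R by (induction n) auto

lemma I_half: assumes "a \<in> R" "2 * a \<in> I" shows "a \<in> I"
proof -
 have "em (1/2) * (2 * a) \<in> I" using assms em_R I_mult by blast
 moreover have "em (1/2) * 2 = em (1/2 * 2)" using em_mult[of "1/2" 2] em_add[of 1 1] by simp
 hence "em (1/2) * (2 * a) = a" using two by (simp flip: mult.assoc)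
 ultimately show ?thesis by simp
qed

text \<open>If \<open>I\<close> were zero, \<open>x\<close> would be invertible in \<open>R\<close>,
  but \<open>1 - x a(x)\<close> has constant term \<open>1\<close>. The norm of a nonzero element of
  \<open>I\<close> is the polynomial sought.\<close>

lemma I_ev_ex: "\<exists>a. a ~= 0 \<and> ev a xc \<in> I"
proof -
 have "\<exists>r\<in>I. r ~= 0"
 proof (rule ccontr)
  assume "\<not> (\<exists>r\<in>I. r ~= 0)"
  hence I0: "I \<subseteq> {0}" by blast
  have "xc ~= 0" using transc[of "[:0,1:]"] by simp
  then obtain c where c: "c \<in> R" "1 - c * xc = 0" using I_comax[OF X_R] I0 by blast
  obtain a b where "c = ev a xc + ev b xc * yc" using c(1) by (rule R_E)
  hence "ev (1 - [:0, 1:] * a) xc + ev (- [:0, 1:] * b) xc * yc = 0"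
   using c(2) by (simp add: ev_diff ev_mult ev_minus algebra_simps)
  hence "1 - [:0, 1:] * a = 0" using indep by blast
  hence "poly (1 - [:0, 1:] * a) 0 = 0" by simp
  thus False by simp
 qed
 then obtain r where r: "r \<in> I" "r ~= 0" by blast
 from R_norm[of r] r I_sub obtain r' N where "r' \<in> R" "N ~= 0" "r * r' = ev N xc" by blast
 thus ?thesis using I_mult'[OF r(1)] by metis
qed

definition q :: "'a poly" where "q = (SOME q. (\<forall>a. ev a xc \<in> I \<longleftrightarrow> q dvd a) \<and> q ~= 0)"

lemma q_props: "(\<forall>a. ev a xc \<in> I \<longleftrightarrow> q dvd a) \<and> q ~= 0"
 unfolding q_def
proof (rule someI_ex)
 obtain g where g: "g ~= 0" "ev g xc \<in> I" and min: "\<And>a. a ~= 0 ==> ev a xc \<in> I ==> degree g \<le> degree a"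
  using ex_has_least_nat[of "\<lambda>a. a ~= 0 \<and> ev a xc \<in> I" _ degree] I_ev_ex by blast
 have "ev a xc \<in> I \<longleftrightarrow> g dvd a" for a
 proof
  assume a: "ev a xc \<in> I"
  have "a mod g = a - a div g * g" by (simp add: minus_div_mult_eq_mod)
  hence "ev (a mod g) xc = ev a xc - ev (a div g) xc * ev g xc" by (simp only: ev_diff ev_mult)
  hence m: "ev (a mod g) xc \<in> I" using I_diff[OF a I_mult[OF g(2) ev_R]] by simp
  have "a mod g = 0"
  proof (rule ccontr)
   assume n: "a mod g ~= 0"
   from min[OF n m] degree_mod_less[OF g(1), of a] n show False by linarith
  qed
  thus "g dvd a" by (simp add: mod_eq_0_iff_dvd)
 next
  assume "g dvd a"
  then obtain b where "a = g * b" by blast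
  thus "ev a xc \<in> I" using I_mult'[OF g(2) ev_R] by (simp add: ev_mult)
 qed
 thus "\<exists>g. (\<forall>a. ev a xc \<in> I \<longleftrightarrow> g dvd a) \<and> g ~= 0" using g(1) by blast
qed

lemma q: "ev a xc \<in> I \<longleftrightarrow> q dvd a" and q_nonzero: "q ~= 0"
 using q_props by blast+

lemma q_mem: "ev q xc \<in> I"
 using q[of q] by simp

lemma q_E: "ev a xc \<in> I ==> \<exists>b. a = q * b"
 using q[of a] by (auto simp: dvd_def)

lemma q_nonunit: "\<not> is_unit q"
 using q[of 1] I_one by simp

lemma p_I: "a \<in> R ==> s \<in> R ==> s \<notin> I ==> a / s \<in> p"
 unfolding p_def loc_at_def by blast

lemma p_E: assumes "h \<in> p" obtains a s where "a \<in> R" "s \<in> R" "s \<notin> I" "s ~= 0" "h = a / s"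
 using assms I_zero unfolding p_def loc_at_def by blast

lemma R_p: "a \<in> R ==> a \<in> p"
 using p_I[OF _ one_R I_one] by simp

lemma inverse_p: "s \<in> R ==> s \<notin> I ==> inverse s \<in> p"
 using p_I[OF one_R] by (simp add: divide_inverse)

lemma add_p: assumes "a \<in> p" "b \<in> p" shows "a + b \<in> p"
proof -
 obtain a1 s where s: "a1 \<in> R" "s \<in> R" "s \<notin> I" "s ~= 0" "a = a1 / s" using assms(1) by (rule p_E)
 obtain b1 t where t: "b1 \<in> R" "t \<in> R" "t \<notin> I" "t ~= 0" "b = b1 / t" using assms(2) by (rule p_E)
 have "a + b = (a1 * t + b1 * s) / (s * t)" using s t by (simp add: add_frac_eq)
 moreover have "s * t \<notin> I" using I_prime[OF s(2) t(2)] s(3) t(3) by blast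
 ultimately show ?thesis using p_I[OF add_R[OF mult_R[OF s(1) t(2)] mult_R[OF t(1) s(2)]] mult_R[OF s(2) t(2)]] by simp
qed

lemma mult_p: assumes "a \<in> p" "b \<in> p" shows "a * b \<in> p"
proof -
 obtain a1 s where s: "a1 \<in> R" "s \<in> R" "s \<notin> I" "s ~= 0" "a = a1 / s" using assms(1) by (rule p_E)
 obtain b1 t where t: "b1 \<in> R" "t \<in> R" "t \<notin> I" "t ~= 0" "b = b1 / t" using assms(2) by (rule p_E)
 have "a * b = (a1 * b1) / (s * t)" using s t by simp
 moreover have "s * t \<notin> I" using I_prime[OF s(2) t(2)] s(3) t(3) by blast
 ultimately show ?thesis using p_I[OF mult_R[OF s(1) t(1)] mult_R[OF s(2) t(2)]] by simp
qed

text \<open>Where \<open>y\<close> does not vanish, the map \<open>x\<close> is unramified since 2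
  is invertible, and the generator \<open>q(x)\<close> of the polynomials in \<open>I\<close> stays
  a uniformizer. At a zero of \<open>y\<close> it becomes a unit times \<open>y^2\<close>, so
  \<open>y\<close> is taken instead.\<close>

definition pu :: 'k where "pu = (if yc \<in> I then yc else ev q xc)"

lemma pi_I: "pu \<in> I"
 unfolding pu_def using q_mem by auto

lemma pi_nz: "pu ~= 0"
 unfolding pu_def using Y_nonzero transc[OF q_nonzero] by auto

lemma inverse_notin: assumes "a \<in> I" "a ~= 0" shows "inverse a \<notin> p"
proof
 assume "inverse a \<in> p"
 then obtain b s where *: "b \<in> R" "s \<in> R" "s \<notin> I" "s ~= 0" "inverse a = b / s" by (rule p_E)
 hence "s = b * a" using assms(2) by (simp add: field_simps)
 thus False using * I_mult assms by blast
qed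

text \<open>At a zero of \<open>y\<close> write \<open>f = q f1\<close>. Another factor
  \<open>q\<close> in \<open>f1\<close> would make \<open>q\<close> divide \<open>f'\<close>,
  against smoothness, so \<open>f1\<close> is a unit and \<open>q\<close> is \<open>y^2\<close> up
  to this unit.\<close>

lemma q_pi: "\<exists>k w. w \<in> p \<and> inverse w \<in> p \<and> ev q xc = w * pu ^ k"
proof (cases "yc \<in> I")
 case False
 thus ?thesis unfolding pu_def using R_p[OF one_R] by (intro exI[of _ 1]) auto
next
 case True
 hence "ev f xc \<in> I" using I_mult[OF True Y_R] YY by simp
 then obtain f1 where f1: "f = q * f1" using q_E by blast
 have "\<not> q dvd f1"
 proof
  assume "q dvd f1"
  then obtain g where "f1 = q * g" by blast
  hence "pderiv f = q * (pderiv (q * g) + g * pderiv q)" unfolding f1 by (simp add: pderiv_mult algebra_simps)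
  hence "q dvd pderiv f" by simp
  thus False using q[of "pderiv f"] smooth True by simp
 qed
 hence n: "ev f1 xc \<notin> I" using q[of f1] by simp
 hence "ev f1 xc ~= 0" using I_zero by auto
 moreover have "yc * yc = ev q xc * ev f1 xc" using YY f1 by (simp add: ev_mult)
 ultimately have "ev q xc = inverse (ev f1 xc) * pu ^ 2"
  using True unfolding pu_def by (simp add: power2_eq_square)
 thus ?thesis using inverse_p[OF ev_R n] R_p[OF ev_R, of f1]
  by (intro exI[of _ 2] exI[of _ "inverse (ev f1 xc)"]) simp
qed

text \<open>At a zero of \<open>y\<close> an element \<open>A + B y\<close> of \<open>I\<close> has
  \<open>A\<close> divisible by \<open>q\<close>. Elsewhere its norm is divisible by
  \<open>q\<close>: either the conjugate is a unit and can be divided away, or both \<open>A\<close>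
  and \<open>B y\<close> lie in \<open>I\<close>, and then \<open>q\<close> divides \<open>A\<close>
  and \<open>B\<close>.\<close>

lemma I_pi: assumes a: "a \<in> I" shows "\<exists>b\<in>p. a = pu * b"
proof -
 obtain A B where ab: "a = ev A xc + ev B xc * yc" using a I_sub R_E by blast
 show ?thesis
 proof (cases "yc \<in> I")
  case True
  hence "ev A xc \<in> I" using I_diff[OF a I_mult[OF True ev_R[of B]]] unfolding ab by simp
  then obtain A' where A': "A = q * A'" using q_E by blast
  obtain k w where w: "w \<in> p" "inverse w \<in> p" "ev q xc = w * pu ^ k" using q_pi by blast
  have "k ~= 0"
  proof
   assume "k = 0"
   hence "inverse (ev q xc) \<in> p" using w by simp
   thus False using inverse_notin[OF q_mem transc[OF q_nonzero]] by blast
  qed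
  then obtain k' where "k = Suc k'" by (cases k) auto
  hence "a = pu * (w * pu ^ k' * ev A' xc + ev B xc)"
   unfolding ab A' ev_mult w(3) using True by (simp add: pu_def algebra_simps)
  moreover have "pu ^ k' \<in> p" using R_p[OF power_R[of pu k']] pi_I I_sub by blast
  ultimately show ?thesis using w(1) by (metis add_p mult_p R_p ev_R)
 next
  case False
  let ?b = "ev A xc - ev B xc * yc"
  have bR: "?b \<in> R" using diff_R mult_R ev_R Y_R by blast
  have prod: "a * ?b = ev (A * A - B * B * f) xc"
   unfolding ab by (simp add: ev_diff ev_mult algebra_simps flip: YY)
  hence "ev (A * A - B * B * f) xc \<in> I" using I_mult'[OF a bR] by simp
  then obtain N where N: "A * A - B * B * f = q * N" using q_E by blast
  show ?thesis
  proof (cases "?b \<in> I")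
   case False
   hence "?b ~= 0" using I_zero by metis
   moreover have "a * ?b = ev q xc * ev N xc" using prod N by (simp add: ev_mult)
   ultimately have "a = pu * (ev N xc / ?b)" using \<open>yc \<notin> I\<close> unfolding pu_def by (simp add: field_simps)
   moreover have "ev N xc / ?b \<in> p" by (rule p_I[OF ev_R bR False])
   ultimately show ?thesis by blast
  next
   case True
   have "2 * ev A xc = a + ?b" "2 * (ev B xc * yc) = a - ?b" unfolding ab by simp_all
   hence "2 * ev A xc \<in> I" "2 * (ev B xc * yc) \<in> I"
    using I_add[OF a True] I_diff[OF a True] by (simp_all only:)
   hence "ev A xc \<in> I" "ev B xc * yc \<in> I" using I_half mult_R ev_R Y_R by blast+
   moreover from this(2) have "ev B xc \<in> I"
    using I_prime[OF Y_R ev_R[of B]] \<open>yc \<notin> I\<close> by (simp add: mult.commute)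
   ultimately obtain A' B' where "A = q * A'" "B = q * B'" using q_E by meson
   hence "a = pu * (ev A' xc + ev B' xc * yc)"
    unfolding ab pu_def using \<open>yc \<notin> I\<close> by (simp add: ev_mult algebra_simps)
   thus ?thesis using R_p[OF R_I] by blast
  qed
 qed
qed

text \<open>Factors \<open>pu\<close> are removed from \<open>h\<close> as long as its numerator
  lies in \<open>I\<close>; the product with \<open>g\<close> bounds the number of removals by
  \<open>k\<close>.\<close>

lemma pi_decomp:
 "h \<in> p ==> g \<in> p ==> w \<in> p ==> inverse w \<in> p ==> w ~= 0 ==> h * g = w * pu ^ k ==>
  \<exists>j v. v \<in> p \<and> inverse v \<in> p \<and> h = v * pu ^ j"
proof (induction k arbitrary: h)
 case 0
 hence "inverse h = g * inverse w" by (auto simp: field_simps)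
 hence "inverse h \<in> p" using mult_p[OF 0(2,4)] by simp
 thus ?case using 0(1) by (intro exI[of _ 0] exI[of _ h]) simp
next
 case (Suc k)
 obtain a s where as: "a \<in> R" "s \<in> R" "s \<notin> I" "s ~= 0" "h = a / s" using Suc.prems(1) by (rule p_E)
 show ?case
 proof (cases "a \<in> I")
  case False
  hence "inverse h \<in> p" using p_I[OF as(2,1) False] as(5) by simp
  thus ?thesis using Suc.prems(1) by (intro exI[of _ 0] exI[of _ h]) simp
 next
  case True
  then obtain b where b: "b \<in> p" "a = pu * b" using I_pi by blast
  let ?h = "b * inverse s"
  have h: "h = pu * ?h" using as b by (simp add: field_simps)
  have "?h \<in> p" using b inverse_p as mult_p by blast
  moreover have "?h * g = w * pu ^ k" using Suc.prems(6) pi_nz unfolding h by (simp add: mult.assoc)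
  ultimately obtain j v where "v \<in> p" "inverse v \<in> p" "?h = v * pu ^ j"
   using Suc.IH[of ?h] Suc.prems(2-5) by blast
  thus ?thesis using h by (intro exI[of _ "Suc j"] exI[of _ v]) simp
 qed
qed

lemma q_decompose: "N ~= 0 ==> \<exists>m N'. N = q ^ m * N' \<and> \<not> q dvd N'"
proof (induction "degree N" arbitrary: N rule: less_induct)
 case less
 show ?case
 proof (cases "q dvd N")
  case True
  then obtain M where M: "N = q * M" by blast
  have "degree q > 0" using q_nonunit q_nonzero is_unit_iff_degree by blast
  hence "degree M < degree N" using less.prems q_nonzero unfolding M by (auto simp: degree_mult_eq)
  then obtain m N' where "M = q ^ m * N'" "\<not> q dvd N'" using less.hyps less.prems M by fastforce
  thus ?thesis using M by (intro exI[of _ "Suc m"] exI[of _ N']) simp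
 next
  case False
  thus ?thesis by (intro exI[of _ 0] exI[of _ N]) simp
 qed
qed

text \<open>\<open>pi_decomp\<close> applies to \<open>h\<close> and its conjugate: their product is
  \<open>q ^ m\<close> times a polynomial prime to \<open>q\<close>, hence a unit times a power of
  \<open>pu\<close>.\<close>

lemma unif_p:
 assumes "h \<in> R" "h ~= 0" shows "\<exists>j v. v \<in> p \<and> inverse v \<in> p \<and> h = v * pu ^ j"
proof -
 obtain r' N where r': "r' \<in> R" "N ~= 0" "h * r' = ev N xc" using R_norm[OF assms] .
 obtain m N' where N': "N = q ^ m * N'" "\<not> q dvd N'" using q_decompose[OF r'(2)] by blast
 obtain k w where w: "w \<in> p" "inverse w \<in> p" "ev q xc = w * pu ^ k" using q_pi by blast
 have nI: "ev N' xc \<notin> I" using N'(2) q[of N'] by simp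
 have "h * r' = (w ^ m * ev N' xc) * pu ^ (k * m)"
  unfolding r'(3) by (subst N'(1)) (simp add: ev_mult ev_power w(3) power_mult_distrib power_mult)
 moreover have pw: "a ^ n \<in> p" if "a \<in> p" for a n using that by (induction n) (auto intro: mult_p R_p one_R)
 have "w ^ m * ev N' xc \<in> p" "inverse (w ^ m * ev N' xc) \<in> p"
  using w pw[OF w(1)] pw[OF w(2)] inverse_p[OF ev_R nI] R_p[OF ev_R, of N']
  by (auto intro: mult_p simp: power_inverse)
 moreover have "w ^ m * ev N' xc ~= 0" using w(3) transc[OF q_nonzero] nI I_zero by auto
 ultimately show ?thesis using pi_decomp[OF R_p[OF assms(1)] R_p[OF r'(1)]] by blast
qed

sublocale dvr p pu
proof
 show "1 \<in> p" by (rule R_p[OF one_R])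
 show "a \<in> p ==> - a \<in> p" for a using mult_p[OF R_p[OF minus_R[OF one_R]], of a] by simp
 show "pu \<in> p" using pi_I I_sub R_p by blast
 show "inverse pu \<notin> p" using inverse_notin[OF pi_I pi_nz] .
 fix h :: 'k assume h: "h ~= 0"
 obtain r c where rc: "r \<in> R" "c ~= 0" "h = r / ev c xc" by (rule frac)
 have r0: "r ~= 0" using rc h by auto
 obtain i v where v: "v \<in> p" "inverse v \<in> p" "r = v * pu ^ i" using unif_p[OF rc(1) r0] by blast
 obtain j w where w: "w \<in> p" "inverse w \<in> p" "ev c xc = w * pu ^ j" using unif_p[OF ev_R transc[OF rc(2)]] by blast
 have "h = (v * inverse w) * pu powi (int i - int j)"
  unfolding rc(3) v(3) w(3) using pi_nz by (simp add: power_int_diff field_simps)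
 moreover have "v * inverse w \<in> p" "inverse (v * inverse w) \<in> p" using v w by (auto intro: mult_p)
 ultimately show "\<exists>n w. w \<in> p \<and> inverse w \<in> p \<and> h = w * pu powi n" by blast
qed (auto simp: pi_nz intro: add_p mult_p)

lemma em_p: "em c \<in> p"
 by (rule R_p[OF em_R])

lemma R_max_ideal: "r \<in> R ==> r \<in> max_ideal p \<longleftrightarrow> r \<in> I"
 using max_ideal_iff[of r] R_p inverse_notin[of r] inverse_p[of r] I_zero by (cases "r = 0") auto

lemma R_I_pow: assumes "a \<in> I" shows "a ^ n \<in> principal_ideal p (pu ^ n)"
proof -
 obtain b where "b \<in> p" "a = pu * b" using I_pi[OF assms] by blast
 thus ?thesis unfolding principal_ideal_def using power_mem[of b n] by (auto simp: power_mult_distrib)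
qed

text \<open>Inverses modulo \<open>I\<close> lift to inverses modulo its powers: the product of
  \<open>1 - c' s\<close> and \<open>1 - c s\<close> has again this shape.\<close>

lemma comax_power:
 assumes "c \<in> R" "s \<in> R" shows "\<exists>c'\<in>R. 1 - c' * s = (1 - c * s) ^ n"
proof (induction n)
 case 0
 show ?case using zero_R by (intro bexI[of _ 0]) auto
next
 case (Suc n)
 then obtain c' where c': "c' \<in> R" "1 - c' * s = (1 - c * s) ^ n" by blast
 have "1 - (c' + c - c' * c * s) * s = (1 - c' * s) * (1 - c * s)" by (simp add: algebra_simps)
 hence "1 - (c' + c - c' * c * s) * s = (1 - c * s) ^ Suc n" using c'(2) by simp
 moreover have "c' + c - c' * c * s \<in> R" using c' assms by (intro diff_R add_R mult_R)
 ultimately show ?case by blast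
qed

lemma approx_power:
 assumes "a \<in> p" shows "\<exists>r\<in>R. a - r \<in> principal_ideal p (pu ^ n)"
proof -
 obtain b s where bs: "b \<in> R" "s \<in> R" "s \<notin> I" "s ~= 0" "a = b / s" using assms by (rule p_E)
 obtain c where c: "c \<in> R" "1 - c * s \<in> I" using I_comax bs by blast
 obtain c' where c': "c' \<in> R" "1 - c' * s = (1 - c * s) ^ n" using comax_power[OF c(1) bs(2)] by blast
 have "a - b * c' = a * (1 - c' * s)" using bs by (simp add: field_simps)
 moreover have "1 - c' * s \<in> principal_ideal p (pu ^ n)" unfolding c' by (rule R_I_pow[OF c(2)])
 ultimately have "a - b * c' \<in> principal_ideal p (pu ^ n)"
  using principal_submod[of "pu ^ n"] assms unfolding submod_closed_def by simp
 thus ?thesis using bs c' mult_R by blast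
qed

lemma principal_eq_pi:
 assumes "s ~= 0" "s \<in> p" shows "principal_ideal p s = principal_ideal p (pu ^ nat (vord s))"
 using assms mem_iff_vord by (subst principal_ideal_eq) (auto simp: pi_nonzero vord_power vord_pi)

lemma approx:
 assumes "a \<in> p" "s ~= 0" shows "\<exists>r\<in>R. a - r \<in> principal_ideal p s"
proof -
 have "principal_ideal p (pu ^ nat (vord s)) \<subseteq> principal_ideal p s"
  using assms(2) by (subst principal_ideal_subset) (auto simp: pi_nonzero vord_power vord_pi)
 thus ?thesis using approx_power[OF assms(1)] by blast
qed

lemma subspace_principal: "vs.subspace (principal_ideal p s)"
 using principal_submod[of s] em_p unfolding submod_closed_def vs.subspace_def by blast

lemma finite_quotient:
 assumes "s ~= 0" "s \<in> p"
 shows "\<exists>bs. quot_basis sc p (principal_ideal p s) bs"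
proof -
 obtain n where n: "principal_ideal p s = principal_ideal p (pu ^ n)" using principal_eq_pi[OF assms] by blast
 have sn: "principal_ideal p s \<subseteq> p" using assms(2) mult_p unfolding principal_ideal_def by auto
 obtain S where S: "finite S" "R \<subseteq> vs.span ((\<lambda>r. ev (q ^ n) xc * r) ` R \<union> S)"
  using R_span_mod[of "q ^ n"] q_nonzero by (metis (no_types, lifting) finite_UnI finite_imageI finite_lessThan power_not_zero)
 have "(\<lambda>r. ev (q ^ n) xc * r) ` R \<subseteq> principal_ideal p s"
 proof safe
  fix r assume "r \<in> R"
  thus "ev (q ^ n) xc * r \<in> principal_ideal p s"
   using R_I_pow[OF q_mem, of n] principal_submod[of s] R_p[of r] unfolding n submod_closed_def
   by (simp add: ev_power mult.commute)
 qed
 hence "R \<subseteq> vs.span (principal_ideal p s \<union> S)" using S(2) vs.span_mono by (meson Un_mono order_refl order_trans)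
 hence "p \<subseteq> vs.span (principal_ideal p s \<union> S)"
 proof (intro subsetI)
  fix a assume RS: "R \<subseteq> vs.span (principal_ideal p s \<union> S)" and "a \<in> p"
  then obtain r where r: "r \<in> R" "a - r \<in> principal_ideal p s" using approx assms by blast
  have "r \<in> vs.span (principal_ideal p s \<union> S)" using RS r by blast
  moreover have "a - r \<in> vs.span (principal_ideal p s \<union> S)" using r by (intro vs.span_base) blast
  ultimately have "r + (a - r) \<in> vs.span (principal_ideal p s \<union> S)" by (rule vs.span_add)
  thus "a \<in> vs.span (principal_ideal p s \<union> S)" by simp
 qed
 moreover have "vs.subspace p" using subspace_principal[of 1] by (simp add: principal_ideal_one)
 ultimately show ?thesis using vs.quot_basis_exists[OF S(1) _ subspace_principal sn] by blast
qed

lemma derivation_p: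
 assumes D: "derivation em D" "D xc \<in> p" "D yc \<in> p" and a: "a \<in> p" shows "D a \<in> p"
proof -
 have DR: "D r \<in> p" if r: "r \<in> R" for r
 proof -
  obtain A B where r: "r = ev A xc + ev B xc * yc" using r by (rule R_E)
  have "D r = ev (pderiv A) xc * D xc + (ev B xc * D yc + yc * (ev (pderiv B) xc * D xc))"
   unfolding r derivation_ev[OF D(1), symmetric] using D(1) unfolding derivation_def by simp
  thus ?thesis using D R_p[OF ev_R] R_p[OF Y_R] by (auto intro!: add_p mult_p)
 qed
 obtain b s where bs: "b \<in> R" "s \<in> R" "s \<notin> I" "s ~= 0" "a = b / s" using a by (rule p_E)
 have "D a = (D b - a * D s) * inverse s"
  unfolding bs(5) derivation_divide[OF D(1) bs(4)] by (simp add: divide_inverse)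
 thus ?thesis using DR[OF bs(1)] DR[OF bs(2)] a inverse_p[OF bs(2,3)] by (auto intro!: mult_p diff_mem)
qed

lemma Y_or_f': "inverse yc \<in> p \<or> ev (pderiv f) xc ~= 0 \<and> inverse (ev (pderiv f) xc) \<in> p"
 using inverse_p[OF Y_R] inverse_p[OF ev_R, of "pderiv f"] smooth I_zero by metis

end

section \<open>Approximation on the affine curve\<close>

context chart
begin

definition s_ideal :: "'k set => bool" where
 "s_ideal J \<longleftrightarrow> J \<subseteq> R \<and> 0 \<in> J \<and> (\<forall>a\<in>J. \<forall>b\<in>J. a + b \<in> J) \<and> (\<forall>r\<in>R. \<forall>a\<in>J. r * a \<in> J)"

lemma cring_ring_on: "cring (ring_on R)"
proof (rule cringI)
 show "abelian_group (ring_on R)"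
 proof (rule abelian_groupI)
  fix a assume "a \<in> carrier (ring_on R)"
  thus "\<exists>b\<in>carrier (ring_on R). b \<oplus>\<^bsub>ring_on R\<^esub> a = \<zero>\<^bsub>ring_on R\<^esub>"
   using minus_R[of a] by (intro bexI[of _ "- a"]) (auto simp: ring_on_def)
 qed (auto simp: ring_on_def add_R zero_R ac_simps)
 show "comm_monoid (ring_on R)"
  by (rule comm_monoidI) (auto simp: ring_on_def mult_R one_R ac_simps)
qed (auto simp: ring_on_def algebra_simps)

lemma ideal_ring_on: "ideal J (ring_on R) \<longleftrightarrow> s_ideal J"
proof
 interpret cring "ring_on R" by (rule cring_ring_on)
 assume "ideal J (ring_on R)"
 then interpret J: ideal J "ring_on R" .
 show "s_ideal J" unfolding s_ideal_def
  using J.a_subset J.zero_closed J.a_closed J.I_l_closed by (auto simp: ring_on_def)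
next
 interpret cring "ring_on R" by (rule cring_ring_on)
 assume J: "s_ideal J"
 have inv: "\<ominus>\<^bsub>ring_on R\<^esub> a = - a" if "a \<in> R" for a
 proof -
  have "- a \<oplus>\<^bsub>ring_on R\<^esub> a = \<zero>\<^bsub>ring_on R\<^esub>" by (simp add: ring_on_def)
  thus ?thesis using minus_equality[of "- a" a] that minus_R[OF that] by (simp add: ring_on_def)
 qed
 show "ideal J (ring_on R)"
 proof (rule idealI)
  show "ring (ring_on R)" by (rule ring_axioms)
  show "subgroup J (add_monoid (ring_on R))"
  proof
   fix a assume a: "a \<in> J"
   hence "a \<in> R" using J unfolding s_ideal_def by blast
   have "- 1 * a \<in> J" using J a minus_R[OF one_R] unfolding s_ideal_def by blast
   thus "inv\<^bsub>add_monoid (ring_on R)\<^esub> a \<in> J" using inv[OF \<open>a \<in> R\<close>] by (simp add: a_inv_def)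
  qed (use J in "auto simp: s_ideal_def ring_on_def")
  fix a x assume "a \<in> J" "x \<in> carrier (ring_on R)"
  hence "x * a \<in> J" using J unfolding s_ideal_def ring_on_def by simp
  thus "x \<otimes>\<^bsub>ring_on R\<^esub> a \<in> J" "a \<otimes>\<^bsub>ring_on R\<^esub> x \<in> J"
   by (simp_all add: ring_on_def mult.commute)
 qed
qed

lemma maximal_iff:
 "maximalideal I (ring_on R) \<longleftrightarrow> s_ideal I \<and> 1 \<notin> I \<and> (\<forall>J. s_ideal J \<longrightarrow> I \<subseteq> J \<longrightarrow> 1 \<notin> J \<longrightarrow> J = I)"
proof -
 have full: "J = R \<longleftrightarrow> 1 \<in> J" if "s_ideal J" for J
  using that one_R unfolding s_ideal_def by (metis mult.right_neutral subsetI subset_antisym)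
 have R: "carrier (ring_on R) = R" by (simp add: ring_on_def)
 have sub: "J \<subseteq> R" if "s_ideal J" for J using that unfolding s_ideal_def by blast
 show ?thesis
  unfolding maximalideal_def maximalideal_axioms_def ideal_ring_on R using full sub by blast
qed

lemma maximal_exists:
 assumes "s_ideal J" "1 \<notin> J" shows "\<exists>I. maximalideal I (ring_on R) \<and> J \<subseteq> I"
proof -
 let ?A = "{I. s_ideal I \<and> J \<subseteq> I \<and> 1 \<notin> I}"
 have "\<exists>M\<in>?A. \<forall>T\<in>?A. M \<subseteq> T \<longrightarrow> T = M"
 proof (rule subset_Zorn_nonempty)
  fix C assume C: "C ~= {}" "subset.chain ?A C"
  hence CA: "\<And>I. I \<in> C ==> s_ideal I \<and> J \<subseteq> I \<and> 1 \<notin> I"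
   and lin: "\<And>I I'. I \<in> C ==> I' \<in> C ==> I \<subseteq> I' \<or> I' \<subseteq> I"
   unfolding subset_chain_def by auto
  have "s_ideal (\<Union>C)" unfolding s_ideal_def
  proof (intro conjI ballI)
   show "\<Union>C \<subseteq> R" "0 \<in> \<Union>C" using CA C(1) unfolding s_ideal_def by blast+
   fix a b assume "a \<in> \<Union>C" "b \<in> \<Union>C"
   then obtain I where "I \<in> C" "a \<in> I" "b \<in> I" using lin by blast
   thus "a + b \<in> \<Union>C" using CA unfolding s_ideal_def by blast
  next
   fix r a assume "r \<in> R" "a \<in> \<Union>C"
   thus "r * a \<in> \<Union>C" using CA unfolding s_ideal_def by blast
  qed
  thus "\<Union>C \<in> ?A" using CA C(1) by blast
 qed (use assms in blast)
 then obtain I where I: "I \<in> ?A" "\<forall>T\<in>?A. I \<subseteq> T \<longrightarrow> T = I" by (rule bexE)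
 have "\<forall>T. s_ideal T \<longrightarrow> I \<subseteq> T \<longrightarrow> 1 \<notin> T \<longrightarrow> T = I"
 proof (intro allI impI)
  fix T assume "s_ideal T" "I \<subseteq> T" "1 \<notin> T"
  hence "T \<in> ?A" using I(1) by blast
  thus "T = I" using I(2) \<open>I \<subseteq> T\<close> by blast
 qed
 thus ?thesis unfolding maximal_iff using I(1) by (intro exI[of _ I]) simp
qed

lemma maximal_chart_point:
 assumes I: "maximalideal I (ring_on R)" and smooth: "yc \<in> I ==> ev (pderiv f) xc \<notin> I"
 shows "chart_point em xc yc f I"
proof unfold_locales
 have s: "s_ideal I" "1 \<notin> I" "\<And>J. s_ideal J ==> I \<subseteq> J ==> 1 \<notin> J ==> J = I"
  using I unfolding maximal_iff by blast+
 show "I \<subseteq> R" "0 \<in> I" "\<And>a b. a \<in> I ==> b \<in> I ==> a + b \<in> I" "\<And>a r. a \<in> I ==> r \<in> R ==> r * a \<in> I" "1 \<notin> I"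
  using s unfolding s_ideal_def by blast+
 show "yc \<in> I ==> ev (pderiv f) xc \<notin> I" by (rule smooth)
 fix r assume r: "r \<in> R" "r \<notin> I"
 let ?J = "{i + c * r |i c. i \<in> I \<and> c \<in> R}"
 have sJ: "s_ideal ?J" unfolding s_ideal_def
 proof (intro conjI ballI)
  show "?J \<subseteq> R" using s(1) r unfolding s_ideal_def by (auto intro!: add_R mult_R)
  show "0 \<in> ?J" using s(1) zero_R unfolding s_ideal_def by (auto intro!: exI[of _ 0])
 next
  fix a b assume "a \<in> ?J" "b \<in> ?J"
  then obtain i c j d where "i \<in> I" "c \<in> R" "a = i + c * r" "j \<in> I" "d \<in> R" "b = j + d * r" by blast
  hence "a + b = (i + j) + (c + d) * r" "i + j \<in> I" "c + d \<in> R"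
   using s(1) add_R unfolding s_ideal_def by (auto simp: algebra_simps)
  thus "a + b \<in> ?J" by blast
 next
  fix b a assume "b \<in> R" "a \<in> ?J"
  then obtain i c where "i \<in> I" "c \<in> R" "a = i + c * r" by blast
  hence "b * a = b * i + (b * c) * r" "b * i \<in> I" "b * c \<in> R"
   using s(1) mult_R \<open>b \<in> R\<close> unfolding s_ideal_def by (auto simp: algebra_simps)
  thus "b * a \<in> ?J" by blast
 qed
 have IJ: "I \<subseteq> ?J"
 proof
  fix i assume "i \<in> I"
  hence "i = i + 0 * r \<and> i \<in> I \<and> 0 \<in> R" using zero_R by simp
  thus "i \<in> ?J" by blast
 qed
 have "r = 0 + 1 * r \<and> 0 \<in> I \<and> 1 \<in> R" using s(1) one_R unfolding s_ideal_def by simp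
 hence rJ: "r \<in> ?J" by blast
 have "1 \<in> ?J" using s(3)[OF sJ IJ] rJ r(2) by blast
 then obtain i c where ic: "1 = i + c * r" "i \<in> I" "c \<in> R" by blast
 hence "1 - c * r = i" by (simp add: diff_eq_eq)
 thus "\<exists>c\<in>R. 1 - c * r \<in> I" using ic by blast
qed

end

text \<open>The Bezout identity is the Jacobian criterion in a form valid over \<open>F\<close>
  itself: a maximal ideal containing \<open>y\<close> cannot contain \<open>f'(x)\<close>, whatever
  its residue field.\<close>

locale affine_curve = chart em xc yc f for em :: "'a::field => 'k::field" and xc yc f +
 assumes coprime_f: "\<exists>u w. u * f + w * pderiv f = 1"
begin

definition pts :: "'k set set" where "pts = {loc_at R I |I. maximalideal I (ring_on R)}"

text \<open>Recovers the maximal ideal from the local ring, as points are stored as local rings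
  only.\<close>

definition idl :: "'k set => 'k set" where "idl p = R \<inter> max_ideal p"

definition unif :: "'k set => 'k" where "unif p = chart_point.pu em xc yc (idl p)"

lemma max_chart_point: "maximalideal I (ring_on R) ==> chart_point em xc yc f I"
proof (rule maximal_chart_point)
 assume m: "maximalideal I (ring_on R)"
 hence s: "s_ideal I" "1 \<notin> I" unfolding maximal_iff by blast+
 obtain u w where uw: "u * f + w * pderiv f = 1" using coprime_f by blast
 assume y: "yc \<in> I"
 show "ev (pderiv f) xc \<notin> I"
 proof
  assume d: "ev (pderiv f) xc \<in> I"
  have "ev (u * f + w * pderiv f) xc = (ev u xc * yc) * yc + ev w xc * ev (pderiv f) xc"
   by (simp add: ev_add ev_mult flip: YY)
  hence e: "1 = (ev u xc * yc) * yc + ev w xc * ev (pderiv f) xc" unfolding uw by simp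
  have "(ev u xc * yc) * yc + ev w xc * ev (pderiv f) xc \<in> I"
   using s(1) y d ev_R mult_R[OF ev_R Y_R] unfolding s_ideal_def by simp
  thus False using s(2) e by simp
 qed
qed

lemma pts_E:
 assumes "p \<in> pts"
 shows "chart_point em xc yc f (idl p)" "chart_point.p em xc yc (idl p) = p" "maximalideal (idl p) (ring_on R)"
proof -
 from assms obtain I where I: "maximalideal I (ring_on R)" "p = loc_at R I" unfolding pts_def by blast
 interpret P: chart_point em xc yc f I by (rule max_chart_point[OF I(1)])
 have "idl p = I" unfolding idl_def I(2) P.p_def[symmetric] using P.R_max_ideal P.I_sub by blast
 thus "chart_point em xc yc f (idl p)" "chart_point.p em xc yc (idl p) = p" "maximalideal (idl p) (ring_on R)"
  using P.chart_point_axioms I P.p_def by simp_all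
qed

lemma pts_dvr: "p \<in> pts ==> dvr p (unif p)"
proof -
 assume p: "p \<in> pts"
 interpret P: chart_point em xc yc f "idl p" by (rule pts_E(1)[OF p])
 show ?thesis using P.dvr_axioms unfolding pts_E(2)[OF p] unif_def .
qed

lemma R_pts: "p \<in> pts ==> r \<in> R ==> r \<in> p"
 using chart_point.R_p[OF pts_E(1)] pts_E(2) by blast

lemma unit_pts: "p \<in> pts ==> r \<in> R ==> r \<notin> idl p ==> inverse r \<in> p"
 using chart_point.inverse_p[OF pts_E(1)] pts_E(2) by metis

lemma idl_inj: "p \<in> pts ==> p' \<in> pts ==> idl p \<subseteq> idl p' ==> p = p'"
proof -
 assume p: "p \<in> pts" "p' \<in> pts" "idl p \<subseteq> idl p'"
 have "idl p' = idl p" using pts_E(3)[OF p(1)] pts_E(3)[OF p(2)] p(3) unfolding maximal_iff by blast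
 thus ?thesis using pts_E(2) p by metis
qed

lemma finite_quot_R:
 assumes "s \<in> R" "s ~= 0"
 shows "\<exists>S. finite S \<and> R \<subseteq> vs.span (principal_ideal R s \<union> S)"
proof -
 obtain r' N where N: "r' \<in> R" "N ~= 0" "s * r' = ev N xc" using R_norm[OF assms] .
 obtain S where S: "finite S" "R \<subseteq> vs.span ((\<lambda>r. ev N xc * r) ` R \<union> S)"
  using R_span_mod[OF N(2)] by (metis (no_types, lifting) finite_UnI finite_imageI finite_lessThan)
 have "(\<lambda>r. ev N xc * r) ` R \<subseteq> principal_ideal R s"
  unfolding principal_ideal_def N(3)[symmetric] using mult_R N(1) by (auto simp: mult.assoc)
 hence "vs.span ((\<lambda>r. ev N xc * r) ` R \<union> S) \<subseteq> vs.span (principal_ideal R s \<union> S)"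
  by (intro vs.span_mono) blast
 thus ?thesis using S by blast
qed

lemma s_ideal_subspace: "s_ideal J ==> vs.subspace J"
 unfolding s_ideal_def vs.subspace_def using em_R by blast

lemma s_ideal_principal: "s \<in> R ==> s_ideal (principal_ideal R s)"
proof -
 assume s: "s \<in> R"
 show ?thesis unfolding s_ideal_def
 proof (intro conjI ballI)
  show "principal_ideal R s \<subseteq> R" unfolding principal_ideal_def using s mult_R by blast
  have "0 = s * 0 \<and> 0 \<in> R" using zero_R by simp
  thus "0 \<in> principal_ideal R s" unfolding principal_ideal_def by blast
 next
  fix a b assume "a \<in> principal_ideal R s" "b \<in> principal_ideal R s"
  then obtain c d where "c \<in> R" "d \<in> R" "a = s * c" "b = s * d" unfolding principal_ideal_def by blast
  hence "a + b = s * (c + d) \<and> c + d \<in> R" by (simp add: distrib_left add_R)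
  thus "a + b \<in> principal_ideal R s" unfolding principal_ideal_def by blast
 next
  fix r a assume "r \<in> R" "a \<in> principal_ideal R s"
  then obtain c where "c \<in> R" "a = s * c" unfolding principal_ideal_def by blast
  hence "r * a = s * (r * c) \<and> r * c \<in> R" using \<open>r \<in> R\<close> by (simp add: mult_R mult.left_commute)
  thus "r * a \<in> principal_ideal R s" unfolding principal_ideal_def by blast
 qed
qed

lemma R_quot:
 assumes "s \<in> R" "s ~= 0" "vs.subspace U" "vs.subspace V" "V \<subseteq> R" "U \<subseteq> V" "principal_ideal R s \<subseteq> U"
 shows "\<exists>bs. quot_basis sc V U bs"
proof -
 obtain S where S: "finite S" "R \<subseteq> vs.span (principal_ideal R s \<union> S)" using finite_quot_R[OF assms(1,2)] by blast
 have "vs.span (principal_ideal R s \<union> S) \<subseteq> vs.span (U \<union> S)" using assms(7) by (intro vs.span_mono) blast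
 hence "V \<subseteq> vs.span (U \<union> S)" using S(2) assms(5) by blast
 from vs.quot_basis_exists[OF S(1) assms(4,3,6) this] show ?thesis .
qed

lemma idl_props:
 assumes "p \<in> pts"
 shows "s_ideal (idl p)" "1 \<notin> idl p" "\<And>a b. a \<in> R ==> b \<in> R ==> a * b \<in> idl p ==> a \<in> idl p \<or> b \<in> idl p"
  "\<And>r. r \<in> idl p ==> r \<in> R"
proof -
 interpret P: chart_point em xc yc f "idl p" by (rule pts_E(1)[OF assms])
 show "s_ideal (idl p)" "1 \<notin> idl p" using pts_E(3)[OF assms] unfolding maximal_iff by blast+
 show "\<And>a b. a \<in> R ==> b \<in> R ==> a * b \<in> idl p ==> a \<in> idl p \<or> b \<in> idl p" using P.I_prime by blast
 show "\<And>r. r \<in> idl p ==> r \<in> R" unfolding idl_def by blast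
qed

text \<open>An element of \<open>idl q\<close> outside \<open>idl p\<close>, raised to a high power,
  vanishes at \<open>q\<close> to the prescribed order and still not at \<open>p\<close>; such
  powers are multiplied over all \<open>q\<close>.\<close>

lemma separate:
 assumes "finite Z" "Z \<subseteq> pts" "p \<in> pts" "p \<notin> Z"
 shows "\<exists>r\<in>R. r \<notin> idl p \<and> (\<forall>q\<in>Z. r \<in> principal_ideal q (unif q ^ n q))"
 using assms(1,2,4)
proof (induction Z)
 case empty
 show ?case using one_R idl_props(2)[OF assms(3)] by auto
next
 case (insert q Z)
 then obtain r where r: "r \<in> R" "r \<notin> idl p" "\<forall>q\<in>Z. r \<in> principal_ideal q (unif q ^ n q)" by auto
 have q: "q \<in> pts" using insert by blast
 have "\<not> idl q \<subseteq> idl p" using idl_inj[OF q assms(3)] insert.prems by blast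
 then obtain a where a: "a \<in> idl q" "a \<notin> idl p" by blast
 have aR: "a \<in> R" using idl_props(4)[OF q a(1)] .
 interpret Q: chart_point em xc yc f "idl q" by (rule pts_E(1)[OF q])
 interpret P: chart_point em xc yc f "idl p" by (rule pts_E(1)[OF assms(3)])
 have "a ^ n q \<in> principal_ideal q (unif q ^ n q)"
  using Q.R_I_pow[OF a(1), of "n q"] unfolding pts_E(2)[OF q] unif_def .
 hence "r * a ^ n q \<in> principal_ideal q (unif q ^ n q)"
  using dvr.principal_submod[OF pts_dvr[OF q]] R_pts[OF q r(1)] unfolding submod_closed_def by blast
 moreover have "r * a ^ n q \<in> principal_ideal q' (unif q' ^ n q')" if "q' \<in> Z" for q'
 proof -
  have q': "q' \<in> pts" using that insert by blast
  have "a ^ n q * r \<in> principal_ideal q' (unif q' ^ n q')"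
   using dvr.principal_submod[OF pts_dvr[OF q']] R_pts[OF q' power_R[OF aR]] r(3) that
   unfolding submod_closed_def by blast
  thus ?thesis by (simp add: mult.commute)
 qed
 moreover have "r * a ^ n q \<notin> idl p"
  using idl_props(3)[OF assms(3) r(1) power_R[OF aR]] r(2) a(2) P.I_prime_power[OF aR] by blast
 ultimately show ?case using mult_R[OF r(1) power_R[OF aR]] by blast
qed

lemma principal_unit: "p \<in> pts ==> s \<in> R ==> s \<notin> idl p ==> principal_ideal p s = p"
proof -
 assume p: "p \<in> pts" and s: "s \<in> R" "s \<notin> idl p"
 interpret d: dvr p "unif p" by (rule pts_dvr[OF p])
 have s0: "s ~= 0" using s idl_props(1)[OF p] unfolding s_ideal_def by auto
 have "h \<in> p" if "h / s \<in> p" for h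
  using d.mult_mem[OF that R_pts[OF p s(1)]] s0 by simp
 moreover have "h / s \<in> p" if "h \<in> p" for h
  using d.mult_mem[OF that unit_pts[OF p s]] by (simp add: divide_inverse)
 ultimately have "h / s \<in> p \<longleftrightarrow> h \<in> p" for h by blast
 thus ?thesis using d.principal_ideal_iff[OF s0] by blast
qed

lemma principal_pi:
 assumes "p \<in> pts" "s \<in> R" "s ~= 0"
 shows "\<exists>n. principal_ideal p s = principal_ideal p (unif p ^ n)"
proof -
 interpret P: chart_point em xc yc f "idl p" by (rule pts_E(1)[OF assms(1)])
 show ?thesis using P.principal_eq_pi[OF assms(3) P.R_p[OF assms(2)]]
  unfolding pts_E(2)[OF assms(1)] unif_def by blast
qed

lemma subspace_pts: "p \<in> pts ==> vs.subspace (principal_ideal p s)"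
 using chart_point.subspace_principal[OF pts_E(1)] pts_E(2) by metis

lemma mult_pts: "p \<in> pts ==> c \<in> R ==> a \<in> principal_ideal p s ==> c * a \<in> principal_ideal p s"
 using dvr.principal_submod[OF pts_dvr] R_pts unfolding submod_closed_def by blast

text \<open>A separating \<open>r\<close> is a unit at \<open>p\<close>, so some multiple
  \<open>c' r\<close> is close to \<open>1\<close> there, without losing the vanishing of
  \<open>r\<close> at the other points.\<close>

lemma idempotent:
 assumes s: "s \<in> R" "s ~= 0" and p: "p \<in> pts" and Z: "finite Z" "Z \<subseteq> pts" "p \<notin> Z"
 shows "\<exists>e\<in>R. 1 - e \<in> principal_ideal p s \<and> (\<forall>q\<in>Z. e \<in> principal_ideal q s)"
proof -
 have "\<forall>q\<in>pts. \<exists>n. principal_ideal q s = principal_ideal q (unif q ^ n)" using principal_pi s by blast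
 then obtain n where n: "\<And>q. q \<in> pts ==> principal_ideal q s = principal_ideal q (unif q ^ n q)" by metis
 obtain r where r: "r \<in> R" "r \<notin> idl p" "\<forall>q\<in>Z. r \<in> principal_ideal q (unif q ^ n q)"
  using separate[OF Z(1,2) p Z(3)] by blast
 interpret P: chart_point em xc yc f "idl p" by (rule pts_E(1)[OF p])
 obtain c where c: "c \<in> R" "1 - c * r \<in> idl p" using P.I_comax[OF r(1,2)] by blast
 obtain c' where c': "c' \<in> R" "1 - c' * r = (1 - c * r) ^ n p" using P.comax_power[OF c(1) r(1)] by blast
 have "1 - c' * r \<in> principal_ideal p s"
  using P.R_I_pow[OF c(2), of "n p"] unfolding c' n[OF p] pts_E(2)[OF p] unif_def .
 moreover have "c' * r \<in> principal_ideal q s" if "q \<in> Z" for q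
  using mult_pts[OF _ c'(1), of q r s] r(3) n Z(2) that by auto
 ultimately show ?thesis using mult_R[OF c'(1) r(1)] by blast
qed

text \<open>Corrections are made one point at a time, each multiplied by an \<open>e\<close> from
  \<open>idempotent\<close> that protects the points already treated. The approximant has no affine
  poles at all, only one at infinity.\<close>

lemma strong_approx:
 assumes s: "s \<in> R" "s ~= 0" and "finite Z" "Z \<subseteq> pts" "\<And>p. p \<in> Z ==> a p \<in> p"
 shows "\<exists>r\<in>R. \<forall>p\<in>Z. r - a p \<in> principal_ideal p s"
 using assms(3-5)
proof (induction Z)
 case empty
 show ?case using zero_R by blast
next
 case (insert p Z)
 then obtain r where r: "r \<in> R" "\<forall>q\<in>Z. r - a q \<in> principal_ideal q s" by auto
 have p: "p \<in> pts" and Z: "Z \<subseteq> pts" using insert.prems by auto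
 obtain e where e: "e \<in> R" "1 - e \<in> principal_ideal p s" "\<forall>q\<in>Z. e \<in> principal_ideal q s"
  using idempotent[OF s p insert.hyps(1) Z insert.hyps(2)] by blast
 interpret P: chart_point em xc yc f "idl p" by (rule pts_E(1)[OF p])
 obtain r' where r': "r' \<in> R" "a p - r' \<in> principal_ideal p s"
  using P.approx[of "a p" s] s(2) insert.prems(2) unfolding pts_E(2)[OF p] by blast
 have d: "r' - r \<in> R" by (rule diff_R[OF r'(1) r(1)])
 have "- ((r' - r) * (1 - e)) - (a p - r') \<in> principal_ideal p s"
  by (intro vs.subspace_diff vs.subspace_neg subspace_pts mult_pts p d e r')
 moreover have "(r - a q) + (r' - r) * e \<in> principal_ideal q s" if "q \<in> Z" for q
  using r(2) e(3) Z that by (intro vs.subspace_add subspace_pts mult_pts d) auto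
 ultimately show ?case
  using add_R[OF r(1) mult_R[OF d e(1)]] by (intro bexI[of _ "r + (r' - r) * e"]) (auto simp: algebra_simps)
qed

definition "locally_in s Z = {r \<in> R. \<forall>p\<in>Z. r \<in> principal_ideal p s}"

lemma subspace_locally_in: "Z \<subseteq> pts ==> vs.subspace (locally_in s Z)"
 using subspace_R subspace_pts unfolding vs.subspace_def locally_in_def by (auto simp: subset_iff)

lemma principal_locally_in: "s \<in> R ==> Z \<subseteq> pts ==> principal_ideal R s \<subseteq> locally_in s Z"
 using R_pts mult_R unfolding principal_ideal_def locally_in_def by auto

text \<open>By strong approximation each further point imposes as many new linear conditions as its
  local length, independently of the previous ones.\<close>

lemma quot_tower:
 assumes s: "s \<in> R" "s ~= 0" and b: "\<And>p. p \<in> pts ==> s \<in> idl p ==> quot_basis sc p (principal_ideal p s) (b p)"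
  and "finite Z" "Z \<subseteq> {p \<in> pts. s \<in> idl p}"
 shows "\<exists>as. quot_basis sc R (locally_in s Z) as \<and> length as = (\<Sum>p\<in>Z. length (b p))"
 using assms(4,5)
proof (induction Z)
 case empty
 show ?case using vs.quot_basis_Nil[OF subspace_R] unfolding locally_in_def by auto
next
 case (insert p Z)
 then obtain as where as: "quot_basis sc R (locally_in s Z) as" "length as = (\<Sum>p\<in>Z. length (b p))" by auto
 have Zp: "insert p Z \<subseteq> pts" "Z \<subseteq> pts" "p \<in> pts" "s \<in> idl p" using insert.prems by auto
 have UU: "locally_in s (insert p Z) \<subseteq> locally_in s Z" "locally_in s Z \<subseteq> R" unfolding locally_in_def by auto
 obtain cs where cs: "quot_basis sc (locally_in s Z) (locally_in s (insert p Z)) cs"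
  using R_quot[OF s subspace_locally_in[OF Zp(1)] subspace_locally_in[OF Zp(2)] UU(2,1) principal_locally_in[OF s(1) Zp(1)]] by blast
 have "quot_basis sc p (principal_ideal p s) (map id cs)"
 proof (rule quot_basis_map[OF _ _ _ _ subspace_locally_in[OF Zp(2)] subspace_pts[OF Zp(3)] cs])
  show "Vector_Spaces.linear sc sc id" by (rule vs.linear_id)
  fix y assume y: "y \<in> p"
  obtain r where r: "r \<in> R" "\<forall>q\<in>insert p Z. r - (if q = p then y else 0) \<in> principal_ideal q s"
   using strong_approx[OF s _ Zp(1), of "\<lambda>q. if q = p then y else 0"] insert.hyps Zp y
    dvr.zero_mem[OF pts_dvr] by (metis finite_insert subsetD)
  have "r \<in> principal_ideal q s" if "q \<in> Z" for q
   using bspec[OF r(2), of q] that insert.hyps(2) by (auto split: if_splits)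
  moreover have "- (r - y) \<in> principal_ideal p s"
   by (intro vs.subspace_neg subspace_pts Zp(3)) (use r(2) in simp)
  ultimately show "\<exists>x\<in>locally_in s Z. y - id x \<in> principal_ideal p s"
   using r(1) unfolding locally_in_def by (intro bexI[of _ r]) auto
 qed (use R_pts[OF Zp(3)] in "auto simp: locally_in_def")
 from vs.quot_basis_length[OF subspace_pts[OF Zp(3)] this b[OF Zp(3,4)]]
 have "length cs = length (b p)" by simp
 moreover have "quot_basis sc R (locally_in s (insert p Z)) (as @ cs)"
  by (rule vs.quot_basis_tower[OF subspace_locally_in[OF Zp(2)] as(1) cs UU subspace_locally_in[OF Zp(1)]])
 ultimately show ?case using as(2) insert.hyps by (intro exI[of _ "as @ cs"]) simp
qed

text \<open>The quotient of \<open>R\<close> by \<open>s\<close> has finite dimension, and each zero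
  of \<open>s\<close> accounts for at least one dimension of it.\<close>

lemma finite_pts_containing:
 assumes s: "s \<in> R" "s ~= 0" shows "finite {p \<in> pts. s \<in> idl p}"
proof (rule ccontr)
 note sR = s_ideal_subspace[OF s_ideal_principal[OF s(1)]]
 have "principal_ideal R s \<subseteq> R" using mult_R s unfolding principal_ideal_def by blast
 then obtain bs where bs: "quot_basis sc R (principal_ideal R s) bs" using R_quot[OF s sR subspace_R] by blast
 have "\<exists>b. quot_basis sc p (principal_ideal p s) b" if "p \<in> pts" for p
  using chart_point.finite_quotient[OF pts_E(1)[OF that] s(2)] R_pts[OF that s(1)] pts_E(2)[OF that] by simp
 then obtain b where b: "\<And>p. p \<in> pts ==> quot_basis sc p (principal_ideal p s) (b p)" by metis
 assume "infinite {p \<in> pts. s \<in> idl p}"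
 then obtain Z where Z: "Z \<subseteq> {p \<in> pts. s \<in> idl p}" "finite Z" "card Z = Suc (length bs)"
  using infinite_arbitrarily_large by blast
 have pts: "Z \<subseteq> pts" using Z(1) by blast
 note U = subspace_locally_in[OF pts] principal_locally_in[OF s(1) pts]
 obtain as where as: "quot_basis sc R (locally_in s Z) as" "length as = (\<Sum>p\<in>Z. length (b p))"
  using quot_tower[OF s b Z(2,1)] by blast
 have UR: "locally_in s Z \<subseteq> R" unfolding locally_in_def by blast
 obtain cs where "quot_basis sc (locally_in s Z) (principal_ideal R s) cs"
  using R_quot[OF s sR U(1) UR U(2)] by blast
 from vs.quot_basis_tower[OF U(1) as(1) this U(2) UR sR]
 have "length as \<le> length bs" using vs.quot_basis_length[OF sR bs] by fastforce
 moreover have "length (b p) \<ge> 1" if p: "p \<in> Z" for p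
 proof -
  have pp: "p \<in> pts" "s \<in> idl p" using p Z(1) by blast+
  interpret P: dvr p "unif p" by (rule pts_dvr[OF pp(1)])
  have "inverse s \<notin> p" using pp(2) P.max_ideal_iff s(2) unfolding idl_def by blast
  hence "1 \<notin> principal_ideal p s" using P.principal_ideal_iff[OF s(2)] by (simp add: inverse_eq_divide)
  moreover have "1 \<in> p" by (rule P.one_mem)
  ultimately show ?thesis using b[OF pp(1)] unfolding quot_basis_def by (cases "b p") auto
 qed
 hence "(\<Sum>p\<in>Z. 1) \<le> length as" unfolding as(2) by (rule sum_mono)
 ultimately show False using Z(3) by simp
qed

text \<open>The denominators of \<open>h\<close> form an ideal. If it is proper, it lies in a
  maximal ideal, and \<open>h\<close> is not regular at that point.\<close>

lemma R_eq: assumes "\<And>p. p \<in> pts ==> h \<in> p" shows "h \<in> R"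
proof (rule ccontr)
 assume h: "h \<notin> R"
 let ?J = "{r \<in> R. r * h \<in> R}"
 have "s_ideal ?J" unfolding s_ideal_def
  by (auto simp: distrib_right mult.assoc intro: add_R mult_R zero_R)
 moreover have "1 \<notin> ?J" using h by simp
 ultimately obtain I where I: "maximalideal I (ring_on R)" "?J \<subseteq> I" using maximal_exists by blast
 interpret P: chart_point em xc yc f I by (rule max_chart_point[OF I(1)])
 have "loc_at R I \<in> pts" unfolding pts_def using I(1) by blast
 from assms[OF this] have "h \<in> P.p" unfolding P.p_def .
 then obtain a s where "a \<in> R" "s \<in> R" "s \<notin> I" "s ~= 0" "h = a / s" by (rule P.p_E)
 hence "s \<in> ?J" by simp
 thus False using I(2) \<open>s \<notin> I\<close> by blast
qed

lemma frac_R: obtains r s where "r \<in> R" "s \<in> R" "s ~= 0" "h = r / s"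
 using frac[of h] ev_R transc by metis

text \<open>\<open>e * b\<close> has the principal part of \<open>b\<close> at \<open>p\<close>
  alone if \<open>e\<close> is close to \<open>1\<close> at \<open>p\<close> and close to
  \<open>0\<close> at the other zeros of the denominator.\<close>

lemma partial_fraction:
 assumes p: "p \<in> pts" shows "\<exists>b2. b - b2 \<in> p \<and> (\<forall>q\<in>pts. q ~= p \<longrightarrow> b2 \<in> q)"
proof -
 obtain r s where rs: "r \<in> R" "s \<in> R" "s ~= 0" "b = r / s" by (rule frac_R)
 have "finite ({q \<in> pts. s \<in> idl q} - {p})" using finite_pts_containing[OF rs(2,3)] by simp
 from idempotent[OF rs(2,3) p this] obtain e where
  e: "e \<in> R" "1 - e \<in> principal_ideal p s" "\<forall>q\<in>{q \<in> pts. s \<in> idl q} - {p}. e \<in> principal_ideal q s" by blast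
 have e': "e \<in> principal_ideal q s" if "q \<in> pts" "q ~= p" for q
  using e(3) that principal_unit[OF that(1) rs(2)] R_pts[OF that(1) e(1)] by (cases "s \<in> idl q") auto
 have "e * b \<in> q" if "q \<in> pts" "e \<in> principal_ideal q s" for q e
  using dvr.mult_mem[OF pts_dvr[OF that(1)], of r "e / s"] R_pts[OF that(1) rs(1)] that(2)
   dvr.principal_ideal_iff[OF pts_dvr[OF that(1)] rs(3)] by (simp add: rs(4) mult.commute)
 from this[OF p e(2)] this[of _ e] e' show ?thesis
  by (intro exI[of _ "e * b"]) (auto simp: algebra_simps)
qed

lemma finite_not_unit:
 assumes "h ~= 0" shows "finite {p \<in> pts. \<not> (h \<in> p \<and> inverse h \<in> p)}"
proof -
 obtain r s where rs: "r \<in> R" "s \<in> R" "s ~= 0" "h = r / s" by (rule frac_R)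
 have r0: "r ~= 0" using rs assms by auto
 have "{p \<in> pts. \<not> (h \<in> p \<and> inverse h \<in> p)} \<subseteq> {p \<in> pts. r \<in> idl p} \<union> {p \<in> pts. s \<in> idl p}"
 proof (rule subsetI, rule UnCI)
  fix p assume "p \<in> {p \<in> pts. \<not> (h \<in> p \<and> inverse h \<in> p)}" and "p \<notin> {p \<in> pts. s \<in> idl p}"
  hence p: "p \<in> pts" and n: "\<not> (h \<in> p \<and> inverse h \<in> p)" and s: "s \<notin> idl p" by blast+
  interpret d: dvr p "unif p" by (rule pts_dvr[OF p])
  have "h \<in> p" unfolding rs(4) divide_inverse
   by (rule d.mult_mem[OF R_pts[OF p rs(1)] unit_pts[OF p rs(2) s]])
  moreover have "inverse h \<in> p" if "r \<notin> idl p"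
   unfolding rs(4) inverse_divide unfolding divide_inverse
   by (rule d.mult_mem[OF R_pts[OF p rs(2)] unit_pts[OF p rs(1) that]])
  ultimately show "p \<in> {p \<in> pts. r \<in> idl p}" using n p by blast
 qed
 thus ?thesis using finite_pts_containing[OF rs(1) r0] finite_pts_containing[OF rs(2,3)]
  by (meson finite_UnI finite_subset)
qed

text \<open>The tower over all zeros of \<open>s\<close> ends at the multiples of \<open>s\<close>:
  an element divisible by \<open>s\<close> at every zero of \<open>s\<close> is divisible by it at
  every point, hence in \<open>R\<close>.\<close>

lemma length_quot:
 assumes s: "s \<in> R" "s ~= 0" and bs: "quot_basis sc R (principal_ideal R s) bs"
  and b: "\<And>p. p \<in> pts ==> s \<in> idl p ==> quot_basis sc p (principal_ideal p s) (b p)"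
 shows "length bs = (\<Sum>p | p \<in> pts \<and> s \<in> idl p. length (b p))"
proof -
 let ?Z = "{p \<in> pts. s \<in> idl p}"
 note U = quot_tower[OF s b finite_pts_containing[OF s] order_refl]
 have "r / s \<in> p" if "p \<in> pts" "r \<in> R" "\<forall>p\<in>?Z. r \<in> principal_ideal p s" for p r
  using that R_pts[OF that(1,2)] principal_unit[OF that(1) s(1)] dvr.principal_ideal_iff[OF pts_dvr[OF that(1)] s(2)]
  by (cases "s \<in> idl p") auto
 hence "r / s \<in> R" if "r \<in> R" "\<forall>p\<in>?Z. r \<in> principal_ideal p s" for r using R_eq that by blast
 hence "locally_in s ?Z \<subseteq> principal_ideal R s"
  unfolding principal_ideal_def[of R] locally_in_def using s(2) by (force intro: exI[of _ "_ / s"])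
 hence "principal_ideal R s = locally_in s ?Z" using principal_locally_in[OF s(1), of ?Z] by blast
 thus ?thesis using U vs.quot_basis_length[OF s_ideal_subspace[OF s_ideal_principal[OF s(1)]] bs] by auto
qed

end

section \<open>Residues on a double cover of the line\<close>

context dvr
begin

lemma vord_add_less:
 assumes "a ~= 0" "b ~= 0" "vord a < vord b" shows "a + b ~= 0 \<and> vord (a + b) = vord a"
proof -
 have m: "b / a \<in> max_ideal p" using assms by (subst max_ideal_iff_vord) (auto simp: vord_divide)
 have "1 + b / a \<notin> max_ideal p"
 proof
  assume "1 + b / a \<in> max_ideal p"
  hence "1 + b / a - b / a \<in> max_ideal p"
   using m principal_submod[of pu] minus_mem[OF one_mem] unfolding max_ideal_eq submod_closed_def
   by (metis diff_conv_add_uminus mult_minus1)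
  thus False using max_ideal_iff[of 1] one_mem by simp
 qed
 moreover have "1 + b / a \<in> p" using m by (intro add_mem one_mem) (simp add: max_ideal_iff)
 moreover from calculation have "1 + b / a ~= 0" using max_ideal_iff zero_mem by metis
 ultimately have "vord (1 + b / a) = 0" using unit_iff_vord by blast
 moreover have "a + b = a * (1 + b / a)" using assms by (simp add: field_simps)
 ultimately show ?thesis using assms \<open>1 + b / a ~= 0\<close> by (simp add: vord_mult)
qed

lemma max_ideal_submod: "submod_closed p (max_ideal p)"
 unfolding max_ideal_eq by (rule principal_submod)

lemma max_ideal_sub: "a \<in> max_ideal p ==> a \<in> p"
 by (simp add: max_ideal_iff)

lemma max_ideal_add: "a \<in> max_ideal p ==> b \<in> max_ideal p ==> a + b \<in> max_ideal p"
 and max_ideal_mult: "c \<in> p ==> a \<in> max_ideal p ==> c * a \<in> max_ideal p"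
 and max_ideal_zero: "0 \<in> max_ideal p"
 using max_ideal_submod unfolding submod_closed_def by blast+

lemma max_ideal_minus: "a \<in> max_ideal p ==> - a \<in> max_ideal p"
 using max_ideal_mult[OF minus_mem[OF one_mem]] by fastforce

lemma max_ideal_diff: "a \<in> max_ideal p ==> b \<in> max_ideal p ==> a - b \<in> max_ideal p"
 using max_ideal_add[OF _ max_ideal_minus] by fastforce

lemma one_not_max: "1 \<notin> max_ideal p"
 using one_mem by (simp add: max_ideal_iff)

lemma max_ideal_prime: "a \<in> p ==> b \<in> p ==> a * b \<in> max_ideal p ==> a \<in> max_ideal p \<or> b \<in> max_ideal p"
 using mult_mem[of "inverse a" "inverse b"] by (auto simp: max_ideal_iff)

end

section \<open>Coordinates over the field of rational functions of x\<close>

context chart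
begin

definition K0 :: "'k set" where "K0 = {ev a xc / ev c xc |a c. c ~= 0}"

lemma K0_I: "c ~= 0 ==> h = ev a xc / ev c xc ==> h \<in> K0"
 unfolding K0_def by blast

lemma K0_E: assumes "h \<in> K0" obtains a c where "c ~= 0" "ev c xc ~= 0" "h = ev a xc / ev c xc"
 using assms transc unfolding K0_def by blast

lemma K0_ev: "ev a xc \<in> K0"
 by (rule K0_I[of 1 _ a]) simp_all

lemma K0_em: "em c \<in> K0"
 using K0_ev[of "[:c:]"] by simp

lemma K0_x: "xc \<in> K0"
 using K0_ev[of "[:0, 1:]"] by simp

lemma K0_add: assumes "A \<in> K0" "B \<in> K0" shows "A + B \<in> K0"
proof -
 obtain a c where a: "c ~= 0" "ev c xc ~= 0" "A = ev a xc / ev c xc" using assms(1) by (rule K0_E)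
 obtain b d where b: "d ~= 0" "ev d xc ~= 0" "B = ev b xc / ev d xc" using assms(2) by (rule K0_E)
 show ?thesis using a b by (intro K0_I[of "c * d" _ "a * d + b * c"]) (auto simp: ev_add ev_mult add_frac_eq)
qed

lemma K0_mult: assumes "A \<in> K0" "B \<in> K0" shows "A * B \<in> K0"
proof -
 obtain a c where a: "c ~= 0" "ev c xc ~= 0" "A = ev a xc / ev c xc" using assms(1) by (rule K0_E)
 obtain b d where b: "d ~= 0" "ev d xc ~= 0" "B = ev b xc / ev d xc" using assms(2) by (rule K0_E)
 show ?thesis using a b by (intro K0_I[of "c * d" _ "a * b"]) (auto simp: ev_mult)
qed

lemma K0_minus: "A \<in> K0 ==> - A \<in> K0"
 using K0_mult[OF K0_em[of "-1"]] by (simp add: em_minus)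

lemma K0_diff: "A \<in> K0 ==> B \<in> K0 ==> A - B \<in> K0"
 using K0_add[OF _ K0_minus, of A B] by simp

lemma K0_power: "A \<in> K0 ==> A ^ n \<in> K0"
 using K0_em[of 1] by (induction n) (auto intro: K0_mult)

lemma K0_indep: assumes "A \<in> K0" "B \<in> K0" "A + B * yc = 0" shows "A = 0" "B = 0"
proof -
 obtain a c where a: "c ~= 0" "ev c xc ~= 0" "A = ev a xc / ev c xc" using assms(1) by (rule K0_E)
 obtain b d where b: "d ~= 0" "ev d xc ~= 0" "B = ev b xc / ev d xc" using assms(2) by (rule K0_E)
 have "ev (a * d) xc + ev (b * c) xc * yc = (A + B * yc) * (ev c xc * ev d xc)"
  unfolding a(3) b(3) using a(2) b(2) by (simp add: ev_mult field_simps)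
 hence "ev (a * d) xc + ev (b * c) xc * yc = 0" using assms(3) by simp
 hence "a * d = 0 \<and> b * c = 0" by (rule indep)
 thus "A = 0" "B = 0" using a b by auto
qed

definition al :: "'k => 'k" where "al h = (SOME A. A \<in> K0 \<and> (\<exists>B\<in>K0. h = A + B * yc))"
definition be :: "'k => 'k" where "be h = (h - al h) / yc"

lemma albe: "al h \<in> K0" "be h \<in> K0" "h = al h + be h * yc"
proof -
 obtain a b c where c: "c ~= 0" "h = (ev a xc + ev b xc * yc) / ev c xc" using gen by blast
 hence "h = ev a xc / ev c xc + ev b xc / ev c xc * yc" by (simp add: add_divide_distrib)
 hence "\<exists>A. A \<in> K0 \<and> (\<exists>B\<in>K0. h = A + B * yc)" using c(1) K0_I by blast
 hence "al h \<in> K0 \<and> (\<exists>B\<in>K0. h = al h + B * yc)" unfolding al_def by (rule someI_ex)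
 then obtain B where B: "al h \<in> K0" "B \<in> K0" "h = al h + B * yc" by blast
 have "h - al h = B * yc" by (rule diff_eq_eq[THEN iffD2]) (rule B(3)[unfolded add.commute[of "al h"]])
 hence "be h = B" unfolding be_def using Y_nonzero by simp
 thus "al h \<in> K0" "be h \<in> K0" "h = al h + be h * yc" using B by (simp_all only:)
qed

lemma albe_eqI:
 assumes "A \<in> K0" "B \<in> K0" "h = A + B * yc" shows "al h = A" "be h = B"
proof -
 have "(al h - A) + (be h - B) * yc = (al h + be h * yc) - (A + B * yc)" by (simp add: algebra_simps)
 also have "\<dots> = h - h" by (simp only: albe(3)[of h, symmetric] assms(3)[symmetric])
 also have "\<dots> = 0" by simp
 finally have 0: "al h - A + (be h - B) * yc = 0" .
 from K0_indep[OF K0_diff[OF albe(1) assms(1)] K0_diff[OF albe(2) assms(2)] 0]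
 show "al h = A" "be h = B" by simp_all
qed

lemma albe_add: "al (h + k) = al h + al k" "be (h + k) = be h + be k"
proof -
 have "h + k = (al h + al k) + (be h + be k) * yc"
  using arg_cong2[OF albe(3)[of h] albe(3)[of k], of "(+)"] by (simp only: distrib_left distrib_right ac_simps)
 from albe_eqI[OF K0_add[OF albe(1) albe(1)] K0_add[OF albe(2) albe(2)] this]
 show "al (h + k) = al h + al k" "be (h + k) = be h + be k" .
qed

lemma albe_mult: assumes "A \<in> K0" shows "al (A * h) = A * al h" "be (A * h) = A * be h"
proof -
 have "A * h = A * al h + A * be h * yc"
  using arg_cong[OF albe(3)[of h], of "\<lambda>h. A * h"] by (simp only: distrib_left mult.assoc)
 from albe_eqI[OF K0_mult[OF assms albe(1)] K0_mult[OF assms albe(2)] this]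
 show "al (A * h) = A * al h" "be (A * h) = A * be h" .
qed

lemma albe_y: "al (yc * h) = be h * ev f xc" "be (yc * h) = al h"
proof -
 have "yc * h = be h * (yc * yc) + al h * yc"
  using arg_cong[OF albe(3)[of h], of "\<lambda>h. yc * h"] by (simp only: distrib_left ac_simps)
 hence "yc * h = be h * ev f xc + al h * yc" unfolding YY .
 from albe_eqI[OF K0_mult[OF albe(2) K0_ev] albe(1) this]
 show "al (yc * h) = be h * ev f xc" "be (yc * h) = al h" .
qed

end

text \<open>An operator \<open>Q\<close> on the rational functions of \<open>x\<close> whose commutator with \<open>x\<close> is a
 functional, extended to the function field.  Its commutators with \<open>x\<close> and \<open>y\<close> have finite rank.\<close>

locale commutator_chart = chart em xc yc f for em :: "'a::field => 'k::field" and xc yc f +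
 fixes Q :: "'k => 'k" and ci :: "'k => 'a"
 assumes Q_add: "A \<in> K0 ==> B \<in> K0 ==> Q (A + B) = Q A + Q B"
  and Q_scale: "A \<in> K0 ==> Q (em c * A) = em c * Q A"
  and chi_add: "A \<in> K0 ==> B \<in> K0 ==> ci (A + B) = ci A + ci B"
  and chi_scale: "A \<in> K0 ==> ci (em c * A) = c * ci A"
  and Q_x: "A \<in> K0 ==> Q (xc * A) - xc * Q A = em (ci A)"
begin

definition PQ :: "'k => 'k" where "PQ h = Q (al h) + Q (be h) * yc"
text \<open>\<open>be h\<close> is the trace of \<open>h / (2y)\<close> to the rational functions of
  \<open>x\<close>. If \<open>ci\<close> is a residue of \<open>A dx\<close>, then
  \<open>rho\<close> is that of \<open>h dx / (2y)\<close>.\<close>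

definition rho :: "'k => 'a" where "rho h = ci (be h)"

lemma PQ_add: "PQ (h + k) = PQ h + PQ k"
 unfolding PQ_def albe_add by (simp add: Q_add albe algebra_simps)

lemma PQ_scale: "PQ (em c * h) = em c * PQ h"
 unfolding PQ_def albe_mult[OF K0_em] by (simp add: Q_scale albe algebra_simps)

lemma rho_add: "rho (h + k) = rho h + rho k"
 unfolding rho_def albe_add by (simp add: chi_add albe)

lemma rho_scale: "rho (em c * h) = c * rho h"
 unfolding rho_def albe_mult[OF K0_em] by (simp add: chi_scale albe)

text \<open>Since \<open>al h = be (yc * h)\<close>, both coordinates of the commutator are values
  of \<open>rho\<close>. The resulting pairs \<open>(1, y)\<close> and \<open>(y, 1)\<close> have
  diagonal sum \<open>2 y\<close>, the value prescribed for \<open>D x\<close>.\<close>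

lemma comm_x: "PQ (xc * h) - xc * PQ h = em (rho (yc * h)) + yc * em (rho h)"
proof -
 have "PQ (xc * h) - xc * PQ h = (Q (xc * al h) - xc * Q (al h)) + (Q (xc * be h) - xc * Q (be h)) * yc"
  unfolding PQ_def albe_mult[OF K0_x] by (simp add: algebra_simps)
 thus ?thesis unfolding rho_def albe_y by (simp add: Q_x albe mult.commute)
qed

lemma Q_pow: "A \<in> K0 ==> Q (xc ^ k * A) - xc ^ k * Q A = (\<Sum>i<k. xc ^ (k - 1 - i) * em (ci (xc ^ i * A)))"
proof (induction k)
 case (Suc k)
 have m: "xc ^ k * A \<in> K0" using Suc.prems K0_mult K0_power K0_x by blast
 have "xc ^ (k - i) = xc * xc ^ (k - 1 - i)" if "i < k" for i
 proof -
  have "k - i = Suc (k - 1 - i)" using that by simp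
  thus ?thesis by (simp only: power_Suc)
 qed
 hence "(\<Sum>i<Suc k. xc ^ (Suc k - 1 - i) * em (ci (xc ^ i * A)))
  = xc * (\<Sum>i<k. xc ^ (k - 1 - i) * em (ci (xc ^ i * A))) + em (ci (xc ^ k * A))"
  by (simp add: sum_distrib_left mult.assoc)
 also have "\<dots> = xc * (Q (xc ^ k * A) - xc ^ k * Q A) + (Q (xc * (xc ^ k * A)) - xc * Q (xc ^ k * A))"
  using Suc Q_x[OF m] by simp
 finally show ?case by (simp add: algebra_simps)
qed simp

lemma K0_sum: "(\<And>i. i \<in> J ==> g i \<in> K0) ==> (\<Sum>i\<in>J. g i) \<in> K0"
 by (induction J rule: infinite_finite_induct) (use K0_em[of 0] in "auto intro: K0_add")

lemma Q_sum: "finite J ==> (\<And>i. i \<in> J ==> g i \<in> K0) ==> Q (\<Sum>i\<in>J. g i) = (\<Sum>i\<in>J. Q (g i))"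
proof (induction J rule: finite_induct)
 case empty
 show ?case using Q_scale[OF K0_em[of 0], of 0] by simp
qed (auto simp: Q_add K0_sum)

lemma comm_y: "PQ (yc * h) - yc * PQ h
 = (\<Sum>k\<le>degree f. em (coeff f k) * (\<Sum>i<k. xc ^ (k - 1 - i) * em (rho (xc ^ i * h))))"
proof -
 have "PQ (yc * h) - yc * PQ h = Q (be h * ev f xc) - Q (be h) * (yc * yc)"
  unfolding PQ_def albe_y by (simp add: algebra_simps)
 also have "\<dots> = Q (be h * ev f xc) - Q (be h) * ev f xc" unfolding YY ..
 also have "be h * ev f xc = (\<Sum>k\<le>degree f. em (coeff f k) * (xc ^ k * be h))"
  unfolding ev_eq sum_distrib_left by (simp add: algebra_simps)
 also have "Q \<dots> = (\<Sum>k\<le>degree f. em (coeff f k) * Q (xc ^ k * be h))"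
  by (subst Q_sum) (auto intro!: K0_mult K0_em K0_power K0_x albe sum.cong simp: Q_scale[OF K0_mult[OF K0_power[OF K0_x] albe(2)]])
 also have "\<dots> - Q (be h) * ev f xc = (\<Sum>k\<le>degree f. em (coeff f k) * (Q (xc ^ k * be h) - xc ^ k * Q (be h)))"
  unfolding ev_eq sum_distrib_left sum_subtractf[symmetric] by (simp add: algebra_simps)
 also have "\<dots> = (\<Sum>k\<le>degree f. em (coeff f k) * (\<Sum>i<k. xc ^ (k - 1 - i) * em (rho (xc ^ i * h))))"
  unfolding Q_pow[OF albe(2)] rho_def albe_mult[OF K0_power[OF K0_x]] ..
 finally show ?thesis .
qed

lemma comm_x_list: "PQ (xc * h) - xc * PQ h = (\<Sum>(r, s)\<leftarrow>[(1, yc), (yc, 1)]. r * em (rho (s * h)))"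
 unfolding comm_x by simp

text \<open>The pairs are the terms of \<open>(f(x1) - f(x2)) / (x1 - x2)\<close>. They arise by
  pulling the powers of \<open>x\<close> in \<open>y^2 = f(x)\<close> through \<open>Q\<close> one
  factor at a time, and on the diagonal they give \<open>f'(x)\<close>.\<close>

definition ylist :: "('k \<times> 'k) list" where
 "ylist = concat (map (\<lambda>k. map (\<lambda>i. (em (coeff f k) * xc ^ (k - 1 - i), xc ^ i)) [0..<k]) [0..<Suc (degree f)])"

lemma sum_ylist: "(\<Sum>(r, s)\<leftarrow>ylist. r * ze s) = (\<Sum>k\<le>degree f. em (coeff f k) * (\<Sum>i<k. xc ^ (k - 1 - i) * ze (xc ^ i)))"
proof -
 have "(\<Sum>(r, s)\<leftarrow>concat (map h ks). r * ze s) = (\<Sum>k\<leftarrow>ks. \<Sum>(r, s)\<leftarrow>h k. r * ze s)" for h and ks :: "nat list"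
  by (induction ks) auto
 hence "(\<Sum>(r, s)\<leftarrow>ylist. r * ze s)
  = (\<Sum>k\<leftarrow>[0..<Suc (degree f)]. \<Sum>i\<leftarrow>[0..<k]. em (coeff f k) * xc ^ (k - 1 - i) * ze (xc ^ i))"
  unfolding ylist_def by (simp add: comp_def)
 also have "\<dots> = (\<Sum>k<Suc (degree f). \<Sum>i<k. em (coeff f k) * xc ^ (k - 1 - i) * ze (xc ^ i))"
  unfolding interv_sum_list_conv_sum_set_nat set_upt atLeast0LessThan ..
 finally show ?thesis unfolding lessThan_Suc_atMost sum_distrib_left by (simp add: mult.assoc)
qed

lemma comm_y_list: "PQ (yc * h) - yc * PQ h = (\<Sum>(r, s)\<leftarrow>ylist. r * em (rho (s * h)))"
 unfolding comm_y sum_ylist[of "\<lambda>s. em (rho (s * h))"] ..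

lemma diag_y_list: "(\<Sum>(r, s)\<leftarrow>ylist. r * s) = ev (pderiv f) xc"
proof -
 have "(\<Sum>i<k. xc ^ (k - 1 - i) * xc ^ i) = of_nat k * xc ^ (k - 1)" for k
 proof -
  have "(\<Sum>i<k. xc ^ (k - 1 - i) * xc ^ i) = (\<Sum>i<k. xc ^ (k - 1))"
   by (intro sum.cong refl) (simp flip: power_add)
  thus ?thesis by simp
 qed
 hence 1: "(\<Sum>(r, s)\<leftarrow>ylist. r * s) = (\<Sum>k\<le>degree f. em (coeff f k) * (of_nat k * xc ^ (k - 1)))"
  unfolding sum_ylist[of "\<lambda>s. s"] by simp
 have "(\<Sum>k\<le>n. em (coeff f k) * (of_nat k * xc ^ (k - 1))) = (\<Sum>k<n. em (of_nat (Suc k) * coeff f (Suc k)) * xc ^ k)" for n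
 proof -
  have of: "em (of_nat k) = of_nat k" for k by (induction k) (simp_all add: em_add)
  show ?thesis
  proof (induction n)
   case (Suc n)
   thus ?case by (simp only: sum.atMost_Suc sum.lessThan_Suc em_mult of diff_Suc_1 mult_ac)
  qed simp
 qed
 also have "(\<Sum>k<degree f. em (of_nat (Suc k) * coeff f (Suc k)) * xc ^ k)
  = (\<Sum>k\<le>degree (pderiv f). em (coeff (pderiv f) k) * xc ^ k)"
 proof -
  have "degree (pderiv f) \<le> degree f - 1"
   by (rule degree_le) (auto simp: coeff_pderiv coeff_eq_0)
  hence "{..<degree f} \<subseteq> {..degree f}" "{..degree (pderiv f)} \<subseteq> {..degree f}" by auto
  have "(\<Sum>k<degree f. em (coeff (pderiv f) k) * xc ^ k) = (\<Sum>k\<le>degree f. em (coeff (pderiv f) k) * xc ^ k)"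
   by (rule sum.mono_neutral_left) (auto simp: coeff_pderiv coeff_eq_0)
  also have "\<dots> = (\<Sum>k\<le>degree (pderiv f). em (coeff (pderiv f) k) * xc ^ k)"
   using \<open>degree (pderiv f) \<le> degree f - 1\<close> by (intro sum.mono_neutral_right) (auto simp: coeff_eq_0)
  finally show ?thesis by (simp add: coeff_pderiv)
 qed
 finally show ?thesis using 1 unfolding ev_eq by simp
qed

lemma ylist_R: "set ylist \<subseteq> R \<times> R"
 unfolding ylist_def by (auto intro!: mult_R em_R power_R X_R)

end

section \<open>The point at infinity\<close>

context chart_point
begin

text \<open>The commutator condition is stable under the operations that build \<open>p\<close> from
  the constants and the two coordinates.\<close>

lemma comm_ok_all:
 assumes "residue_pre em p pu P lam D" "residue_pre.comm_ok em p P lam D xc" "residue_pre.comm_ok em p P lam D yc"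
 shows "residue_datum em p pu P lam D"
proof -
 interpret r: residue_pre em p pu P lam D by (rule assms)
 have ev: "r.comm_ok (ev a xc)" for a
  by (induction a) (auto intro!: r.comm_ok_add r.comm_ok_mult r.comm_ok_em assms R_p X_R ev_R
   r.comm_ok_em[of 0, simplified])
 have R: "r.comm_ok h" if h: "h \<in> R" for h
 proof -
  obtain a b where h: "h = ev a xc + ev b xc * yc" using h by (rule R_E)
  show ?thesis unfolding h by (intro r.comm_ok_add r.comm_ok_mult ev assms R_p ev_R Y_R)
 qed
 show ?thesis
 proof
  fix h assume "h \<in> p"
  then obtain a s where as: "a \<in> R" "s \<in> R" "s \<notin> I" "s ~= 0" "h = a / s" by (rule p_E)
  show "r.comm_ok h" unfolding as(5) divide_inverse
   by (intro r.comm_ok_mult r.comm_ok_inverse R as R_p inverse_p)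
 qed
qed

end

locale hyp = affine_curve em xc yc f for em :: "'a::field => 'k::field" and xc yc f +
 fixes g :: nat and D :: "'k => 'k"
 assumes deg_f: "degree f = 2 * g + 1" and g_pos: "1 \<le> g"
  and D: "derivation em D" and D_x: "D xc = 2 * yc"
begin

definition u :: 'k where "u = inverse xc"
definition v :: 'k where "v = yc / xc ^ (g + 1)"
text \<open>\<open>u^(2g+2) f(1/u)\<close>: as \<open>f\<close> has degree \<open>2g + 1\<close>,
  one factor \<open>u\<close> remains beside the reversed polynomial. It is responsible for the
  ramification at infinity.\<close>

definition Finf :: "'a poly" where "Finf = pCons 0 (reflect_poly f)"
definition Iinf :: "'k set" where "Iinf = {ev a u + ev b u * v |a b. poly a 0 = 0}"
text \<open>\<open>T^n a(1/T)\<close> for \<open>n\<close> at least the degree; it converts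
  polynomials in \<open>x\<close> into polynomials in \<open>u\<close> and back.\<close>

definition rev :: "nat => 'a poly => 'a poly" where "rev n a = monom 1 (n - degree a) * reflect_poly a"

lemma x_nonzero: "xc ~= 0"
 using transc[of "[:0, 1:]"] by simp

lemma u_nonzero: "u ~= 0"
 using x_nonzero u_def by simp

lemma ev_reflect: assumes "t ~= 0" shows "ev (reflect_poly a) t = t ^ degree a * ev a (inverse t)"
proof -
 have d: "degree (map_poly em a) = degree a" by (rule degree_map_poly) simp
 have "map_poly em (reflect_poly a) = reflect_poly (map_poly em a)"
  by (rule poly_eqI) (simp add: coeff_map_poly coeff_reflect_poly d)
 thus ?thesis unfolding ev_def using poly_reflect_poly_nz[OF assms, of "map_poly em a"] d by simp
qed

lemma ev_rev: assumes "degree a \<le> n" "t ~= 0" shows "ev (rev n a) t = t ^ n * ev a (inverse t)"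
proof -
 have "t ^ (n - degree a) * t ^ degree a = t ^ n" using assms(1) by (simp flip: power_add)
 thus ?thesis unfolding rev_def ev_mult ev_monom ev_reflect[OF assms(2)] by (simp flip: mult.assoc)
qed

lemma ev_rev_u: "degree a \<le> n ==> ev (rev n a) u = u ^ n * ev a xc"
 using ev_rev[of a n u] u_nonzero by (simp add: u_def)

lemma ev_rev_x: "degree a \<le> n ==> ev (rev n a) xc = xc ^ n * ev a u"
 using ev_rev[of a n xc] x_nonzero by (simp add: u_def)

lemma rev_nonzero: "a ~= 0 ==> rev n a ~= 0"
 unfolding rev_def by (simp add: monom_eq_0_iff)

lemma y_v: "yc = xc ^ (g + 1) * v" and v_y: "v = u ^ (g + 1) * yc"
 unfolding v_def u_def using x_nonzero by (simp_all add: field_simps)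

lemma xu: "xc * u = 1" "u * xc = 1"
 unfolding u_def using x_nonzero by simp_all

lemma xu_pow: "xc ^ n * u ^ n = 1" "u ^ n * xc ^ n = 1"
 by (simp_all flip: power_mult_distrib add: xu)

lemma coeff_Finf: "coeff (pderiv Finf) 0 = lead_coeff f" "poly Finf 0 = 0"
 unfolding Finf_def by (simp_all add: coeff_pderiv)

sublocale inf: chart em u v Finf
proof
 fix q :: "'a poly" assume q: "q ~= 0"
 have "xc ^ degree q * ev q u ~= 0"
  unfolding ev_rev_x[OF order_refl, symmetric] using transc[OF rev_nonzero[OF q]] .
 thus "ev q u ~= 0" by auto
next
 have "ev (reflect_poly f) u = u ^ (2 * g + 1) * ev f xc"
  using ev_reflect[OF u_nonzero, of f] deg_f by (simp add: u_def)
 moreover have "v ^ 2 = u * (u ^ (2 * g + 1) * ev f xc)"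
 proof -
  have e: "(g + 1) * 2 = Suc (2 * g + 1)" by simp
  show ?thesis unfolding v_y power_mult_distrib Y_sq power_mult[symmetric] e power_Suc by (simp only: mult.assoc)
 qed
 ultimately show "v ^ 2 = ev Finf u" by (simp add: Finf_def)
next
 fix h
 obtain a b c where c: "c ~= 0" "h = (ev a xc + ev b xc * yc) / ev c xc" using gen by blast
 define M where "M = degree a + degree b + degree c"
 have m: "degree a \<le> M + (g + 1)" "degree b \<le> M" "degree c \<le> M + (g + 1)" unfolding M_def by auto
 have "ev (rev M b) u * v = u ^ (M + (g + 1)) * (ev b xc * yc)"
  unfolding ev_rev_u[OF m(2)] v_y power_add by simp
 hence "(ev (rev (M + (g + 1)) a) u + ev (rev M b) u * v) / ev (rev (M + (g + 1)) c) u
  = (u ^ (M + (g + 1)) * (ev a xc + ev b xc * yc)) / (u ^ (M + (g + 1)) * ev c xc)"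
  unfolding ev_rev_u[OF m(1)] ev_rev_u[OF m(3)] by (simp only: distrib_left)
 also have "\<dots> = h" using c u_nonzero by simp
 finally show "\<exists>a b c. c ~= 0 \<and> h = (ev a u + ev b u * v) / ev c u" using rev_nonzero[OF c(1)] by metis
next
 show "(2::'a) ~= 0" by (rule two)
next
 fix a b assume 0: "ev a u + ev b u * v = 0"
 let ?M = "degree a + degree b"
 have "xc ^ (?M + (g + 1)) * (ev a u + ev b u * v) = ev (rev (?M + (g + 1)) a) xc + ev (rev ?M b) xc * yc"
 proof -
  have "ev (rev ?M b) xc = xc ^ ?M * ev b u" by (rule ev_rev_x) simp
  hence "ev (rev ?M b) xc * yc = xc ^ ?M * ev b u * (xc ^ (g + 1) * v)" by (rule arg_cong2[OF _ y_v])
  also have "\<dots> = xc ^ (?M + (g + 1)) * (ev b u * v)" unfolding power_add[of xc ?M "g + 1"] by (simp only: mult_ac)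
  finally have "ev (rev ?M b) xc * yc = xc ^ (?M + (g + 1)) * (ev b u * v)" .
  moreover have "ev (rev (?M + (g + 1)) a) xc = xc ^ (?M + (g + 1)) * ev a u" by (rule ev_rev_x) simp
  ultimately show ?thesis by (simp only: distrib_left)
 qed
 hence "rev (?M + (g + 1)) a = 0 \<and> rev ?M b = 0" using 0 indep by simp
 thus "a = 0 \<and> b = 0" using rev_nonzero by blast
qed

lemma Iinf_iff: "ev a u + ev b u * v \<in> Iinf \<longleftrightarrow> poly a 0 = 0"
proof
 assume "ev a u + ev b u * v \<in> Iinf"
 then obtain a' b' where *: "ev a u + ev b u * v = ev a' u + ev b' u * v" "poly a' 0 = 0" unfolding Iinf_def by blast
 hence "ev (a - a') u + ev (b - b') u * v = 0" by (simp add: ev_diff algebra_simps)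
 hence "a - a' = 0" using inf.indep by blast
 thus "poly a 0 = 0" using * by simp
next
 assume "poly a 0 = 0"
 thus "ev a u + ev b u * v \<in> Iinf" unfolding Iinf_def by blast
qed

lemma inf_mult: "(ev a u + ev b u * v) * (ev c u + ev d u * v) = ev (a * c + b * d * Finf) u + ev (a * d + b * c) u * v"
 by (simp add: ev_add ev_mult algebra_simps flip: inf.YY)

lemma inf_add: "(ev a u + ev b u * v) + (ev c u + ev d u * v) = ev (a + c) u + ev (b + d) u * v"
 by (simp add: ev_add algebra_simps)

sublocale inf: chart_point em u v Finf Iinf
proof unfold_locales
 show "Iinf \<subseteq> inf.R" unfolding Iinf_def inf.R_def by blast
 show "0 \<in> Iinf" using Iinf_iff[of 0 0] by simp
 show "1 \<notin> Iinf" using Iinf_iff[of 1 0] by simp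
 fix a b assume "a \<in> Iinf" "b \<in> Iinf"
 then obtain a1 a2 b1 b2 where "a = ev a1 u + ev a2 u * v" "poly a1 0 = 0" "b = ev b1 u + ev b2 u * v" "poly b1 0 = 0"
  unfolding Iinf_def by blast
 thus "a + b \<in> Iinf" by (simp add: inf_add Iinf_iff)
next
 fix a r assume "a \<in> Iinf" "r \<in> inf.R"
 then obtain a1 a2 b1 b2 where "a = ev a1 u + ev a2 u * v" "poly a1 0 = 0" "r = ev b1 u + ev b2 u * v"
  unfolding Iinf_def inf.R_def by blast
 thus "r * a \<in> Iinf" by (simp add: inf_mult Iinf_iff coeff_Finf)
next
 fix r assume r: "r \<in> inf.R" "r \<notin> Iinf"
 then obtain a b where ab: "r = ev a u + ev b u * v" unfolding inf.R_def by blast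
 hence a0: "poly a 0 ~= 0" using r Iinf_iff by blast
 let ?c = "em (1 / poly a 0)"
 have "1 - ?c * r = ev (1 - smult (1 / poly a 0) a) u + ev (- smult (1 / poly a 0) b) u * v"
  unfolding ab by (simp add: ev_diff ev_smult ev_minus algebra_simps)
 also have "\<dots> \<in> Iinf" using a0 by (subst Iinf_iff) simp
 finally show "\<exists>c\<in>inf.R. 1 - c * r \<in> Iinf" using inf.em_R by blast
next
 have "f ~= 0" using deg_f by auto
 hence "lead_coeff f ~= 0" by simp
 hence "poly (pderiv Finf) 0 ~= 0" unfolding poly_0_coeff_0 coeff_Finf .
 thus "ev (pderiv Finf) u \<notin> Iinf" using Iinf_iff[of "pderiv Finf" 0] by simp
qed

lemma v_I: "v \<in> Iinf"
 using Iinf_iff[of 0 1] by simp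

lemma pi_inf: "inf.pu = v"
 unfolding inf.pu_def using v_I by simp

lemma vord_v: "inf.vord v = 1"
 using inf.vord_pi pi_inf by simp

lemma unit_inf: "poly a 0 ~= 0 ==> inf.vord (ev a u) = 0 \<and> ev a u ~= 0"
proof -
 assume a: "poly a 0 ~= 0"
 hence n: "ev a u \<notin> Iinf" using Iinf_iff[of a 0] by simp
 moreover have "a ~= 0" using a by (metis poly_0)
 hence "ev a u ~= 0" by (rule inf.transc)
 ultimately show ?thesis
  using inf.unit_iff_vord[of "ev a u"] inf.R_p[OF inf.ev_R] inf.R_max_ideal[OF inf.ev_R] by blast
qed

lemma vord_u: "inf.vord u = 2"
proof -
 have "f ~= 0" using deg_f by auto
 hence r: "inf.vord (ev (reflect_poly f) u) = 0 \<and> ev (reflect_poly f) u ~= 0" by (intro unit_inf) simp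
 have "v * v = u * ev (reflect_poly f) u" using inf.YY by (simp add: Finf_def)
 moreover have "v ~= 0" by (rule inf.Y_nonzero)
 ultimately have "inf.vord v + inf.vord v = inf.vord u + inf.vord (ev (reflect_poly f) u)"
  using inf.vord_mult[of v v] inf.vord_mult[OF u_nonzero, of "ev (reflect_poly f) u"] r by simp
 thus ?thesis using r vord_v by simp
qed

lemma vord_x: "inf.vord xc = - 2"
 using inf.vord_inverse[OF u_nonzero] vord_u by (simp add: u_def)

lemma vord_ev: assumes "a ~= 0" shows "inf.vord (ev a xc) = - 2 * int (degree a)"
proof -
 have r: "inf.vord (ev (reflect_poly a) u) = 0 \<and> ev (reflect_poly a) u ~= 0" using assms by (intro unit_inf) simp
 have "ev a xc = xc ^ degree a * ev (reflect_poly a) u"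
  using ev_reflect[OF u_nonzero, of a] xu_pow[of "degree a"] by (simp add: u_def flip: mult.assoc)
 thus ?thesis using r x_nonzero by (simp add: inf.vord_mult inf.vord_power vord_x)
qed

lemma vord_y: "inf.vord yc = - (2 * int g + 1)"
proof -
 have "inf.vord (xc ^ (g + 1) * v) = - (2 * int g + 1)"
  unfolding inf.vord_mult[OF power_not_zero[OF x_nonzero] inf.Y_nonzero] inf.vord_power[OF x_nonzero] vord_x vord_v
  by simp
 thus ?thesis by (simp only: y_v[symmetric])
qed

lemma K0_inf: "inf.K0 = K0"
proof (intro subset_antisym subsetI)
 fix A assume "A \<in> inf.K0"
 then obtain a c where a: "c ~= 0" "ev c u ~= 0" "A = ev a u / ev c u" by (rule inf.K0_E)
 let ?n = "degree a + degree c"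
 have "A = (xc ^ ?n * ev a u) / (xc ^ ?n * ev c u)" using a x_nonzero by simp
 also have "\<dots> = ev (rev ?n a) xc / ev (rev ?n c) xc" by (simp add: ev_rev_x)
 finally show "A \<in> K0" using rev_nonzero[OF a(1)] K0_I by blast
next
 fix A assume "A \<in> K0"
 then obtain a c where a: "c ~= 0" "ev c xc ~= 0" "A = ev a xc / ev c xc" by (rule K0_E)
 let ?n = "degree a + degree c"
 have "A = (u ^ ?n * ev a xc) / (u ^ ?n * ev c xc)" using a u_nonzero by simp
 also have "\<dots> = ev (rev ?n a) u / ev (rev ?n c) u" by (simp add: ev_rev_u)
 finally show "A \<in> inf.K0" using rev_nonzero[OF a(1)] inf.K0_I by blast
qed

lemma K0_u: "u \<in> K0"
 using inf.K0_x K0_inf by simp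

lemma albe_inf: "inf.al h = al h" "inf.be h = xc ^ (g + 1) * be h"
proof -
 have "h = al h + be h * yc" by (rule albe)
 also have "be h * yc = xc ^ (g + 1) * be h * v"
  using arg_cong[OF y_v, of "\<lambda>t. be h * t"] by (simp only: ac_simps)
 finally have eq: "h = al h + xc ^ (g + 1) * be h * v" .
 from inf.albe_eqI[OF _ _ eq, unfolded K0_inf, OF albe(1) K0_mult[OF K0_power[OF K0_x] albe(2)]]
 show "inf.al h = al h" "inf.be h = xc ^ (g + 1) * be h" .
qed

lemma vord_K0_even: assumes "A \<in> K0" "A ~= 0" shows "even (inf.vord A)"
proof -
 obtain a c where a: "c ~= 0" "ev c xc ~= 0" "A = ev a xc / ev c xc" using assms(1) by (rule K0_E)
 hence a0: "a ~= 0" using assms(2) by auto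
 have "inf.vord A = - 2 * int (degree a) + 2 * int (degree c)"
  unfolding a(3) using transc a0 a(1) by (subst inf.vord_divide) (auto simp: vord_ev)
 thus ?thesis by simp
qed

text \<open>Rational functions of \<open>x\<close> have even order at infinity and \<open>v\<close>
  has order one, so the two summands cannot cancel.\<close>

lemma K0_v_mem:
 assumes "A \<in> K0" "B \<in> K0" "A + B * v \<in> inf.p" shows "A \<in> inf.p" "B \<in> inf.p"
proof -
 have "A \<in> inf.p \<and> B \<in> inf.p"
 proof (cases "A = 0 \<or> B = 0")
  case True
  moreover have "B \<in> inf.p" if "B * v \<in> inf.p" "B ~= 0"
  proof -
   have "inf.vord (B * v) \<ge> 0" using that inf.mem_iff_vord[of "B * v"] inf.Y_nonzero by simp
   hence "inf.vord B \<ge> - 1" using that inf.Y_nonzero by (simp add: inf.vord_mult vord_v)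
   moreover have "even (inf.vord B)" by (rule vord_K0_even[OF assms(2) that(2)])
   ultimately have "inf.vord B \<ge> 0" by presburger
   thus ?thesis using inf.mem_iff_vord that by blast
  qed
  ultimately show ?thesis using assms(3) inf.zero_mem by (cases "A = 0"; cases "B = 0") auto
 next
  case False
  hence nz: "A ~= 0" "B ~= 0" "B * v ~= 0" using inf.Y_nonzero by auto
  have vB: "inf.vord (B * v) = inf.vord B + 1" using nz inf.Y_nonzero by (simp add: inf.vord_mult vord_v)
  obtain i where i: "inf.vord A = 2 * i" using vord_K0_even[OF assms(1) nz(1)] by (rule evenE)
  obtain j where j: "inf.vord B = 2 * j" using vord_K0_even[OF assms(2) nz(2)] by (rule evenE)
  have "inf.vord A \<ge> 0 \<and> inf.vord B \<ge> 0"
  proof (cases "inf.vord A < inf.vord (B * v)")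
   case True
   from inf.vord_add_less[OF nz(1,3) True] assms(3) inf.mem_iff_vord[of "A + B * v"]
   have "inf.vord A \<ge> 0" by simp
   thus ?thesis using True vB by linarith
  next
   case False
   hence lt: "inf.vord (B * v) < inf.vord A" using i j vB by presburger
   from inf.vord_add_less[OF nz(3,1) lt] assms(3) inf.mem_iff_vord[of "A + B * v"]
   have "inf.vord (B * v) \<ge> 0" by (simp add: add.commute)
   thus ?thesis using lt vB i j by presburger
  qed
  thus ?thesis using inf.mem_iff_vord nz by blast
 qed
 thus "A \<in> inf.p" "B \<in> inf.p" by auto
qed

lemma albe_inf_mem: "h \<in> inf.p ==> inf.al h \<in> inf.p \<and> inf.be h \<in> inf.p"
 using K0_v_mem[of "inf.al h" "inf.be h"] inf.albe[of h] K0_inf by metis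

lemma inf_residue: assumes "h \<in> inf.p" shows "\<exists>c. h - em c \<in> max_ideal inf.p"
proof -
 obtain a s where as: "a \<in> inf.R" "s \<in> inf.R" "s \<notin> Iinf" "s ~= 0" "h = a / s" using assms by (rule inf.p_E)
 obtain a1 a2 where a: "a = ev a1 u + ev a2 u * v" using as(1) by (rule inf.R_E)
 obtain s1 s2 where s: "s = ev s1 u + ev s2 u * v" using as(2) by (rule inf.R_E)
 have s0: "poly s1 0 ~= 0" using as(3) s Iinf_iff by blast
 let ?c = "poly a1 0 / poly s1 0"
 have "a - em ?c * s = ev (a1 - smult ?c s1) u + ev (a2 - smult ?c s2) u * v"
  unfolding a s by (simp add: ev_diff ev_smult algebra_simps)
 also have "\<dots> \<in> Iinf" using s0 by (subst Iinf_iff) simp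
 finally have "a - em ?c * s \<in> max_ideal inf.p" using inf.R_max_ideal inf.I_sub by blast
 hence "inverse s * (a - em ?c * s) \<in> max_ideal inf.p" using inf.max_ideal_mult inf.inverse_p as by blast
 moreover have "inverse s * (a - em ?c * s) = h - em ?c" unfolding as(5) using as(4) by (simp add: field_simps)
 ultimately show ?thesis by metis
qed

section \<open>Polynomial parts and the residue at infinity\<close>

abbreviation minf :: "'k set" where "minf \<equiv> max_ideal inf.p"

lemma ev_minf: "ev d xc \<in> minf ==> d = 0"
 using inf.max_ideal_iff_vord[of "ev d xc"] vord_ev[of d] transc[of d] by fastforce

lemma ev_frac_minf: "c ~= 0 ==> a = 0 \<or> degree a < degree c ==> ev a xc / ev c xc \<in> minf"
proof (cases "a = 0")
 case False
 assume c: "c ~= 0" "a = 0 \<or> degree a < degree c"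
 thus ?thesis using False transc by (subst inf.max_ideal_iff_vord) (auto simp: inf.vord_divide vord_ev)
qed (auto simp: inf.max_ideal_zero)

text \<open>The projection of \<open>F(x)\<close> to \<open>F[x]\<close> along the rational
  functions that vanish at infinity.\<close>

definition pol :: "'k => 'k" where "pol A = ev (THE d. A - ev d xc \<in> minf) xc"

lemma pol_eqI: assumes "A - ev d xc \<in> minf" shows "pol A = ev d xc"
proof -
 have "(THE d. A - ev d xc \<in> minf) = d"
 proof (rule the_equality)
  show "A - ev d xc \<in> minf" by (rule assms)
  fix e assume "A - ev e xc \<in> minf"
  hence "(A - ev d xc) - (A - ev e xc) \<in> minf" using assms inf.max_ideal_diff by blast
  hence "ev (e - d) xc \<in> minf" by (simp add: ev_diff)
  thus "e = d" using ev_minf by fastforce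
 qed
 thus ?thesis unfolding pol_def by simp
qed

lemma pol_ex: assumes "A \<in> K0" obtains d where "A - ev d xc \<in> minf" "pol A = ev d xc"
proof -
 obtain a c where a: "c ~= 0" "ev c xc ~= 0" "A = ev a xc / ev c xc" using assms by (rule K0_E)
 have "ev a xc = ev (a div c) xc * ev c xc + ev (a mod c) xc"
  by (simp flip: ev_mult ev_add)
 hence "A - ev (a div c) xc = ev (a mod c) xc / ev c xc" using a by (simp add: field_simps)
 also have "\<dots> \<in> minf" using degree_mod_less[OF a(1), of a] by (intro ev_frac_minf a) auto
 finally show ?thesis using that pol_eqI by blast
qed

lemma pol_minf: "A \<in> minf ==> pol A = 0"
 using pol_eqI[of A 0] by simp

lemma pol_ev: "pol (ev d xc) = ev d xc"
 by (rule pol_eqI) (simp add: inf.max_ideal_zero)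

lemma pol_add: "A \<in> K0 ==> B \<in> K0 ==> pol (A + B) = pol A + pol B"
proof -
 assume "A \<in> K0" "B \<in> K0"
 then obtain d e where d: "A - ev d xc \<in> minf" "pol A = ev d xc" "B - ev e xc \<in> minf" "pol B = ev e xc"
  using pol_ex by metis
 have eq: "(A + B) - ev (d + e) xc = (A - ev d xc) + (B - ev e xc)" by (simp add: ev_add)
 have "pol (A + B) = ev (d + e) xc" by (rule pol_eqI) (unfold eq, rule inf.max_ideal_add[OF d(1,3)])
 thus ?thesis using d by (simp add: ev_add)
qed

lemma pol_scale: "A \<in> K0 ==> pol (em c * A) = em c * pol A"
proof -
 assume "A \<in> K0"
 then obtain d where d: "A - ev d xc \<in> minf" "pol A = ev d xc" by (rule pol_ex)
 have eq: "em c * A - ev (smult c d) xc = em c * (A - ev d xc)" by (simp add: ev_smult algebra_simps)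
 have "pol (em c * A) = ev (smult c d) xc"
  by (rule pol_eqI) (unfold eq, rule inf.max_ideal_mult[OF inf.em_p d(1)])
 thus ?thesis using d by (simp add: ev_smult)
qed

lemma x_minf: assumes "A \<in> K0" "A \<in> minf" shows "xc * A \<in> inf.p"
proof (cases "A = 0")
 case False
 have "inf.vord A > 0" using assms inf.max_ideal_iff_vord False by blast
 hence "inf.vord A \<ge> 2" using vord_K0_even[OF assms(1) False] by presburger
 thus ?thesis using False x_nonzero by (subst inf.mem_iff_vord) (auto simp: inf.vord_mult vord_x)
qed (auto simp: inf.zero_mem)

lemma pol_x: assumes "A \<in> K0" shows "\<exists>c. pol (xc * A) - xc * pol A = em c"
proof -
 obtain d where d: "A - ev d xc \<in> minf" "pol A = ev d xc" using assms by (rule pol_ex)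
 have "xc * (A - ev d xc) \<in> inf.p" using x_minf[OF K0_diff[OF assms K0_ev] d(1)] .
 then obtain c where "xc * (A - ev d xc) - em c \<in> minf" using inf_residue by blast
 moreover have "xc * (A - ev d xc) - em c = xc * A - ev (pCons c d) xc" by (simp add: algebra_simps)
 ultimately have "pol (xc * A) = ev (pCons c d) xc" using pol_eqI by metis
 thus ?thesis using d by (intro exI[of _ c]) simp
qed

text \<open>The commutator of \<open>pol\<close> with \<open>x\<close> reads off the coefficient of
  \<open>1/x\<close> in the expansion at infinity, the negative of the residue of
  \<open>A dx\<close> there.\<close>

definition chi :: "'k => 'a" where "chi A = (THE c. pol (xc * A) - xc * pol A = em c)"

lemma chi: "A \<in> K0 ==> pol (xc * A) - xc * pol A = em (chi A)"
proof -
 assume "A \<in> K0"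
 then obtain c where c: "pol (xc * A) - xc * pol A = em c" using pol_x by blast
 hence "chi A = c" unfolding chi_def by (intro the_equality) (auto simp: em_eq_iff)
 thus ?thesis using c by simp
qed

lemma chi_add: "A \<in> K0 ==> B \<in> K0 ==> chi (A + B) = chi A + chi B"
proof -
 assume a: "A \<in> K0" "B \<in> K0"
 have "em (chi (A + B)) = (pol (xc * A) - xc * pol A) + (pol (xc * B) - xc * pol B)"
  unfolding chi[OF K0_add[OF a], symmetric]
  by (simp add: distrib_left pol_add a K0_mult K0_x)
 also have "\<dots> = em (chi A + chi B)" unfolding chi[OF a(1)] chi[OF a(2)] em_add ..
 finally show ?thesis by (simp add: em_eq_iff)
qed

lemma chi_scale: "A \<in> K0 ==> chi (em c * A) = c * chi A"
proof -
 assume a: "A \<in> K0"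
 have "em (chi (em c * A)) = em c * (pol (xc * A) - xc * pol A)"
  unfolding chi[OF K0_mult[OF K0_em a], symmetric]
  by (simp add: pol_scale a K0_mult K0_x mult.left_commute[of xc] right_diff_distrib)
 also have "\<dots> = em (c * chi A)" unfolding chi[OF a] em_mult ..
 finally show ?thesis by (simp add: em_eq_iff)
qed

sublocale aff: commutator_chart em xc yc f pol chi
 by unfold_locales (fact pol_add pol_scale chi_add chi_scale chi)+

text \<open>\<open>x pol(u A)\<close> collects the terms of positive degree in \<open>x\<close>, so
  \<open>reg\<close> keeps the part regular at infinity. The detour through \<open>u A\<close> makes
  the commutator with \<open>u\<close> a value of \<open>chi\<close> again.\<close>

definition reg :: "'k => 'k" where "reg A = A - xc * pol (u * A)"
definition chi' :: "'k => 'a" where "chi' A = chi (u * (u * A))"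

sublocale inf: commutator_chart em u v Finf reg chi'
proof (unfold_locales, unfold K0_inf)
 fix A B c assume A: "A \<in> K0"
 have uA: "u * A \<in> K0" "u * (u * A) \<in> K0" using A K0_u K0_mult by blast+
 show "reg (em c * A) = em c * reg A"
  unfolding reg_def using pol_scale[OF uA(1), of c] by (simp add: algebra_simps)
 show "chi' (em c * A) = c * chi' A"
  unfolding chi'_def using chi_scale[OF uA(2), of c] by (simp add: mult.left_commute)
 have "reg (u * A) - u * reg A = pol (xc * (u * (u * A))) - xc * pol (u * (u * A))"
  unfolding reg_def by (simp add: right_diff_distrib mult.assoc[symmetric] xu)
 thus "reg (u * A) - u * reg A = em (chi' A)" unfolding chi'_def chi[OF uA(2)] .
 assume B: "B \<in> K0"
 have uB: "u * B \<in> K0" "u * (u * B) \<in> K0" using B K0_u K0_mult by blast+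
 show "reg (A + B) = reg A + reg B" "chi' (A + B) = chi' A + chi' B"
  unfolding reg_def chi'_def using pol_add[OF uA(1) uB(1)] chi_add[OF uA(2) uB(2)]
  by (simp_all add: distrib_left)
qed

text \<open>\<open>D u = - 2 u^2 y\<close> and \<open>v = u^(g+1) y\<close>, so this factor restores
  the normalisation \<open>Dinf u = 2 v\<close> that the chart theory expects.\<close>

definition Dinf :: "'k => 'k" where "Dinf h = - (u ^ (g - 1)) * D h"

lemma Dinf: "derivation em Dinf"
 unfolding Dinf_def by (rule derivation_scale[OF D])

lemma Dinf_u: "Dinf u = 2 * v"
proof -
 have "D u = - (u * u * (2 * yc))" unfolding u_def derivation_inverse[OF D x_nonzero] D_x by simp
 hence "Dinf u = u ^ (g - 1) * (u * u) * (2 * yc)" unfolding Dinf_def by simp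
 also have "u ^ (g - 1) * (u * u) = u ^ (g + 1)"
  using g_pos by (cases g) auto
 finally show ?thesis by (simp add: v_y)
qed

lemma derivation_y:
 assumes "chart em a b h" "derivation em E" "E a = 2 * b" shows "E b = ev (pderiv h) a"
proof -
 interpret c: chart em a b h by (rule assms)
 have "2 * b * E b = E (b * b)" using assms(2) unfolding derivation_def by simp
 also have "\<dots> = ev (pderiv h) a * (2 * b)" unfolding c.YY derivation_ev[OF assms(2)] assms(3) ..
 finally show ?thesis using c.two_k c.Y_nonzero by simp
qed

lemma D_y: "D yc = ev (pderiv f) xc"
 by (rule derivation_y[OF chart_axioms D D_x])

lemma Dinf_v: "Dinf v = ev (pderiv Finf) u"
 by (rule derivation_y[OF inf.chart_axioms Dinf Dinf_u])

lemma reg_mem: assumes "A \<in> K0" shows "reg A \<in> inf.p"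
proof -
 have uA: "u * A \<in> K0" using assms K0_u K0_mult by blast
 obtain d where d: "u * A - ev d xc \<in> minf" "pol (u * A) = ev d xc" using uA by (rule pol_ex)
 have "reg A = xc * (u * A - ev d xc)" unfolding reg_def d by (simp add: right_diff_distrib mult.assoc[symmetric] xu)
 thus ?thesis using x_minf[OF K0_diff[OF uA K0_ev] d(1)] by simp
qed

lemma u_minf: "u \<in> minf"
 using inf.max_ideal_iff_vord[OF u_nonzero] vord_u by simp

lemma pol_u: "A \<in> inf.p ==> pol (u * A) = 0"
 using inf.max_ideal_mult[OF _ u_minf] by (intro pol_minf) (simp add: mult.commute)

lemma inf_residue_pre: "residue_pre em inf.p inf.pu inf.PQ inf.rho Dinf"
proof unfold_locales
 fix a assume a: "a \<in> inf.p"
 have m: "inf.al a \<in> inf.p" "inf.be a \<in> inf.p" using albe_inf_mem[OF a] by auto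
 show "inf.PQ a = a" unfolding inf.PQ_def reg_def using pol_u m inf.albe(3)[of a] by simp
 have "chi (u * (u * inf.be a)) = 0"
 proof -
  have K: "inf.be a \<in> K0" using inf.albe K0_inf by blast
  have um: "u * inf.be a \<in> inf.p" using inf.mult_mem inf.max_ideal_sub[OF u_minf] m by blast
  have "em (chi (u * (u * inf.be a))) = pol (xc * (u * (u * inf.be a))) - xc * pol (u * (u * inf.be a))"
   using chi[OF K0_mult[OF K0_u K0_mult[OF K0_u K]]] by simp
  also have "xc * (u * (u * inf.be a)) = u * inf.be a" by (simp add: mult.assoc[symmetric] xu)
  finally show ?thesis using pol_u[OF m(2)] pol_u[OF um] by simp
 qed
 thus "inf.rho a = 0" unfolding inf.rho_def chi'_def .
next
 fix a
 have "inf.al a \<in> K0" "inf.be a \<in> K0" using inf.albe K0_inf by blast+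
 thus "inf.PQ a \<in> inf.p" unfolding inf.PQ_def
  using reg_mem inf.max_ideal_sub inf.R_p[OF inf.Y_R] by (intro inf.add_mem inf.mult_mem) auto
qed (fact inf.em_p inf.PQ_add inf.PQ_scale inf.rho_add inf.rho_scale Dinf)+

sublocale infr: residue_datum em inf.p inf.pu inf.PQ inf.rho Dinf
proof (rule inf.comm_ok_all[OF inf_residue_pre])
 interpret r: residue_pre em inf.p inf.pu inf.PQ inf.rho Dinf by (rule inf_residue_pre)
 have "1 \<in> inf.p" "v \<in> inf.p" using inf.one_mem inf.R_p[OF inf.Y_R] by blast+
 thus "r.comm_ok u" unfolding r.comm_ok_def
  by (intro exI[of _ "[(1, v), (v, 1)]"]) (auto simp: inf.comm_x_list Dinf_u)
 have "set inf.ylist \<subseteq> inf.p \<times> inf.p" using inf.ylist_R inf.R_p by blast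
 thus "r.comm_ok v" unfolding r.comm_ok_def
  by (intro exI[of _ "inf.ylist"]) (auto simp: inf.comm_y_list inf.diag_y_list Dinf_v)
qed

text \<open>\<open>u^2\<close> from \<open>chi'\<close> and \<open>x^(g+1)\<close> from the change
  of \<open>be\<close> leave \<open>x^(g-1)\<close>, which is inverse to the factor in
  \<open>Dinf\<close> up to sign. Normalised by the same \<open>D\<close>, the residue at infinity
  is therefore minus \<open>aff.rho\<close>.\<close>

lemma rho_inf: "inf.rho h = aff.rho (xc ^ (g - 1) * h)"
proof -
 have "u * (u * (xc ^ (g + 1) * be h)) = xc ^ (g - 1) * be h"
 proof -
  have "xc ^ (g + 1) = xc * (xc * xc ^ (g - 1))" using g_pos by (cases g) auto
  hence "u * (u * (xc ^ (g + 1) * be h)) = (u * xc) * (u * xc) * xc ^ (g - 1) * be h" by (simp only: ac_simps)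
  thus ?thesis by (simp add: xu)
 qed
 thus ?thesis unfolding inf.rho_def aff.rho_def chi'_def albe_inf albe_mult[OF K0_power[OF K0_x]] by (simp only:)
qed

section \<open>Residues at the affine points\<close>

lemma PQ_R: "aff.PQ h \<in> R"
proof -
 obtain d where d: "pol (al h) = ev d xc" using pol_ex[OF albe(1)] by metis
 obtain e where e: "pol (be h) = ev e xc" using pol_ex[OF albe(2)] by metis
 show ?thesis unfolding aff.PQ_def d e by (rule R_I) simp
qed

lemma R_coords: assumes "h \<in> R" shows "aff.PQ h = h" "aff.rho h = 0"
proof -
 obtain a b where h: "h = ev a xc + ev b xc * yc" using assms by (rule R_E)
 have ab: "al h = ev a xc" "be h = ev b xc" using albe_eqI[OF K0_ev K0_ev h] by auto
 show "aff.PQ h = h" by (simp only: aff.PQ_def ab pol_ev) (rule h[symmetric])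
 have "em (chi (ev b xc)) = pol (ev (pCons 0 b) xc) - xc * pol (ev b xc)" using chi[OF K0_ev] by simp
 also have "\<dots> = 0" unfolding pol_ev by simp
 finally show "aff.rho h = 0" unfolding aff.rho_def ab by simp
qed

text \<open>A function with the principal part of \<open>b\<close> at \<open>p\<close> and no other
  affine pole. Projection and residue at \<open>p\<close> are computed on it with the operators
  \<open>aff.PQ\<close> and \<open>aff.rho\<close>, so the residue at \<open>p\<close> is by
  definition minus that of \<open>part p b\<close> at infinity.\<close>

definition part :: "'k set => 'k => 'k" where
 "part p b = (SOME b2. b - b2 \<in> p \<and> (\<forall>q\<in>pts. q ~= p \<longrightarrow> b2 \<in> q))"
definition Pp :: "'k set => 'k => 'k" where "Pp p b = (b - part p b) + aff.PQ (part p b)"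
definition lamp :: "'k set => 'k => 'a" where "lamp p b = aff.rho (part p b)"

lemma part:
 assumes "p \<in> pts" shows "b - part p b \<in> p" "\<And>q. q \<in> pts ==> q ~= p ==> part p b \<in> q"
 using someI_ex[OF partial_fraction[OF assms, of b]] unfolding part_def[symmetric] by blast+

text \<open>Two choices of the principal part differ by an element of \<open>R\<close>, which
  \<open>aff.PQ\<close> fixes and \<open>aff.rho\<close> kills.\<close>

lemma part_eq:
 assumes p: "p \<in> pts" and b2: "b - b2 \<in> p" "\<And>q. q \<in> pts ==> q ~= p ==> b2 \<in> q"
 shows "Pp p b = (b - b2) + aff.PQ b2" "lamp p b = aff.rho b2"
proof -
 have "part p b - b2 \<in> R"
 proof (rule R_eq)
  fix q assume q: "q \<in> pts"
  interpret d: dvr q "unif q" by (rule pts_dvr[OF q])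
  show "part p b - b2 \<in> q"
  proof (cases "q = p")
   case True
   thus ?thesis using d.diff_mem[of "b - b2" "b - part p b"] part(1)[OF p, of b] b2(1) by simp
  qed (use part(2)[OF p q] b2(2)[OF q] d.diff_mem in blast)
 qed
 note r = R_coords[OF this]
 have eq: "part p b = b2 + (part p b - b2)" by simp
 have "aff.PQ (part p b) = aff.PQ b2 + (part p b - b2)"
  using aff.PQ_add[of b2 "part p b - b2"] r(1) by simp
 thus "Pp p b = (b - b2) + aff.PQ b2" unfolding Pp_def by simp
 show "lamp p b = aff.rho b2" unfolding lamp_def
  using aff.rho_add[of b2 "part p b - b2"] r(2) by simp
qed

lemma pts_residue_pre: assumes p: "p \<in> pts" shows "residue_pre em p (unif p) (Pp p) (lamp p) D"
proof -
 interpret P: chart_point em xc yc f "idl p" by (rule pts_E(1)[OF p])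
 interpret d: dvr p "unif p" by (rule pts_dvr[OF p])
 note others = dvr.add_mem[OF pts_dvr] dvr.mult_mem[OF pts_dvr]
 show ?thesis
 proof unfold_locales
  fix c show em: "em c \<in> p" using R_pts[OF p em_R] .
  fix a
  have "em c * a - em c * part p a \<in> p" using d.mult_mem[OF em part(1)[OF p]] by (simp add: right_diff_distrib)
  from part_eq[OF p this others(2)] part_eq[OF p part(1)[OF p, of a] part(2)[OF p]] part(2)[OF p] R_pts[OF _ em_R]
  have "Pp p (em c * a) = (em c * a - em c * part p a) + aff.PQ (em c * part p a)" "lamp p (em c * a) = aff.rho (em c * part p a)"
   by blast+
  thus "Pp p (em c * a) = em c * Pp p a" "lamp p (em c * a) = c * lamp p a"
   unfolding aff.PQ_scale aff.rho_scale by (simp_all add: Pp_def lamp_def algebra_simps)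
  fix b
  have "(a + b) - (part p a + part p b) \<in> p" using d.add_mem[OF part(1)[OF p, of a] part(1)[OF p, of b]] by (simp add: algebra_simps)
  from part_eq[OF p this others(1)] part(2)[OF p]
  have "Pp p (a + b) = (a + b - (part p a + part p b)) + aff.PQ (part p a + part p b)" "lamp p (a + b) = aff.rho (part p a + part p b)"
   by blast+
  thus "Pp p (a + b) = Pp p a + Pp p b" "lamp p (a + b) = lamp p a + lamp p b"
   unfolding aff.PQ_add aff.rho_add by (simp_all add: Pp_def lamp_def algebra_simps)
  show "Pp p a \<in> p" unfolding Pp_def by (intro d.add_mem part(1)[OF p] R_pts[OF p PQ_R])
 next
  fix a assume a: "a \<in> p"
  have z: "q \<in> pts ==> 0 \<in> q" for q using R_pts[OF _ zero_R] .
  from part_eq[of p a 0, OF p] a z R_coords[OF zero_R] show "Pp p a = a" "lamp p a = 0" by auto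
 qed (fact D)
qed

lemma pts_residue: assumes p: "p \<in> pts" shows "residue_datum em p (unif p) (Pp p) (lamp p) D"
proof -
 interpret P: chart_point em xc yc f "idl p" by (rule pts_E(1)[OF p])
 interpret d: dvr p "unif p" by (rule pts_dvr[OF p])
 interpret r: residue_pre em p "unif p" "Pp p" "lamp p" D by (rule pts_residue_pre[OF p])
 \<comment> \<open>\<open>s * part p b\<close> may serve as the principal part of
   \<open>s * b\<close>, because \<open>s\<close> has no affine poles. The commutators at
   \<open>p\<close> thereby become those of \<open>aff.PQ\<close>.\<close>
 have shift: "lamp p (s * b) = aff.rho (s * part p b) \<and> Pp p (s * b) = (s * b - s * part p b) + aff.PQ (s * part p b)" if s: "s \<in> R" for s b
 proof -
  have "s * b - s * part p b \<in> p" using d.mult_mem[OF R_pts[OF p s] part(1)[OF p]] by (simp add: right_diff_distrib)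
  moreover have "s * part p b \<in> q" if "q \<in> pts" "q ~= p" for q
   using dvr.mult_mem[OF pts_dvr[OF that(1)] R_pts[OF that(1) s] part(2)[OF p that]] .
  ultimately show ?thesis using part_eq[OF p] by blast
 qed
 have ok: "r.comm_ok ta" if t: "ta \<in> R" and rs: "set rs \<subseteq> R \<times> R" "(\<Sum>(r, s)\<leftarrow>rs. r * s) = D ta"
  "\<And>h. aff.PQ (ta * h) - ta * aff.PQ h = (\<Sum>(r, s)\<leftarrow>rs. r * em (aff.rho (s * h)))" for ta rs
 proof -
  have "Pp p (ta * b) - ta * Pp p b = (\<Sum>(r, s)\<leftarrow>rs. r * em (lamp p (s * b)))" for b
  proof -
   have "Pp p (ta * b) - ta * Pp p b = aff.PQ (ta * part p b) - ta * aff.PQ (part p b)"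
    using shift[OF t, of b] by (simp add: Pp_def algebra_simps)
   also have "\<dots> = (\<Sum>(r, s)\<leftarrow>rs. r * em (lamp p (s * b)))"
    unfolding rs(3) using rs(1) shift by (intro arg_cong[of _ _ sum_list] map_cong) auto
   finally show ?thesis .
  qed
  moreover have "set rs \<subseteq> p \<times> p" using rs(1) R_pts[OF p] by blast
  ultimately show ?thesis unfolding r.comm_ok_def using rs(2) by blast
 qed
 have pi: "P.pu = unif p" "P.p = p" by (simp_all add: unif_def pts_E(2)[OF p])
 have "residue_pre em P.p P.pu (Pp p) (lamp p) D" unfolding pi by (rule pts_residue_pre[OF p])
 from P.comm_ok_all[OF this, unfolded pi]
 show ?thesis
  using ok[OF X_R, of "[(1, yc), (yc, 1)]"] ok[OF Y_R, of aff.ylist]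
   aff.comm_x_list aff.comm_y_list aff.diag_y_list aff.ylist_R D_x D_y one_R Y_R by simp
qed

end

section \<open>Taylor expansions\<close>

lemma fps_mult_nth_split:
 assumes "n > 0"
 shows "fps_nth (a * b) n = fps_nth a 0 * fps_nth b n + fps_nth a n * fps_nth b 0 + (\<Sum>i\<in>{1..<n}. fps_nth a i * fps_nth b (n - i))"
proof -
 have "{0..n} = insert 0 (insert n {1..<n})" using assms by auto
 thus ?thesis unfolding fps_mult_nth using assms by (simp add: add.assoc)
qed

fun sqrt_coeff :: "'k::field => 'k fps => nat => 'k" where
 "sqrt_coeff b A n = (if n = 0 then b else
   (fps_nth A n - (\<Sum>i\<in>{1..<n}. sqrt_coeff b A i * sqrt_coeff b A (n - i))) / (2 * b))"

declare sqrt_coeff.simps [simp del]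

lemma fps_sqrt_exists:
 fixes A :: "'k::field fps"
 assumes "b ~= 0" "(2::'k) ~= 0" "b * b = fps_nth A 0"
 shows "\<exists>B. B * B = A \<and> fps_nth B 0 = b"
proof -
 define B where "B = Abs_fps (sqrt_coeff b A)"
 have B: "fps_nth B n = sqrt_coeff b A n" for n by (simp add: B_def)
 have B0: "fps_nth B 0 = b" unfolding B by (simp add: sqrt_coeff.simps)
 have "fps_nth (B * B) n = fps_nth A n" for n
 proof (cases "n = 0")
  case False
  have "fps_nth B n = (fps_nth A n - (\<Sum>i\<in>{1..<n}. fps_nth B i * fps_nth B (n - i))) / (2 * b)"
   unfolding B using False by (subst sqrt_coeff.simps) simp
  hence "2 * b * fps_nth B n = fps_nth A n - (\<Sum>i\<in>{1..<n}. fps_nth B i * fps_nth B (n - i))"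
   using assms by simp
  thus ?thesis using False by (subst fps_mult_nth_split) (simp_all add: B0 algebra_simps)
 qed (use B0 assms in simp)
 hence "B * B = A" by (intro fps_ext)
 thus ?thesis using B0 by blast
qed

section \<open>Taylor homomorphisms\<close>

context field_ext
begin

definition evF :: "'a poly => 'k fps => 'k fps" where "evF q s = poly (map_poly (\<lambda>c. fps_const (em c)) q) s"

lemma evF_pCons [simp]: "evF (pCons a q) s = fps_const (em a) + s * evF q s"
 unfolding evF_def by (simp add: map_poly_pCons)

lemma evF_0 [simp]: "evF 0 s = 0"
 by (simp add: evF_def)

lemma evF_1 [simp]: "evF 1 s = 1"
 by (simp add: one_pCons)

lemma evF_add: "evF (q + r) s = evF q s + evF r s"
proof -
 have "map_poly (\<lambda>c. fps_const (em c)) (q + r) = map_poly (\<lambda>c. fps_const (em c)) q + map_poly (\<lambda>c. fps_const (em c)) r"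
  by (rule poly_eqI) (simp add: coeff_map_poly em_add flip: fps_const_add)
 thus ?thesis unfolding evF_def by simp
qed

lemma evF_smult: "evF (smult c q) s = fps_const (em c) * evF q s"
 by (induction q) (simp_all add: em_mult algebra_simps flip: fps_const_mult)

lemma evF_mult: "evF (q * r) s = evF q s * evF r s"
 by (induction q) (simp_all add: evF_add evF_smult algebra_simps)

lemma evF_nth_0: "fps_nth (evF q s) 0 = ev q (fps_nth s 0)"
 by (induction q) simp_all

text \<open>Hasse families are the algebra homomorphisms from the function field to its power series
 ring that lift the identity; this one sends \<open>a\<close> to its Taylor expansion.\<close>

definition taylor_hom :: "('k => 'k fps) => bool" where
 "taylor_hom Ph \<longleftrightarrow> (\<forall>a b. Ph (a + b) = Ph a + Ph b) \<and> (\<forall>a b. Ph (a * b) = Ph a * Ph b) \<and>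
   (\<forall>c. Ph (em c) = fps_const (em c)) \<and> (\<forall>a. fps_nth (Ph a) 0 = a)"

lemma taylor_hom_ev: "taylor_hom Ph ==> Ph (ev q t) = evF q (Ph t)"
proof (induction q)
 case 0
 thus ?case unfolding taylor_hom_def by (metis em_zero ev_0 evF_0 fps_const_0_eq_0)
qed (simp add: taylor_hom_def)

lemma taylor_hom_power: "taylor_hom Ph ==> Ph (a ^ n) = Ph a ^ n"
proof (induction n)
 case 0
 thus ?case unfolding taylor_hom_def by (metis em_one fps_const_1_eq_1 power_0)
qed (simp add: taylor_hom_def)

lemma taylor_hom_derivation:
 assumes "taylor_hom Ph" shows "derivation em (\<lambda>a. fps_nth (Ph a) 1)"
 using assms unfolding derivation_def taylor_hom_def by (simp add: algebra_simps)

lemma taylor_hom_compose: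
 assumes "taylor_hom Ph" "fps_nth c 0 = 0" shows "taylor_hom (\<lambda>a. fps_compose (Ph a) c)"
 using assms unfolding taylor_hom_def
 by (auto simp: fps_compose_add_distrib fps_compose_mult_distrib)

text \<open>Composition with the compositional inverse of \<open>Ph z - z\<close> makes
  \<open>z\<close> the expansion variable; the inverse exists because the linear coefficient is
  nonzero.\<close>

lemma taylor_reparam:
 assumes Ph: "taylor_hom Ph" and z: "fps_nth (Ph z) 1 ~= 0"
 shows "\<exists>Ps. taylor_hom Ps \<and> Ps z = fps_const z + fps_X \<and> (\<forall>a. Ph a = fps_compose (Ps a) (Ph z - fps_const z))"
proof -
 define S where "S = Ph z - fps_const z"
 have S: "fps_nth S 0 = 0" "fps_nth S 1 ~= 0" using Ph z unfolding S_def taylor_hom_def by simp_all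
 define T where "T = fps_inv S"
 have TS: "fps_compose T S = fps_X" "fps_compose S T = fps_X"
  unfolding T_def using fps_inv[OF S] fps_inv_right[OF S] by simp_all
 have T0: "fps_nth T 0 = 0" unfolding T_def by (simp add: fps_inv_def)
 define Ps where "Ps a = fps_compose (Ph a) T" for a
 have "taylor_hom Ps" unfolding Ps_def by (rule taylor_hom_compose[OF Ph T0])
 moreover have "Ph z = fps_const z + S" unfolding S_def by simp
 hence "Ps z = fps_const z + fps_X" unfolding Ps_def by (simp add: fps_compose_add_distrib TS)
 moreover have "Ph a = fps_compose (Ps a) S" for a
  unfolding Ps_def fps_compose_assoc[OF S(1) T0, symmetric] TS by simp
 ultimately show ?thesis unfolding S_def by blast
qed

end

context chart
begin

text \<open>The image of \<open>y\<close> is one of two square roots, and its constant term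
  \<open>y\<close> selects one since \<open>2 y\<close> is nonzero.\<close>

lemma taylor_hom_eqI:
 assumes Ph: "taylor_hom Ph" and Ps: "taylor_hom Ps" and x: "Ph xc = Ps xc"
 shows "Ph = Ps"
proof
 have "Ph (yc * yc) = Ps (yc * yc)" unfolding YY taylor_hom_ev[OF Ph] taylor_hom_ev[OF Ps] x ..
 hence "(Ph yc - Ps yc) * (Ph yc + Ps yc) = 0"
  using Ph Ps unfolding taylor_hom_def by (simp add: algebra_simps)
 moreover have "fps_nth (Ph yc + Ps yc) 0 ~= 0"
  using Ph Ps Y_nonzero two_k unfolding taylor_hom_def by (simp flip: mult_2)
 hence "Ph yc + Ps yc ~= 0" by (metis fps_zero_nth)
 ultimately have y: "Ph yc = Ps yc" by simp
 fix h
 obtain a b c where c: "c ~= 0" "h = (ev a xc + ev b xc * yc) / ev c xc" using gen by blast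
 have hc: "h * ev c xc = ev a xc + ev b xc * yc" using c transc by simp
 have "X' h * evF c (X' xc) = evF a (X' xc) + evF b (X' xc) * X' yc" if "taylor_hom X'" for X'
  using arg_cong[OF hc, of X'] that taylor_hom_ev[OF that] unfolding taylor_hom_def by simp
 from this[OF Ph] this[OF Ps] have "Ph h * evF c (Ph xc) = Ps h * evF c (Ph xc)" using x y by simp
 moreover have "fps_nth (evF c (Ph xc)) 0 ~= 0"
  unfolding evF_nth_0 using Ph transc[OF c(1)] unfolding taylor_hom_def by simp
 hence "evF c (Ph xc) ~= 0" by auto
 ultimately show "Ph h = Ps h" by simp
qed

text \<open>\<open>y\<close> is sent to the square root of \<open>f(x + X)\<close> with constant
  term \<open>y\<close>. Each \<open>h\<close> is expanded through chosen polynomials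
  \<open>A\<close>, \<open>B\<close>, \<open>C\<close>, and \<open>Ph_eq\<close> shows that any
  other representation gives the same series.\<close>

lemma taylor_hom_exists: "\<exists>Ph. taylor_hom Ph \<and> Ph xc = fps_const xc + fps_X"
proof -
 define xT :: "'k fps" where "xT = fps_const xc + fps_X"
 have x0: "fps_nth xT 0 = xc" by (simp add: xT_def)
 have "yc * yc = fps_nth (evF f xT) 0" unfolding evF_nth_0 x0 YY ..
 from fps_sqrt_exists[OF Y_nonzero two_k this] obtain yT where yT: "yT * yT = evF f xT" "fps_nth yT 0 = yc" by blast
 have "\<exists>A B C. C ~= 0 \<and> h = (ev A xc + ev B xc * yc) / ev C xc" for h by (rule gen)
 then obtain A B C where ABC: "\<And>h. C h ~= 0" "\<And>h. h = (ev (A h) xc + ev (B h) xc * yc) / ev (C h) xc" by metis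
 define Ph where "Ph h = (evF (A h) xT + evF (B h) xT * yT) * inverse (evF (C h) xT)" for h
 have unit: "evF c xT * inverse (evF c xT) = 1" if "c ~= 0" for c
  using transc[OF that] by (intro inverse_mult_eq_1') (simp add: evF_nth_0 x0)
 have Ph_eq: "Ph h = s" if "c ~= 0" "h * ev c xc = ev a xc + ev b xc * yc" "s * evF c xT = evF a xT + evF b xT * yT" for h a b c s
 proof -
  have "h * ev (C h) xc = ev (A h) xc + ev (B h) xc * yc"
   using ABC(2)[of h] transc[OF ABC(1)[of h]] by (metis nonzero_eq_divide_eq)
  hence "(ev (A h) xc + ev (B h) xc * yc) * ev c xc = (ev a xc + ev b xc * yc) * ev (C h) xc"
   using that(2) by (metis mult.assoc mult.commute)
  hence "ev (A h * c - a * C h) xc + ev (B h * c - b * C h) xc * yc = 0"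
   by (simp add: ev_diff ev_mult algebra_simps)
  hence *: "A h * c = a * C h" "B h * c = b * C h" using indep by fastforce+
  have "(evF (A h) xT + evF (B h) xT * yT) * evF c xT = (evF a xT + evF b xT * yT) * evF (C h) xT"
   using arg_cong[OF *(1), of "\<lambda>q. evF q xT"] arg_cong[OF *(2), of "\<lambda>q. evF q xT"]
   by (simp add: evF_mult algebra_simps)
  also have "\<dots> = s * evF c xT * evF (C h) xT" using that(3) by simp
  finally have "(evF (A h) xT + evF (B h) xT * yT) * evF c xT * inverse (evF c xT)
   = s * evF c xT * evF (C h) xT * inverse (evF c xT)" by simp
  hence "(evF (A h) xT + evF (B h) xT * yT) * (evF c xT * inverse (evF c xT))
   = s * evF (C h) xT * (evF c xT * inverse (evF c xT))" by (simp only: mult_ac)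
  hence "evF (A h) xT + evF (B h) xT * yT = s * evF (C h) xT" unfolding unit[OF that(1)] by simp
  hence "Ph h = s * evF (C h) xT * inverse (evF (C h) xT)" unfolding Ph_def by simp
  thus ?thesis using unit[OF ABC(1)[of h]] by (simp add: mult.assoc)
 qed
 have hC: "h * ev (C h) xc = ev (A h) xc + ev (B h) xc * yc" for h
  using ABC(2)[of h] transc[OF ABC(1)[of h]] by (metis nonzero_eq_divide_eq)
 have PhC: "Ph h * evF (C h) xT = evF (A h) xT + evF (B h) xT * yT" for h
  unfolding Ph_def using unit[OF ABC(1)[of h]] by (simp add: mult.assoc mult.commute[of "inverse _"])
 have CC: "C h * C k ~= 0" for h k using ABC(1) by simp
 have "Ph (h + k) = Ph h + Ph k" for h k
 proof (rule Ph_eq[OF CC[of h k], of _ "A h * C k + A k * C h" "B h * C k + B k * C h"])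
  have "(h + k) * ev (C h * C k) xc = (h * ev (C h) xc) * ev (C k) xc + (k * ev (C k) xc) * ev (C h) xc"
   by (simp add: ev_mult algebra_simps)
  thus "(h + k) * ev (C h * C k) xc = ev (A h * C k + A k * C h) xc + ev (B h * C k + B k * C h) xc * yc"
   unfolding hC by (simp add: ev_mult ev_add algebra_simps)
  have "(Ph h + Ph k) * evF (C h * C k) xT = (Ph h * evF (C h) xT) * evF (C k) xT + (Ph k * evF (C k) xT) * evF (C h) xT"
   by (simp add: evF_mult algebra_simps)
  thus "(Ph h + Ph k) * evF (C h * C k) xT = evF (A h * C k + A k * C h) xT + evF (B h * C k + B k * C h) xT * yT"
   unfolding PhC by (simp add: evF_mult evF_add algebra_simps)
 qed
 moreover have "Ph (h * k) = Ph h * Ph k" for h k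
 proof (rule Ph_eq[OF CC[of h k], of _ "A h * A k + B h * B k * f" "A h * B k + B h * A k"])
  have "(h * k) * ev (C h * C k) xc = (h * ev (C h) xc) * (k * ev (C k) xc)"
   by (simp add: ev_mult algebra_simps)
  thus "(h * k) * ev (C h * C k) xc = ev (A h * A k + B h * B k * f) xc + ev (A h * B k + B h * A k) xc * yc"
   unfolding hC by (simp add: ev_mult ev_add algebra_simps flip: YY)
  have "(Ph h * Ph k) * evF (C h * C k) xT = (Ph h * evF (C h) xT) * (Ph k * evF (C k) xT)"
   by (simp add: evF_mult algebra_simps)
  thus "(Ph h * Ph k) * evF (C h * C k) xT = evF (A h * A k + B h * B k * f) xT + evF (A h * B k + B h * A k) xT * yT"
   unfolding PhC by (simp add: evF_mult evF_add algebra_simps flip: yT(1))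
 qed
 moreover have "Ph (em c) = fps_const (em c)" for c
  by (rule Ph_eq[of 1 _ "[:c:]" 0]) simp_all
 moreover have "fps_nth (Ph h) 0 = h" for h
 proof -
  have "fps_nth (Ph h * evF (C h) xT) 0 = ev (A h) xc + ev (B h) xc * yc"
   unfolding PhC by (simp add: evF_nth_0 x0 yT)
  hence "fps_nth (Ph h) 0 * ev (C h) xc = h * ev (C h) xc" unfolding hC by (simp add: evF_nth_0 x0)
  thus ?thesis using transc[OF ABC(1)[of h]] by simp
 qed
 moreover have "Ph xc = xT"
  by (rule Ph_eq[of 1 _ "[:0, 1:]" 0]) simp_all
 ultimately show ?thesis unfolding taylor_hom_def xT_def by blast
qed

end

lemma fps_binomial_nth: "fps_nth ((fps_const z + fps_X) ^ n) k = of_nat (n choose k) * (z::'k::field) ^ (n - k)"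
proof -
 have "(fps_X + fps_const z) ^ n = (\<Sum>j\<le>n. of_nat (n choose j) * fps_X ^ j * fps_const z ^ (n - j))"
  by (rule binomial_ring)
 also have "\<dots> = (\<Sum>j\<le>n. fps_const (of_nat (n choose j) * z ^ (n - j)) * fps_X ^ j)"
  by (intro sum.cong refl) (simp add: fps_of_nat[symmetric] fps_const_power mult_ac flip: fps_const_mult)
 finally have "fps_nth ((fps_const z + fps_X) ^ n) k = (\<Sum>j\<le>n. of_nat (n choose j) * z ^ (n - j) * (if k = j then 1 else 0))"
  by (simp add: fps_sum_nth add.commute fps_X_power_nth)
 also have "\<dots> = (\<Sum>j\<in>{..n}. if k = j then of_nat (n choose j) * z ^ (n - j) else 0)"
  by (intro sum.cong) auto
 also have "\<dots> = of_nat (n choose k) * z ^ (n - k)" by (auto simp: sum.delta binomial_eq_0)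
 finally show ?thesis .
qed

section \<open>Integrality of Taylor coefficients\<close>

context chart_point
begin

definition integral :: "'k fps => bool" where "integral s \<longleftrightarrow> (\<forall>n. fps_nth s n \<in> p)"

lemma integral_add: "integral s ==> integral t ==> integral (s + t)"
 unfolding integral_def by (simp add: add_p)

lemma integral_mult: "integral s ==> integral t ==> integral (s * t)"
 unfolding integral_def fps_mult_nth by (auto intro!: sum_mem mult_p)

lemma integral_const: "c \<in> p ==> integral (fps_const c)"
 unfolding integral_def by (simp add: zero_mem)

lemma integral_X: "integral fps_X"
 unfolding integral_def fps_X_nth using zero_mem one_mem by auto

lemma integral_evF: "integral s ==> integral (evF r s)"
 by (induction r) (auto intro!: integral_add integral_mult integral_const em_p intro: integral_const[OF zero_mem, simplified])

lemma integral_inverse: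
 assumes s: "integral s" "fps_nth s 0 ~= 0" "inverse (fps_nth s 0) \<in> p"
 shows "integral (inverse s)"
 unfolding integral_def
proof
 fix n show "fps_nth (inverse s) n \<in> p"
 proof (induction n rule: less_induct)
  case (less n)
  show ?case
  proof (cases "n = 0")
   case False
   have "0 = fps_nth (inverse s * s) n" using inverse_mult_eq_1[OF s(2)] False by simp
   also have "\<dots> = fps_nth (inverse s) 0 * fps_nth s n + fps_nth (inverse s) n * fps_nth s 0
    + (\<Sum>i\<in>{1..<n}. fps_nth (inverse s) i * fps_nth s (n - i))"
    using False by (intro fps_mult_nth_split) simp
   finally have "fps_nth (inverse s) n = - ((fps_nth (inverse s) 0 * fps_nth s n
    + (\<Sum>i\<in>{1..<n}. fps_nth (inverse s) i * fps_nth s (n - i))) * inverse (fps_nth s 0))"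
    using s(2) by (simp add: field_simps eq_neg_iff_add_eq_0)
   also have "\<dots> \<in> p"
    using less False s unfolding integral_def by (intro minus_mem mult_p add_p sum_mem) auto
   finally show ?thesis .
  qed (use s in simp)
 qed
qed

lemma taylor_integral:
 assumes Ph: "taylor_hom Ph" "integral (Ph xc)" "integral (Ph yc)" and h: "h \<in> p"
 shows "integral (Ph h)"
proof -
 have R: "integral (Ph r)" if r: "r \<in> R" for r
 proof -
  obtain a b where r: "r = ev a xc + ev b xc * yc" using r by (rule R_E)
  have "Ph r = evF a (Ph xc) + evF b (Ph xc) * Ph yc"
   using Ph(1) taylor_hom_ev[OF Ph(1)] unfolding r taylor_hom_def by simp
  thus ?thesis using Ph by (auto intro!: integral_add integral_mult integral_evF)
 qed
 obtain a s where as: "a \<in> R" "s \<in> R" "s \<notin> I" "s ~= 0" "h = a / s" using h by (rule p_E)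
 have s0: "fps_nth (Ph s) 0 = s" using Ph(1) unfolding taylor_hom_def by blast
 have "h * s = a" using as by simp
 hence "Ph h * Ph s = Ph a" using Ph(1) unfolding taylor_hom_def by metis
 hence "Ph h * (Ph s * inverse (Ph s)) = Ph a * inverse (Ph s)" by (simp add: mult.assoc)
 moreover have "Ph s * inverse (Ph s) = 1" using s0 as(4) by (intro inverse_mult_eq_1') simp
 ultimately have "Ph h = Ph a * inverse (Ph s)" by simp
 thus ?thesis using R[OF as(1)] R[OF as(2)] s0 as(4) inverse_p[OF as(2,3)]
  by (auto intro!: integral_mult integral_inverse)
qed

text \<open>The coefficients of \<open>y\<close> follow recursively from \<open>y^2 = f(x)\<close>,
  dividing by nothing but the unit \<open>2 y\<close>.\<close>

lemma taylor_integral_x: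
 assumes Ph: "taylor_hom Ph" "integral (Ph xc)" and y: "inverse yc \<in> p"
 shows "integral (Ph yc)"
 unfolding integral_def
proof
 have y0: "fps_nth (Ph yc) 0 = yc" using Ph(1) unfolding taylor_hom_def by blast
 have "Ph yc * Ph yc = Ph (yc * yc)" using Ph(1) unfolding taylor_hom_def by simp
 also have "\<dots> = evF f (Ph xc)" unfolding YY by (rule taylor_hom_ev[OF Ph(1)])
 finally have sq: "integral (Ph yc * Ph yc)" using integral_evF Ph(2) by simp
 fix n show "fps_nth (Ph yc) n \<in> p"
 proof (induction n rule: less_induct)
  case (less n)
  show ?case
  proof (cases "n = 0")
   case False
   let ?s = "\<Sum>i\<in>{1..<n}. fps_nth (Ph yc) i * fps_nth (Ph yc) (n - i)"
   have "fps_nth (Ph yc * Ph yc) n = yc * fps_nth (Ph yc) n + fps_nth (Ph yc) n * yc + ?s"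
    using False by (subst fps_mult_nth_split) (simp_all add: y0)
   hence e: "2 * yc * fps_nth (Ph yc) n = fps_nth (Ph yc * Ph yc) n - ?s" by (simp add: algebra_simps)
   have "em (1/2) * 2 = em (1/2 * 2)" using em_mult[of "1/2" 2] em_add[of 1 1] by simp
   hence "em (1/2) * 2 = 1" using two by simp
   hence "fps_nth (Ph yc) n = em (1/2) * inverse yc * (2 * yc * fps_nth (Ph yc) n)"
    using Y_nonzero by (simp add: field_simps)
   also have "\<dots> \<in> p" unfolding e using less sq False unfolding integral_def
    by (intro mult_p em_p y diff_mem sum_mem) auto
   finally show ?thesis .
  qed (use y0 R_p[OF Y_R] in simp)
 qed
qed

lemma evF_taylor: "\<exists>Z. evF r (a + h) = evF r a + h * evF (pderiv r) a + h * h * Z"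
proof (induction r)
 case 0
 show ?case by (intro exI[of _ 0]) simp
next
 case (pCons c r)
 then obtain Z where Z: "evF r (a + h) = evF r a + h * evF (pderiv r) a + h * h * Z" by blast
 show ?case unfolding evF_pCons pderiv_pCons evF_add Z
  by (intro exI[of _ "evF (pderiv r) a + a * Z + h * Z"]) (simp add: algebra_simps)
qed

text \<open>With \<open>y\<close> as parameter the coefficients of \<open>x\<close> are solved from
  \<open>f(x) = (y + X)^2\<close>; the new one at each order enters linearly, with the unit
  \<open>f'(x)\<close> as factor.\<close>

lemma taylor_integral_y:
 assumes Ph: "taylor_hom Ph" "Ph yc = fps_const yc + fps_X"
  and f': "ev (pderiv f) xc ~= 0" "inverse (ev (pderiv f) xc) \<in> p"
 shows "integral (Ph xc)"
 unfolding integral_def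
proof
 have x0: "fps_nth (Ph xc) 0 = xc" using Ph(1) unfolding taylor_hom_def by blast
 have "evF f (Ph xc) = Ph (yc * yc)" unfolding YY by (rule taylor_hom_ev[OF Ph(1), symmetric])
 also have "\<dots> = Ph yc * Ph yc" using Ph(1) unfolding taylor_hom_def by simp
 finally have sq: "integral (evF f (Ph xc))"
  unfolding Ph(2) by (auto intro!: integral_mult integral_add integral_const integral_X R_p Y_R)
 fix n show "fps_nth (Ph xc) n \<in> p"
 proof (induction n rule: less_induct)
  case (less n)
  show ?case
  proof (cases "n = 0")
   case False
   \<comment> \<open>The truncation is integral by induction; the remainder \<open>h\<close> starts
     at order \<open>n\<close>, so its square does not reach that order.\<close>
   define A where "A = Abs_fps (\<lambda>i. if i < n then fps_nth (Ph xc) i else 0)"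
   have A: "integral A" unfolding A_def integral_def using less zero_mem by simp
   define h where "h = Ph xc - A"
   have h: "fps_nth h i = 0" if "i < n" for i unfolding h_def A_def using that by simp
   have Ah: "A + h = Ph xc" unfolding h_def by simp
   have hn: "fps_nth h n = fps_nth (Ph xc) n" unfolding h_def A_def by simp
   have A0: "fps_nth A 0 = xc" unfolding A_def using False x0 by simp
   obtain Z where Z: "evF f (A + h) = evF f A + h * evF (pderiv f) A + h * h * Z" using evF_taylor by blast
   have low: "fps_nth (h * s) n = fps_nth h n * fps_nth s 0" for s
   proof -
    have "fps_nth (h * s) n = (\<Sum>i=0..n. fps_nth h i * fps_nth s (n - i))" by (rule fps_mult_nth)
    also have "\<dots> = (\<Sum>i\<in>{n}. fps_nth h i * fps_nth s (n - i))"
     by (rule sum.mono_neutral_right) (use h in auto)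
    finally show ?thesis by simp
   qed
   have "fps_nth (h * h * Z) n = 0" using low[of "h * Z"] h[of 0] False by (simp add: mult.assoc)
   hence "fps_nth (evF f (Ph xc)) n = fps_nth (evF f A) n + fps_nth (Ph xc) n * ev (pderiv f) xc"
    using arg_cong[OF Z[unfolded Ah], of "\<lambda>s. fps_nth s n"] low[of "evF (pderiv f) A"]
    by (simp add: hn evF_nth_0 A0)
   hence "fps_nth (Ph xc) n = (fps_nth (evF f (Ph xc)) n - fps_nth (evF f A) n) * inverse (ev (pderiv f) xc)"
    using f'(1) by (simp add: field_simps)
   also have "\<dots> \<in> p" using sq integral_evF[OF A] f'(2) unfolding integral_def by (intro mult_p diff_mem) auto
   finally show ?thesis .
  qed (use x0 R_p[OF X_R] in simp)
 qed
qed

end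

lemma det_mem:
 assumes "dvr p pu" "A \<in> carrier_mat n n" "\<And>i j. i < n ==> j < n ==> A $$ (i, j) \<in> p"
 shows "det A \<in> p"
proof -
 interpret dvr p pu by (rule assms)
 have prod: "(\<Prod>i\<in>J. h i) \<in> p" if "\<And>i. i \<in> J ==> h i \<in> p" for J and h :: "nat => 'a"
  using that by (induction J rule: infinite_finite_induct) (auto intro: one_mem mult_mem)
 have entry: "A $$ (i, q i) \<in> p" if "q permutes {0..<n}" "i \<in> {0..<n}" for q i
  using assms(3)[of i "q i"] permutes_in_image[OF that(1), of i] that(2) by simp
 have "(\<Prod>i = 0..<n. A $$ (i, q i)) \<in> p" if "q permutes {0..<n}" for q
  by (rule prod) (rule entry[OF that])
 moreover have "signof q \<in> p" for q :: "nat => nat"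
  unfolding sign_def using one_mem minus_mem[OF one_mem] by simp
 ultimately show ?thesis unfolding det_def'[OF assms(2)] by (intro sum_mem mult_mem) auto
qed

section \<open>Residue fields and etale coordinates\<close>

definition subfield_of :: "'k::field set => bool" where
 "subfield_of M \<longleftrightarrow> 1 \<in> M \<and> (\<forall>a\<in>M. \<forall>b\<in>M. a + b \<in> M \<and> a - b \<in> M \<and> a * b \<in> M) \<and> (\<forall>a\<in>M. inverse a \<in> M)"

definition coeffs_in :: "'k::field set => 'k poly => bool" where
 "coeffs_in M A \<longleftrightarrow> (\<forall>i. coeff A i \<in> M)"

lemma min_poly_dvd:
 assumes M: "subfield_of M" and h: "h ~= 0" "coeffs_in M h" "poly h aa = 0"
  and min: "\<And>A. A ~= 0 ==> coeffs_in M A ==> poly A aa = 0 ==> degree h \<le> degree A"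
  and A: "coeffs_in M A" "poly A aa = 0"
 shows "h dvd A"
 using A
proof (induction "degree A" arbitrary: A rule: less_induct)
 case less
 show ?case
 proof (cases "A = 0")
  case False
  hence le: "degree h \<le> degree A" using min less.prems by blast
  define c where "c = lead_coeff A / lead_coeff h"
  let ?B = "monom c (degree A - degree h) * h"
  have c: "c \<in> M" unfolding c_def using M h(2) less.prems(1) unfolding subfield_of_def coeffs_in_def divide_inverse by blast
  have c0: "c ~= 0" using False h by (simp add: c_def)
  have M0: "0 \<in> M" using M unfolding subfield_of_def by (metis diff_self)
  have "coeff ?B i \<in> M" for i
   using M c h(2) M0 unfolding subfield_of_def coeffs_in_def by (simp add: coeff_monom_mult)
  hence cA: "coeffs_in M (A - ?B)" using M less.prems(1) unfolding subfield_of_def coeffs_in_def by simp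
  have rA: "poly (A - ?B) aa = 0" using less.prems h(3) by simp
  have dB: "degree ?B = degree A"
   using c0 h(1) le by (subst degree_mult_eq) (auto simp: degree_monom_eq monom_eq_0_iff)
  have "lead_coeff (monom c (degree A - degree h)) = c" using c0 by (simp add: degree_monom_eq)
  hence lB: "lead_coeff ?B = lead_coeff A"
   unfolding lead_coeff_mult using h(1) by (simp add: c_def)
  have "h dvd A - ?B"
  proof (cases "A - ?B = 0")
   case True
   thus ?thesis by simp
  next
   case False
   have "degree (A - ?B) \<le> degree A" using dB by (intro degree_diff_le) auto
   moreover have "degree (A - ?B) ~= degree A"
    using False lB dB by (metis diff_self coeff_diff leading_coeff_0_iff)
   ultimately show ?thesis using less.hyps cA rA by simp
  qed
  moreover have "A = (A - ?B) + ?B" by simp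
  ultimately show ?thesis by (metis dvd_add dvd_triv_right)
 qed simp
qed

text \<open>The minimal polynomial over \<open>M\<close> divides \<open>P\<close> and
  \<open>H\<close>. Its only root is \<open>aa\<close>, and a simple one, so it is linear and its
  coefficients give \<open>aa\<close>.\<close>

lemma root_in_subfield:
 fixes aa :: "'k::alg_closed_field"
 assumes M: "subfield_of M" and P: "coeffs_in M P" "P ~= 0" "poly P aa = 0"
  and H: "coeffs_in M H" "poly H aa = 0" "poly (pderiv H) aa ~= 0"
  and common: "\<And>bb. poly P bb = 0 ==> poly H bb = 0 ==> bb = aa"
 shows "aa \<in> M"
proof -
 obtain h where h: "h ~= 0" "coeffs_in M h" "poly h aa = 0"
  and min: "\<And>A. A ~= 0 ==> coeffs_in M A ==> poly A aa = 0 ==> degree h \<le> degree A"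
  using ex_has_least_nat[of "\<lambda>A. A ~= 0 \<and> coeffs_in M A \<and> poly A aa = 0" P degree] P by blast
 have hP: "h dvd P" by (rule min_poly_dvd[OF M h min P(1,3)])
 have hH: "h dvd H" by (rule min_poly_dvd[OF M h min H(1,2)])
 from h(3) obtain k where k: "h = [:- aa, 1:] * k" unfolding poly_eq_0_iff_dvd by blast
 have "degree k = 0"
 proof (rule ccontr)
  assume "degree k ~= 0"
  then obtain bb where b: "poly k bb = 0" using alg_closed_imp_poly_has_root[of k] by auto
  hence "poly h bb = 0" unfolding k by simp
  hence "poly P bb = 0" "poly H bb = 0" using hP hH by (metis dvdE mult_eq_0_iff poly_mult)+
  hence "bb = aa" by (rule common)
  hence "poly k aa = 0" using b by simp
  then obtain k' where k': "k = [:- aa, 1:] * k'" unfolding poly_eq_0_iff_dvd by blast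
  obtain H' where H': "H = h * H'" using hH by blast
  have "H = [:- aa, 1:] * ([:- aa, 1:] * (k' * H'))" unfolding H' k k' by (simp only: mult.assoc)
  hence "pderiv H = [:- aa, 1:] * pderiv ([:- aa, 1:] * (k' * H')) + ([:- aa, 1:] * (k' * H')) * pderiv [:- aa, 1:]"
   by (simp only: pderiv_mult)
  hence "poly (pderiv H) aa = 0" by simp
  thus False using H(3) by simp
 qed
 then obtain c where c: "k = [:c:]" by (metis degree_eq_zeroE)
 have "c ~= 0" using h(1) k c by auto
 have "coeff h 0 = - aa * c" "coeff h 1 = c" unfolding k c by simp_all
 hence "aa = (0 - coeff h 0) * inverse (coeff h 1)" using \<open>c ~= 0\<close> by simp
 moreover have "0 \<in> M" using M unfolding subfield_of_def by (metis diff_self)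
 ultimately show ?thesis using M h(2) unfolding subfield_of_def coeffs_in_def by metis
qed

interpretation ac: field_ext to_ac
 by unfold_locales simp_all

text \<open>A relation of least degree for a nonzero \<open>m\<close> has nonzero constant term, and
  dividing by it exhibits the inverse of \<open>m\<close> as a polynomial in
  \<open>m\<close>.\<close>

lemma range_ev_subfield:
 fixes ta :: "'a::field alg_closure"
 shows "subfield_of (range (\<lambda>Q. ac.ev Q ta))"
proof -
 let ?M = "range (\<lambda>Q. ac.ev Q ta)"
 have "inverse m \<in> ?M" if "m \<in> ?M" for m
 proof (cases "m = 0")
  case True
  thus ?thesis using rangeI[of "\<lambda>Q. ac.ev Q ta" 0] by simp
 next
  case False
  obtain Q where Q: "m = ac.ev Q ta" using \<open>m \<in> ?M\<close> by blast
  obtain P0 :: "'a poly" where P0: "P0 ~= 0" "ac.ev P0 m = 0"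
   using alg_closure_algebraic[of m] unfolding ac.ev_def by blast
  obtain P :: "'a poly" where P: "P ~= 0" "ac.ev P m = 0" and min: "\<And>A :: 'a poly. A ~= 0 ==> ac.ev A m = 0 ==> degree P \<le> degree A"
   using ex_has_least_nat[of "\<lambda>A :: 'a poly. A ~= 0 \<and> ac.ev A m = 0" P0 degree] P0 by blast
  obtain c P' where P': "P = pCons c P'" by (rule pCons_cases)
  have e: "to_ac c + m * ac.ev P' m = 0" using P(2) unfolding P' by simp
  have "c ~= 0"
  proof
   assume c: "c = 0"
   hence "ac.ev P' m = 0" using e False by simp
   moreover have "P' ~= 0" using P(1) P' c by simp
   ultimately show False using min[of P'] P' c by simp
  qed
  have "to_ac c = - (m * ac.ev P' m)" using e by (simp add: eq_neg_iff_add_eq_0)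
  hence "m * (- (to_ac (1 / c) * ac.ev P' m)) = to_ac (1 / c) * to_ac c" by (simp add: algebra_simps)
  also have "\<dots> = 1" using \<open>c ~= 0\<close> by (simp flip: to_ac_mult)
  finally have "m * (- (to_ac (1 / c) * ac.ev P' m)) = 1" .
  hence "inverse m = - (to_ac (1 / c) * ac.ev P' m)" by (rule inverse_unique)
  also have "\<dots> = ac.ev (smult (- (1 / c)) (P' \<circ>\<^sub>p Q)) ta"
   unfolding Q by (simp add: ac.ev_smult ac.ev_pcompose ac.ev_minus)
  finally show ?thesis by blast
 qed
 moreover have "ac.ev A ta + ac.ev B ta \<in> ?M" "ac.ev A ta - ac.ev B ta \<in> ?M" "ac.ev A ta * ac.ev B ta \<in> ?M" for A B
  unfolding ac.ev_add[symmetric] ac.ev_diff[symmetric] ac.ev_mult[symmetric] by simp_all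
 moreover have "1 \<in> ?M" by (rule range_eqI[of _ _ 1]) simp
 ultimately show ?thesis unfolding subfield_of_def by blast
qed

text \<open>The minimal polynomial of \<open>aa\<close> over \<open>F(aa + c bb)\<close> divides both \<open>P\<close> and
 \<open>(ta - T)^2 - c^2 f(T)\<close>; for almost all \<open>c\<close> these have only the root \<open>aa\<close> in common, and it is a
 simple root of the second one.  No separability of \<open>aa\<close> is needed.\<close>

lemma primitive_infinite:
 fixes aa bb :: "'a::field alg_closure"
 assumes inf: "infinite (UNIV :: 'a set)" and two: "(2 :: 'a) ~= 0" and P: "P ~= 0" "ac.ev P aa = 0" and bb: "bb ^ 2 = ac.ev f aa"
 shows "\<exists>c. aa \<in> range (\<lambda>Q. ac.ev Q (aa + to_ac c * bb)) \<and> bb \<in> range (\<lambda>Q. ac.ev Q (aa + to_ac c * bb))"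
proof (cases "bb = 0")
 case True
 have "aa = ac.ev [:0, 1:] aa" "bb = ac.ev 0 aa" using True by simp_all
 hence "aa \<in> range (\<lambda>Q. ac.ev Q aa)" "bb \<in> range (\<lambda>Q. ac.ev Q aa)" by (metis rangeI)+
 thus ?thesis using True by (intro exI[of _ 0]) simp
next
 case False
 have two': "(2 :: 'a alg_closure) ~= 0" using two by (metis to_ac_eq_0_iff to_ac_numeral)
 let ?f' = "ac.ev (pderiv f) aa"
 let ?Pa = "map_poly to_ac P"
 have Pa: "?Pa ~= 0" using P(1) by (metis ac.em_eq_0_iff map_poly_eq_0_iff to_ac_0)
 define roots where "roots = {r. poly ?Pa r = 0}"
 have fr: "finite roots" unfolding roots_def by (rule poly_roots_finite[OF Pa])
 define sq where "sq r = {s. s ^ 2 = ac.ev f r}" for r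
 have fs: "finite (sq r)" for r
 proof -
  have "sq r = {s. poly [:- ac.ev f r, 0, 1:] s = 0}" unfolding sq_def by (auto simp: power2_eq_square)
  thus ?thesis using poly_roots_finite[of "[:- ac.ev f r, 0, 1:]"] by simp
 qed
 \<comment> \<open>\<open>0\<close> is excluded in order to divide by \<open>c\<close>, the second
   value would make \<open>aa\<close> a multiple root of \<open>H\<close>, and the quotients are the
   values for which another root \<open>r\<close> of \<open>P\<close> becomes a root of
   \<open>H\<close>.\<close>
 define bad where "bad = {0, - 2 * bb / ?f'} \<union> (\<Union>r\<in>roots. (\<lambda>s. (r - aa) / (bb - s)) ` sq r)"
 have "finite bad" unfolding bad_def using fr fs by blast
 hence "finite (to_ac -` bad)" using inj_to_ac by (rule finite_vimageI)
 then obtain c where c: "to_ac c \<notin> bad" using inf ex_new_if_finite by (metis vimageI2)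
 define C where "C = to_ac c"
 have C: "C \<notin> bad" "C ~= 0" using c unfolding C_def bad_def by auto
 define ta where "ta = aa + C * bb"
 let ?M = "range (\<lambda>Q. ac.ev Q ta)"
 note M = range_ev_subfield[of ta]
 have emM: "to_ac d \<in> ?M" for d by (rule range_eqI[of _ _ "[:d:]"]) simp
 have tM: "ta \<in> ?M" by (rule range_eqI[of _ _ "[:0, 1:]"]) simp
 define H where "H = [:ta, - 1:] ^ 2 - smult (C ^ 2) (map_poly to_ac f)"
 have mM: "\<And>a b. a \<in> ?M ==> b \<in> ?M ==> a * b \<in> ?M" "\<And>a b. a \<in> ?M ==> b \<in> ?M ==> a - b \<in> ?M" "\<And>a b. a \<in> ?M ==> b \<in> ?M ==> a + b \<in> ?M"
  using M unfolding subfield_of_def by blast+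
 have M01: "0 \<in> ?M" "1 \<in> ?M" using emM[of 0] emM[of 1] by simp_all
 have sq2: "[:ta, - 1:] ^ 2 = [:ta * ta, - (2 * ta), 1:]" by (simp add: power2_eq_square)
 have "coeff [:ta * ta, - (2 * ta), 1:] i \<in> ?M" for i
 proof -
  have "- (2 * ta) = 0 - (ta + ta)" by simp
  hence "- (2 * ta) \<in> ?M" using mM tM M01 by metis
  thus ?thesis using mM(1)[OF tM tM] M01 by (auto simp: coeff_pCons split: nat.splits)
 qed
 moreover have "coeff (smult (C ^ 2) (map_poly to_ac f)) i \<in> ?M" for i
  using mM(1)[OF mM(1)[OF emM[of c] emM[of c]] emM[of "coeff f i"]] by (simp add: coeff_map_poly power2_eq_square C_def)
 ultimately have HM: "coeffs_in ?M H" unfolding coeffs_in_def H_def sq2 coeff_diff using mM(2) by blast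
 have polyH: "poly H r = (ta - r) ^ 2 - C ^ 2 * ac.ev f r" for r
  unfolding H_def ac.ev_def by simp
 have H0: "poly H aa = 0" unfolding polyH ta_def bb[symmetric] by (simp add: power_mult_distrib)
 have "pderiv (map_poly to_ac f) = map_poly to_ac (pderiv f)"
  by (rule poly_eqI) (simp add: coeff_pderiv coeff_map_poly)
 hence "poly (pderiv H) aa = - 2 * (ta - aa) - C ^ 2 * ?f'"
  unfolding H_def sq2 pderiv_diff pderiv_smult ac.ev_def by (simp add: pderiv_pCons algebra_simps)
 hence dH: "poly (pderiv H) aa = - C * (2 * bb + C * ?f')" unfolding ta_def by (simp add: power2_eq_square algebra_simps)
 have "2 * bb + C * ?f' ~= 0"
 proof
  assume a: "2 * bb + C * ?f' = 0"
  hence "?f' ~= 0" using False two' by auto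
  hence "C = - 2 * bb / ?f'" using a by (simp add: field_simps eq_neg_iff_add_eq_0)
  thus False using C unfolding bad_def by blast
 qed
 hence H1: "poly (pderiv H) aa ~= 0" unfolding dH using C by simp
 have PM: "coeffs_in ?M ?Pa" using emM unfolding coeffs_in_def by (simp add: coeff_map_poly)
 have P0: "poly ?Pa aa = 0" using P(2) unfolding ac.ev_def .
 have aM: "aa \<in> ?M"
 proof (rule root_in_subfield[OF M PM Pa P0 HM H0 H1])
  fix r assume r: "poly ?Pa r = 0" "poly H r = 0"
  show "r = aa"
  proof (rule ccontr)
   assume ra: "r ~= aa"
   let ?s = "(ta - r) / C"
   have "?s ^ 2 = ac.ev f r" using r(2) C unfolding polyH by (simp add: power_divide)
   hence s: "?s \<in> sq r" unfolding sq_def by simp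
   have Cs: "C * ?s = aa + C * bb - r" using C unfolding ta_def by simp
   hence "C * (bb - ?s) = r - aa" by (simp add: right_diff_distrib)
   moreover from this have "bb - ?s ~= 0" using ra by auto
   ultimately have "C = (r - aa) / (bb - ?s)" by (simp add: field_simps)
   hence "C \<in> bad" using s r(1) unfolding bad_def roots_def by blast
   thus False using C by blast
  qed
 qed
 have "bb = (ta - aa) * inverse C" unfolding ta_def using C by simp
 hence "bb \<in> ?M" using M aM tM emM[of c] unfolding subfield_of_def C_def by metis
 thus ?thesis using aM unfolding ta_def C_def by blast
qed

text \<open>The multiplicative group of a finite field is cyclic; \<open>ring_on S\<close> makes
  \<open>S\<close> a structure to which this applies.\<close>

lemma primitive_finite:
 fixes S :: "'k::field set"
 assumes S: "subfield_of S" "finite S"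
 shows "\<exists>ta\<in>S. \<forall>a\<in>S. a ~= 0 \<longrightarrow> (\<exists>i. a = ta ^ i)"
proof -
 have S0: "0 \<in> S" using S(1) unfolding subfield_of_def by (metis diff_self)
 have neg: "- a \<in> S" if "a \<in> S" for a using S(1) S0 that unfolding subfield_of_def by (metis diff_0)
 have cr: "cring (ring_on S)"
 proof (rule cringI)
  show "abelian_group (ring_on S)"
  proof (rule abelian_groupI)
   fix a assume "a \<in> carrier (ring_on S)"
   thus "\<exists>b\<in>carrier (ring_on S). b \<oplus>\<^bsub>ring_on S\<^esub> a = \<zero>\<^bsub>ring_on S\<^esub>"
    using neg[of a] by (intro bexI[of _ "- a"]) (auto simp: ring_on_def)
  qed (use S S0 in "auto simp: ring_on_def subfield_of_def ac_simps")
  show "comm_monoid (ring_on S)"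
   by (rule comm_monoidI) (use S in "auto simp: ring_on_def subfield_of_def ac_simps")
 qed (auto simp: ring_on_def algebra_simps)
 interpret cring "ring_on S" by (rule cr)
 have "Ring.field (ring_on S)"
 proof (rule cring_fieldI)
  have "a \<in> Units (ring_on S)" if "a \<in> S" "a ~= 0" for a
  proof -
   have "inverse a \<in> S" using S(1) that unfolding subfield_of_def by blast
   thus ?thesis using that unfolding Units_def ring_on_def by (auto intro!: bexI[of _ "inverse a"])
  qed
  moreover have "a ~= 0" if "a \<in> Units (ring_on S)" for a
   using that unfolding Units_def ring_on_def by auto
  moreover have "a \<in> S" if "a \<in> Units (ring_on S)" for a
   using that unfolding Units_def ring_on_def by auto
  ultimately show "Units (ring_on S) = carrier (ring_on S) - {\<zero>\<^bsub>ring_on S\<^esub>}"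
   by (auto simp: ring_on_def)
 qed
 then interpret F: Ring.field "ring_on S" .
 have "finite (carrier (ring_on S))" using S(2) by (simp add: ring_on_def)
 from F.finite_field_mult_group_has_gen[OF this] obtain ta where
  t: "ta \<in> carrier (Multiplicative_Group.mult_of (ring_on S))" "carrier (Multiplicative_Group.mult_of (ring_on S)) = {ta [^]\<^bsub>ring_on S\<^esub> (i::nat) |i. i \<in> UNIV}"
  by (rule bexE)
 have tS: "ta \<in> S" using t(1) by (simp add: ring_on_def)
 have pw: "ta [^]\<^bsub>ring_on S\<^esub> (i::nat) = ta ^ i" for i
 proof (induction i)
  case 0
  show ?case by (simp add: nat_pow_def ring_on_def)
 next
  case (Suc i)
  thus ?case by (simp add: nat_pow_def ring_on_def mult.commute)
 qed
 have "\<exists>i. a = ta ^ i" if "a \<in> S" "a ~= 0" for a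
 proof -
  have "a \<in> carrier (Multiplicative_Group.mult_of (ring_on S))" using that by (simp add: ring_on_def)
  thus ?thesis unfolding t(2) pw by blast
 qed
 thus ?thesis using tS by blast
qed

context chart_point
begin

text \<open>The residue field is realised in the algebraic closure: \<open>x\<close> goes to a root
  of \<open>q\<close> and \<open>y\<close> to a square root of \<open>f\<close> there. When two
  points lie over this root, the sign of the square root must be chosen to match
  \<open>I\<close>.\<close>

lemma residue_embedding:
 obtains aa bb :: "'a alg_closure" where "bb ^ 2 = ac.ev f aa"
  "\<And>a b. ev a xc + ev b xc * yc \<in> I \<longleftrightarrow> ac.ev a aa + ac.ev b aa * bb = 0" "ac.ev q aa = 0"
proof -
 have "degree q > 0" using q_nonunit q_nonzero is_unit_iff_degree by blast
 hence "degree (map_poly to_ac q) > 0" by (subst degree_map_poly) auto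
 from alg_closed_imp_poly_has_root[OF this] obtain aa :: "'a alg_closure" where aa: "ac.ev q aa = 0" unfolding ac.ev_def by blast
 have qa: "ac.ev a aa = 0 \<longleftrightarrow> q dvd a" for a
 proof
  assume "q dvd a"
  thus "ac.ev a aa = 0" using aa by (auto simp: ac.ev_mult)
 next
  assume a: "ac.ev a aa = 0"
  obtain d where d: "d ~= 0" "ac.ev d aa = 0" and min: "\<And>A. A ~= 0 ==> ac.ev A aa = 0 ==> degree d \<le> degree A"
   using ex_has_least_nat[of "\<lambda>A. A ~= 0 \<and> ac.ev A aa = 0" q degree] q_nonzero aa by blast
  have dvd: "d dvd A" if A: "ac.ev A aa = 0" for A
  proof -
   have "A mod d = A - A div d * d" by (simp add: minus_div_mult_eq_mod)
   hence m: "ac.ev (A mod d) aa = 0" using A d by (simp only: ac.ev_diff ac.ev_mult) simp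
   have "A mod d = 0"
   proof (rule ccontr)
    assume n: "A mod d ~= 0"
    from min[OF n m] degree_mod_less[OF d(1), of A] n show False by linarith
   qed
   thus ?thesis by (simp add: mod_eq_0_iff_dvd)
  qed
  obtain e where e: "q = d * e" using dvd[OF aa] by blast
  have "ev d xc * ev e xc \<in> I" using q_mem unfolding e ev_mult .
  hence "ev d xc \<in> I \<or> ev e xc \<in> I" using I_prime[OF ev_R ev_R] by blast
  hence "q dvd d \<or> q dvd e" using q by blast
  moreover have "\<not> q dvd e"
  proof
   assume "q dvd e"
   from this obtain e' where "e = q * e'" by blast
   hence "q * (d * e') = q * 1" using e by (simp add: mult.left_commute mult.commute)
   hence "d * e' = 1" using q_nonzero by (metis mult_left_cancel)
   hence "ac.ev (d * e') aa = 1" by simp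
   thus False using d(2) by (simp add: ac.ev_mult)
  qed
  ultimately show "q dvd a" using dvd[OF a] dvd_trans by blast
 qed
 have two': "(2 :: 'a alg_closure) ~= 0" using two by (metis to_ac_eq_0_iff to_ac_numeral)
 have main: "ev a xc + ev b xc * yc \<in> I \<longleftrightarrow> ac.ev a aa + ac.ev b aa * bb = 0"
  if bb: "bb ^ 2 = ac.ev f aa" and ker: "\<And>a b. ac.ev a aa + ac.ev b aa * bb = 0 ==> ev a xc + ev b xc * yc \<in> I" for bb a b
 proof
  assume r: "ev a xc + ev b xc * yc \<in> I"
  show "ac.ev a aa + ac.ev b aa * bb = 0"
  proof (rule ccontr)
   assume n: "ac.ev a aa + ac.ev b aa * bb ~= 0"
   have "(ev a xc + ev b xc * yc) * (ev a xc - ev b xc * yc) = ev (a * a - b * b * f) xc"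
    by (simp add: ev_diff ev_mult algebra_simps flip: YY)
   moreover have "ev a xc - ev b xc * yc \<in> R" by (intro diff_R mult_R ev_R Y_R)
   ultimately have "ev (a * a - b * b * f) xc \<in> I" using I_mult'[OF r] by metis
   hence "ac.ev (a * a - b * b * f) aa = 0" using q qa by blast
   hence "(ac.ev a aa + ac.ev b aa * bb) * (ac.ev a aa - ac.ev b aa * bb) = 0"
    using bb by (simp add: ac.ev_diff ac.ev_mult algebra_simps power2_eq_square)
   hence "ac.ev a aa + ac.ev (- b) aa * bb = 0" using n by (simp add: ac.ev_minus)
   from ker[OF this] have r': "ev a xc - ev b xc * yc \<in> I" by (simp add: ev_minus)
   have e: "2 * ev a xc = (ev a xc + ev b xc * yc) + (ev a xc - ev b xc * yc)" by simp
   have "2 * ev a xc \<in> I" unfolding e by (rule I_add[OF r r'])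
   hence aI: "ev a xc \<in> I" using I_half ev_R by blast
   hence a0: "ac.ev a aa = 0" using q qa by blast
   have "ev b xc * yc \<in> I" using I_diff[OF r aI] by simp
   hence "ev b xc \<in> I \<or> yc \<in> I" using I_prime ev_R Y_R by blast
   hence "ac.ev b aa * bb = 0"
   proof
    assume "ev b xc \<in> I"
    thus ?thesis using q[of b] qa[of b] by simp
   next
    assume "yc \<in> I"
    hence "ev f xc \<in> I" using I_mult[OF _ Y_R, of yc] YY by simp
    hence "bb ^ 2 = 0" using q[of f] qa[of f] bb by simp
    thus ?thesis by simp
   qed
   thus False using n a0 by simp
  qed
 qed (rule ker)
 obtain bb0 where bb0: "bb0 ^ 2 = ac.ev f aa" using nth_root_exists[of 2 "ac.ev f aa"] by auto
 have "\<exists>bb. bb ^ 2 = ac.ev f aa \<and> (\<forall>a b. ac.ev a aa + ac.ev b aa * bb = 0 \<longrightarrow> ev a xc + ev b xc * yc \<in> I)"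
 proof (cases "bb0 = 0")
  case True
  hence "ev f xc \<in> I" using bb0 qa[of f] q[of f] by simp
  hence "yc \<in> I" using I_prime[OF Y_R Y_R] YY by auto
  hence "ev a xc + ev b xc * yc \<in> I" if "ac.ev a aa + ac.ev b aa * bb0 = 0" for a b
   using that True qa[of a] q[of a] by (intro I_add I_mult ev_R) auto
  thus ?thesis using bb0 by blast
 next
  case False
  show ?thesis
  proof (rule ccontr)
   assume n: "\<not> ?thesis"
   \<comment> \<open>If both signs failed, there would be a witness outside \<open>I\<close> for
     each. Their product has coefficients divisible by \<open>q\<close> and so lies in
     \<open>I\<close>, against primality.\<close>
   hence "\<exists>a b. ac.ev a aa + ac.ev b aa * bb0 = 0 \<and> ev a xc + ev b xc * yc \<notin> I" using bb0 by blast
   then obtain a b where ab: "ac.ev a aa + ac.ev b aa * bb0 = 0" "ev a xc + ev b xc * yc \<notin> I" by blast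
   have "(- bb0) ^ 2 = ac.ev f aa" using bb0 by simp
   hence "\<exists>a b. ac.ev a aa + ac.ev b aa * (- bb0) = 0 \<and> ev a xc + ev b xc * yc \<notin> I" using n by blast
   then obtain c d where cd: "ac.ev c aa + ac.ev d aa * (- bb0) = 0" "ev c xc + ev d xc * yc \<notin> I" by blast
   let ?A = "a * c + b * d * f" and ?B = "a * d + b * c"
   have prod: "(ev a xc + ev b xc * yc) * (ev c xc + ev d xc * yc) = ev ?A xc + ev ?B xc * yc"
    by (simp add: ev_add ev_mult algebra_simps flip: YY)
   have a: "ac.ev a aa = - (ac.ev b aa * bb0)" and c: "ac.ev c aa = ac.ev d aa * bb0"
    using ab(1) cd(1) by (simp_all add: eq_neg_iff_add_eq_0)
   have "ac.ev ?A aa = 0" "ac.ev ?B aa = 0"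
    by (simp_all add: ac.ev_add ac.ev_mult a c bb0[symmetric] power2_eq_square)
   hence "ev ?A xc + ev ?B xc * yc \<in> I" using qa[of ?A] qa[of ?B] q[of ?A] q[of ?B] by (intro I_add I_mult' Y_R) auto
   hence "(ev a xc + ev b xc * yc) * (ev c xc + ev d xc * yc) \<in> I" using prod by simp
   from I_prime[OF _ _ this ab(2)] cd(2) show False using R_I by blast
  qed
 qed
 then obtain bb where "bb ^ 2 = ac.ev f aa" "\<forall>a b. ac.ev a aa + ac.ev b aa * bb = 0 \<longrightarrow> ev a xc + ev b xc * yc \<in> I" by blast
 thus ?thesis using that[of bb aa] main aa by blast
qed

text \<open>A Nisnevich chart needs a function whose value generates the residue field. For infinite
  \<open>F\<close> it is \<open>x + c y\<close>: \<open>y\<close> is separable over the value of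
  \<open>x\<close>, so inseparability of the latter does no harm. For finite \<open>F\<close> it
  lifts a generator of the cyclic multiplicative group.\<close>

lemma residue_simple: "\<exists>t\<in>R. \<forall>a\<in>p. \<exists>Q. a - ev Q t \<in> max_ideal p"
proof -
 obtain aa bb :: "'a alg_closure" where bb: "bb ^ 2 = ac.ev f aa"
  and I: "\<And>a b. ev a xc + ev b xc * yc \<in> I \<longleftrightarrow> ac.ev a aa + ac.ev b aa * bb = 0" and qaa: "ac.ev q aa = 0"
  using residue_embedding by metis
 define th where "th r = (let (a, b) = (SOME ab. r = ev (fst ab) xc + ev (snd ab) xc * yc) in ac.ev a aa + ac.ev b aa * bb)" for r
 have th: "th (ev a xc + ev b xc * yc) = ac.ev a aa + ac.ev b aa * bb" for a b
 proof -
  have "(SOME ab. ev a xc + ev b xc * yc = ev (fst ab) xc + ev (snd ab) xc * yc) = (a, b)"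
  proof (rule some_equality)
   fix ab assume "ev a xc + ev b xc * yc = ev (fst ab) xc + ev (snd ab) xc * yc"
   hence "ev (a - fst ab) xc + ev (b - snd ab) xc * yc = 0" by (simp add: ev_diff algebra_simps)
   from indep[OF this] show "ab = (a, b)" by (cases ab) simp
  qed simp
  thus ?thesis unfolding th_def by simp
 qed
 have thI: "r \<in> I \<longleftrightarrow> th r = 0" if "r \<in> R" for r
  using that I th by (metis R_E)
 have thadd: "th (r + s) = th r + th s" and thdiff: "th (r - s) = th r - th s" and thmult: "th (r * s) = th r * th s"
  if r: "r \<in> R" and s: "s \<in> R" for r s
 proof -
  obtain a b where ab: "r = ev a xc + ev b xc * yc" using r by (rule R_E)
  obtain c d where cd: "s = ev c xc + ev d xc * yc" using s by (rule R_E)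
  have "r + s = ev (a + c) xc + ev (b + d) xc * yc" "r - s = ev (a - c) xc + ev (b - d) xc * yc"
   unfolding ab cd by (simp_all add: ev_add ev_diff algebra_simps)
  thus "th (r + s) = th r + th s" "th (r - s) = th r - th s"
   by (simp_all only: th ab cd) (simp_all add: ac.ev_add ac.ev_diff algebra_simps)
  have "r * s = ev (a * c + b * d * f) xc + ev (a * d + b * c) xc * yc"
   unfolding ab cd by (simp add: ev_add ev_mult algebra_simps flip: YY)
  thus "th (r * s) = th r * th s"
   by (simp only: th ab cd) (simp add: ac.ev_add ac.ev_mult algebra_simps flip: bb power2_eq_square)
 qed
 have them: "th (em c) = to_ac c" for c using th[of "[:c:]" 0] by simp
 have evR: "ev Q t \<in> R" if "t \<in> R" for Q t
  using that by (induction Q) (auto intro: zero_R add_R em_R mult_R)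
 have thev: "th (ev Q t) = ac.ev Q (th t)" if "t \<in> R" for Q t
 proof (induction Q)
  case 0
  show ?case using them[of 0] by simp
 qed (simp add: thadd thmult them em_R mult_R that evR)
 have "\<exists>t\<in>R. th ` R \<subseteq> range (\<lambda>Q. ac.ev Q (th t))"
 proof (cases "finite (UNIV :: 'a set)")
  case False
  from primitive_infinite[OF this two q_nonzero qaa bb] obtain c where
   c: "aa \<in> range (\<lambda>Q. ac.ev Q (aa + to_ac c * bb))" "bb \<in> range (\<lambda>Q. ac.ev Q (aa + to_ac c * bb))" by blast
  define t where "t = ev [:0, 1:] xc + ev [:c:] xc * yc"
  have tR: "t \<in> R" unfolding t_def by (rule R_I) (rule refl)
  have "th t = aa + to_ac c * bb" unfolding t_def th by simp
  moreover from c obtain Q1 Q2 where Q: "aa = ac.ev Q1 (aa + to_ac c * bb)" "bb = ac.ev Q2 (aa + to_ac c * bb)" by blast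
  have "th r \<in> range (\<lambda>Q. ac.ev Q (aa + to_ac c * bb))" if r: "r \<in> R" for r
  proof -
   obtain a b where ab: "r = ev a xc + ev b xc * yc" using r by (rule R_E)
   let ?t = "aa + to_ac c * bb"
   have "th r = ac.ev a (ac.ev Q1 ?t) + ac.ev b (ac.ev Q1 ?t) * ac.ev Q2 ?t"
    unfolding ab th Q[symmetric] ..
   also have "\<dots> = ac.ev (a \<circ>\<^sub>p Q1 + (b \<circ>\<^sub>p Q1) * Q2) ?t"
    by (simp only: ac.ev_add ac.ev_mult ac.ev_pcompose)
   finally show ?thesis by blast
  qed
  ultimately have "th ` R \<subseteq> range (\<lambda>Q. ac.ev Q (th t))" by (simp add: image_subset_iff)
  thus ?thesis using tR by blast
 next
  case True
  have "finite (th ` R)"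
  proof -
   have sub: "th ` R \<subseteq> (\<lambda>(a, b). ac.ev a aa + ac.ev b aa * bb) ` ({a. degree a \<le> degree q} \<times> {a. degree a \<le> degree q})"
   proof
    fix z assume "z \<in> th ` R"
    then obtain r where r: "r \<in> R" "z = th r" by blast
    obtain a b where ab: "r = ev a xc + ev b xc * yc" using r(1) by (rule R_E)
    have red: "ac.ev a aa = ac.ev (a mod q) aa" for a
    proof -
     have "a = a div q * q + a mod q" by simp
     hence "ac.ev a aa = ac.ev (a div q) aa * ac.ev q aa + ac.ev (a mod q) aa" by (metis ac.ev_add ac.ev_mult)
     thus ?thesis using qaa by simp
    qed
    have deg: "degree (a mod q) \<le> degree q" for a using degree_mod_less[OF q_nonzero, of a] by auto
    have "z = (\<lambda>(a, b). ac.ev a aa + ac.ev b aa * bb) (a mod q, b mod q)" using r ab th red by simp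
    thus "z \<in> (\<lambda>(a, b). ac.ev a aa + ac.ev b aa * bb) ` ({a. degree a \<le> degree q} \<times> {a. degree a \<le> degree q})"
     using deg by blast
   qed
   have fin: "finite {a :: 'a poly. degree a \<le> degree q}"
   proof -
    have "{a :: 'a poly. degree a \<le> degree q} \<subseteq> Poly ` {xs. set xs \<subseteq> UNIV \<and> length xs \<le> Suc (degree q)}"
    proof
     fix a :: "'a poly" assume "a \<in> {a. degree a \<le> degree q}"
     hence "length (coeffs a) \<le> Suc (degree q)" by (cases "a = 0") (auto simp: length_coeffs)
     thus "a \<in> Poly ` {xs. set xs \<subseteq> UNIV \<and> length xs \<le> Suc (degree q)}"
      by (intro image_eqI[of _ _ "coeffs a"]) auto
    qed
    thus ?thesis by (rule finite_subset) (rule finite_imageI[OF finite_lists_length_le[OF True]])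
   qed
   show ?thesis by (rule finite_subset[OF sub finite_imageI[OF finite_cartesian_product[OF fin fin]]])
  qed
  moreover have "subfield_of (th ` R)"
  proof -
   have "inverse (th r) \<in> th ` R" if r: "r \<in> R" for r
   proof (cases "r \<in> I")
    case True
    hence "inverse (th r) = th 0" using thI r zero_R I_zero by simp
    thus ?thesis using zero_R by blast
   next
    case False
    then obtain c where c: "c \<in> R" "1 - c * r \<in> I" using I_comax r by blast
    hence "th (1 - c * r) = 0" using thI diff_R one_R mult_R r by blast
    hence "th r * th c = 1" using c r them[of 1] by (simp add: thdiff thmult one_R mult_R mult.commute)
    hence "inverse (th r) = th c" by (rule inverse_unique)
    thus ?thesis using c by blast
   qed
   moreover have "1 \<in> th ` R" using them[of 1] one_R by (metis em_one image_eqI to_ac_1)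
   ultimately show ?thesis unfolding subfield_of_def
    using thadd thdiff thmult add_R diff_R mult_R by (auto simp flip: thadd thdiff thmult)
  qed
  ultimately obtain ta where ta: "ta \<in> th ` R" "\<forall>a\<in>th ` R. a ~= 0 \<longrightarrow> (\<exists>i. a = ta ^ i)" using primitive_finite by blast
  then obtain t where t: "t \<in> R" "ta = th t" by blast
  have "th r \<in> range (\<lambda>Q. ac.ev Q ta)" if "r \<in> R" for r
  proof (cases "th r = 0")
   case True
   hence "th r = ac.ev 0 ta" by (simp only: ac.ev_0)
   thus ?thesis by (rule range_eqI)
  next
   case False
   from ta(2)[THEN bspec, OF imageI[OF that], THEN mp, OF False]
   obtain i where "th r = ta ^ i" by (rule exE)
   hence "th r = ac.ev (monom 1 i) ta" by (simp only: ac.ev_monom to_ac_1 mult_1)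
   thus ?thesis by (rule range_eqI)
  qed
  hence "th ` R \<subseteq> range (\<lambda>Q. ac.ev Q (th t))" unfolding t(2) by (simp add: image_subset_iff)
  thus ?thesis using t(1) by blast
 qed
 then obtain t where t: "t \<in> R" "th ` R \<subseteq> range (\<lambda>Q. ac.ev Q (th t))" by blast
 have "\<exists>Q. a - ev Q t \<in> max_ideal p" if a: "a \<in> p" for a
 proof -
  obtain r where r: "r \<in> R" "a - r \<in> principal_ideal p pu" using approx[OF a pi_nonzero] by blast
  obtain Q where Q: "th r = ac.ev Q (th t)" using t(2) r(1) by blast
  have "th (r - ev Q t) = 0" using Q thev[OF t(1)] thdiff[OF r(1) evR[OF t(1)]] by simp
  hence "r - ev Q t \<in> max_ideal p" using thI R_max_ideal diff_R[OF r(1) evR[OF t(1)]] by blast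
  from max_ideal_add[OF r(2)[folded max_ideal_eq] this] show ?thesis by (intro exI[of _ Q]) simp
 qed
 thus ?thesis using t(1) by blast
qed

text \<open>A map that is a derivation only modulo the maximal ideal is still controlled there by
  its values at the two coordinates.\<close>

lemma mod_derivation_zero:
 assumes E: "\<And>a. a \<in> p ==> E a \<in> p"
  and add: "\<And>a b. a \<in> p ==> b \<in> p ==> E (a + b) - (E a + E b) \<in> max_ideal p"
  and mult: "\<And>a b. a \<in> p ==> b \<in> p ==> E (a * b) - (a * E b + b * E a) \<in> max_ideal p"
  and const: "\<And>c. E (em c) \<in> max_ideal p"
  and gens: "E xc \<in> max_ideal p" "E yc \<in> max_ideal p" and a: "a \<in> p"
 shows "E a \<in> max_ideal p"
proof -
 have add': "E (a + b) \<in> max_ideal p" if "a \<in> p" "b \<in> p" "E a \<in> max_ideal p" "E b \<in> max_ideal p" for a b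
  using max_ideal_add[OF add[OF that(1,2)] max_ideal_add[OF that(3,4)]] by simp
 have mult': "E (a * b) \<in> max_ideal p" if "a \<in> p" "b \<in> p" "E a \<in> max_ideal p" "E b \<in> max_ideal p" for a b
  using max_ideal_add[OF mult[OF that(1,2)] max_ideal_add[OF max_ideal_mult[OF that(1,4)] max_ideal_mult[OF that(2,3)]]] by simp
 have ev: "E (ev r xc) \<in> max_ideal p" for r
 proof (induction r)
  case 0
  show ?case using const[of 0] by simp
 next
  case (pCons c r)
  show ?case unfolding ev_pCons
   by (intro add' mult' const gens pCons em_p mult_p R_p[OF X_R] R_p[OF ev_R])
 qed
 have R: "E r \<in> max_ideal p" if r: "r \<in> R" for r
 proof -
  obtain b c where r: "r = ev b xc + ev c xc * yc" using r by (rule R_E)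
  show ?thesis unfolding r by (intro add' mult' ev gens mult_p R_p[OF Y_R] R_p[OF ev_R])
 qed
 obtain b s where bs: "b \<in> R" "s \<in> R" "s \<notin> I" "s ~= 0" "a = b / s" using a by (rule p_E)
 have sa: "s * a = b" using bs by simp
 have "s * E a + a * E s \<in> max_ideal p"
  using max_ideal_diff[OF R[OF bs(1)] mult[OF R_p[OF bs(2)] a]] unfolding sa by simp
 from max_ideal_diff[OF this max_ideal_mult[OF a R[OF bs(2)]]] have "s * E a \<in> max_ideal p" by simp
 from max_ideal_mult[OF inverse_p[OF bs(2,3)] this] show ?thesis using bs(4) by (simp flip: mult.assoc)
qed

lemma two_inverse: "inverse 2 \<in> p"
proof -
 have "em (1/2) * 2 = em (1/2 * 2)" using em_mult[of "1/2" 2] em_add[of 1 1] by simp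
 hence "2 * em (1/2) = 1" using two by (simp add: mult.commute)
 hence i: "inverse 2 = em (1/2)" by (rule inverse_unique)
 show ?thesis unfolding i by (rule em_p)
qed

text \<open>The factor is \<open>E x / (2y)\<close> and also \<open>E y / f'(x)\<close>; one of the
  two denominators is a unit at \<open>p\<close>.\<close>

lemma derivation_multiple:
 assumes D: "derivation em D" "D xc = 2 * yc" "D yc = ev (pderiv f) xc"
  and E: "derivation em E" "E xc \<in> p" "E yc \<in> p"
 shows "\<exists>h\<in>p. E = (\<lambda>a. h * D a)"
proof -
 let ?h = "E xc / (2 * yc)"
 have hx: "?h * D xc = E xc" unfolding D(2) using two_k Y_nonzero by simp
 have eq: "E = (\<lambda>a. ?h * D a)" by (rule derivation_eqI[OF E(1) derivation_scale[OF D(1)]]) (use hx in simp)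
 have hy: "?h * ev (pderiv f) xc = E yc" using fun_cong[OF eq, of yc] D(3) by simp
 have "?h \<in> p"
 proof (cases "inverse yc \<in> p")
  case True
  have "?h = E xc * (inverse 2 * inverse yc)" by (simp only: divide_inverse inverse_mult_distrib)
  thus ?thesis using mult_p[OF E(2) mult_p[OF two_inverse True]] by (simp only:)
 next
  case False
  hence f: "ev (pderiv f) xc ~= 0" "inverse (ev (pderiv f) xc) \<in> p" using Y_or_f' by auto
  have "?h = E yc * inverse (ev (pderiv f) xc)" unfolding hy[symmetric] using f(1) by simp
  thus ?thesis using mult_p[OF E(3) f(2)] by (simp only:)
 qed
 with eq show ?thesis by (rule bexI)
qed

end

section \<open>Etale coordinates\<close>

context chart_point begin

lemma derivation_mem:
 assumes D: "derivation em D" "D xc = 2 * yc" "D yc = ev (pderiv f) xc" and a: "a \<in> p"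
 shows "D a \<in> p"
proof (rule derivation_p[OF D(1) _ _ a])
 have "yc + yc \<in> p" by (intro add_p R_p Y_R)
 thus "D xc \<in> p" unfolding D(2) by (simp only: mult_2)
 show "D yc \<in> p" unfolding D(3) by (intro R_p ev_R)
qed

text \<open>A generator of the residue field may have its derivative in the maximal ideal. Adding an
  element of the maximal ideal with unit derivative repairs this and does not change the
  residue.\<close>

lemma etale_exists:
 assumes D: "derivation em D" "D xc = 2 * yc" "D yc = ev (pderiv f) xc"
 shows "\<exists>t\<in>p. D t \<notin> max_ideal p \<and> (\<forall>a\<in>p. \<exists>Q. a - ev Q t \<in> max_ideal p)"
proof -
 note Dp = derivation_mem[OF D]
 obtain t where t: "t \<in> R" "\<forall>a\<in>p. \<exists>Q. a - ev Q t \<in> max_ideal p" using residue_simple by blast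
 have tp: "t \<in> p" using R_p t by blast
 have evp: "ev Q s \<in> p" if "s \<in> p" for Q s unfolding ev_eq using that by (intro sum_mem mult_p em_p power_mem)
 show ?thesis
 proof (cases "D t \<in> max_ideal p")
  case False
  thus ?thesis using t tp by blast
 next
  case True
  have "\<exists>z\<in>p. D z \<notin> max_ideal p"
  proof (cases "inverse yc \<in> p")
   case True
   from mult_p[OF two_inverse this] have "inverse (2 * yc) \<in> p" by (simp only: inverse_mult_distrib)
   moreover have "2 * yc ~= 0" using two_k Y_nonzero by simp
   ultimately have "D xc \<notin> max_ideal p" unfolding D(2) max_ideal_iff by blast
   thus ?thesis using R_p[OF X_R] by blast
  next
   case False
   hence "D yc \<notin> max_ideal p" unfolding D(3) max_ideal_iff using Y_or_f' by blast
   thus ?thesis using R_p[OF Y_R] by blast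
  qed
  then obtain z where z: "z \<in> p" "D z \<notin> max_ideal p" by blast
  then obtain Q where Q: "z - ev Q t \<in> max_ideal p" using t by blast
  let ?w = "z - ev Q t"
  have "D z = ev (pderiv Q) t * D t + D ?w"
   unfolding derivation_diff[OF D(1)] derivation_ev[OF D(1)] by simp
  hence w: "D ?w \<notin> max_ideal p"
   using z(2) max_ideal_add[OF max_ideal_mult[OF evp[OF tp] True]] by metis
  let ?t = "t + ?w"
  have "D ?t = D t + D ?w" using D(1) unfolding derivation_def by blast
  hence 1: "D ?t \<notin> max_ideal p" using w max_ideal_diff[OF _ True, of "D ?t"] by auto
  have ev: "ev A ?t - ev A t \<in> max_ideal p" for A
  proof (induction A)
   case 0
   show ?case by (simp add: max_ideal_zero)
  next
   case (pCons c A)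
   have "ev (pCons c A) ?t - ev (pCons c A) t = ?t * (ev A ?t - ev A t) + ev A t * ?w" by (simp add: algebra_simps)
   also have "\<dots> \<in> max_ideal p"
    by (intro max_ideal_add max_ideal_mult pCons Q evp tp add_p max_ideal_sub[OF Q])
   finally show ?case .
  qed
  have "\<exists>A. a - ev A ?t \<in> max_ideal p" if a: "a \<in> p" for a
  proof -
   from bspec[OF t(2) a] obtain A where A: "a - ev A t \<in> max_ideal p" by (rule exE)
   have e: "a - ev A ?t = (a - ev A t) - (ev A ?t - ev A t)" by (rule sym) (rule diff_diff_eq2[THEN trans], simp only: diff_add_cancel)
   have "a - ev A ?t \<in> max_ideal p" by (subst e) (rule max_ideal_diff[OF A ev])
   thus ?thesis by (rule exI)
  qed
  moreover have "?t \<in> p" by (intro add_p tp max_ideal_sub Q)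
  ultimately show ?thesis using 1 by blast
 qed
qed

text \<open>If no polynomial in \<open>t\<close> were a uniformizer, \<open>p/pu^2\<close> would split as \<open>F[t] + m\<close>, and
 the projection to \<open>m/pu^2\<close> would be a derivation killing \<open>t\<close> but not \<open>pu\<close>; but all derivations
 are multiples of \<open>D\<close>.\<close>

lemma etale_uniformizer:
 assumes D: "derivation em D" "D xc = 2 * yc" "D yc = ev (pderiv f) xc"
  and t: "t \<in> p" "D t \<notin> max_ideal p" "\<And>a. a \<in> p ==> \<exists>Q. a - ev Q t \<in> max_ideal p"
 shows "\<exists>Q. ev Q t ~= 0 \<and> vord (ev Q t) = 1"
proof (rule ccontr)
 assume no: "\<not> ?thesis"
 note Dp = derivation_mem[OF D]
 have evp: "ev Q s \<in> p" if "s \<in> p" for Q s unfolding ev_eq using that by (intro sum_mem mult_p em_p power_mem)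
 have div: "a / pu \<in> p" if "a \<in> max_ideal p" for a
  using that unfolding max_ideal_eq principal_ideal_iff[OF pi_nonzero] .
 \<comment> \<open>The negated claim in usable form: a polynomial in \<open>t\<close> that vanishes
   at \<open>p\<close> vanishes to order at least two.\<close>
 have sq: "ev Q t / pu \<in> max_ideal p" if m: "ev Q t \<in> max_ideal p" for Q
 proof (cases "ev Q t = 0")
  case False
  hence "vord (ev Q t) > 0" "vord (ev Q t) ~= 1" using m max_ideal_iff_vord no by blast+
  thus ?thesis using False pi_nonzero by (subst max_ideal_iff_vord) (auto simp: vord_divide vord_pi)
 qed (simp add: max_ideal_zero)
 define Qa where "Qa a = (SOME Q. a - ev Q t \<in> max_ideal p)" for a
 have Qa: "a - ev (Qa a) t \<in> max_ideal p" if "a \<in> p" for a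
  unfolding Qa_def by (rule someI_ex[OF t(3)[OF that]])
 \<comment> \<open>The coordinate of \<open>a\<close> along \<open>pu\<close> in the splitting of
   \<open>p\<close> modulo \<open>pu^2\<close>; by \<open>sq\<close> another polynomial changes it
   only within the maximal ideal.\<close>
 define dl where "dl a = (a - ev (Qa a) t) / pu" for a
 have dlp: "dl a \<in> p" if "a \<in> p" for a unfolding dl_def by (rule div[OF Qa[OF that]])
 have dl: "dl a - (a - ev Q t) / pu \<in> max_ideal p" if a: "a \<in> p" and Q: "a - ev Q t \<in> max_ideal p" for a Q
 proof -
  have "ev (Q - Qa a) t = (a - ev (Qa a) t) - (a - ev Q t)" by (simp add: ev_diff)
  hence "ev (Q - Qa a) t \<in> max_ideal p" using max_ideal_diff[OF Qa[OF a] Q] by simp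
  from sq[OF this] show ?thesis unfolding dl_def by (simp add: ev_diff diff_divide_distrib)
 qed
 have add: "dl (a + b) - (dl a + dl b) \<in> max_ideal p" if ab: "a \<in> p" "b \<in> p" for a b
 proof -
  have "(a + b) - ev (Qa a + Qa b) t = (a - ev (Qa a) t) + (b - ev (Qa b) t)" by (simp add: ev_add)
  from dl[OF add_p[OF ab], of "Qa a + Qa b"] this max_ideal_add[OF Qa[OF ab(1)] Qa[OF ab(2)]]
  show ?thesis unfolding dl_def[of a] dl_def[of b] by (simp add: add_divide_distrib)
 qed
 have mult: "dl (a * b) - (a * dl b + b * dl a) \<in> max_ideal p" if ab: "a \<in> p" "b \<in> p" for a b
 proof -
  have eq: "a * b - ev (Qa a * Qa b) t = a * (b - ev (Qa b) t) + ev (Qa b) t * (a - ev (Qa a) t)"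
   by (simp add: ev_mult algebra_simps)
  have "a * b - ev (Qa a * Qa b) t \<in> max_ideal p"
   unfolding eq by (intro max_ideal_add max_ideal_mult ab Qa evp t)
  from dl[OF mult_p[OF ab] this] have 1: "dl (a * b) - (a * dl b + ev (Qa b) t * dl a) \<in> max_ideal p"
   unfolding eq dl_def[of a] dl_def[of b] by (simp add: add_divide_distrib)
  have 2: "dl a * (b - ev (Qa b) t) \<in> max_ideal p" by (rule max_ideal_mult[OF dlp[OF ab(1)] Qa[OF ab(2)]])
  have "dl (a * b) - (a * dl b + b * dl a) = (dl (a * b) - (a * dl b + ev (Qa b) t * dl a)) - dl a * (b - ev (Qa b) t)"
   by (simp add: algebra_simps)
  thus ?thesis using max_ideal_diff[OF 1 2] by (simp only:)
 qed
 have const: "dl (em c) \<in> max_ideal p" for c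
  using dl[OF em_p, of c "[:c:]"] by (simp add: max_ideal_zero)
 have dlt: "dl t \<in> max_ideal p" using dl[OF t(1), of "[:0, 1:]"] by (simp add: max_ideal_zero)
 have dlpi: "dl pu - 1 \<in> max_ideal p"
  using dl[OF pi_mem, of 0] pi_nonzero max_ideal_iff[of pu] pi_mem pi_nonunit by simp
 have dlev: "dl (ev r xc) - ev (pderiv r) xc * dl xc \<in> max_ideal p" for r
 proof (induction r)
  case 0
  show ?case using const[of 0] by simp
 next
  case (pCons c r)
  have x: "xc \<in> p" "ev r xc \<in> p" "em c \<in> p" "xc * ev r xc \<in> p" using R_p X_R ev_R em_p mult_p by blast+
  have eq: "dl (ev (pCons c r) xc) - ev (pderiv (pCons c r)) xc * dl xc
   = (dl (em c + xc * ev r xc) - (dl (em c) + dl (xc * ev r xc))) + dl (em c)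
    + (dl (xc * ev r xc) - (xc * dl (ev r xc) + ev r xc * dl xc))
    + xc * (dl (ev r xc) - ev (pderiv r) xc * dl xc)"
   by (simp add: pderiv_pCons ev_add algebra_simps)
  show ?case unfolding eq
   by (intro max_ideal_add max_ideal_mult add mult const pCons x)
 qed
 have rel: "2 * yc * dl yc - ev (pderiv f) xc * dl xc \<in> max_ideal p"
 proof -
  have y: "yc \<in> p" by (rule R_p[OF Y_R])
  have "2 * yc * dl yc - ev (pderiv f) xc * dl xc
   = (dl (ev f xc) - ev (pderiv f) xc * dl xc) - (dl (yc * yc) - (yc * dl yc + yc * dl yc))"
   unfolding YY by (simp add: algebra_simps)
  thus ?thesis using max_ideal_diff[OF dlev mult[OF y y]] by (simp only:)
 qed
 have xy: "dl xc \<in> p" "dl yc \<in> p" using dlp R_p X_R Y_R by blast+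
 \<comment> \<open>By \<open>rel\<close> the values of \<open>dl\<close> at the coordinates satisfy
   the same linear relation as those of \<open>D\<close>, of which one is a unit; so they are
   proportional modulo the maximal ideal.\<close>
 have "\<exists>h\<in>p. dl xc - h * D xc \<in> max_ideal p \<and> dl yc - h * D yc \<in> max_ideal p"
 proof (cases "inverse yc \<in> p")
  case True
  let ?i = "inverse 2 * inverse yc"
  have i: "?i \<in> p" by (rule mult_p[OF two_inverse True])
  have ii: "?i * (2 * yc) = 1" using two_k Y_nonzero by simp
  have "?i * (2 * yc * dl yc - ev (pderiv f) xc * dl xc) \<in> max_ideal p" by (rule max_ideal_mult[OF i rel])
  moreover have "?i * (2 * yc * dl yc - ev (pderiv f) xc * dl xc) = (?i * (2 * yc)) * dl yc - (?i * dl xc) * D yc"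
   unfolding D(3) by (simp only: right_diff_distrib mult_ac)
  ultimately have m: "dl yc - (?i * dl xc) * D yc \<in> max_ideal p" by (simp only: ii mult_1_left)
  have "(?i * dl xc) * D xc = (?i * (2 * yc)) * dl xc" unfolding D(2) by (simp only: mult_ac)
  hence "dl xc - (?i * dl xc) * D xc = 0" by (simp only: ii mult_1_left diff_self)
  hence "dl xc - (?i * dl xc) * D xc \<in> max_ideal p" using max_ideal_zero by (simp only:)
  thus ?thesis using mult_p[OF i xy(1)] m by (intro bexI conjI)
 next
  case False
  let ?i = "inverse (ev (pderiv f) xc)"
  have i: "ev (pderiv f) xc ~= 0" "?i \<in> p" using Y_or_f' False by auto
  have ii: "?i * ev (pderiv f) xc = 1" using i by simp
  have "- (?i * (2 * yc * dl yc - ev (pderiv f) xc * dl xc)) \<in> max_ideal p"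
   by (intro max_ideal_minus max_ideal_mult i rel)
  moreover have "- (?i * (2 * yc * dl yc - ev (pderiv f) xc * dl xc)) = (?i * ev (pderiv f) xc) * dl xc - (?i * dl yc) * D xc"
   unfolding D(2) by (simp only: right_diff_distrib mult_ac minus_diff_eq)
  ultimately have m: "dl xc - (?i * dl yc) * D xc \<in> max_ideal p" by (simp only: ii mult_1_left)
  have "(?i * dl yc) * D yc = (?i * ev (pderiv f) xc) * dl yc" unfolding D(3) by (simp only: mult_ac)
  hence "dl yc - (?i * dl yc) * D yc = 0" by (simp only: ii mult_1_left diff_self)
  hence "dl yc - (?i * dl yc) * D yc \<in> max_ideal p" using max_ideal_zero by (simp only:)
  thus ?thesis using mult_p[OF i(2) xy(2)] m by (intro bexI conjI)
 qed
 then obtain h where h: "h \<in> p" "dl xc - h * D xc \<in> max_ideal p" "dl yc - h * D yc \<in> max_ideal p" by blast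
 define E where "E a = dl a - h * D a" for a
 have Dadd: "D (a + b) = D a + D b" and Dmult: "D (a * b) = a * D b + b * D a" and Dem: "D (em c) = 0" for a b c
  using D(1) unfolding derivation_def by blast+
 have zero: "E a \<in> max_ideal p" if "a \<in> p" for a
 proof (rule mod_derivation_zero[OF _ _ _ _ _ _ that])
  fix a assume "a \<in> p"
  thus "E a \<in> p" unfolding E_def using dlp Dp h by (intro diff_mem mult_p) auto
 next
  fix a b assume ab: "a \<in> p" "b \<in> p"
  have "E (a + b) - (E a + E b) = dl (a + b) - (dl a + dl b)" unfolding E_def Dadd by (simp add: algebra_simps)
  thus "E (a + b) - (E a + E b) \<in> max_ideal p" using add[OF ab] by simp
  have "E (a * b) - (a * E b + b * E a) = dl (a * b) - (a * dl b + b * dl a)" unfolding E_def Dmult by (simp add: algebra_simps)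
  thus "E (a * b) - (a * E b + b * E a) \<in> max_ideal p" using mult[OF ab] by simp
 next
  fix c show "E (em c) \<in> max_ideal p" unfolding E_def Dem using const by simp
 qed (use h in "simp_all add: E_def")
 have "dl t - E t \<in> max_ideal p" by (rule max_ideal_diff[OF dlt zero[OF t(1)]])
 hence "h * D t \<in> max_ideal p" unfolding E_def by simp
 hence hm: "h \<in> max_ideal p" using max_ideal_prime[OF h(1) Dp[OF t(1)]] t(2) by blast
 have "E pu + D pu * h - (dl pu - 1) \<in> max_ideal p"
  by (intro max_ideal_diff max_ideal_add zero pi_mem max_ideal_mult Dp hm dlpi)
 hence "1 \<in> max_ideal p" unfolding E_def by (simp add: mult.commute)
 thus False using one_not_max by simp
qed

text \<open>A uniformizer that is a polynomial in \<open>t\<close> gives an adic expansion whose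
  digits are polynomials in \<open>t\<close>.\<close>

lemma etale_surj:
 assumes D: "derivation em D" "D xc = 2 * yc" "D yc = ev (pderiv f) xc"
  and t: "t \<in> p" "D t \<notin> max_ideal p" "\<And>a. a \<in> p ==> \<exists>Q. a - ev Q t \<in> max_ideal p"
  and s: "s ~= 0" and a: "a \<in> p"
 shows "\<exists>Q. a - ev Q t \<in> principal_ideal p s"
proof -
 obtain Q0 where Q0: "ev Q0 t ~= 0" "vord (ev Q0 t) = 1" using etale_uniformizer[OF D t] by blast
 let ?mu = "ev Q0 t"
 have m: "max_ideal p = principal_ideal p ?mu" using max_ideal_eq_iff[OF Q0(1)] Q0(2) by simp
 have "\<exists>Q. \<exists>b\<in>p. a - ev Q t = ?mu ^ n * b" for n
 proof (induction n)
  case 0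
  show ?case using a by (intro exI[of _ 0] bexI[of _ a]) simp_all
 next
  case (Suc n)
  then obtain Q b where Q: "b \<in> p" "a - ev Q t = ?mu ^ n * b" by blast
  obtain Q' where "b - ev Q' t \<in> max_ideal p" using t(3)[OF Q(1)] by blast
  then obtain b' where b': "b' \<in> p" "b - ev Q' t = ?mu * b'" unfolding m principal_ideal_def by blast
  have "a - ev (Q + Q0 ^ n * Q') t = (a - ev Q t) - ?mu ^ n * ev Q' t" by (simp add: ev_add ev_mult ev_power)
  also have "\<dots> = ?mu ^ n * (b - ev Q' t)" unfolding Q(2) by (simp add: right_diff_distrib)
  also have "\<dots> = ?mu ^ Suc n * b'" unfolding b'(2) by simp
  finally show ?case using b'(1) by blast
 qed
 from this[of "nat (vord s)"] obtain Q b where Q: "b \<in> p" "a - ev Q t = ?mu ^ nat (vord s) * b" by blast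
 have "principal_ideal p (?mu ^ nat (vord s)) \<subseteq> principal_ideal p s"
  using s Q0 by (subst principal_ideal_subset) (auto simp: vord_power)
 moreover have "a - ev Q t \<in> principal_ideal p (?mu ^ nat (vord s))"
  unfolding Q(2) principal_ideal_def using Q(1) by blast
 ultimately show ?thesis by blast
qed

end

section \<open>Principal parts\<close>

context chart_point begin

text \<open>Serves two purposes: with \<open>a = x\<close> it gives the tangent stalk in the
  convention identifying a field with its value at \<open>x\<close>, and with \<open>a = z\<close>
  it decides whether \<open>dz\<close> vanishes at \<open>p\<close>.\<close>

lemma tangent_stalk:
 assumes D: "derivation em D" "D xc = 2 * yc" "D yc = ev (pderiv f) xc"
 shows "{E a |E. derivation em E \<and> E ` p \<subseteq> p} = principal_ideal p (D a)"
proof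
 show "{E a |E. derivation em E \<and> E ` p \<subseteq> p} \<subseteq> principal_ideal p (D a)"
 proof
  fix w assume "w \<in> {E a |E. derivation em E \<and> E ` p \<subseteq> p}"
  then obtain E where E: "derivation em E" "E ` p \<subseteq> p" "w = E a" by blast
  have "E xc \<in> p" "E yc \<in> p" using E(2) R_p X_R Y_R by blast+
  from derivation_multiple[OF D E(1) this] obtain h where "h \<in> p" "E = (\<lambda>a. h * D a)" by blast
  thus "w \<in> principal_ideal p (D a)" unfolding principal_ideal_def E(3) by (auto simp: mult.commute)
 qed
 show "principal_ideal p (D a) \<subseteq> {E a |E. derivation em E \<and> E ` p \<subseteq> p}"
 proof
  fix w assume "w \<in> principal_ideal p (D a)"
  then obtain h where h: "h \<in> p" "w = D a * h" unfolding principal_ideal_def by blast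
  have 1: "(\<lambda>b. h * D b) ` p \<subseteq> p" using derivation_mem[OF D] mult_p[OF h(1)] by (simp add: image_subset_iff)
  have 2: "derivation em (\<lambda>b. h * D b)" by (rule derivation_scale[OF D(1)])
  have "w = (\<lambda>b. h * D b) a" using h(2) by (simp add: mult.commute)
  thus "w \<in> {E a |E. derivation em E \<and> E ` p \<subseteq> p}" using 1 2
   by (intro CollectI exI[of _ "\<lambda>b. h * D b"] conjI)
 qed
qed

lemma d_nonzero_iff:
 assumes D: "derivation em D" "D xc = 2 * yc" "D yc = ev (pderiv f) xc"
 shows "(\<exists>E. derivation em E \<and> E ` p \<subseteq> p \<and> E z \<notin> max_ideal p) \<longleftrightarrow> D z \<notin> max_ideal p"
proof
 assume "\<exists>E. derivation em E \<and> E ` p \<subseteq> p \<and> E z \<notin> max_ideal p"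
 then obtain E where E: "derivation em E" "E ` p \<subseteq> p" "E z \<notin> max_ideal p" by blast
 hence "E z \<in> principal_ideal p (D z)" using tangent_stalk[OF D, of z] by blast
 then obtain h where h: "h \<in> p" "E z = D z * h" unfolding principal_ideal_def by blast
 show "D z \<notin> max_ideal p"
 proof
  assume "D z \<in> max_ideal p"
  from max_ideal_mult[OF h(1) this] have "E z \<in> max_ideal p" unfolding h(2) by (simp only: mult.commute)
  thus False using E(3) by blast
 qed
next
 assume "D z \<notin> max_ideal p"
 moreover have "D ` p \<subseteq> p" using derivation_mem[OF D] by blast
 ultimately show "\<exists>E. derivation em E \<and> E ` p \<subseteq> p \<and> E z \<notin> max_ideal p" using D(1) by blast
qed

text \<open>Of the two coordinates one has a unit as its \<open>D\<close>-derivative, and in that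
  parameter regular functions have regular Taylor coefficients. The first coordinate can fail where
  the second vanishes.\<close>

lemma taylor_parameter:
 assumes D: "derivation em D" "D xc = 2 * yc" "D yc = ev (pderiv f) xc"
  and Ph: "taylor_hom Ph" and c: "c ~= 0" "\<And>a. fps_nth (Ph a) 1 = c * D a"
 obtains z Ps where "z \<in> p" "D z \<notin> max_ideal p" "taylor_hom Ps" "Ps z = fps_const z + fps_X"
  "\<And>a. Ph a = fps_compose (Ps a) (Ph z - fps_const z)" "\<And>h. h \<in> p ==> integral (Ps h)"
proof (cases "inverse yc \<in> p")
 case True
 have "inverse (2 * yc) \<in> p" using mult_p[OF two_inverse True] by (simp only: inverse_mult_distrib)
 hence Dz: "D xc \<notin> max_ideal p" unfolding D(2) max_ideal_iff using two_k Y_nonzero by auto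
 hence "fps_nth (Ph xc) 1 ~= 0" unfolding c(2) using c(1) max_ideal_zero by auto
 from taylor_reparam[OF Ph this] obtain Ps where Ps: "taylor_hom Ps" "Ps xc = fps_const xc + fps_X"
  "\<And>a. Ph a = fps_compose (Ps a) (Ph xc - fps_const xc)" by blast
 have x: "integral (Ps xc)" unfolding Ps(2) by (intro integral_add integral_const integral_X R_p X_R)
 show ?thesis
  by (rule that[OF R_p[OF X_R] Dz Ps]) (rule taylor_integral[OF Ps(1) x taylor_integral_x[OF Ps(1) x True]])
next
 case False
 hence f': "ev (pderiv f) xc ~= 0" "inverse (ev (pderiv f) xc) \<in> p" using Y_or_f' by auto
 hence Dz: "D yc \<notin> max_ideal p" unfolding D(3) max_ideal_iff by blast
 have "fps_nth (Ph yc) 1 ~= 0" unfolding c(2) D(3) using c(1) f'(1) by simp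
 from taylor_reparam[OF Ph this] obtain Ps where Ps: "taylor_hom Ps" "Ps yc = fps_const yc + fps_X"
  "\<And>a. Ph a = fps_compose (Ps a) (Ph yc - fps_const yc)" by blast
 have y: "integral (Ps yc)" unfolding Ps(2) by (intro integral_add integral_const integral_X R_p Y_R)
 show ?thesis
  by (rule that[OF R_p[OF Y_R] Dz Ps]) (rule taylor_integral[OF Ps(1) taylor_integral_y[OF Ps(1,2) f'] y])
qed

end

lemma prod_power_choose_two: "(\<Prod>i<n. s * (z::'b::comm_semiring_1) ^ i) = s ^ n * z ^ (n choose 2)"
proof (induction n)
 case (Suc n)
 have "Suc n choose 2 = n + (n choose 2)" by (simp add: numeral_2_eq_2)
 thus ?case by (simp add: Suc power_add mult_ac)
qed (simp add: binomial_eq_0)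

lemma mat_of_cols_mult:
 assumes A: "A \<in> carrier_mat n n" and ws: "set ws \<subseteq> carrier_vec n"
 shows "mat_of_cols n (map (\<lambda>w. A *\<^sub>v w) ws) = A * mat_of_cols n ws"
 by (rule eq_matI) (use assms in "auto simp: mat_of_cols_index col_mat_of_cols subset_iff")

text \<open>In the parameter \<open>z\<close> the jets of \<open>s a\<close> are \<open>A\<close> times the jets of \<open>a\<close>, with \<open>A\<close> lower
 triangular; the jets of \<open>a\<close> in \<open>p\<close> are integral there.\<close>

lemma (in chart_point) det_jets:
 fixes n :: nat
 assumes Ph: "taylor_hom Ph" and Ps: "taylor_hom Ps" "Ps z = fps_const z + fps_X"
  "\<And>a. Ph a = fps_compose (Ps a) (Ph z - fps_const z)" "\<And>h. h \<in> p ==> integral (Ps h)"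
  and z: "z \<in> p" and s: "s ~= 0"
 defines "JP \<equiv> {vec n (\<lambda>i. \<Sum>v\<in>S. c v * fps_nth (Ph v) i) |S c.
   finite S \<and> S \<subseteq> principal_ideal p s \<and> c ` S \<subseteq> p}"
 shows "rspan p {det (mat_of_cols n js) |js. length js = n \<and> set js \<subseteq> JP}
  = principal_ideal p (s ^ n * fps_nth (Ph z) 1 ^ (n choose 2))"
proof -
 define Z where "Z = Ph z - fps_const z"
 \<comment> \<open>The change from jets of a function in the parameter \<open>z\<close> to jets of
   \<open>s\<close> times that function as given by \<open>Ph\<close>. It is triangular because
   \<open>Ph z - z\<close> has no constant term.\<close>
 define A where "A = mat n n (\<lambda>(i, j). fps_nth (Ph s * Z ^ j) i)"
 have Z0: "fps_nth Z 0 = 0" using Ph unfolding Z_def taylor_hom_def by simp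
 have Z1: "fps_nth Z 1 = fps_nth (Ph z) 1" unfolding Z_def by simp
 have Zpow: "fps_nth (Z ^ j) m = 0" if "m < j" for j m
  using startsby_zero_power_prefix[OF Z0] that by blast
 have A: "A \<in> carrier_mat n n" unfolding A_def by simp
 have Azero: "fps_nth (Ph s * Z ^ j) i = 0" if "i < j" for i j
  unfolding fps_mult_nth using that by (intro sum.neutral ballI) (simp add: Zpow)
 have Adiag: "fps_nth (Ph s * Z ^ i) i = s * fps_nth (Ph z) 1 ^ i" for i
 proof -
  have "fps_nth (Ph s * Z ^ i) i = (\<Sum>k\<in>{0}. fps_nth (Ph s) k * fps_nth (Z ^ i) (i - k))"
   unfolding fps_mult_nth by (rule sum.mono_neutral_right) (auto simp: Zpow)
  also have "\<dots> = s * fps_nth Z 1 ^ i"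
   using Ph startsby_zero_power_nth_same[OF Z0, of i] unfolding taylor_hom_def by simp
  finally show ?thesis unfolding Z1 .
 qed
 have detA: "det A = s ^ n * fps_nth (Ph z) 1 ^ (n choose 2)"
 proof -
  have "det A = prod_list (diag_mat A)"
   by (rule det_lower_triangular[OF _ A]) (simp add: A_def Azero)
  also have "\<dots> = (\<Prod>i<n. s * fps_nth (Ph z) 1 ^ i)"
   using A unfolding prod_list_diag_prod by (simp add: A_def Adiag atLeast0LessThan del: One_nat_def)
  finally show ?thesis unfolding prod_power_choose_two .
 qed
 have jet: "fps_nth (Ph (s * a)) i = (\<Sum>j<n. A $$ (i, j) * fps_nth (Ps a) j)" if i: "i < n" for a i
 proof -
  have "Ph (s * a) = Ph s * fps_compose (Ps a) Z"
   using Ph Ps(3)[of a] unfolding taylor_hom_def Z_def by metis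
  hence "fps_nth (Ph (s * a)) i = (\<Sum>k=0..i. fps_nth (Ph s) k * (\<Sum>j=0..i - k. fps_nth (Ps a) j * fps_nth (Z ^ j) (i - k)))"
   by (simp only: fps_mult_nth fps_compose_nth)
  also have "\<dots> = (\<Sum>k=0..i. fps_nth (Ph s) k * (\<Sum>j<n. fps_nth (Ps a) j * fps_nth (Z ^ j) (i - k)))"
  proof (rule sum.cong[OF refl], rule arg_cong[where f = "(*) _"])
   fix k
   show "(\<Sum>j=0..i - k. fps_nth (Ps a) j * fps_nth (Z ^ j) (i - k)) = (\<Sum>j<n. fps_nth (Ps a) j * fps_nth (Z ^ j) (i - k))"
    by (rule sum.mono_neutral_left) (use i in "auto simp: Zpow")
  qed
  also have "\<dots> = (\<Sum>j<n. (\<Sum>k=0..i. fps_nth (Ph s) k * fps_nth (Z ^ j) (i - k)) * fps_nth (Ps a) j)"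
   unfolding sum_distrib_left sum_distrib_right by (subst sum.swap) (simp add: mult_ac)
  also have "\<dots> = (\<Sum>j<n. A $$ (i, j) * fps_nth (Ps a) j)"
   by (rule sum.cong) (use i in "simp_all add: A_def fps_mult_nth")
  finally show ?thesis .
 qed
 have col: "\<exists>w\<in>carrier_vec n. (\<forall>j<n. w $ j \<in> p) \<and> y = A *\<^sub>v w" if "y \<in> JP" for y
 proof -
  from that obtain S c where S: "finite S" "S \<subseteq> principal_ideal p s" "c ` S \<subseteq> p"
   and y: "y = vec n (\<lambda>i. \<Sum>v\<in>S. c v * fps_nth (Ph v) i)" unfolding JP_def by blast
  define w where "w = vec n (\<lambda>j. \<Sum>v\<in>S. c v * fps_nth (Ps (v / s)) j)"
  have w: "w \<in> carrier_vec n" unfolding w_def by simp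
  have wp: "\<forall>j<n. w $ j \<in> p"
  proof (intro allI impI)
   fix j assume "j < n"
   have "c v * fps_nth (Ps (v / s)) j \<in> p" if "v \<in> S" for v
   proof (rule mult_p)
    show "c v \<in> p" using S(3) that by blast
    have "v / s \<in> p" using principal_ideal_iff[OF s] S(2) that by blast
    from Ps(4)[OF this] show "fps_nth (Ps (v / s)) j \<in> p" unfolding integral_def by blast
   qed
   thus "w $ j \<in> p" unfolding w_def using \<open>j < n\<close> by (simp add: sum_mem)
  qed
  have "y = A *\<^sub>v w"
  proof (rule eq_vecI)
   fix i assume "i < dim_vec (A *\<^sub>v w)"
   hence i: "i < n" using A by simp
   have "y $ i = (\<Sum>v\<in>S. c v * fps_nth (Ph (s * (v / s))) i)" unfolding y using i s by simp
   also have "\<dots> = (\<Sum>v\<in>S. \<Sum>j<n. A $$ (i, j) * (c v * fps_nth (Ps (v / s)) j))"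
    unfolding jet[OF i] sum_distrib_left by (simp add: mult_ac)
   also have "\<dots> = (\<Sum>j<n. A $$ (i, j) * w $ j)"
    by (subst sum.swap) (simp add: w_def sum_distrib_left)
   also have "\<dots> = (A *\<^sub>v w) $ i"
    using i A w by (simp add: scalar_prod_def atLeast0LessThan)
   finally show "y $ i = (A *\<^sub>v w) $ i" .
  qed (use A y in simp)
  thus ?thesis using w wp by blast
 qed
 have sub: "{det (mat_of_cols n js) |js. length js = n \<and> set js \<subseteq> JP} \<subseteq> principal_ideal p (det A)"
 proof
  fix d assume "d \<in> {det (mat_of_cols n js) |js. length js = n \<and> set js \<subseteq> JP}"
  then obtain js where js: "length js = n" "set js \<subseteq> JP" "d = det (mat_of_cols n js)" by blast
  define w where "w y = (SOME w. w \<in> carrier_vec n \<and> (\<forall>j<n. w $ j \<in> p) \<and> y = A *\<^sub>v w)" for y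
  have w: "w y \<in> carrier_vec n \<and> (\<forall>j<n. w y $ j \<in> p) \<and> y = A *\<^sub>v w y" if "y \<in> JP" for y
   unfolding w_def by (rule someI_ex) (use col[OF that] in blast)
  let ?ws = "map w js"
  have ws: "set ?ws \<subseteq> carrier_vec n" using w js(2) by auto
  have "map (\<lambda>w. A *\<^sub>v w) ?ws = js" using w js(2) by (auto intro!: map_idI)
  hence m: "mat_of_cols n js = A * mat_of_cols n ?ws" using mat_of_cols_mult[OF A ws] by simp
  have W: "mat_of_cols n ?ws \<in> carrier_mat n n" using js(1) by (metis length_map mat_of_cols_carrier(1))
  have "det (mat_of_cols n ?ws) \<in> p"
  proof (rule det_mem[OF dvr_axioms W])
   fix i j assume ij: "i < n" "j < n"
   have "js ! j \<in> JP" using js ij by (auto simp: subset_iff)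
   thus "mat_of_cols n ?ws $$ (i, j) \<in> p" using w ij js(1) by (simp add: mat_of_cols_index)
  qed
  thus "d \<in> principal_ideal p (det A)"
   unfolding js(3) m det_mult[OF A W] principal_ideal_def by blast
 qed
 have "det A \<in> {det (mat_of_cols n js) |js. length js = n \<and> set js \<subseteq> JP}"
 proof -
  \<comment> \<open>The jets of the powers of \<open>z\<close> form a unitriangular matrix of
    binomial terms, so \<open>det A\<close> itself occurs among the determinants.\<close>
  define W where "W = map (\<lambda>k. vec n (\<lambda>j. fps_nth (Ps (z ^ k)) j)) [0..<n]"
  let ?js = "map (\<lambda>w. A *\<^sub>v w) W"
  have W: "set W \<subseteq> carrier_vec n" "length W = n" unfolding W_def by auto
  have Wc: "mat_of_cols n W \<in> carrier_mat n n" using W(2) by (metis mat_of_cols_carrier(1))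
  have ent: "mat_of_cols n W $$ (j, k) = of_nat (k choose j) * z ^ (k - j)" if "j < n" "k < n" for j k
   using that W(2) unfolding W_def by (simp add: mat_of_cols_index taylor_hom_power[OF Ps(1)] Ps(2) fps_binomial_nth)
  have "det (mat_of_cols n W) = prod_list (diag_mat (mat_of_cols n W))"
   by (rule det_upper_triangular[OF _ Wc]) (use Wc in "auto simp: upper_triangular_def ent binomial_eq_0")
  also have "\<dots> = 1" using Wc unfolding prod_list_diag_prod by (simp add: ent)
  finally have "det A = det (mat_of_cols n ?js)"
   unfolding mat_of_cols_mult[OF A W(1)] det_mult[OF A Wc] by simp
  moreover have "set ?js \<subseteq> JP"
  proof
   fix y assume "y \<in> set ?js"
   then obtain k where k: "k < n" "y = A *\<^sub>v vec n (\<lambda>j. fps_nth (Ps (z ^ k)) j)" unfolding W_def by auto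
   have "y = vec n (\<lambda>i. \<Sum>v\<in>{s * z ^ k}. (\<lambda>_. 1) v * fps_nth (Ph v) i)"
    unfolding k(2) by (rule eq_vecI) (use A in "simp_all add: jet scalar_prod_def atLeast0LessThan")
   moreover have "{s * z ^ k} \<subseteq> principal_ideal p s" unfolding principal_ideal_def using power_mem[OF z] by blast
   moreover have "(\<lambda>_. 1) ` {s * z ^ k} \<subseteq> p" using one_mem by simp
   moreover have "finite {s * z ^ k}" by simp
   ultimately show "y \<in> JP" unfolding JP_def
    by (intro CollectI exI[of _ "{s * z ^ k}"] exI[of _ "\<lambda>_. 1"] conjI)
  qed
  moreover have "length ?js = n" using W(2) by simp
  ultimately show ?thesis by (intro CollectI exI[of _ ?js] conjI)
 qed
 from rspan_eqI[OF sub this] show ?thesis unfolding detA .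
qed

section \<open>Functions with poles only at infinity\<close>

context hyp begin

text \<open>The Riemann--Roch space of \<open>m\<close> times the point at infinity.\<close>

definition Rm :: "nat => 'k set" where "Rm m = {h \<in> R. h = 0 \<or> inf.vord h \<ge> - int m}"

text \<open>\<open>x^i\<close> has pole order \<open>2 i\<close> and \<open>x^j y\<close> has
  \<open>2 j + 2 g + 1\<close>. The truncated subtraction leaves the second list empty for
  \<open>m \<le> 2 * g\<close>.\<close>

definition Rbasis :: "nat => 'k list" where
 "Rbasis m = map (\<lambda>i. xc ^ i) [0..<m div 2 + 1] @ map (\<lambda>j. xc ^ j * yc) [0..<(m + 1 - 2 * g) div 2]"

lemma length_Rbasis: "length (Rbasis m) = m div 2 + 1 + (m + 1 - 2 * g) div 2"
 unfolding Rbasis_def by simp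

text \<open>The pole orders of \<open>a(x)\<close> and \<open>b(x) y\<close> have different parity,
  so the pole order of the sum is the larger of the two.\<close>

lemma Rm_iff:
 "ev a xc + ev b xc * yc \<in> Rm m \<longleftrightarrow> (a = 0 \<or> 2 * degree a \<le> m) \<and> (b = 0 \<or> 2 * degree b + 2 * g + 1 \<le> m)"
proof -
 have R: "ev a xc + ev b xc * yc \<in> R" by (rule R_I[OF refl])
 have va: "a ~= 0 ==> inf.vord (ev a xc) = - int (2 * degree a)" using vord_ev by simp
 have vb: "b ~= 0 ==> inf.vord (ev b xc * yc) = - int (2 * degree b + 2 * g + 1)"
  using vord_ev vord_y ev_eq_0_iff Y_nonzero by (subst inf.vord_mult) auto
 have nz: "a ~= 0 ==> ev a xc ~= 0" "b ~= 0 ==> ev b xc * yc ~= 0" using ev_eq_0_iff Y_nonzero by auto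
 consider "a = 0" "b = 0" | "a = 0" "b ~= 0" | "a ~= 0" "b = 0" | "a ~= 0" "b ~= 0" by blast
 thus ?thesis
 proof cases
  case 1
  thus ?thesis unfolding Rm_def using zero_R by simp
 next
  case 2
  thus ?thesis unfolding Rm_def using R vb nz by auto
 next
  case 3
  thus ?thesis unfolding Rm_def using R va nz by auto
 next
  case 4
  show ?thesis
  proof (cases "2 * degree a < 2 * degree b + 2 * g + 1")
   case True
   hence "inf.vord (ev b xc * yc) < inf.vord (ev a xc)" using va vb 4 by simp
   from inf.vord_add_less[OF nz(2)[OF 4(2)] nz(1)[OF 4(1)] this] show ?thesis
    unfolding Rm_def using R vb[OF 4(2)] True 4 by (auto simp: add.commute)
  next
   case False
   hence "inf.vord (ev a xc) < inf.vord (ev b xc * yc)" using va vb 4 by simp presburger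
   from inf.vord_add_less[OF nz(1)[OF 4(1)] nz(2)[OF 4(2)] this] show ?thesis
    unfolding Rm_def using R va[OF 4(1)] False 4 by auto
  qed
 qed
qed

lemma subspace_Rm: "vs.subspace (Rm m)"
proof (rule vs.subspaceI)
 show "0 \<in> Rm m" unfolding Rm_def using zero_R by simp
 fix h k assume "h \<in> Rm m" "k \<in> Rm m"
 then obtain a b c d where ab: "h = ev a xc + ev b xc * yc" "k = ev c xc + ev d xc * yc"
  unfolding Rm_def R_def by blast
 with \<open>h \<in> Rm m\<close> \<open>k \<in> Rm m\<close> have "a = 0 \<or> 2 * degree a \<le> m" "b = 0 \<or> 2 * degree b + 2 * g + 1 \<le> m"
  "c = 0 \<or> 2 * degree c \<le> m" "d = 0 \<or> 2 * degree d + 2 * g + 1 \<le> m" using Rm_iff by simp_all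
 hence "a + c = 0 \<or> 2 * degree (a + c) \<le> m" "b + d = 0 \<or> 2 * degree (b + d) + 2 * g + 1 \<le> m"
  using degree_add_le_max[of a c] degree_add_le_max[of b d] by (auto simp: max_def split: if_splits)
 moreover have "h + k = ev (a + c) xc + ev (b + d) xc * yc" unfolding ab by (simp add: ev_add algebra_simps)
 ultimately show "h + k \<in> Rm m" using Rm_iff by simp
next
 fix c h assume h: "h \<in> Rm m"
 show "em c * h \<in> Rm m"
 proof (cases "c = 0 \<or> h = 0")
  case True
  thus ?thesis unfolding Rm_def using zero_R by auto
 next
  case False
  have "inf.vord (em c) = 0"
  proof -
   have "inverse (em c) = em (inverse c)" by (simp add: em_inverse)
   hence "em c \<in> inf.p" "inverse (em c) \<in> inf.p" using inf.em_p by simp_all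
   thus ?thesis using False inf.unit_iff_vord[of "em c"] inf.max_ideal_iff by simp
  qed
  hence "inf.vord (em c * h) = inf.vord h" using False inf.vord_mult[of "em c" h] by simp
  thus ?thesis using h False mult_R[OF em_R] unfolding Rm_def by auto
 qed
qed

lemma quot_basis_Rbasis: "quot_basis sc (Rm m) {0} (Rbasis m)"
proof -
 let ?k = "m div 2 + 1" and ?l = "(m + 1 - 2 * g) div 2"
 define P :: "(nat => 'a) => nat => 'a poly" where "P c k = (\<Sum>i<k. monom (c i) i)" for c k
 have coeffP: "coeff (P c k) j = (if j < k then c j else 0)" for c k j
  unfolding P_def by (simp add: coeff_sum)
 have evP: "ev (P c k) xc = (\<Sum>i<k. em (c i) * xc ^ i)" for c k
  unfolding P_def by (induction k) (simp_all add: ev_add ev_monom)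
 have lc: "lc sc (Rbasis m) c = ev (P c ?k) xc + ev (P (\<lambda>j. c (j + ?k)) ?l) xc * yc" for c
  unfolding Rbasis_def lc_append evP by (simp add: lc_def sum_distrib_right mult.assoc nth_append del: upt_Suc)
 show ?thesis
  unfolding quot_basis_def
 proof (intro conjI ballI allI impI)
  show "set (Rbasis m) \<subseteq> Rm m"
  proof
   fix h assume "h \<in> set (Rbasis m)"
   then consider i where "i < ?k" "h = xc ^ i" | j where "j < ?l" "h = xc ^ j * yc"
    unfolding Rbasis_def set_append set_map Un_iff image_iff set_upt by (metis atLeastLessThan_iff)
   thus "h \<in> Rm m"
   proof cases
    case 1
    thus ?thesis using Rm_iff[of "monom 1 i" 0 m] by (simp add: ev_monom degree_monom_eq)
   next
    case 2
    thus ?thesis using Rm_iff[of 0 "monom 1 j" m] by (simp add: ev_monom degree_monom_eq)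
   qed
  qed
 next
  fix h assume h: "h \<in> Rm m"
  then obtain a b where ab: "h = ev a xc + ev b xc * yc" unfolding Rm_def R_def by blast
  with h have d: "a = 0 \<or> 2 * degree a \<le> m" "b = 0 \<or> 2 * degree b + 2 * g + 1 \<le> m" using Rm_iff by simp_all
  have "P (coeff a) ?k = a"
   by (rule poly_eqI) (use d(1) in "auto simp: coeffP coeff_eq_0")
  moreover have "P (coeff b) ?l = b"
   by (rule poly_eqI) (use d(2) in "auto simp: coeffP coeff_eq_0")
  ultimately have "lc sc (Rbasis m) (\<lambda>i. if i < ?k then coeff a i else coeff b (i - ?k)) = h"
   unfolding lc ab by (simp add: P_def)
  thus "\<exists>c. h - lc sc (Rbasis m) c \<in> {0}" by auto
 next
  fix c i assume "lc sc (Rbasis m) c \<in> {0}" and i: "i < length (Rbasis m)"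
  hence "P c ?k = 0 \<and> P (\<lambda>j. c (j + ?k)) ?l = 0" unfolding lc by (intro indep) simp
  hence 0: "\<And>j. j < ?k ==> c j = 0" "\<And>j. j < ?l ==> c (j + ?k) = 0"
   using coeffP by (metis coeff_0)+
  show "c i = 0"
  proof (cases "i < ?k")
   case False
   hence "i - ?k < ?l" "i = i - ?k + ?k" using i unfolding length_Rbasis by linarith+
   thus ?thesis using 0(2) by metis
  qed (use 0 in blast)
 qed
qed

lemma R_Rm: "h \<in> R ==> \<exists>m. \<forall>m'\<ge>m. h \<in> Rm m'"
 by (intro exI[of _ "nat (- inf.vord h)"]) (auto simp: Rm_def)

lemma vord_R: assumes "s \<in> R" "s ~= 0" shows "inf.vord s \<le> 0"
proof (rule ccontr)
 assume "\<not> inf.vord s \<le> 0"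
 hence "s \<in> Rm 0" unfolding Rm_def using assms by simp
 moreover obtain a b where ab: "s = ev a xc + ev b xc * yc" using assms(1) by (rule R_E)
 ultimately have "degree a = 0" "b = 0" using Rm_iff[of a b 0] by auto
 then obtain e where "a = [:e:]" using degree_eq_zeroE[of a] by metis
 hence "\<exists>c. s = em c" using \<open>b = 0\<close> unfolding ab by (intro exI[of _ e]) simp
 then obtain c where c: "s = em c" by blast
 hence "inverse s = em (inverse c)" by (simp add: em_inverse)
 hence "inverse s \<in> inf.p" "s \<in> inf.p" using inf.em_p c by simp_all
 hence "inf.vord s = 0" using assms(2) inf.unit_iff_vord[of s] inf.max_ideal_iff by simp
 thus False using \<open>\<not> inf.vord s \<le> 0\<close> by simp
qed

text \<open>Euclid's argument: \<open>1\<close> plus \<open>x\<close> times a product of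
  polynomials, one from each maximal ideal, lies in no maximal ideal. It would be invertible in
  \<open>R\<close>, but a nonzero element of \<open>R\<close> cannot vanish at infinity. The zero
  section is thereby not isolated.\<close>

lemma infinite_pts: "infinite pts"
proof
 assume fin: "finite pts"
 have "\<exists>a. a ~= 0 \<and> ev a xc \<in> idl p" if "p \<in> pts" for p
  using chart_point.I_ev_ex[OF pts_E(1)[OF that]] .
 then obtain a where a: "\<And>p. p \<in> pts ==> a p ~= 0 \<and> ev (a p) xc \<in> idl p" by metis
 define Q where "Q = [:0, 1:] * (\<Prod>p\<in>pts. a p)"
 have "(\<Prod>p\<in>pts. a p) ~= 0" using a fin by auto
 hence "degree Q > 0" unfolding Q_def by (subst degree_mult_eq) auto
 hence dQ: "degree (1 + Q) > 0" by (simp add: degree_add_eq_right)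
 have "inverse (ev (1 + Q) xc) \<in> R"
 proof (rule R_eq, rule unit_pts[OF _ ev_R])
  fix p assume p: "p \<in> pts"
  interpret P: chart_point em xc yc f "idl p" by (rule pts_E(1)[OF p])
  have "ev Q xc = ev ([:0, 1:] * (\<Prod>q\<in>pts - {p}. a q)) xc * ev (a p) xc"
   unfolding Q_def prod.remove[OF fin p] ev_mult by (simp only: mult_ac)
  hence "ev Q xc \<in> idl p" using P.I_mult[OF conjunct2[OF a[OF p]] ev_R] by (simp only:)
  hence "ev (1 + Q) xc - ev Q xc \<in> idl p" if "ev (1 + Q) xc \<in> idl p" using P.I_diff[OF that] by blast
  thus "ev (1 + Q) xc \<notin> idl p" using P.I_one by (auto simp: ev_add)
 qed
 moreover have "1 + Q ~= 0" using dQ by auto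
 ultimately show False
  using vord_R[of "inverse (ev (1 + Q) xc)"] inf.vord_inverse[of "ev (1 + Q) xc"] vord_ev[of "1 + Q"] dQ ev_eq_0_iff by simp
qed

text \<open>This is the equality of zeros and poles. With \<open>d\<close> the pole order of
  \<open>s\<close>, multiplication by \<open>s\<close> maps \<open>Rm (m - d)\<close> onto the
  multiples of \<open>s\<close> in \<open>Rm m\<close>, and for large \<open>m\<close> these spaces
  differ in dimension by \<open>d\<close>.\<close>

lemma length_quot_R:
 assumes s: "s \<in> R" "s ~= 0" and bs: "quot_basis sc R (principal_ideal R s) bs"
 shows "int (length bs) = - inf.vord s"
proof -
 define d where "d = nat (- inf.vord s)"
 have d: "int d = - inf.vord s" using vord_R[OF s] unfolding d_def by simp
 have bsR: "set bs \<subseteq> R" using bs unfolding quot_basis_def by blast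
 have "\<exists>m. \<forall>m'\<ge>m. set bs \<subseteq> Rm m'" using bsR
 proof (induction bs)
  case (Cons b bs)
  then obtain m1 m2 where "\<forall>m'\<ge>m1. set bs \<subseteq> Rm m'" "\<forall>m'\<ge>m2. b \<in> Rm m'" using R_Rm[of b] by auto
  thus ?case by (intro exI[of _ "max m1 m2"]) simp
 qed simp
 then obtain m0 where m0: "\<And>m'. m' \<ge> m0 ==> set bs \<subseteq> Rm m'" by blast
 \<comment> \<open>Large enough to contain the basis \<open>bs\<close> and to keep both
   \<open>m\<close> and \<open>m - d\<close> at least \<open>2 g\<close>, where \<open>Rm k\<close>
   has dimension \<open>k + 1 - g\<close>.\<close>
 define m where "m = m0 + d + 2 * g"
 define T where "T h = s * h" for h
 have img: "T h \<in> Rm m \<longleftrightarrow> h \<in> Rm (m - d)" if h: "h \<in> R" for h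
 proof (cases "h = 0")
  case False
  have "s * h \<in> R" using s h by (rule_tac mult_R)
  moreover have "inf.vord (s * h) = - int d + inf.vord h" using False s d by (simp add: inf.vord_mult)
  moreover have "d \<le> m" unfolding m_def by simp
  ultimately show ?thesis using False s h unfolding Rm_def T_def by (simp add: of_nat_diff) linarith
 qed (simp add: Rm_def zero_R T_def)
 have sub: "Rm k \<subseteq> R" for k unfolding Rm_def by blast
 have U: "T ` Rm (m - d) = principal_ideal R s \<inter> Rm m"
  unfolding principal_ideal_def using img sub by (auto simp: T_def)
 have lin: "Vector_Spaces.linear sc sc T"
  by (rule Vector_Spaces.linear_iff[THEN iffD2]) (auto simp: T_def distrib_left mult.left_commute intro: vs.vector_space_axioms)
 have subU: "vs.subspace (principal_ideal R s \<inter> Rm m)"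
  by (rule vs.subspace_inter[OF s_ideal_subspace[OF s_ideal_principal[OF s(1)]] subspace_Rm])
 have 1: "quot_basis sc (Rm m) (principal_ideal R s \<inter> Rm m) bs"
  unfolding quot_basis_def
 proof (intro conjI ballI allI impI)
  show sb: "set bs \<subseteq> Rm m" by (rule m0) (simp add: m_def)
  fix h assume h: "h \<in> Rm m"
  hence "\<exists>c. h - lc sc bs c \<in> principal_ideal R s" using bs sub unfolding quot_basis_def by blast
  then obtain c where c: "h - lc sc bs c \<in> principal_ideal R s" by blast
  moreover have "h - lc sc bs c \<in> Rm m"
   by (intro vs.subspace_diff subspace_Rm h vs.lc_mem sb)
  ultimately show "\<exists>c. h - lc sc bs c \<in> principal_ideal R s \<inter> Rm m" by blast
 next
  fix c i assume "lc sc bs c \<in> principal_ideal R s \<inter> Rm m" "i < length bs"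
  thus "c i = 0" using bs unfolding quot_basis_def by blast
 qed
 have 2: "quot_basis sc (principal_ideal R s \<inter> Rm m) {0} (map T (Rbasis (m - d)))"
 proof (rule quot_basis_map[OF lin _ _ _ subspace_Rm _ quot_basis_Rbasis])
  show "T h \<in> principal_ideal R s \<inter> Rm m" if "h \<in> Rm (m - d)" for h using U that by blast
  show "\<exists>x\<in>Rm (m - d). y - T x \<in> {0}" if "y \<in> principal_ideal R s \<inter> Rm m" for y using U that by auto
  show "T h \<in> {0} \<longleftrightarrow> h \<in> {0}" for h using s unfolding T_def by simp
  show "vs.subspace {0}" by (rule vs.subspace_single_0)
 qed
 have "quot_basis sc (Rm m) {0} (bs @ map T (Rbasis (m - d)))"
  by (rule vs.quot_basis_tower[OF subU 1 2]) (use vs.subspace_0[OF subU] vs.subspace_single_0 in auto)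
 from vs.quot_basis_length[OF vs.subspace_single_0 this quot_basis_Rbasis]
 have "length bs + length (Rbasis (m - d)) = length (Rbasis m)" by simp
 moreover have "length (Rbasis k) = k + 1 - g" if "k \<ge> 2 * g" for k
  using that unfolding length_Rbasis by presburger
 ultimately have "length bs = d" unfolding m_def by simp
 thus ?thesis using d by simp
qed

end

lemma (in field_ext) em_2: "em 2 = 2" using em_add[of 1 1] by (simp only: em_one one_add_one)

lemma (in chart_point) vord_em: assumes "c ~= 0" shows "vord (em c) = 0"
proof -
 have "inverse (em c) \<in> p" using em_p[of "inverse c"] by (simp only: em_inverse)
 thus ?thesis using unit_iff_vord[of "em c"] em_p[of c] max_ideal_iff[of "em c"] assms by simp
qed

lemma (in dvr) vord_minus: assumes "a ~= 0" shows "vord (- a) = vord a"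
proof -
 have "vord (- 1) = 0" using unit_iff_vord[of "- 1"] max_ideal_iff[of "- 1"] minus_mem[OF one_mem] by simp
 thus ?thesis using vord_mult[of "- 1" a] assms by simp
qed

section \<open>Stalks of the bundles on the curve\<close>

locale hyp_model = hyp em xc yc f g D for em :: "'a::field => 'k::field" and xc yc f g D +
 fixes C :: "('a, 'k) hyp_curve" and Ph :: "'k => 'k fps"
 assumes C: "emb C = em" "xf C = xc" "yf C = yc" "rhs C = f" "genus C = g"
  and Phi: "taylor_hom Ph" "Ph xc = fps_const xc + fps_X" and D_Phi: "D = (\<lambda>a. 2 * yc * fps_nth (Ph a) 1)"
begin

definition cp :: "'k set set" where "cp = insert inf.p pts"
definition un :: "'k set => 'k" where "un p = (if p = inf.p then v else unif p)"
text \<open>\<open>th p * D\<close> generates the derivations regular at \<open>p\<close>; at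
  infinity the factor is the one in \<open>Dinf\<close>.\<close>

definition th :: "'k set => 'k" where "th p = (if p = inf.p then - (u ^ (g - 1)) else 1)"
definition Dl :: "'k set => 'k => 'k" where "Dl p h = th p * D h"
text \<open>The value of this local generator at \<open>x\<close>, which generates the tangent stalk
  when vector fields are identified with their values at \<open>x\<close>.\<close>

definition ta :: "'k set => 'k" where "ta p = th p * (2 * yc)"

lemma evalp_eq: "evalp C q h = ev q h"
 unfolding evalp_def ev_def C ..

lemma affine_ring_eq: "affine_ring C = R"
 unfolding affine_ring_def R_def evalp_eq C ..

lemma infty_pt_eq: "infty_pt C = inf.p"
 unfolding inf.p_def unfolding infty_pt_def inf.R_def Iinf_def evalp_eq uf_def vf_def C u_def[symmetric] v_def[symmetric] ..

lemma closed_points_eq: "closed_points C = cp"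
 unfolding closed_points_def affine_ring_eq infty_pt_eq cp_def pts_def ..

lemma derivations_C: "derivations C = Collect (derivation em)"
 unfolding derivations_eq C ..

lemma basis_mod_iff: "vs.subspace W ==> basis_mod C V W bs \<longleftrightarrow> quot_basis sc V W bs"
 unfolding basis_mod_def C by (rule vs.quot_basis_alt[symmetric])

lemma dim_mod_eq:
 assumes "vs.subspace W" "quot_basis sc V W bs" shows "dim_mod C V W = length bs"
 unfolding dim_mod_def
 by (rule the_equality) (use assms basis_mod_iff vs.quot_basis_length in blast)+

lemma inf_notin_pts: "inf.p \<notin> pts"
proof
 assume "inf.p \<in> pts"
 hence "xc \<in> inf.p" by (rule R_pts[OF _ X_R])
 thus False using vord_x inf.mem_iff_vord[OF x_nonzero] by simp
qed

lemma inf_cp: "inf.p \<in> cp" and pts_cp: "p \<in> pts ==> p \<in> cp"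
 unfolding cp_def by auto

lemma pts_simps: "p \<in> pts ==> th p = 1 \<and> un p = unif p \<and> ta p = 2 * yc \<and> Dl p = D \<and> p ~= inf.p"
 using inf_notin_pts unfolding th_def un_def ta_def Dl_def by auto

lemma inf_simps: "th inf.p = - (u ^ (g - 1))" "un inf.p = v" "Dl inf.p = Dinf" "ta inf.p = Dinf xc"
 unfolding th_def un_def ta_def Dl_def Dinf_def D_x by simp_all

lemma Dl_x: "Dl p xc = ta p" unfolding Dl_def ta_def D_x ..

lemma th_nonzero: "th p ~= 0" unfolding th_def using u_nonzero by simp

lemma ta_nonzero: "ta p ~= 0" unfolding ta_def using th_nonzero two_k Y_nonzero by simp

text \<open>A common description of the affine points and the point at infinity, so that each local
  statement is transferred once.\<close>

lemma local_chart:
 assumes "p \<in> cp"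
 obtains x y F I where "chart_point em x y F I" "p = chart_point.p em x y I" "un p = chart_point.pu em x y I"
  "derivation em (Dl p)" "Dl p x = 2 * y" "Dl p y = ev (pderiv F) x"
proof (cases "p = inf.p")
 case True
 show ?thesis
  by (rule that[OF inf.chart_point_axioms True]) (use True pi_inf Dinf Dinf_u Dinf_v in "simp_all add: inf_simps")
next
 case False
 hence p: "p \<in> pts" using assms unfolding cp_def by blast
 show ?thesis
  by (rule that[OF pts_E(1)[OF p] pts_E(2)[OF p, symmetric]]) (use p D D_x D_y in "simp_all add: pts_simps unif_def")
qed

lemma chart_facts:
 assumes "p \<in> cp"
 shows cp_dvr: "dvr p (un p)"
  and tangent_stalk_cp: "tangent C p = principal_ideal p (ta p)"
  and d_nonzero_cp: "d_nonzero_at C z p \<longleftrightarrow> Dl p z \<notin> max_ideal p"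
  and Dl_mem: "a \<in> p ==> Dl p a \<in> p"
  and em_cp: "em b \<in> p"
  and subspace_principal_cp: "vs.subspace (principal_ideal p s)"
  and finite_quotient_cp: "s ~= 0 ==> s \<in> p ==> \<exists>bs. quot_basis sc p (principal_ideal p s) bs"
  and etale_cp: "\<exists>t\<in>p. Dl p t \<notin> max_ideal p \<and> (\<forall>a\<in>p. \<exists>Q. a - ev Q t \<in> max_ideal p)"
  and etale_surj_cp: "t \<in> p ==> Dl p t \<notin> max_ideal p ==> \<forall>a\<in>p. \<exists>Q. a - ev Q t \<in> max_ideal p ==>
   s ~= 0 ==> a \<in> p ==> \<exists>Q. a - ev Q t \<in> principal_ideal p s"
proof -
 obtain x y F I where c: "chart_point em x y F I" and p: "p = chart_point.p em x y I" "un p = chart_point.pu em x y I"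
  and D': "derivation em (Dl p)" "Dl p x = 2 * y" "Dl p y = ev (pderiv F) x" by (rule local_chart[OF assms])
 interpret P: chart_point em x y F I by (rule c)
 show "dvr p (un p)" unfolding p(2) unfolding p(1) by (rule P.dvr_axioms)
 show "tangent C p = principal_ideal p (ta p)"
  using P.tangent_stalk[OF D', of xc] unfolding p(1)[symmetric] Dl_x tangent_def derivations_C C mem_Collect_eq .
 show "d_nonzero_at C z p \<longleftrightarrow> Dl p z \<notin> max_ideal p"
  using P.d_nonzero_iff[OF D', of z] unfolding p(1)[symmetric] d_nonzero_at_def derivations_C by blast
 note facts = P.derivation_mem[OF D'] P.em_p P.subspace_principal P.finite_quotient P.etale_exists[OF D']
  P.etale_surj[OF D', folded p(1)]
 show "a \<in> p ==> Dl p a \<in> p" "em b \<in> p" "vs.subspace (principal_ideal p s)"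
  "s ~= 0 ==> s \<in> p ==> \<exists>bs. quot_basis sc p (principal_ideal p s) bs"
  "\<exists>t\<in>p. Dl p t \<notin> max_ideal p \<and> (\<forall>a\<in>p. \<exists>Q. a - ev Q t \<in> max_ideal p)"
  using facts(1-5) unfolding p(1)[symmetric] by blast+
 assume "t \<in> p" "Dl p t \<notin> max_ideal p" "\<forall>a\<in>p. \<exists>Q. a - ev Q t \<in> max_ideal p" "s ~= 0" "a \<in> p"
 thus "\<exists>Q. a - ev Q t \<in> principal_ideal p s" by (intro facts(6)) blast+
qed

lemma finite_bad: assumes "h ~= 0" shows "finite {q \<in> cp. \<not> (h \<in> q \<and> inverse h \<in> q)}"
proof (rule finite_subset)
 show "{q \<in> cp. \<not> (h \<in> q \<and> inverse h \<in> q)} \<subseteq> insert inf.p {q \<in> pts. \<not> (h \<in> q \<and> inverse h \<in> q)}"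
  unfolding cp_def by blast
 show "finite (insert inf.p {q \<in> pts. \<not> (h \<in> q \<and> inverse h \<in> q)})"
  by (rule finite.insertI[OF finite_not_unit[OF assms]])
qed

text \<open>Any Hasse family assembles to a Taylor homomorphism with \<open>x\<close> going to
  \<open>x + X\<close>, and by \<open>taylor_hom_eqI\<close> there is only one.\<close>

lemma hasse_eq: "hasse C xc = (\<lambda>k a. fps_nth (Ph a) k)"
 unfolding hasse_def
proof (rule the_equality)
 show "hasse_family C xc (\<lambda>k a. fps_nth (Ph a) k)"
  unfolding hasse_family_def C taylor_hom_power[OF Phi(1)] Phi(2) fps_binomial_nth
  using Phi(1) unfolding taylor_hom_def by (auto simp: fps_mult_nth[of "Ph _"] atLeast0AtMost)
next
 fix H assume H: "hasse_family C xc H"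
 define Ps where "Ps a = Abs_fps (\<lambda>k. H k a)" for a
 have pow: "H k (xc ^ n) = of_nat (n choose k) * xc ^ (n - k)" for k n
  using H unfolding hasse_family_def by blast
 have one: "H k 1 = (if k = 0 then 1 else 0)" for k using pow[of k 0] by (simp add: binomial_eq_0)
 have "Ps (em c) = fps_const (em c)" for c
 proof (rule fps_ext)
  fix k
  have "H k (em c * 1) = em c * H k 1" using H unfolding hasse_family_def C by blast
  thus "fps_nth (Ps (em c)) k = fps_nth (fps_const (em c)) k" unfolding Ps_def one by simp
 qed
 moreover have "Ps (a * b) = Ps a * Ps b" "Ps (a + b) = Ps a + Ps b" "fps_nth (Ps a) 0 = a" for a b
  using H unfolding hasse_family_def Ps_def
  by (auto intro!: fps_ext simp: fps_mult_nth atLeast0AtMost)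
 ultimately have "taylor_hom Ps" unfolding taylor_hom_def by blast
 moreover have "Ps xc = Ph xc"
 proof (rule fps_ext)
  fix k show "fps_nth (Ps xc) k = fps_nth (Ph xc) k"
   using pow[of k 1] unfolding Ps_def Phi(2) by (cases k) (auto simp: binomial_eq_0 fps_X_nth)
 qed
 ultimately have "Ps = Ph" using taylor_hom_eqI Phi(1) by blast
 thus "H = (\<lambda>k a. fps_nth (Ph a) k)" unfolding Ps_def fun_eq_iff by (metis fps_nth_Abs_fps)
qed

definition sO :: "nat => 'k set => 'k" where "sO m p = (if p = inf.p then inverse (v ^ m) else 1)"

lemma v_nonzero: "v ~= 0" using inf.pi_nz unfolding pi_inf .

lemma sO_nonzero: "sO m p ~= 0" unfolding sO_def using v_nonzero by simp

lemma O_infty_stalk: assumes "p \<in> cp" shows "O_infty C m p = principal_ideal p (sO m p)"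
proof (cases "p = inf.p")
 case True
 have "hom_sheaf (\<lambda>p. max_pow p m) (\<lambda>p. p) inf.p = principal_ideal inf.p (1 / v ^ m)"
  by (rule inf.hom_sheaf_principal) (use v_nonzero in "simp_all add: inf.max_pow_eq inf.principal_ideal_one pi_inf")
 thus ?thesis using True unfolding O_infty_def infty_pt_eq hom_sheaf_def sO_def by (simp add: inverse_eq_divide)
next
 case False
 interpret P: dvr p "un p" by (rule cp_dvr[OF assms])
 show ?thesis using False unfolding O_infty_def infty_pt_eq sO_def by (simp add: P.principal_ideal_one)
qed

lemma H0_O_infty: "H0 C (O_infty C m) = Rm m"
proof -
 have "h \<in> H0 C (O_infty C m) \<longleftrightarrow> h \<in> Rm m" for h
 proof -
  have 1: "O_infty C m p = p" if "p \<in> pts" for p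
   using pts_simps[OF that] unfolding O_infty_def infty_pt_eq by simp
  have 2: "h \<in> O_infty C m inf.p \<longleftrightarrow> h = 0 \<or> inf.vord h \<ge> - int m"
   unfolding O_infty_stalk[OF inf_cp] sO_def using v_nonzero
   by (simp add: inf.principal_ideal_vord inf.vord_inverse inf.vord_power vord_v)
  have "h \<in> R \<longleftrightarrow> (\<forall>p\<in>pts. h \<in> p)" using R_eq R_pts by blast
  thus ?thesis unfolding H0_def sections_on_def closed_points_eq cp_def Rm_def using 1 2 by auto
 qed
 thus ?thesis by blast
qed

lemma h0_O_infty: "h0 C (O_infty C m) = m div 2 + 1 + (m + 1 - 2 * g) div 2"
 unfolding h0_def H0_O_infty dim_mod_eq[OF vs.subspace_single_0 quot_basis_Rbasis] length_Rbasis ..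

text \<open>The generator of \<open>L^n\<close> tensor \<open>K^(n choose 2)\<close>: the Taylor
  coefficient of order \<open>i\<close> contributes one factor \<open>L\<close> and \<open>i\<close>
  factors of the canonical bundle \<open>K\<close>.\<close>

definition eg :: "nat => nat => 'k set => 'k" where "eg n m p = sO m p ^ n * inverse (ta p) ^ (n choose 2)"

lemma eg_nonzero: "eg n m p ~= 0" unfolding eg_def using sO_nonzero ta_nonzero by simp

text \<open>\<open>det_jets\<close> produces a power of \<open>dz/dx\<close> for a local parameter
  \<open>z\<close>. This derivative is \<open>Dl p z / ta p\<close>, and the unit
  \<open>Dl p z\<close> drops out of the ideal.\<close>

lemma det_principal_parts_stalk:
 assumes p: "p \<in> cp" shows "det_principal_parts C n (O_infty C m) p = principal_ideal p (eg n m p)"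
proof -
 obtain x y F I where c: "chart_point em x y F I" and pp: "p = chart_point.p em x y I"
  and D': "derivation em (Dl p)" "Dl p x = 2 * y" "Dl p y = ev (pderiv F) x" by (rule local_chart[OF p])
 interpret P: chart_point em x y F I by (rule c)
 have PhiD: "fps_nth (Ph a) 1 = inverse (ta p) * Dl p a" for a
  unfolding Dl_def ta_def fun_cong[OF D_Phi, of a] using th_nonzero[of p] two_k Y_nonzero by (simp add: field_simps)
 have "inverse (ta p) ~= 0" using ta_nonzero by simp
 from P.taylor_parameter[OF D' Phi(1) this PhiD] obtain z Ps where
  z: "z \<in> P.p" "Dl p z \<notin> max_ideal P.p" and Ps: "taylor_hom Ps" "Ps z = fps_const z + fps_X"
  "\<And>a. Ph a = fps_compose (Ps a) (Ph z - fps_const z)" "\<And>h. h \<in> P.p ==> P.integral (Ps h)" by metis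
 have w: "Dl p z \<in> p" "Dl p z ~= 0" "inverse (Dl p z) \<in> p"
  using Dl_mem[OF p] z P.max_ideal_iff P.max_ideal_zero unfolding pp[symmetric] by auto
 have "det_principal_parts C n (O_infty C m) p = principal_ideal p (sO m p ^ n * fps_nth (Ph z) 1 ^ (n choose 2))"
  using P.det_jets[OF Phi(1) Ps z(1) sO_nonzero[of m p], of n]
  unfolding pp[symmetric] det_principal_parts_def principal_parts_def O_infty_stalk[OF p] C hasse_eq .
 also have "sO m p ^ n * fps_nth (Ph z) 1 ^ (n choose 2) = eg n m p * Dl p z ^ (n choose 2)"
  unfolding PhiD eg_def by (simp add: power_mult_distrib)
 also have "principal_ideal p \<dots> = principal_ideal p (eg n m p)"
 proof -
  interpret Q: dvr p "un p" by (rule cp_dvr[OF p])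
  have "Q.vord (Dl p z) = 0" using w Q.unit_iff_vord[of "Dl p z"] Q.max_ideal_iff by simp
  thus ?thesis using w eg_nonzero[of n m p] by (simp add: Q.principal_ideal_eq Q.vord_mult Q.vord_power)
 qed
 finally show ?thesis .
qed

lemma canonical_stalk: assumes "p \<in> cp" shows "canonical C p = principal_ideal p (inverse (ta p))"
proof -
 interpret P: dvr p "un p" by (rule cp_dvr[OF assms])
 have "hom_sheaf (tangent C) (\<lambda>p. p) p = principal_ideal p (1 / ta p)"
  by (rule P.hom_sheaf_principal) (simp_all add: tangent_stalk_cp[OF assms] P.principal_ideal_one ta_nonzero)
 thus ?thesis unfolding canonical_def by (simp add: inverse_eq_divide)
qed

lemma pluecker_stalk:
 assumes "p \<in> cp"
 shows "tensor (tensor_pow (O_infty C m) n) (tensor_pow (canonical C) (n choose 2)) p = principal_ideal p (eg n m p)"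
proof -
 interpret P: dvr p "un p" by (rule cp_dvr[OF assms])
 show ?thesis unfolding eg_def
  by (intro P.tensor_principal P.tensor_pow_principal O_infty_stalk canonical_stalk assms)
qed

text \<open>\<open>2 (g - 1)\<close> from the factor \<open>u ^ (g - 1)\<close> minus the pole order
  \<open>2 g + 1\<close> of \<open>y\<close>.\<close>

lemma vord_ta_inf: "inf.vord (ta inf.p) = - 3"
proof -
 have t: "inf.vord 2 = 0" using inf.vord_em[OF two] by (simp only: em_2)
 have e: "ta inf.p = - (u ^ (g - 1) * (2 * yc))" unfolding ta_def inf_simps by simp
 have "inf.vord (ta inf.p) = inf.vord (u ^ (g - 1)) + (inf.vord 2 + inf.vord yc)"
 proof -
  have n: "u ^ (g - 1) ~= 0" "2 * yc ~= 0" using u_nonzero two_k Y_nonzero by simp_all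
  show ?thesis unfolding e inf.vord_minus[OF no_zero_divisors[OF n]] inf.vord_mult[OF n] inf.vord_mult[OF two_k Y_nonzero] ..
 qed
 hence "inf.vord (ta inf.p) = int (g - 1) * 2 - (2 * int g + 1)"
  unfolding inf.vord_power[OF u_nonzero] vord_u vord_y t by simp
 thus ?thesis using g_pos by (simp add: of_nat_diff)
qed

lemma vord_eg_inf: "inf.vord (eg n m inf.p) = 3 * int (n choose 2) - int n * int m"
proof -
 have "inf.vord (sO m inf.p) = - int m" unfolding sO_def using v_nonzero
  by (simp add: inf.vord_inverse inf.vord_power vord_v)
 thus ?thesis unfolding eg_def using sO_nonzero ta_nonzero
  by (simp add: inf.vord_mult inf.vord_power inf.vord_inverse vord_ta_inf)
qed

lemma eg_pts: "p \<in> pts ==> eg n m p = inverse (2 * yc) ^ (n choose 2)"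
 unfolding eg_def sO_def using pts_simps by simp

lemma quot_basis_inf: "quot_basis sc inf.p (max_ideal inf.p) [1]"
 unfolding quot_basis_def
proof (intro conjI ballI allI impI)
 fix h assume "h \<in> inf.p"
 then obtain c where "h - em c \<in> minf" using inf_residue by blast
 thus "\<exists>c. h - lc sc [1] c \<in> minf" by (intro exI[of _ "\<lambda>_. c"]) (simp add: lc_def)
next
 fix c i assume c: "lc sc [1] c \<in> minf" and "i < length [1 :: 'k]"
 hence i: "i = 0" by simp
 show "c i = 0"
 proof (rule ccontr)
  assume "c i ~= 0"
  moreover have "em (c 0) \<in> minf" using c by (simp add: lc_def)
  ultimately show False using i inf.max_ideal_iff[of "em (c 0)"] inf.em_p[of "inverse (c 0)"] by (simp add: em_inverse)
 qed
qed (simp add: inf.one_mem)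

text \<open>On the affine part the generator is a power of \<open>1/(2y)\<close>, so beside infinity
  only the zeros of \<open>y\<close> contribute. There \<open>y\<close> is the uniformizer, and
  their residue degrees add up to the pole order \<open>2 g + 1\<close> of \<open>y\<close>.\<close>

lemma degree_eg:
 assumes M: "\<And>p. p \<in> cp ==> M p = principal_ideal p (eg n m p)"
 shows "bundle_degree C M = int n * int m + int (n choose 2) * (2 * int g - 2)"
proof -
 let ?K = "int (n choose 2)"
 define Z where "Z = {p \<in> pts. yc \<in> idl p}"
 have finZ: "finite Z" unfolding Z_def by (rule finite_pts_containing[OF Y_R Y_nonzero])
 have ord: "order_of_one M p = - dvr.vord p (un p) (eg n m p)" if "p \<in> cp" for p
  using dvr.order_of_one_eq[of p _ M, OF cp_dvr[OF that] M[OF that] eg_nonzero] .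
 have unY: "unif p = yc" if "p \<in> Z" for p
  unfolding unif_def using that chart_point.pu_def[OF pts_E(1), of p] unfolding Z_def by simp
 have vord: "dvr.vord p (unif p) (inverse (2 * yc) ^ (n choose 2)) = (if p \<in> Z then - ?K else 0)" if p: "p \<in> pts" for p
 proof -
  interpret P: dvr p "unif p" by (rule pts_dvr[OF p])
  have "inverse (em 2) \<in> p" using em_cp[OF pts_cp[OF p], of "inverse 2"] by (simp only: em_inverse)
  hence "P.vord 2 = 0" using em_cp[OF pts_cp[OF p], of 2] two_k P.unit_iff_vord[of 2] P.max_ideal_iff[of 2]
   unfolding em_2 by blast
  hence v: "P.vord (inverse (2 * yc) ^ (n choose 2)) = - ?K * P.vord yc"
   using two_k Y_nonzero P.vord_power[of "inverse (2 * yc)"] P.vord_inverse[of "2 * yc"]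
   by (simp add: P.vord_mult del: inverse_mult_distrib)
  show ?thesis
  proof (cases "p \<in> Z")
   case True
   thus ?thesis using v P.vord_pi unY by simp
  next
   case False
   hence "yc \<notin> max_ideal p" "yc \<in> p" using R_pts[OF p Y_R] p unfolding Z_def idl_def by (auto simp: Y_R)
   hence "P.vord yc = 0" using P.unit_iff_vord[OF Y_nonzero] by blast
   thus ?thesis using v False by simp
  qed
 qed
 have ordp: "order_of_one M p = (if p \<in> Z then ?K else 0)" if p: "p \<in> pts" for p
  using ord[OF pts_cp[OF p]] vord[OF p] eg_pts[OF p] pts_simps[OF p] by simp
 have ordi: "order_of_one M inf.p = int n * int m - 3 * ?K"
  using ord[OF inf_cp] vord_eg_inf[of n m] unfolding inf_simps(2) pi_inf by simp
 have dimi: "dim_mod C inf.p (max_ideal inf.p) = 1"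
  using dim_mod_eq[OF _ quot_basis_inf] inf.subspace_principal unfolding inf.max_ideal_eq by simp
 obtain bs where bs: "quot_basis sc R (principal_ideal R yc) bs"
  using R_quot[OF Y_R Y_nonzero s_ideal_subspace[OF s_ideal_principal[OF Y_R]] subspace_R] s_ideal_principal[OF Y_R]
  unfolding s_ideal_def by blast
 have lbs: "int (length bs) = 2 * int g + 1" using length_quot_R[OF Y_R Y_nonzero bs] vord_y by simp
 have mi: "max_ideal p = principal_ideal p yc" if "p \<in> Z" for p
  using dvr.max_ideal_eq[OF pts_dvr] unY[OF that] that unfolding Z_def by fastforce
 have "\<exists>b. quot_basis sc p (principal_ideal p yc) b" if "p \<in> Z" for p
  by (rule finite_quotient_cp) (use that Y_nonzero R_pts Y_R pts_cp in "auto simp: Z_def")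
 then obtain b where b: "\<And>p. p \<in> Z ==> quot_basis sc p (principal_ideal p yc) (b p)" by metis
 have "length bs = (\<Sum>p\<in>Z. length (b p))"
  unfolding Z_def by (rule length_quot[OF Y_R Y_nonzero bs]) (rule b, simp add: Z_def)
 also have "\<dots> = (\<Sum>p\<in>Z. dim_mod C p (max_ideal p))"
 proof (rule sum.cong[OF refl])
  fix p assume p: "p \<in> Z"
  hence "p \<in> cp" unfolding Z_def cp_def by blast
  from dim_mod_eq[OF subspace_principal_cp[OF this] b[OF p]] show "length (b p) = dim_mod C p (max_ideal p)"
   unfolding mi[OF p] by simp
 qed
 finally have sumZ: "(\<Sum>p\<in>Z. int (dim_mod C p (max_ideal p))) = 2 * int g + 1" using lbs by simp
 have iZ: "inf.p \<notin> Z" using inf_notin_pts unfolding Z_def by blast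
 have "bundle_degree C M = (\<Sum>p\<in>insert inf.p Z. order_of_one M p * int (dim_mod C p (max_ideal p)))"
  unfolding bundle_degree_def closed_points_eq
 proof (rule sum.mono_neutral_left)
  show "{p \<in> cp. order_of_one M p ~= 0} \<subseteq> insert inf.p Z" using ordp unfolding cp_def by auto
  show "\<forall>p\<in>insert inf.p Z - {p \<in> cp. order_of_one M p ~= 0}. order_of_one M p * int (dim_mod C p (max_ideal p)) = 0"
   unfolding Z_def cp_def by auto
 qed (use finZ in simp)
 also have "\<dots> = int n * int m - 3 * ?K + (\<Sum>p\<in>Z. order_of_one M p * int (dim_mod C p (max_ideal p)))"
  using finZ iZ by (simp add: ordi dimi)
 also have "(\<Sum>p\<in>Z. order_of_one M p * int (dim_mod C p (max_ideal p))) = (\<Sum>p\<in>Z. ?K * int (dim_mod C p (max_ideal p)))"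
  by (rule sum.cong) (use ordp in "auto simp: Z_def")
 also have "\<dots> = ?K * (2 * int g + 1)" unfolding sum_distrib_left[symmetric] sumZ ..
 finally show ?thesis by (simp add: algebra_simps)
qed

end

lemma gamma_C_even: "even (gamma_C g l)"
 unfolding gamma_C_def by auto

text \<open>\<open>n\<close> is \<open>l + 1\<close> for \<open>l \<le> g\<close> and
  \<open>2 l - g + 1\<close> beyond, which produces the two cases of \<open>gamma_C\<close>.\<close>

lemma gamma_C_eq:
 assumes "1 \<le> g" and n: "n = 2 * l div 2 + 1 + (2 * l + 1 - 2 * g) div 2"
 shows "int n * int (2 * l) + int (n choose 2) * (2 * int g - 2) = int (gamma_C g l)"
proof -
 have "even (n * (n - 1))" by (cases n) auto
 hence "2 * (n choose 2) = n * (n - 1)" unfolding choose_two by simp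
 hence "2 * int (n choose 2) = int (n * (n - 1))" by (metis of_nat_mult of_nat_numeral)
 moreover have "n \<ge> 1" unfolding n by simp
 ultimately have "2 * int (n choose 2) = int n * (int n - 1)" by (simp only: of_nat_mult of_nat_diff of_nat_1)
 moreover have "int (n choose 2) * (2 * int g - 2) = (2 * int (n choose 2)) * (int g - 1)" by (simp add: algebra_simps)
 ultimately have "int (n choose 2) * (2 * int g - 2) = int n * (int n - 1) * (int g - 1)" by (simp only:)
 hence e: "int n * int (2 * l) + int (n choose 2) * (2 * int g - 2) = int n * (2 * int l + (int n - 1) * (int g - 1))"
  by (simp add: algebra_simps)
 show ?thesis
 proof (cases "l \<le> g")
  case True
  hence "n = l + 1" unfolding n by presburger
  thus ?thesis unfolding e gamma_C_def using True by (simp add: algebra_simps)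
 next
  case False
  hence n: "int n = 2 * int l - int g + 1" "2 * l - g + 1 = n" unfolding n by presburger+
  show ?thesis unfolding e gamma_C_def using False unfolding n(2) of_nat_mult of_nat_power
   by (simp add: n(1) power2_eq_square algebra_simps)
 qed
qed

section \<open>Local indices\<close>

context hyp_model begin

definition lr :: "'k set => 'k => 'a" where "lr p = (if p = inf.p then inf.rho else lamp p)"
text \<open>\<open>lr\<close> is normalised by the local generator \<open>Dl p\<close>. The factor
  \<open>th p\<close> refers all points to the single differential dual to \<open>D\<close>, as a
  sum over points requires.\<close>

definition lg :: "'k set => 'k => 'a" where "lg p h = lr p (th p * h)"

lemma res_datum:
 assumes "p \<in> cp" obtains P where "residue_datum em p (un p) P (lr p) (Dl p)"
proof (cases "p = inf.p")
 case True
 show ?thesis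
  by (rule that[of inf.PQ]) (use infr.residue_datum_axioms True in "simp add: lr_def inf_simps pi_inf")
next
 case False
 hence p: "p \<in> pts" using assms unfolding cp_def by blast
 show ?thesis
  by (rule that[of "Pp p"]) (use pts_residue[OF p] pts_simps[OF p] in "simp add: lr_def")
qed

text \<open>\<open>G(t)\<close> generates the same ideal as the local equation of the section, so
  the theory for \<open>G(t)\<close> applies, and replacing \<open>1/G(t)\<close> by the inverse of
  the local equation does not affect the residues in question.\<close>

lemma scheja_storch_eq:
 assumes p: "p \<in> cp" and t: "t \<in> p" "Dl p t \<notin> max_ideal p" "\<forall>a\<in>p. \<exists>Q. a - ev Q t \<in> max_ideal p"
  and ph: "ph \<in> max_ideal p" "ph ~= 0" "max_pow p n \<subseteq> principal_ideal p ph" "ev G t - ph \<in> max_pow p (2 * n)"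
 shows "scheja_storch_functional C p ph t G (\<lambda>a. lr p (a * Dl p t / ph))" (is ?A)
  and "scheja_storch_functional C p ph t G et ==> s \<in> p ==> et s = lr p (s * Dl p t / ph)"
proof -
 obtain P where "residue_datum em p (un p) P (lr p) (Dl p)" using res_datum[OF p] .
 then interpret r: residue_datum em p "un p" P "lr p" "Dl p" .
 let ?g = "ev G t" and ?d = "ev G t - ph"
 have vph: "r.vord ph > 0" using ph(1) r.max_ideal_iff_vord[OF ph(2)] by blast
 have vn: "r.vord ph \<le> int n"
  using ph(2,3) r.pi_nonzero unfolding r.max_pow_eq by (simp add: r.principal_ideal_subset r.vord_power r.vord_pi)
 have vd: "?d = 0 \<or> r.vord ?d \<ge> 2 * int n"
  using ph(4) r.pi_nonzero unfolding r.max_pow_eq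
  by (subst (asm) r.principal_ideal_vord) (simp_all add: r.vord_power r.vord_pi)
 have g: "?g ~= 0 \<and> r.vord ?g = r.vord ph"
 proof (cases "?d = 0")
  case False
  hence "r.vord ph < r.vord ?d" using vd vn vph by linarith
  from r.vord_add_less[OF ph(2) False this] show ?thesis by simp
 qed (use ph(2) in simp)
 hence pg: "principal_ideal p ?g = principal_ideal p ph" using ph(2) by (simp add: r.principal_ideal_eq)
 interpret b: bezoutian em p "un p" P "lr p" "Dl p" t G ?g
 proof
  fix a assume "a \<in> p"
  thus "\<exists>Q. a - ev Q t \<in> principal_ideal p ?g" using etale_surj_cp[OF p t] g by blast
 qed (use t g in auto)
 \<comment> \<open>The numerator has order at least \<open>2 n\<close> and the denominator at most
   \<open>2 n\<close>; this is the purpose of the precision \<open>2 n\<close> in the choice of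
   \<open>G\<close>.\<close>
 have quot: "?d / (?g * ph) \<in> p"
 proof (cases "?d = 0")
  case False
  hence "r.vord (?d / (?g * ph)) \<ge> 0" using g ph(2) vd vn by (simp add: r.vord_divide r.vord_mult)
  moreover have "?d / (?g * ph) ~= 0" using False g ph(2) by simp
  ultimately show ?thesis using r.mem_iff_vord by blast
 next
  case True
  thus ?thesis using r.zero_mem by simp
 qed
 have eq: "lr p (a * Dl p t / ?g) = lr p (a * Dl p t / ph)" if "a \<in> p" for a
 proof -
  have "a * Dl p t / ph - a * Dl p t / ?g = (a * Dl p t) * (?d / (?g * ph))"
   using g ph(2) by (simp add: field_simps)
  also have "\<dots> \<in> p" by (intro r.mult_mem that Dl_mem[OF p t(1)] quot)
  finally have "lr p (a * Dl p t / ph - a * Dl p t / ?g) = 0" by (rule r.lam_zero)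
  thus ?thesis unfolding r.lam_diff by simp
 qed
 have bz: "bezout_coeff C G t i = bez G t i" for i unfolding bezout_coeff_def bez_def C ..
 have tp: "t ^ i \<in> p" for i by (rule r.power_mem[OF t(1)])
 have ssf: "scheja_storch_functional C p ph t G ze \<longleftrightarrow>
   b.functional ze \<and> (\<Sum>i<degree G. em (ze (t ^ i)) * bez G t i) - 1 \<in> principal_ideal p ?g" for ze
  unfolding scheja_storch_functional_def b.functional_def pg C bz by blast
 have fn: "b.functional (\<lambda>a. lr p (a * Dl p t / ?g))" by (rule b.functional_residue[OF Dl_mem[OF p t(1)]])
 have rs: "(\<Sum>i<degree G. em (lr p (t ^ i * Dl p t / ?g)) * bez G t i) - 1 \<in> principal_ideal p ?g"
  by (rule b.scheja_storch_residue[OF r.comm[OF t(1)]])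
 have "lr p (ph * a * Dl p t / ph) = 0" if "a \<in> p" for a
  using r.lam_zero[OF r.mult_mem[OF that Dl_mem[OF p t(1)]]] ph(2) by simp
 hence "b.functional (\<lambda>a. lr p (a * Dl p t / ph))"
  unfolding b.functional_def pg unfolding principal_ideal_def
  by (auto simp: distrib_right add_divide_distrib r.lam_add mult.assoc r.lam_scale simp flip: times_divide_eq_right)
 thus ?A unfolding ssf using rs unfolding eq[OF tp] by blast
 assume "scheja_storch_functional C p ph t G et" and s: "s \<in> p"
 hence "b.functional et" "(\<Sum>i<degree G. em (et (t ^ i)) * bez G t i) - 1 \<in> principal_ideal p ?g" unfolding ssf by blast+
 from b.scheja_storch_unique[OF fn rs this s] show "et s = lr p (s * Dl p t / ph)" unfolding eq[OF s] .
qed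

text \<open>Multiplication by a generator transports the local algebra of the section to a quotient
  of fractional ideals; this links index bases with bases of \<open>N p\<close> modulo
  \<open>W p\<close>.\<close>

lemma quot_basis_scale:
 assumes p: "p \<in> cp" and s: "s ~= 0" "ph ~= 0" and bs: "quot_basis sc p (principal_ideal p ph) bs"
 shows "quot_basis sc (principal_ideal p s) (principal_ideal p (ph * s)) (map (\<lambda>a. s * a) bs)"
proof (rule quot_basis_map[OF _ _ _ _ _ _ bs])
 interpret P: dvr p "un p" by (rule cp_dvr[OF p])
 show "Vector_Spaces.linear sc sc (\<lambda>a. s * a)"
  by (rule Vector_Spaces.linear_iff[THEN iffD2]) (auto simp: distrib_left mult.left_commute intro: vs.vector_space_axioms)
 show "s * x \<in> principal_ideal p s" if "x \<in> p" for x using that unfolding principal_ideal_def by blast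
 show "\<exists>x\<in>p. y - s * x \<in> principal_ideal p (ph * s)" if y: "y \<in> principal_ideal p s" for y
 proof -
  obtain x where x: "x \<in> p" "y = s * x" using y unfolding principal_ideal_def by blast
  have "0 \<in> principal_ideal p (ph * s)" using P.principal_submod unfolding submod_closed_def by blast
  thus ?thesis using x by (intro bexI[of _ x]) simp_all
 qed
 show "s * x \<in> principal_ideal p (ph * s) \<longleftrightarrow> x \<in> principal_ideal p ph" for x
  using s by (simp add: P.principal_ideal_iff mult.commute)
 show "vs.subspace p" using subspace_principal_cp[OF p, of 1] unfolding P.principal_ideal_one .
 show "vs.subspace (principal_ideal p (ph * s))" by (rule subspace_principal_cp[OF p])
qed

end

section \<open>The local forms of an oriented section\<close>

locale oriented_section = hyp_model em xc yc f g D C Ph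
 for em :: "'a::field => 'k::field" and xc yc f g D C Ph +
 fixes E N :: "'k subsheaf" and c :: 'k and ee :: "'k set => 'k" and sg :: 'k
 assumes E_stalk: "\<And>p. p \<in> cp ==> E p = principal_ideal p (ee p)" and ee_nonzero: "\<And>p. p \<in> cp ==> ee p ~= 0"
  and orient: "relative_orientation C E N c"
  and sec: "sg \<in> H0 C E" "sg ~= 0"
begin

lemma c_nonzero: "c ~= 0" using orient unfolding relative_orientation_def bundle_iso_def by blast

definition nu :: "'k set => 'k" where "nu p = (SOME s. s ~= 0 \<and> N p = principal_ideal p s)"
text \<open>A compatible trivialization has \<open>c e / D' x = s^2\<close> with
  \<open>D' = D / D t\<close>. Then \<open>w s^2 = e D t / sg\<close>, which is the density in the
  Scheja--Storch functional for whatever \<open>t\<close> and \<open>e\<close>.\<close>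

definition w :: 'k where "w = 2 * yc / (c * sg)"
text \<open>The local equation \<open>sg / ee p\<close> times \<open>N p\<close>;
  \<open>W_dual\<close> recognises it as the dual lattice of \<open>N p\<close>.\<close>

definition W :: "'k set => 'k set" where "W p = principal_ideal p (sg / ee p * nu p)"
definition B :: "'k set => 'k => 'k => 'a" where "B p x y = lg p (w * x * y)"

lemma N_open:
 assumes "p \<in> cp"
 obtains U s where "open_subset C U" "p \<in> U" "s ~= 0" "\<And>q. q \<in> U ==> N q = principal_ideal q s"
proof -
 have "line_bundle C N" using orient unfolding relative_orientation_def by (rule conjunct1)
 then obtain U s where "open_subset C U" "p \<in> U" and g: "generates_on N U s"
  using assms unfolding line_bundle_def closed_points_eq by blast
 moreover have "N q = principal_ideal q s" if "q \<in> U" for q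
  using g that unfolding generates_on_def principal_ideal_def by (simp only: simp_thms)
 moreover have "s ~= 0" using g unfolding generates_on_def by (rule conjunct1)
 ultimately show ?thesis using that[of U s] by (simp only: simp_thms)
qed

lemma N_stalk: assumes "p \<in> cp" shows "nu p ~= 0" "N p = principal_ideal p (nu p)"
proof -
 obtain U s where s: "p \<in> U" "s ~= 0" "\<And>q. q \<in> U ==> N q = principal_ideal q s" using N_open[OF assms] by metis
 have "\<exists>s. s ~= 0 \<and> N p = principal_ideal p s" by (rule exI, rule conjI, rule s(2), rule s(3), rule s(1))
 hence 1: "nu p ~= 0 \<and> N p = principal_ideal p (nu p)" unfolding nu_def by (rule someI_ex)
 show "nu p ~= 0" by (rule conjunct1[OF 1])
 show "N p = principal_ideal p (nu p)" by (rule conjunct2[OF 1])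
qed

lemma w_nonzero: "w ~= 0" unfolding w_def using c_nonzero sec(2) two_k Y_nonzero by simp

lemma orient_vord:
 assumes p: "p \<in> cp"
 shows "dvr.vord p (un p) (c * (ee p / ta p)) = 2 * dvr.vord p (un p) (nu p)"
proof -
 interpret P: dvr p "un p" by (rule cp_dvr[OF p])
 note n = N_stalk[OF p] ee_nonzero[OF p] ta_nonzero[of p] c_nonzero
 have "(\<lambda>h. c * h) ` hom_sheaf (tangent C) E p = tensor N N p"
  using orient p unfolding relative_orientation_def bundle_iso_def closed_points_eq by blast
 also have "hom_sheaf (tangent C) E p = principal_ideal p (ee p / ta p)"
  by (rule P.hom_sheaf_principal) (rule tangent_stalk_cp[OF p] E_stalk[OF p] n)+
 also have "(\<lambda>h. c * h) ` principal_ideal p (ee p / ta p) = principal_ideal p (c * (ee p / ta p))"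
  by (rule P.image_principal)
 also have "tensor N N p = principal_ideal p (nu p * nu p)" by (rule P.tensor_principal) (rule n(2))+
 finally have "P.vord (c * (ee p / ta p)) = P.vord (nu p * nu p)"
  by (subst (asm) P.principal_ideal_eq) (use n in auto)
 thus ?thesis using n by (simp add: P.vord_mult)
qed

text \<open>The element is \<open>nu^2\<close> divided by \<open>c * ee / ta\<close>, which have
  equal order by the orientation. That it is a unit means that \<open>B p\<close> identifies
  \<open>W p\<close> with the dual of \<open>N p\<close>.\<close>

lemma kappa:
 assumes p: "p \<in> cp" shows "dvr.vord p (un p) (th p * w * (sg / ee p * nu p) * nu p) = 0"
proof -
 interpret P: dvr p "un p" by (rule cp_dvr[OF p])
 note n = N_stalk(1)[OF p] ee_nonzero[OF p] ta_nonzero[of p] c_nonzero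
 have "th p * w * (sg / ee p * nu p) * nu p = (nu p * nu p) / (c * (ee p / ta p))"
  unfolding w_def ta_def using n sec(2) by (simp add: field_simps)
 thus ?thesis using orient_vord[OF p] n by (simp add: P.vord_divide P.vord_mult)
qed

lemma sg_stalk: assumes "p \<in> cp" shows "sg / ee p \<in> p"
proof -
 interpret P: dvr p "un p" by (rule cp_dvr[OF assms])
 have "sg \<in> E p" using sec(1) assms unfolding H0_def sections_on_def closed_points_eq by blast
 thus ?thesis unfolding E_stalk[OF assms] P.principal_ideal_iff[OF ee_nonzero[OF assms]] .
qed

lemma zeros_iff: "p \<in> zeros C E sg \<longleftrightarrow> p \<in> cp \<and> sg / ee p \<in> max_ideal p"
proof (cases "p \<in> cp")
 case True
 interpret P: dvr p "un p" by (rule cp_dvr[OF True])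
 note e = ee_nonzero[OF True]
 have "tensor max_ideal E p = principal_ideal p (un p * ee p)"
  by (rule P.tensor_principal) (rule P.max_ideal_eq E_stalk[OF True])+
 moreover have "sg \<in> principal_ideal p (un p * ee p) \<longleftrightarrow> sg / ee p \<in> principal_ideal p (un p)"
  using P.pi_nonzero e by (simp add: P.principal_ideal_iff mult.commute)
 ultimately show ?thesis unfolding zeros_def closed_points_eq P.max_ideal_eq using True by simp
qed (simp add: zeros_def closed_points_eq)

lemma W_sub: assumes "p \<in> cp" shows "W p \<subseteq> N p"
proof -
 interpret P: dvr p "un p" by (rule cp_dvr[OF assms])
 note n = N_stalk[OF assms] ee_nonzero[OF assms] sec(2)
 have s: "sg / ee p ~= 0" using n by simp
 have "P.vord (sg / ee p) \<ge> 0" using P.mem_iff_vord[OF s] sg_stalk[OF assms] by blast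
 thus ?thesis unfolding W_def n(2) using P.vord_mult[OF s n(1)] P.principal_ideal_subset[OF _ n(1), of "sg / ee p * nu p"] s n(1)
  by simp
qed

lemma W_dual: assumes p: "p \<in> cp" shows "W p = principal_ideal p (inverse (th p * w * nu p))"
proof -
 interpret P: dvr p "un p" by (rule cp_dvr[OF p])
 note n = N_stalk(1)[OF p] ee_nonzero[OF p] th_nonzero[of p] w_nonzero sec(2)
 have nz: "sg / ee p * nu p ~= 0" "th p * w * nu p ~= 0" "inverse (th p * w * nu p) ~= 0" using n by simp_all
 have "P.vord (sg / ee p * nu p) + P.vord (th p * w * nu p) = 0"
  unfolding P.vord_mult[OF nz(1,2), symmetric] using kappa[OF p] by (simp only: mult_ac)
 thus ?thesis unfolding W_def P.principal_ideal_eq[OF nz(1,3)] P.vord_inverse[OF nz(2)] by simp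
qed

text \<open>By \<open>lam_nondeg\<close> an element whose multiples by \<open>p\<close> all have
  residue zero is regular, so orthogonality to a lattice is integrality of the product with its
  generator.\<close>

lemma dual_iff:
 assumes p: "p \<in> cp" and m: "m ~= 0"
 shows "(\<forall>y\<in>principal_ideal p m. B p x y = 0) \<longleftrightarrow> x \<in> principal_ideal p (inverse (th p * w * m))"
proof -
 obtain P where "residue_datum em p (un p) P (lr p) (Dl p)" using res_datum[OF p] .
 then interpret r: residue_datum em p "un p" P "lr p" "Dl p" .
 have nz: "inverse (th p * w * m) ~= 0" using m th_nonzero w_nonzero by simp
 have "x / inverse (th p * w * m) = th p * w * x * m" by (simp only: divide_inverse inverse_inverse_eq mult_ac)
 hence "x \<in> principal_ideal p (inverse (th p * w * m)) \<longleftrightarrow> th p * w * x * m \<in> p"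
  unfolding r.principal_ideal_iff[OF nz] by (simp only:)
 also have "\<dots> \<longleftrightarrow> (\<forall>a\<in>p. lr p (th p * w * x * m * a) = 0)"
  using r.lam_nondeg r.lam_zero r.mult_mem by blast
 also have "\<dots> \<longleftrightarrow> (\<forall>y\<in>principal_ideal p m. B p x y = 0)"
  unfolding principal_ideal_def B_def lg_def by (auto simp: mult.assoc)
 finally show ?thesis by simp
qed

lemma bilinear_form_principal:
 assumes p: "p \<in> cp" and m: "m ~= 0" and sub: "principal_ideal p (inverse (th p * w * m)) \<subseteq> principal_ideal p m"
 shows "bilinear_form sc (principal_ideal p m) (principal_ideal p (inverse (th p * w * m))) (B p)"
proof -
 obtain P where "residue_datum em p (un p) P (lr p) (Dl p)" using res_datum[OF p] .
 then interpret r: residue_datum em p "un p" P "lr p" "Dl p" .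
 show ?thesis
 proof
  show "vs.subspace (principal_ideal p m)" "vs.subspace (principal_ideal p (inverse (th p * w * m)))"
   by (rule subspace_principal_cp[OF p])+
  show "principal_ideal p (inverse (th p * w * m)) \<subseteq> principal_ideal p m" by (rule sub)
  show "B p x y = B p y x" for x y unfolding B_def by (simp add: mult_ac)
  show "B p (x + y) z = B p x z + B p y z" for x y z
   unfolding B_def lg_def by (simp add: distrib_left distrib_right r.lam_add)
  show "B p (em b * x) z = b * B p x z" for b x z
  proof -
   have "th p * (w * (em b * x) * z) = em b * (th p * (w * x * z))" by (simp add: mult_ac)
   thus ?thesis unfolding B_def lg_def by (simp only: r.lam_scale)
  qed
 qed (use dual_iff[OF p m] in blast)+
qed

lemma bilinear_form_B: assumes p: "p \<in> cp" shows "bilinear_form sc (N p) (W p) (B p)"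
 using bilinear_form_principal[OF p N_stalk(1)[OF p]] W_sub[OF p] unfolding W_dual[OF p] N_stalk(2)[OF p] by blast

text \<open>The square root \<open>s\<close> given by compatibility carries the local algebra to
  \<open>N p\<close> modulo \<open>W p\<close>. Since \<open>th w s^2\<close> is the density of the
  Scheja--Storch functional, this is an isometry, and the chart and the trivialization disappear
  from the form.\<close>

lemma compatible_props:
 assumes p: "p \<in> cp" and chart: "nisnevich_chart C p U t" and triv: "compatible_triv C E N c U t e"
 obtains s where "s ~= 0" "principal_ideal p s = N p" "sg / e ~= 0" "principal_ideal p (sg / e * s) = W p"
  "th p * w * s * s = Dl p t / (sg / e)" "e ~= 0" "principal_ideal p e = E p"
proof -
 interpret P: dvr p "un p" by (rule cp_dvr[OF p])
 note n = N_stalk[OF p] ee_nonzero[OF p] ta_nonzero[of p] c_nonzero th_nonzero[of p] two_k Y_nonzero sec(2)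
 from chart have pU: "p \<in> U" and t: "t \<in> p" "Dl p t \<notin> max_ideal p"
  unfolding nisnevich_chart_def sections_on_def using d_nonzero_cp[OF p] by blast+
 from triv pU have e: "e ~= 0" "principal_ideal p e = E p"
  unfolding compatible_triv_def generates_on_def principal_ideal_def by blast+
 from triv obtain D' s where D': "derivation em D'" "D' t = 1" and s: "s \<in> N p" "c * (e / D' xc) = s * s"
  using pU unfolding compatible_triv_def derivations_C C sections_on_def by blast
 let ?h = "D' xc / (2 * yc)"
 have "D' = (\<lambda>a. ?h * D a)"
  by (rule derivation_eqI[OF D'(1) derivation_scale[OF D]]) (use D_x n in simp)
 hence h: "?h * D t = 1" using D'(2) by metis
 hence Dt: "D t ~= 0" by auto
 have "D' xc = (?h * D t) * (2 * yc / D t)" using n Dt by simp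
 hence D'x: "D' xc = 2 * yc / D t" unfolding h by simp
 have Dlt: "Dl p t ~= 0" unfolding Dl_def using n Dt by simp
 have u: "P.vord (Dl p t) = 0" using P.unit_iff_vord[OF Dlt] Dl_mem[OF p t(1)] t(2) by blast
 have D'x': "D' xc = ta p / Dl p t" unfolding D'x ta_def Dl_def using n by simp
 have ve: "P.vord e = P.vord (ee p)" using e n unfolding E_stalk[OF p] by (simp add: P.principal_ideal_eq)
 have s0: "s ~= 0" using s(2) e(1) n Dt unfolding D'x by auto
 have "c * (ee p / ta p) * (e / ee p * Dl p t) = s * s" using s(2) n unfolding D'x' by simp
 hence "P.vord (c * (ee p / ta p)) = P.vord (s * s)"
  using n e Dlt ve u by (metis (no_types) P.vord_mult P.vord_divide add_0_right diff_self divide_eq_0_iff mult_eq_0_iff)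
 hence vs: "P.vord s = P.vord (nu p)" using orient_vord[OF p] s0 by (simp add: P.vord_mult)
 show ?thesis
 proof (rule that[of s])
  show "principal_ideal p s = N p" unfolding n using s0 n vs by (simp add: P.principal_ideal_eq)
  show "principal_ideal p (sg / e * s) = W p"
   unfolding W_def using s0 n vs e ve by (simp add: P.principal_ideal_eq P.vord_mult P.vord_divide)
  show "th p * w * s * s = Dl p t / (sg / e)"
   unfolding mult.assoc s(2)[symmetric] unfolding D'x w_def Dl_def using n e Dt by (simp add: field_simps)
 qed (use s0 e n in auto)
qed

lemma local_index_gram:
 assumes p: "p \<in> zeros C E sg" and ind: "is_local_index C E N c sg p bb"
 shows "\<exists>bs. quot_basis sc (N p) (W p) bs \<and> bb = gw_class (gram (B p) bs)"
proof -
 have pc: "p \<in> cp" using p zeros_iff by blast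
 interpret P: dvr p "un p" by (rule cp_dvr[OF pc])
 from ind obtain U t e ph n G et bs where ch: "nisnevich_chart C p U t" and tr: "compatible_triv C E N c U t e"
  and ph: "ph = sg / e" "max_pow p n \<subseteq> principal_ideal p ph" "ev G t - ph \<in> max_pow p (2 * n)"
  and et: "scheja_storch_functional C p ph t G et" and bs: "basis_mod C p (principal_ideal p ph) bs"
  and bb: "bb = gw_class (gram (\<lambda>a b. et (a * b)) bs)"
  unfolding is_local_index_def evalp_eq gram_def by blast
 obtain s where s: "s ~= 0" "principal_ideal p s = N p" "sg / e ~= 0" "principal_ideal p (sg / e * s) = W p"
  "th p * w * s * s = Dl p t / (sg / e)" "e ~= 0" "principal_ideal p e = E p" using compatible_props[OF pc ch tr] by metis
 from ch have t: "t \<in> p" "Dl p t \<notin> max_ideal p" "\<forall>a\<in>p. \<exists>Q. a - ev Q t \<in> max_ideal p"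
  unfolding nisnevich_chart_def sections_on_def evalp_eq using d_nonzero_cp[OF pc] by blast+
 have "P.vord e = P.vord (ee p)" using s ee_nonzero[OF pc] unfolding E_stalk[OF pc] by (simp add: P.principal_ideal_eq)
 hence phm: "ph \<in> max_ideal p" "ph ~= 0" using p s(3,6) ee_nonzero[OF pc] sec(2) unfolding zeros_iff ph(1)
  by (simp_all add: P.max_ideal_iff_vord P.vord_divide)
 have qb: "quot_basis sc p (principal_ideal p ph) bs" using bs basis_mod_iff[OF subspace_principal_cp[OF pc]] by blast
 have "gram (B p) (map (\<lambda>a. s * a) bs) = gram (\<lambda>a b. et (a * b)) bs"
 proof (rule gram_map)
  fix x y assume "x \<in> set bs" "y \<in> set bs"
  hence "x * y \<in> p" using qb P.mult_mem unfolding quot_basis_def by blast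
  from scheja_storch_eq(2)[OF pc t phm ph(2,3) et this]
  have "et (x * y) = lr p (x * y * (Dl p t / ph))" by simp
  also have "x * y * (Dl p t / ph) = th p * (w * (s * x) * (s * y))"
   unfolding ph(1) s(5)[symmetric] by (simp add: mult_ac)
  finally show "B p (s * x) (s * y) = et (x * y)" unfolding B_def lg_def by simp
 qed
 thus ?thesis using quot_basis_scale[OF pc s(1,3) qb[unfolded ph(1)]] bb unfolding s(2,4) by metis
qed

text \<open>For \<open>t\<close> etale at \<open>p\<close> and a generator \<open>s\<close> of
  \<open>N\<close> near \<open>p\<close>, the trivialization \<open>e = s^2 (2y / D t) / c\<close>
  is compatible by construction. \<open>U\<close> leaves out the finitely many points where
  \<open>t\<close> has a pole or fails to be etale.\<close>

lemma chart_exists: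
 assumes p: "p \<in> cp"
 shows "\<exists>U t e. nisnevich_chart C p U t \<and> compatible_triv C E N c U t e"
proof -
 obtain t where t: "t \<in> p" "Dl p t \<notin> max_ideal p" "\<forall>a\<in>p. \<exists>Q. a - ev Q t \<in> max_ideal p" using etale_cp[OF p] by blast
 obtain U0 s where U0: "open_subset C U0" "p \<in> U0" and s: "s ~= 0" "\<And>q. q \<in> U0 ==> N q = principal_ideal q s"
  using N_open[OF p] by metis
 have "Dl p t ~= 0" using t(2) dvr.max_ideal_zero[OF cp_dvr[OF p]] by auto
 hence Dt: "D t ~= 0" unfolding Dl_def by auto
 hence t0: "t ~= 0" using derivation_0[OF D] by auto
 define U where "U = {q \<in> U0. t \<in> q \<and> Dl q t \<notin> max_ideal q}"
 have U0cp: "U0 \<subseteq> cp" using U0 unfolding open_subset_def closed_points_eq by blast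
 have "cp - U \<subseteq> (cp - U0) \<union> {q \<in> cp. \<not> (t \<in> q \<and> inverse t \<in> q)} \<union> insert inf.p {q \<in> cp. \<not> (D t \<in> q \<and> inverse (D t) \<in> q)}"
 proof
  fix q assume q: "q \<in> cp - U"
  have "Dl q t \<notin> max_ideal q" if "q ~= inf.p" "D t \<in> q" "inverse (D t) \<in> q"
  proof -
   have "q \<in> pts" using q that unfolding cp_def by blast
   hence "Dl q t = D t" using pts_simps by metis
   thus ?thesis using that Dt dvr.max_ideal_iff[OF cp_dvr, of q] q by simp
  qed
  thus "q \<in> (cp - U0) \<union> {q \<in> cp. \<not> (t \<in> q \<and> inverse t \<in> q)} \<union> insert inf.p {q \<in> cp. \<not> (D t \<in> q \<and> inverse (D t) \<in> q)}"
   using q unfolding U_def by blast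
 qed
 moreover have "finite (cp - U0)" using U0 unfolding open_subset_def closed_points_eq by blast
 ultimately have "finite (cp - U)" using finite_bad[OF t0] finite_bad[OF Dt] by (simp add: finite_subset)
 hence open_U: "open_subset C U" unfolding open_subset_def closed_points_eq U_def using U0cp by auto
 have pU: "p \<in> U" unfolding U_def using U0 t by blast
 have ch: "nisnevich_chart C p U t"
  unfolding nisnevich_chart_def sections_on_def evalp_eq using open_U pU t(3) d_nonzero_cp U0cp unfolding U_def by blast
 define e where "e = s * s * (2 * yc / D t) / c"
 have n: "c ~= 0" "2 * yc ~= 0" using c_nonzero two_k Y_nonzero by simp_all
 have e0: "e ~= 0" unfolding e_def using s(1) n Dt by simp
 have "E q = principal_ideal q e" if q: "q \<in> U" for q
 proof -
  have qc: "q \<in> cp" and qU: "q \<in> U0" and tq: "t \<in> q" "Dl q t \<notin> max_ideal q" using q U0cp unfolding U_def by blast+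
  interpret Q: dvr q "un q" by (rule cp_dvr[OF qc])
  note m = N_stalk[OF qc] ee_nonzero[OF qc] ta_nonzero[of q] th_nonzero[of q]
  have Dq: "Dl q t ~= 0" unfolding Dl_def using m Dt by simp
  have v0: "Q.vord (Dl q t) = 0" using Q.unit_iff_vord[OF Dq] Dl_mem[OF qc tq(1)] tq(2) by blast
  have "principal_ideal q s = principal_ideal q (nu q)" using s(2)[OF qU] m(2) by simp
  hence vs: "Q.vord s = Q.vord (nu q)" using s(1) m by (simp add: Q.principal_ideal_eq)
  have e': "e = s * s * (ta q / Dl q t) / c" unfolding e_def ta_def Dl_def using m by simp
  have "Q.vord e = Q.vord (ee q)"
   using orient_vord[OF qc] vs v0 m s(1) n(1) Dq unfolding e' by (simp add: Q.vord_mult Q.vord_divide)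
  thus ?thesis unfolding E_stalk[OF qc] using e0 m by (simp add: Q.principal_ideal_eq)
 qed
 hence gen: "generates_on E U e" unfolding generates_on_def principal_ideal_def using e0 by blast
 define D' where "D' a = inverse (D t) * D a" for a
 have "derivation em D'" unfolding D'_def by (rule derivation_scale[OF D])
 moreover have "D' t = 1" unfolding D'_def using Dt by simp
 moreover have "c * (e / D' xc) = s * s" unfolding D'_def D_x e_def using n Dt by (simp add: field_simps)
 moreover have "s \<in> sections_on N U" unfolding sections_on_def
 proof
  fix q assume "q \<in> U"
  hence q: "q \<in> U0" "q \<in> cp" using U0cp unfolding U_def by blast+
  have "s * 1 \<in> principal_ideal q s" unfolding principal_ideal_def using dvr.one_mem[OF cp_dvr[OF q(2)]] by blast
  thus "s \<in> N q" unfolding s(2)[OF q(1)] by simp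
 qed
 ultimately have "compatible_triv C E N c U t e"
  unfolding compatible_triv_def derivations_C C using gen by blast
 thus ?thesis using ch by blast
qed

text \<open>The local order of the section may serve as \<open>n\<close>, and
  \<open>etale_surj_cp\<close> supplies a polynomial \<open>G\<close> of the required
  precision.\<close>

lemma local_index_exists:
 assumes p: "p \<in> zeros C E sg" shows "\<exists>bb. is_local_index C E N c sg p bb"
proof -
 have pc: "p \<in> cp" using p zeros_iff by blast
 interpret P: dvr p "un p" by (rule cp_dvr[OF pc])
 obtain U t e where ch: "nisnevich_chart C p U t" and tr: "compatible_triv C E N c U t e" using chart_exists[OF pc] by blast
 obtain s where s: "sg / e ~= 0" "e ~= 0" "principal_ideal p e = E p" using compatible_props[OF pc ch tr] by metis
 from ch have t: "t \<in> p" "Dl p t \<notin> max_ideal p" "\<forall>a\<in>p. \<exists>Q. a - ev Q t \<in> max_ideal p"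
  unfolding nisnevich_chart_def sections_on_def evalp_eq using d_nonzero_cp[OF pc] by blast+
 let ?ph = "sg / e"
 have "P.vord e = P.vord (ee p)" using s ee_nonzero[OF pc] unfolding E_stalk[OF pc] by (simp add: P.principal_ideal_eq)
 hence phm: "?ph \<in> max_ideal p" using p s ee_nonzero[OF pc] sec(2) unfolding zeros_iff
  by (simp add: P.max_ideal_iff_vord P.vord_divide)
 hence php: "?ph \<in> p" by (rule P.max_ideal_sub)
 define n where "n = nat (P.vord ?ph)"
 have "int n = P.vord ?ph" using P.mem_iff_vord[OF s(1)] php unfolding n_def by simp
 hence n: "max_pow p n \<subseteq> principal_ideal p ?ph"
  unfolding P.max_pow_eq using s(1) P.pi_nonzero by (simp add: P.principal_ideal_subset P.vord_power P.vord_pi)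
 have "un p ^ (2 * n) ~= 0" using P.pi_nonzero by simp
 from etale_surj_cp[OF pc t this php] obtain G where "?ph - ev G t \<in> principal_ideal p (un p ^ (2 * n))" by blast
 then obtain a where a: "a \<in> p" "?ph - ev G t = un p ^ (2 * n) * a" unfolding principal_ideal_def by blast
 have "ev G t - ?ph = un p ^ (2 * n) * (- a)" using a(2) by (metis minus_diff_eq mult_minus_right)
 hence G: "ev G t - ?ph \<in> max_pow p (2 * n)" unfolding P.max_pow_eq principal_ideal_def using P.minus_mem[OF a(1)] by blast
 obtain bs where bs: "quot_basis sc p (principal_ideal p ?ph) bs" using finite_quotient_cp[OF pc s(1) php] by blast
 show ?thesis
  unfolding is_local_index_def evalp_eq basis_mod_iff[OF subspace_principal_cp[OF pc]]
  using ch tr n G scheja_storch_eq(1)[OF pc t phm s(1) n G] bs by blast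
qed

lemma W_basis: assumes "p \<in> cp" shows "\<exists>bs. quot_basis sc (N p) (W p) bs"
proof -
 interpret P: dvr p "un p" by (rule cp_dvr[OF assms])
 note n = N_stalk[OF assms] ee_nonzero[OF assms] sec(2)
 have "sg / ee p ~= 0" using n by simp
 from finite_quotient_cp[OF assms this sg_stalk[OF assms]] obtain bs where
  "quot_basis sc p (principal_ideal p (sg / ee p)) bs" by blast
 from quot_basis_scale[OF assms n(1) \<open>sg / ee p ~= 0\<close> this] show ?thesis unfolding W_def n(2) by blast
qed

lemma local_index_eq:
 assumes p: "p \<in> zeros C E sg" and bs: "quot_basis sc (N p) (W p) bs"
 shows "\<exists>!bb. is_local_index C E N c sg p bb" "local_index C E N c sg p = gw_class (gram (B p) bs)"
proof -
 have "p \<in> cp" using p zeros_iff by blast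
 then interpret b: bilinear_form sc "N p" "W p" "B p" by (rule bilinear_form_B)
 have u: "bb = gw_class (gram (B p) bs)" if "is_local_index C E N c sg p bb" for bb
  using local_index_gram[OF p that] b.gw_class_gram_unique[OF _ bs] by blast
 moreover obtain bb where "is_local_index C E N c sg p bb" using local_index_exists[OF p] by blast
 ultimately show ex: "\<exists>!bb. is_local_index C E N c sg p bb" by blast
 show "local_index C E N c sg p = gw_class (gram (B p) bs)"
  unfolding local_index_def by (rule u) (rule theI'[OF ex])
qed

end

section \<open>The residue theorem and the Lagrangian\<close>

lemma gram_Nil: "gram B [] = 0\<^sub>m 0 0" by (rule eq_matI) (auto simp: gram_def)

section \<open>Orthogonal sums over finitely many points\<close>

context field_ext begin

definition scF :: "'a => ('i => 'k) => 'i => 'k" where "scF c a = (\<lambda>i. em c * a i)"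

text \<open>Families are zero outside \<open>Z\<close>, so that they are determined by their values
  on \<open>Z\<close> and the empty sum is the zero space.\<close>

definition fam :: "'i set => ('i => 'k set) => ('i => 'k) set" where
 "fam Z V = {a. (\<forall>i\<in>Z. a i \<in> V i) \<and> (\<forall>i. i \<notin> Z \<longrightarrow> a i = 0)}"

definition single :: "'i => 'k => 'i => 'k" where "single i x = (\<lambda>j. if j = i then x else 0)"

lemma vector_space_scF: "Vector_Spaces.vector_space scF"
 by unfold_locales (auto simp: scF_def fun_eq_iff algebra_simps em_add em_mult)

lemma subspace_fam:
 assumes "\<And>i. i \<in> Z ==> vs.subspace (V i)" shows "module.subspace scF (fam Z V)"
proof -
 interpret F: Vector_Spaces.vector_space scF by (rule vector_space_scF)
 show ?thesis
  by (rule F.subspaceI)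
   (use vs.subspace_0[OF assms] vs.subspace_add[OF assms] vs.subspace_scale[OF assms] in "auto simp: fam_def scF_def")
qed

lemma single_fam:
 assumes "\<And>j. j \<in> Z ==> vs.subspace (V j)" "i \<in> Z" "x \<in> V i" shows "single i x \<in> fam Z V"
 using assms(2,3) vs.subspace_0[OF assms(1)] unfolding fam_def single_def by auto

lemma bilinear_form_fam:
 assumes Z: "finite Z" and B: "\<And>i. i \<in> Z ==> bilinear_form sc (V i) (W i) (B i)"
 shows "bilinear_form scF (fam Z V) (fam Z W) (\<lambda>x y. \<Sum>i\<in>Z. B i (x i) (y i))"
proof -
 interpret F: Vector_Spaces.vector_space scF by (rule vector_space_scF)
 note b = bilinear_form.subV[OF B] bilinear_form.subW[OF B]
 have memV: "x i \<in> V i" if "x \<in> fam Z V" "i \<in> Z" for x i using that unfolding fam_def by blast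
 have memW: "x i \<in> W i" if "x \<in> fam Z W" "i \<in> Z" for x i using that unfolding fam_def by blast
 show ?thesis
 proof
  show "F.subspace (fam Z V)" "F.subspace (fam Z W)" by (rule subspace_fam, rule b, assumption)+
  show "fam Z W \<subseteq> fam Z V" using bilinear_form.WV[OF B] unfolding fam_def by blast
 next
  fix x y assume "x \<in> fam Z V" "y \<in> fam Z V"
  thus "(\<Sum>i\<in>Z. B i (x i) (y i)) = (\<Sum>i\<in>Z. B i (y i) (x i))"
   by (intro sum.cong refl bilinear_form.sym[OF B] memV)
 next
  fix x y z assume "x \<in> fam Z V" "y \<in> fam Z V" "z \<in> fam Z V"
  thus "(\<Sum>i\<in>Z. B i ((x + y) i) (z i)) = (\<Sum>i\<in>Z. B i (x i) (z i)) + (\<Sum>i\<in>Z. B i (y i) (z i))"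
   unfolding sum.distrib[symmetric] plus_fun_def by (intro sum.cong refl bilinear_form.add_left[OF B] memV)
 next
  fix c x z assume "x \<in> fam Z V" "z \<in> fam Z V"
  thus "(\<Sum>i\<in>Z. B i (scF c x i) (z i)) = c * (\<Sum>i\<in>Z. B i (x i) (z i))"
   unfolding sum_distrib_left scF_def by (intro sum.cong refl bilinear_form.scale_left[OF B] memV)
 next
  fix x y assume "x \<in> fam Z W" "y \<in> fam Z V"
  thus "(\<Sum>i\<in>Z. B i (x i) (y i)) = 0"
   by (intro sum.neutral ballI bilinear_form.rad[OF B] memV memW)
 next
  fix x assume x: "x \<in> fam Z V" and z: "\<And>y. y \<in> fam Z V ==> (\<Sum>i\<in>Z. B i (x i) (y i)) = 0"
  have "x i \<in> W i" if i: "i \<in> Z" for i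
  proof (rule bilinear_form.nondeg[OF B[OF i] memV[OF x i]])
   fix y assume y: "y \<in> V i"
   have "(\<Sum>j\<in>Z. B j (x j) (single i y j)) = (\<Sum>j\<in>Z. if j = i then B i (x i) y else 0)"
   proof (rule sum.cong[OF refl])
    fix j assume j: "j \<in> Z"
    have "B j (x j) 0 = 0" by (rule bilinear_form.rad'[OF B[OF j] vs.subspace_0[OF b(2)[OF j]] memV[OF x j]])
    thus "B j (x j) (single i y j) = (if j = i then B i (x i) y else 0)" unfolding single_def by simp
   qed
   also have "\<dots> = B i (x i) y" using Z i by simp
   finally show "B i (x i) y = 0" using z[OF single_fam[of Z V, OF b(1) i y]] by simp
  qed
  thus "x \<in> fam Z W" using x unfolding fam_def by blast
 qed
qed

text \<open>Bases supported at single points are concatenated; the Gram matrix is then block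
  diagonal.\<close>

lemma quot_basis_fam:
 assumes "finite Z" and "\<And>i. i \<in> Z ==> vs.subspace (V i)" "\<And>i. i \<in> Z ==> vs.subspace (W i)" "\<And>i. i \<in> Z ==> W i \<subseteq> V i"
  "\<And>i. i \<in> Z ==> quot_basis sc (V i) (W i) (b i)"
 shows "\<exists>bs. quot_basis scF (fam Z V) (fam Z W) bs \<and> length bs = (\<Sum>i\<in>Z. length (b i)) \<and>
  (\<forall>B. (\<forall>i\<in>Z. bilinear_form sc (V i) (W i) (B i)) \<longrightarrow>
   gw_class (gram (\<lambda>x y. \<Sum>i\<in>Z. B i (x i) (y i)) bs) = (\<Sum>i\<in>Z. gw_class (gram (B i) (b i))))"
 using assms
proof (induction Z rule: finite_induct)
 case empty
 interpret F: Vector_Spaces.vector_space scF by (rule vector_space_scF)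
 have "fam {} V = {0}" "fam {} W = {0}" unfolding fam_def by auto
 thus ?case using F.quot_basis_Nil[OF F.subspace_single_0]
  by (intro exI[of _ "[]"]) (simp add: gram_Nil gw_class_empty)
next
 case (insert i Z)
 interpret F: Vector_Spaces.vector_space scF by (rule vector_space_scF)
 from insert.IH insert.prems obtain bs where bs: "quot_basis scF (fam Z V) (fam Z W) bs" "length bs = (\<Sum>i\<in>Z. length (b i))"
  and gw: "\<And>B. \<forall>i\<in>Z. bilinear_form sc (V i) (W i) (B i) ==>
   gw_class (gram (\<lambda>x y. \<Sum>i\<in>Z. B i (x i) (y i)) bs) = (\<Sum>i\<in>Z. gw_class (gram (B i) (b i)))" by blast
 let ?as = "map (single i) (b i)" and ?Z = "insert i Z"
 define U where "U = fam ?Z (\<lambda>j. if j = i then W j else V j)"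
 have sub: "F.subspace (fam ?Z V)" "F.subspace (fam ?Z W)" "F.subspace U" "F.subspace (fam Z V)"
  unfolding U_def by (rule subspace_fam, use insert.prems in auto)+
 have WU: "fam ?Z W \<subseteq> U" "U \<subseteq> fam ?Z V" using insert.prems(3) unfolding U_def fam_def by auto
 have bi: "quot_basis sc (V i) (W i) (b i)" "vs.subspace (V i)" "W i \<subseteq> V i" using insert.prems by simp_all
 have 0: "\<And>j. j \<in> ?Z ==> 0 \<in> V j" "\<And>j. j \<in> ?Z ==> 0 \<in> W j" using vs.subspace_0 insert.prems by simp_all
 have 1: "quot_basis scF (fam ?Z V) U ?as"
 proof (rule quot_basis_map[OF _ _ _ _ bi(2) sub(3) bi(1)])
  show "Vector_Spaces.linear sc scF (single i)"
   by (rule Vector_Spaces.linear_iff[THEN iffD2])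
    (auto simp: single_def scF_def fun_eq_iff intro: vs.vector_space_axioms F.vector_space_axioms)
  show "single i x \<in> fam ?Z V" if "x \<in> V i" for x using that 0 unfolding fam_def single_def by auto
  show "single i x \<in> U \<longleftrightarrow> x \<in> W i" if "x \<in> V i" for x
   using that 0 insert.hyps unfolding fam_def single_def U_def by auto
  show "\<exists>x\<in>V i. y - single i x \<in> U" if y: "y \<in> fam ?Z V" for y
  proof (rule bexI[of _ "y i"])
   show "y i \<in> V i" using y unfolding fam_def by blast
   show "y - single i (y i) \<in> U" using y 0 unfolding fam_def U_def single_def by auto
  qed
 qed
 have 2: "quot_basis scF U (fam ?Z W) (map id bs)"
 proof (rule quot_basis_map[OF F.linear_id _ _ _ sub(4) sub(2) bs(1)])
  show "id x \<in> U" if "x \<in> fam Z V" for x using that 0 insert.hyps unfolding fam_def U_def by auto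
  show "id x \<in> fam ?Z W \<longleftrightarrow> x \<in> fam Z W" if "x \<in> fam Z V" for x
   using that 0 insert.hyps unfolding fam_def by auto
  show "\<exists>x\<in>fam Z V. y - id x \<in> fam ?Z W" if y: "y \<in> U" for y
  proof (rule bexI[of _ "\<lambda>j. if j = i then 0 else y j"])
   show "(\<lambda>j. if j = i then 0 else y j) \<in> fam Z V" using y insert.hyps unfolding fam_def U_def by auto
   show "y - id (\<lambda>j. if j = i then 0 else y j) \<in> fam ?Z W"
    using y 0 unfolding fam_def U_def by auto
  qed
 qed
 have big: "quot_basis scF (fam ?Z V) (fam ?Z W) (?as @ bs)"
  using F.quot_basis_tower[OF sub(3) 1 2 WU sub(2)] by simp
 have "gw_class (gram (\<lambda>x y. \<Sum>i\<in>?Z. B i (x i) (y i)) (?as @ bs)) = (\<Sum>i\<in>?Z. gw_class (gram (B i) (b i)))"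
  if B: "\<forall>j\<in>?Z. bilinear_form sc (V j) (W j) (B j)" for B
 proof -
  let ?BZ = "\<lambda>x y. \<Sum>i\<in>Z. B i (x i) (y i)" and ?BI = "\<lambda>x y. \<Sum>i\<in>?Z. B i (x i) (y i)"
  have BI: "?BI x y = B i (x i) (y i) + ?BZ x y" for x y using insert.hyps by simp
  have z: "B j x 0 = 0" "B j 0 x = 0" if "j \<in> ?Z" "x \<in> V j" for j x
   using bilinear_form.rad[of sc "V j" "W j" "B j"] bilinear_form.rad'[of sc "V j" "W j" "B j"] B 0(2) that by blast+
  have as: "x i \<in> V i \<and> (\<forall>j\<in>Z. x j = 0)" if "x \<in> set ?as" for x
   using that bi(1) insert.hyps unfolding quot_basis_def single_def by auto
  have bsV: "x i = 0 \<and> (\<forall>j\<in>Z. x j \<in> V j)" if "x \<in> set bs" for x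
   using that bs(1) insert.hyps unfolding quot_basis_def fam_def by auto
  have "gram ?BI (?as @ bs) = orth_sum (gram ?BI ?as) (gram ?BI bs)"
  proof (rule gram_append)
   fix x y assume xy: "x \<in> set ?as" "y \<in> set bs"
   note as[OF xy(1)] bsV[OF xy(2)]
   moreover from this have "?BZ x y = 0" "?BZ y x = 0" using z by (auto intro!: sum.neutral)
   ultimately show "?BI x y = 0 \<and> ?BI y x = 0" unfolding BI using z by simp
  qed
  also have "gram ?BI ?as = gram (B i) (b i)"
  proof (rule gram_map)
   fix x y assume "x \<in> set (b i)" "y \<in> set (b i)"
   have "?BZ (single i x) (single i y) = 0"
    by (rule sum.neutral) (use insert.hyps z 0 in "auto simp: single_def")
   thus "?BI (single i x) (single i y) = B i x y" unfolding BI by (simp add: single_def)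
  qed
  also have "gram ?BI bs = gram ?BZ bs"
  proof -
   have "gram ?BI (map id bs) = gram ?BZ bs"
   proof (rule gram_map)
    fix x y assume "x \<in> set bs" "y \<in> set bs"
    thus "?BI (id x) (id y) = ?BZ x y" unfolding BI using bsV[of x] bsV[of y] z(1)[OF insertI1 0(1)[OF insertI1]] by simp
   qed
   thus ?thesis by simp
  qed
  also have "gw_class (orth_sum (gram (B i) (b i)) (gram ?BZ bs)) = gw_class (gram (B i) (b i)) + gw_class (gram ?BZ bs)"
  proof (rule gw_class_orth_sum)
   show "nondeg_sym (gram (B i) (b i))" using bilinear_form.nondeg_sym_gram B bi(1) by blast
   have "bilinear_form scF (fam Z V) (fam Z W) ?BZ" by (rule bilinear_form_fam) (use insert.hyps B in auto)
   thus "nondeg_sym (gram ?BZ bs)" by (rule bilinear_form.nondeg_sym_gram[OF _ bs(1)])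
  qed
  finally show ?thesis using gw[of B] B insert.hyps by simp
 qed
 moreover have "length (?as @ bs) = (\<Sum>i\<in>?Z. length (b i))" using bs(2) insert.hyps by simp
 ultimately show ?case using big by blast
qed

end

section \<open>The residue theorem and duality at infinity\<close>

context hyp begin

text \<open>Subtracting all principal parts leaves an element of \<open>R\<close>, on which
  \<open>aff.rho\<close> vanishes. The right-hand side is minus the residue at infinity.\<close>

lemma residue_theorem:
 assumes Z: "finite Z" "Z \<subseteq> pts" and H: "\<And>q. q \<in> pts ==> q \<notin> Z ==> H \<in> q"
 shows "(\<Sum>p\<in>Z. lamp p H) = aff.rho H"
proof -
 have rs: "aff.rho (\<Sum>p\<in>Z'. part p H) = (\<Sum>p\<in>Z'. lamp p H)" if "finite Z'" for Z'
  using that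
 proof (induction Z' rule: finite_induct)
  case empty
  show ?case using aff.rho_scale[of 0 0] by simp
 qed (simp add: aff.rho_add lamp_def)
 have "H - (\<Sum>p\<in>Z. part p H) \<in> R"
 proof (rule R_eq)
  fix q assume q: "q \<in> pts"
  interpret Q: dvr q "unif q" by (rule pts_dvr[OF q])
  have s: "(\<Sum>p\<in>Z - {q}. part p H) \<in> q" by (rule Q.sum_mem) (use Z part(2) q in blast)
  show "H - (\<Sum>p\<in>Z. part p H) \<in> q"
  proof (cases "q \<in> Z")
   case True
   have e: "H - (\<Sum>p\<in>Z. part p H) = (H - part q H) - (\<Sum>p\<in>Z - {q}. part p H)"
    using sum.remove[OF Z(1) True, of "\<lambda>p. part p H"] by simp
   show ?thesis unfolding e by (rule Q.diff_mem[OF part(1)[OF q] s])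
  next
   case False
   thus ?thesis using Q.diff_mem[OF H[OF q False] s] by simp
  qed
 qed
 hence "aff.rho (H - (\<Sum>p\<in>Z. part p H)) = 0" by (rule R_coords)
 moreover have "aff.rho H = aff.rho (H - (\<Sum>p\<in>Z. part p H)) + aff.rho (\<Sum>p\<in>Z. part p H)"
  by (simp flip: aff.rho_add)
 ultimately show ?thesis using rs[OF Z(1)] by simp
qed

lemma chi_ev: "chi (ev d xc) = 0"
proof -
 have "em (chi (ev d xc)) = pol (ev (pCons 0 d) xc) - xc * pol (ev d xc)"
  using chi[OF K0_ev, of d] by simp
 also have "\<dots> = 0" unfolding pol_ev by simp
 finally show ?thesis by simp
qed

lemma chi_minf:
 assumes B: "B \<in> K0" "B \<in> minf" and z: "\<And>j. j \<le> m ==> chi (xc ^ j * B) = 0"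
 shows "xc ^ Suc m * B \<in> minf"
proof -
 have step: "xc * A \<in> minf" if A: "A \<in> K0" "A \<in> minf" "chi A = 0" for A
 proof -
  have "pol (xc * A) = 0" using chi[OF A(1)] pol_minf[OF A(2)] A(3) by simp
  moreover obtain d where "xc * A - ev d xc \<in> minf" "pol (xc * A) = ev d xc" using pol_ex[OF K0_mult[OF K0_x A(1)]] .
  ultimately show ?thesis by simp
 qed
 show ?thesis using z
 proof (induction m)
  case 0
  thus ?case using step[OF B] by simp
 next
  case (Suc m)
  hence "xc ^ Suc m * B \<in> minf" by simp
  moreover have "chi (xc ^ Suc m * B) = 0" by (rule Suc.prems) simp
  ultimately have "xc * (xc ^ Suc m * B) \<in> minf" by (intro step K0_mult K0_power K0_x B(1))
  thus ?case by (simp only: power_Suc mult.assoc)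
 qed
qed

text \<open>\<open>chi (x^j A)\<close> is the coefficient of \<open>x^(-j-1)\<close>. If these
  vanish for \<open>j \<le> m\<close>, the fractional part starts at \<open>x^(-m-2)\<close> or
  later, and \<open>x\<close> has order \<open>- 2\<close>.\<close>

lemma perp_vord:
 assumes A: "A \<in> K0" and z: "\<And>j. j \<le> m ==> chi (xc ^ j * A) = 0"
 shows "A = pol A \<or> inf.vord (A - pol A) \<ge> 2 * int m + 4"
proof (cases "A = pol A")
 case False
 obtain d where d: "A - ev d xc \<in> minf" "pol A = ev d xc" using pol_ex[OF A] .
 let ?B = "A - pol A"
 have B: "?B \<in> K0" "?B \<in> minf" "?B ~= 0" using d A K0_ev K0_diff False by auto
 have "chi (xc ^ j * ?B) = 0" if "j \<le> m" for j
 proof -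
  have "xc ^ j * ev d xc = ev (monom 1 j * d) xc" by (simp add: ev_mult ev_monom)
  hence "chi (xc ^ j * ev d xc) = 0" using chi_ev by simp
  moreover have "xc ^ j * A = xc ^ j * ?B + xc ^ j * ev d xc" unfolding d(2) by (simp add: algebra_simps)
  ultimately show ?thesis
   using chi_add[OF K0_mult[OF K0_power[OF K0_x] B(1)] K0_mult[OF K0_power[OF K0_x] K0_ev], of j j d] z[OF that] by simp
 qed
 from chi_minf[OF B(1,2) this] have "xc ^ Suc m * ?B \<in> minf" by blast
 moreover have nz: "xc ^ Suc m * ?B ~= 0" using B(3) x_nonzero by simp
 ultimately have "inf.vord (xc ^ Suc m * ?B) > 0" using inf.max_ideal_iff_vord by blast
 moreover have "inf.vord (xc ^ Suc m * ?B) = - 2 * int (Suc m) + inf.vord ?B"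
  using inf.vord_mult[of "xc ^ Suc m" ?B] inf.vord_power[OF x_nonzero, of "Suc m"] B(3) x_nonzero vord_x by simp
 moreover have "even (inf.vord ?B)" by (rule vord_K0_even[OF B(1,3)])
 ultimately obtain b where b: "inf.vord ?B = 2 * b" "0 < - 2 * int (Suc m) + 2 * b" by (elim evenE) simp
 hence "int (Suc m) < b" by simp
 hence "2 * int m + 4 \<le> inf.vord ?B" unfolding b(1) by simp
 thus ?thesis by (rule disjI2)
qed simp

text \<open>Testing against \<open>x^j\<close> controls the coordinate \<open>be G\<close>, testing
  against \<open>x^j y\<close> the coordinate \<open>al G\<close>; the ranges of \<open>j\<close>
  are those of a basis of \<open>Rm (2 * k)\<close>. The fractional part of \<open>G\<close> is then
  small enough to absorb the pole of \<open>u^(g-1) x^k\<close>.\<close>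

lemma rho_perp:
 assumes k: "g + 1 \<le> k" and perp: "\<And>r. r \<in> Rm (2 * k) ==> aff.rho (G * r) = 0"
 shows "u ^ (g - 1) * xc ^ k * (G - aff.PQ G) \<in> inf.p"
proof -
 have be: "chi (xc ^ j * be G) = 0" if "j \<le> k" for j
 proof -
  have "ev (monom 1 j) xc + ev 0 xc * yc \<in> Rm (2 * k)" unfolding Rm_iff using that by (simp add: degree_monom_eq)
  from perp[OF this] show ?thesis unfolding aff.rho_def
   by (simp add: ev_monom mult.commute[of G] albe_mult K0_power K0_x)
 qed
 have al: "chi (xc ^ j * al G) = 0" if "j \<le> k - g - 1" for j
 proof -
  have "2 * j + 2 * g + 1 \<le> 2 * k" using that k by simp
  hence "ev 0 xc + ev (monom 1 j) xc * yc \<in> Rm (2 * k)" unfolding Rm_iff by (simp add: degree_monom_eq)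
  from perp[OF this] have "chi (be (xc ^ j * (yc * G))) = 0"
   unfolding aff.rho_def by (simp add: ev_monom mult_ac)
  thus ?thesis by (simp add: albe_mult albe_y K0_power K0_x)
 qed
 let ?a = "al G - pol (al G)" and ?b = "be G - pol (be G)" and ?m = "u ^ (g - 1) * xc ^ k"
 have vm: "?m ~= 0" "inf.vord ?m = 2 * int (g - 1) - 2 * int k"
  using u_nonzero x_nonzero inf.vord_mult[of "u ^ (g - 1)" "xc ^ k"] inf.vord_power[OF u_nonzero] inf.vord_power[OF x_nonzero]
  by (simp_all add: vord_u vord_x)
 have 1: "?m * ?a \<in> inf.p"
 proof (cases "?a = 0")
  case False
  hence "inf.vord ?a \<ge> 2 * int (k - g - 1) + 4" using perp_vord[OF albe(1) al] by auto
  hence "inf.vord (?m * ?a) \<ge> 0" using inf.vord_mult[OF vm(1) False] vm(2) k g_pos by (simp add: of_nat_diff)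
  thus ?thesis using inf.mem_iff_vord[of "?m * ?a"] vm(1) False by simp
 qed (use inf.zero_mem in simp)
 have 2: "?m * (?b * yc) \<in> inf.p"
 proof (cases "?b = 0")
  case False
  hence nz: "?b * yc ~= 0" using Y_nonzero by simp
  have "inf.vord ?b \<ge> 2 * int k + 4" using perp_vord[OF albe(2) be] False by auto
  hence "inf.vord (?m * (?b * yc)) \<ge> 0"
   using inf.vord_mult[OF vm(1) nz] inf.vord_mult[OF False Y_nonzero] vm(2) vord_y g_pos by (simp add: of_nat_diff)
  thus ?thesis using inf.mem_iff_vord[OF no_zero_divisors[OF vm(1) nz]] by blast
 qed (use inf.zero_mem in simp)
 have "G - aff.PQ G = ?a + ?b * yc" unfolding aff.PQ_def by (subst albe(3)[of G]) (simp add: algebra_simps)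
 hence "?m * (G - aff.PQ G) = ?m * ?a + ?m * (?b * yc)" by (simp only: distrib_left)
 thus ?thesis using inf.add_mem[OF 1 2] by (simp only:)
qed

end

context oriented_section begin

lemma lg_pts: "p \<in> pts ==> lg p h = lamp p h"
 using pts_simps[of p] unfolding lg_def lr_def by simp

lemma lg_inf: "lg inf.p h = - aff.rho h"
proof -
 have "xc ^ (g - 1) * (- (u ^ (g - 1)) * h) = em (- 1) * h"
  using xu_pow[of "g - 1"] by (simp add: em_minus mult.assoc[symmetric])
 thus ?thesis unfolding lg_def lr_def inf_simps rho_inf by (simp only: if_True simp_thms aff.rho_scale) simp
qed

lemma lg_add: assumes "p \<in> cp" shows "lg p (a + b) = lg p a + lg p b"
proof -
 obtain P where "residue_datum em p (un p) P (lr p) (Dl p)" using res_datum[OF assms] .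
 then interpret r: residue_datum em p "un p" P "lr p" "Dl p" .
 show ?thesis unfolding lg_def by (simp add: distrib_left r.lam_add)
qed

lemma B_add: "p \<in> cp ==> B p (a + b) y = B p a y + B p b y"
 unfolding B_def by (simp add: distrib_left distrib_right lg_add)

lemma global_residue:
 assumes Z: "finite Z" "Z \<subseteq> cp" "inf.p \<in> Z" and H: "\<And>q. q \<in> pts ==> q \<notin> Z ==> H \<in> q"
 shows "(\<Sum>p\<in>Z. lg p H) = 0"
proof -
 have Zf: "Z - {inf.p} \<subseteq> pts" using Z(2) unfolding cp_def by blast
 have "(\<Sum>p\<in>Z - {inf.p}. lg p H) = (\<Sum>p\<in>Z - {inf.p}. lamp p H)"
  by (rule sum.cong[OF refl]) (use Zf lg_pts in blast)
 also have "\<dots> = aff.rho H"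
  by (rule residue_theorem) (use Z(1) Zf H inf_notin_pts in blast)+
 finally show ?thesis unfolding sum.remove[OF Z(1,3)] lg_inf by simp
qed

text \<open>\<open>nu p\<close> is regular outside finitely many points, because near infinity one
  generator of \<open>N\<close> serves on an open set; the denominators at the exceptional points
  are multiplied.\<close>

lemma denominator: "\<exists>h\<in>R. h ~= 0 \<and> (\<forall>p\<in>pts. h * nu p \<in> p)"
proof -
 obtain U s where U: "open_subset C U" and s: "s ~= 0" "\<And>q. q \<in> U ==> N q = principal_ideal q s"
  using N_open[OF inf_cp] by metis
 define Z where "Z = {p \<in> pts. nu p \<notin> p}"
 have "Z \<subseteq> (cp - U) \<union> {q \<in> cp. \<not> (s \<in> q \<and> inverse s \<in> q)}"
 proof
  fix q assume q: "q \<in> Z"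
  hence qc: "q \<in> cp" and nq: "nu q \<notin> q" unfolding Z_def cp_def by blast+
  interpret Q: dvr q "un q" by (rule cp_dvr[OF qc])
  have "s \<notin> q" if "q \<in> U"
  proof
   assume sq: "s \<in> q"
   have "nu q * 1 \<in> principal_ideal q (nu q)" unfolding principal_ideal_def using Q.one_mem by blast
   hence "nu q \<in> principal_ideal q s" using s(2)[OF that] N_stalk(2)[OF qc] by simp
   then obtain a where a: "a \<in> q" "nu q = s * a" unfolding principal_ideal_def by blast
   show False using nq Q.mult_mem[OF sq a(1)] unfolding a(2) by contradiction
  qed
  thus "q \<in> (cp - U) \<union> {q \<in> cp. \<not> (s \<in> q \<and> inverse s \<in> q)}" using qc by blast
 qed
 moreover have "finite (cp - U)" using U unfolding open_subset_def closed_points_eq by blast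
 ultimately have finZ: "finite Z" using finite_bad[OF s(1)] by (meson finite_Un finite_subset)
 have "\<exists>d\<in>R. d ~= 0 \<and> d * nu p \<in> R" for p
 proof -
  obtain r d where "r \<in> R" "d \<in> R" "d ~= 0" "nu p = r / d" by (rule frac_R)
  thus ?thesis by (intro bexI[of _ d]) auto
 qed
 then obtain d where d: "\<And>p. d p \<in> R" "\<And>p. d p ~= 0" "\<And>p. d p * nu p \<in> R" by metis
 show ?thesis
 proof (intro bexI conjI ballI)
  show "(\<Prod>p\<in>Z. d p) \<in> R" by (rule prod_R) (rule d)
  show "(\<Prod>p\<in>Z. d p) ~= 0" using d(2) by (simp add: finZ)
  fix p assume p: "p \<in> pts"
  interpret P: dvr p "unif p" by (rule pts_dvr[OF p])
  show "(\<Prod>p\<in>Z. d p) * nu p \<in> p"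
  proof (cases "p \<in> Z")
   case True
   have "(\<Prod>p\<in>Z. d p) * nu p = (\<Prod>p\<in>Z - {p}. d p) * (d p * nu p)"
    unfolding prod.remove[OF finZ True] by (simp add: mult_ac)
   also have "\<dots> \<in> R" by (intro mult_R prod_R d)
   finally show ?thesis by (rule R_pts[OF p])
  next
   case False
   hence "nu p \<in> p" using p unfolding Z_def by blast
   moreover have "(\<Prod>p\<in>Z. d p) \<in> p" by (intro R_pts[OF p] prod_R d)
   ultimately show ?thesis by (intro P.mult_mem)
  qed
 qed
qed

section \<open>The global Lagrangian\<close>

definition mm :: "'k => nat => 'k set => 'k" where
 "mm h k p = inverse h * (if p = inf.p then xc ^ k else 1)"

text \<open>The lattice \<open>O(2k infinity) / h\<close>: its sections on the affine part are the
  quotients \<open>r / h\<close> with \<open>r\<close> in \<open>R\<close>, to which strong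
  approximation applies directly. \<open>M'\<close> is its dual lattice by
  \<open>dual_iff\<close>.\<close>

definition M :: "'k => nat => 'k set => 'k set" where "M h k p = principal_ideal p (mm h k p)"

definition M' :: "'k => nat => 'k set => 'k set" where
 "M' h k p = principal_ideal p (inverse (th p * w * mm h k p))"

lemma mm_nonzero: "h ~= 0 ==> mm h k p ~= 0" unfolding mm_def using x_nonzero by simp

lemma M_iff: assumes "p \<in> cp" "h ~= 0" shows "x \<in> M h k p \<longleftrightarrow> x / mm h k p \<in> p"
 unfolding M_def by (rule dvr.principal_ideal_iff[OF cp_dvr[OF assms(1)] mm_nonzero[OF assms(2)]])

lemma M'_iff: assumes "p \<in> cp" "h ~= 0" shows "x \<in> M' h k p \<longleftrightarrow> th p * w * mm h k p * x \<in> p"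
proof -
 have "inverse (th p * w * mm h k p) ~= 0" using th_nonzero w_nonzero mm_nonzero[OF assms(2)] by simp
 from dvr.principal_ideal_iff[OF cp_dvr[OF assms(1)] this] show ?thesis
  unfolding M'_def divide_inverse inverse_inverse_eq by (simp add: mult.commute)
qed

lemma Rm_M:
 assumes "p \<in> cp" "h ~= 0" shows "r \<in> Rm (2 * k) ==> r / h \<in> M h k p"
  and "r \<in> R ==> r / h \<in> M h k inf.p ==> r \<in> Rm (2 * k)"
proof -
 have v: "inf.vord (xc ^ k) = - 2 * int k" using inf.vord_power[OF x_nonzero, of k] vord_x by simp
 have e: "r / h / mm h k inf.p = r / xc ^ k" for r unfolding mm_def using assms(2) by (simp add: field_simps)
 have i: "r / xc ^ k \<in> inf.p \<longleftrightarrow> r = 0 \<or> inf.vord r \<ge> - 2 * int k" for r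
 proof (cases "r = 0")
  case False
  hence "r / xc ^ k ~= 0" using x_nonzero by simp
  thus ?thesis using inf.mem_iff_vord[of "r / xc ^ k"] inf.vord_divide[of r "xc ^ k"] False x_nonzero v by auto
 qed (simp add: inf.zero_mem)
 show "r / h \<in> M h k p" if r: "r \<in> Rm (2 * k)"
 proof (cases "p = inf.p")
  case True
  show ?thesis unfolding True M_iff[OF inf_cp assms(2)] e i using r unfolding Rm_def by auto
 next
  case False
  hence "p \<in> pts" using assms(1) unfolding cp_def by blast
  hence "r \<in> p" using r R_pts unfolding Rm_def by blast
  moreover have "r / h / mm h k p = r" using False assms(2) unfolding mm_def by (simp add: field_simps)
  ultimately show ?thesis unfolding M_iff[OF assms] by simp
 qed
 show "r \<in> Rm (2 * k)" if "r \<in> R" "r / h \<in> M h k inf.p"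
  using that unfolding M_iff[OF inf_cp assms(2)] e i Rm_def by auto
qed

text \<open>The sections of \<open>M\<close> over the whole curve, embedded diagonally modulo the dual lattice \<open>M'\<close>:
 isotropic by the residue theorem, and its own orthogonal complement by strong approximation.\<close>

lemma lagrangian_M:
 assumes h: "h \<in> R" "h ~= 0" and k: "g + 1 \<le> k" and Z: "finite Z" "Z \<subseteq> cp" "inf.p \<in> Z"
  and unit: "\<And>q. q \<in> pts ==> q \<notin> Z ==> w * inverse h * inverse h \<in> q \<and> h * h * inverse w \<in> q"
  and sub: "\<And>p. p \<in> Z ==> M' h k p \<subseteq> M h k p"
 shows "lagrangian scF (fam Z (M h k)) (fam Z (M' h k)) (\<lambda>x y. \<Sum>p\<in>Z. B p (x p) (y p))
  {a \<in> fam Z (M h k). \<exists>r\<in>Rm (2 * k). \<forall>p\<in>Z. a p - r / h \<in> M' h k p}" (is "lagrangian _ ?V ?W ?B ?L")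
proof -
 have bl: "bilinear_form sc (M h k p) (M' h k p) (B p)" if "p \<in> Z" for p
  using bilinear_form_principal[of p "mm h k p"] mm_nonzero[OF h(2)] sub[OF that] that Z(2)
  unfolding M_def M'_def by blast
 interpret F: bilinear_form scF ?V ?W ?B by (rule bilinear_form_fam[OF Z(1) bl])
 note subM = bilinear_form.subV[OF bl] and subM' = bilinear_form.subW[OF bl]
 have RM: "r / h \<in> M h k p" if "r \<in> Rm (2 * k)" "p \<in> Z" for r p using Rm_M(1)[OF _ h(2) that(1)] Z(2) that(2) by blast
 have glob: "(\<Sum>p\<in>Z. B p (r / h) (s / h)) = 0" if rs: "r \<in> R" "s \<in> R" for r s
 proof -
  have "(\<Sum>p\<in>Z. lg p (w * (r / h) * (s / h))) = 0"
  proof (rule global_residue[OF Z])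
   fix q assume q: "q \<in> pts" "q \<notin> Z"
   interpret Q: dvr q "unif q" by (rule pts_dvr[OF q(1)])
   have e: "w * (r / h) * (s / h) = w * inverse h * inverse h * (r * s)" by (simp add: divide_inverse mult_ac)
   show "w * (r / h) * (s / h) \<in> q" unfolding e
    by (rule Q.mult_mem[OF conjunct1[OF unit[OF q]] R_pts[OF q(1) mult_R[OF rs]]])
  qed
  thus ?thesis unfolding B_def .
 qed
 show ?thesis
 proof
  show "F.subspace ?L"
  proof (rule F.subspaceI)
   have "0 \<in> Rm (2 * k)" using vs.subspace_0[OF subspace_Rm] .
   thus "0 \<in> ?L" using F.subspace_0[OF F.subV] vs.subspace_0[OF subM'] by (auto intro!: bexI[of _ 0])
  next
   fix a b assume a: "a \<in> ?L" and b: "b \<in> ?L"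
   then obtain r s where rs: "r \<in> Rm (2 * k)" "s \<in> Rm (2 * k)" "\<And>p. p \<in> Z ==> a p - r / h \<in> M' h k p"
    "\<And>p. p \<in> Z ==> b p - s / h \<in> M' h k p" by blast
   have "(a + b) p - (r + s) / h \<in> M' h k p" if "p \<in> Z" for p
    using vs.subspace_add[OF subM'[OF that] rs(3)[OF that] rs(4)[OF that]] by (simp add: add_divide_distrib algebra_simps)
   moreover have "a + b \<in> ?V" using a b F.subspace_add[OF F.subV] by blast
   ultimately show "a + b \<in> ?L" using vs.subspace_add[OF subspace_Rm rs(1,2)] by blast
  next
   fix d a assume a: "a \<in> ?L"
   then obtain r where r: "r \<in> Rm (2 * k)" "\<And>p. p \<in> Z ==> a p - r / h \<in> M' h k p" by blast
   have "scF d a p - (em d * r) / h \<in> M' h k p" if "p \<in> Z" for p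
    using vs.subspace_scale[OF subM'[OF that] r(2)[OF that], of d] by (simp add: scF_def algebra_simps)
   moreover have "scF d a \<in> ?V" using a F.subspace_scale[OF F.subV] by blast
   ultimately show "scF d a \<in> ?L" using vs.subspace_scale[OF subspace_Rm r(1), of d] by blast
  qed
  show "?W \<subseteq> ?L"
  proof
   fix a assume a: "a \<in> ?W"
   hence "\<forall>p\<in>Z. a p - 0 / h \<in> M' h k p" unfolding fam_def by simp
   thus "a \<in> ?L" using a F.WV vs.subspace_0[OF subspace_Rm, of "2 * k"] by blast
  qed
  show "?L \<subseteq> ?V" by blast
 next
  fix x y assume x: "x \<in> ?L" and y: "y \<in> ?L"
  then obtain r s where rs: "r \<in> Rm (2 * k)" "s \<in> Rm (2 * k)" "\<And>p. p \<in> Z ==> x p - r / h \<in> M' h k p"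
   "\<And>p. p \<in> Z ==> y p - s / h \<in> M' h k p" by blast
  have "B p (x p) (y p) = B p (r / h) (s / h)" if p: "p \<in> Z" for p
  proof -
   interpret b: bilinear_form sc "M h k p" "M' h k p" "B p" by (rule bl[OF p])
   note m = RM[OF rs(1) p] RM[OF rs(2) p]
   have xy: "x p \<in> M h k p" "y p \<in> M h k p" using x y p unfolding fam_def by blast+
   have "B p (x p - r / h) (y p) = 0" by (rule b.rad[OF rs(3)[OF p] xy(2)])
   hence 1: "B p (x p) (y p) = B p (r / h) (y p)" using b.diff_left[OF xy(1) m(1) xy(2)] by simp
   have "B p (r / h) (y p - s / h) = 0" by (rule b.rad'[OF rs(4)[OF p] m(1)])
   hence "B p (r / h) (y p) = B p (r / h) (s / h)" using b.diff_right[OF xy(2) m(2) m(1)] by simp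
   thus ?thesis using 1 by simp
  qed
  hence "?B x y = (\<Sum>p\<in>Z. B p (r / h) (s / h))" by (intro sum.cong) auto
  also have "\<dots> = 0" by (rule glob) (use rs in "auto simp: Rm_def")
  finally show "?B x y = 0" .
 next
  fix x assume x: "x \<in> ?V" and perp: "\<And>y. y \<in> ?L ==> ?B x y = 0"
  let ?Zf = "Z - {inf.p}"
  have Zf: "?Zf \<subseteq> pts" using Z(2) unfolding cp_def by blast
  have mmf: "mm h k p = inverse h" "th p = 1" if "p \<in> pts" for p using pts_simps[OF that] unfolding mm_def by simp_all
  have xM: "x p \<in> M h k p" if "p \<in> Z" for p using x that unfolding fam_def by blast
  have hx: "h * x p \<in> p" if p: "p \<in> ?Zf" for p
  proof -
   have pp: "p \<in> pts" "p \<in> Z" using p Zf by blast+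
   have "x p / mm h k p \<in> p" using xM[OF pp(2)] unfolding M_iff[OF pts_cp[OF pp(1)] h(2)] .
   moreover have "x p / mm h k p = h * x p" unfolding mmf[OF pp(1)] by (simp add: divide_inverse mult.commute)
   ultimately show ?thesis by (simp only:)
  qed
  \<comment> \<open>\<open>s\<close> is a denominator of \<open>w / h^2\<close>; agreement of
    \<open>r0\<close> with \<open>h * x p\<close> modulo \<open>s\<close> puts
    \<open>x p - r0 / h\<close> into the dual lattice.\<close>
  obtain s0 s where s: "s0 \<in> R" "s \<in> R" "s ~= 0" "w * inverse h * inverse h = s0 / s" by (rule frac_R)
  obtain r0 where r0: "r0 \<in> R" "\<forall>p\<in>?Zf. r0 - h * x p \<in> principal_ideal p s"
   using strong_approx[OF s(2,3) finite_Diff[OF Z(1)] Zf, of "\<lambda>p. h * x p"] hx by blast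
  have near: "x p - r0 / h \<in> M' h k p" if p: "p \<in> ?Zf" for p
  proof -
   have pp: "p \<in> pts" "p \<in> cp" using p Zf pts_cp by blast+
   interpret P: dvr p "unif p" by (rule pts_dvr[OF pp(1)])
   obtain b where b: "b \<in> p" "r0 - h * x p = s * b" using r0(2) p unfolding principal_ideal_def by blast
   have "w * inverse h * (x p - r0 / h) = - (w * inverse h * inverse h * (r0 - h * x p))"
    using h(2) by (simp add: field_simps)
   also have "\<dots> = - (s0 * b)" unfolding b(2) s(4) using s(3) by simp
   also have "\<dots> \<in> p" by (intro P.minus_mem P.mult_mem b R_pts[OF pp(1)] s)
   finally show ?thesis unfolding M'_iff[OF pp(2) h(2)] mmf[OF pp(1)] by simp
  qed
  \<comment> \<open>The remaining error sits at infinity. At the other points of \<open>Z\<close> it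
    is in the dual lattice, so orthogonality to the global sections becomes a condition on
    \<open>G\<close> alone.\<close>
  define A where "A = x inf.p - r0 / h"
  define G where "G = w * A / h"
  have "aff.rho (G * r) = 0" if r: "r \<in> Rm (2 * k)" for r
  proof -
   let ?y = "\<lambda>p. if p \<in> Z then r / h else 0"
   have "?y \<in> ?V" using RM[OF r] unfolding fam_def by simp
   moreover have "\<forall>p\<in>Z. ?y p - r / h \<in> M' h k p" using vs.subspace_0[OF subM'] by simp
   ultimately have "?y \<in> ?L" using r by blast
   hence "(\<Sum>p\<in>Z. B p (x p) (?y p)) = 0" by (rule perp)
   hence "0 = (\<Sum>p\<in>Z. B p (x p) (?y p))" by (rule sym)
   also have "\<dots> = (\<Sum>p\<in>Z. B p (r0 / h) (r / h) + B p (x p - r0 / h) (r / h))"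
    by (rule sum.cong[OF refl]) (use Z(2) in "auto simp flip: B_add")
   also have "\<dots> = (\<Sum>p\<in>Z. B p (x p - r0 / h) (r / h))"
    unfolding sum.distrib using glob[OF r0(1)] r unfolding Rm_def by simp
   also have "\<dots> = B inf.p A (r / h) + (\<Sum>p\<in>?Zf. B p (x p - r0 / h) (r / h))"
    unfolding A_def by (rule sum.remove[OF Z(1,3)])
   also have "(\<Sum>p\<in>?Zf. B p (x p - r0 / h) (r / h)) = 0"
    by (rule sum.neutral) (use near RM[OF r] bilinear_form.rad[OF bl] in blast)
   finally have "lg inf.p (w * A * (r / h)) = 0" unfolding B_def by simp
   moreover have "w * A * (r / h) = G * r" unfolding G_def by simp
   ultimately show ?thesis unfolding lg_inf by simp
  qed
  note inf0 = rho_perp[OF k this]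
  let ?P = "aff.PQ G"
  have PR: "?P \<in> R" by (rule PQ_R)
  \<comment> \<open>At affine points the change \<open>h PQ(G) / w\<close> stays in the dual
    lattice, as \<open>PQ(G)\<close> lies in \<open>R\<close>; at infinity it replaces
    \<open>G\<close> by \<open>G - PQ(G)\<close>, which \<open>rho_perp\<close> bounds.\<close>
  define r1 where "r1 = r0 + h * h * ?P * inverse w"
  have near1: "x p - r1 / h \<in> M' h k p" if p: "p \<in> Z" for p
  proof (cases "p = inf.p")
   case False
   hence pz: "p \<in> ?Zf" using p by blast
   hence pp: "p \<in> pts" "p \<in> cp" using Zf pts_cp by blast+
   have "w * inverse h * (h * ?P / w) = ?P" using h(2) w_nonzero by simp
   hence "h * ?P / w \<in> M' h k p" unfolding M'_iff[OF pp(2) h(2)] mmf[OF pp(1)] using R_pts[OF pp(1) PR] by simp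
   from vs.subspace_diff[OF subM'[OF p] near[OF pz] this]
   have "x p - r0 / h - h * ?P / w \<in> M' h k p" .
   moreover have "x p - r1 / h = x p - r0 / h - h * ?P / w"
    unfolding r1_def using h(2) w_nonzero by (simp add: field_simps)
   ultimately show ?thesis by (simp only:)
  next
   case True
   have "th inf.p * w * mm h k inf.p * (x inf.p - r1 / h) = - (u ^ (g - 1) * xc ^ k * (w * inverse h * (x inf.p - r1 / h)))"
    unfolding inf_simps mm_def by (simp add: mult_ac)
   also have "w * inverse h * (x inf.p - r1 / h) = G - ?P"
    unfolding r1_def G_def A_def using h(2) w_nonzero by (simp add: field_simps)
   also have "- (u ^ (g - 1) * xc ^ k * (G - ?P)) \<in> inf.p" by (rule inf.minus_mem[OF inf0])
   finally show ?thesis unfolding True M'_iff[OF inf_cp h(2)] .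
  qed
  have rM: "r1 / h \<in> M h k p" if p: "p \<in> Z" for p
   using vs.subspace_diff[OF subM[OF p] xM[OF p] subsetD[OF sub[OF p] near1[OF p]]] by simp
  have "r1 \<in> R"
  proof (rule R_eq)
   fix q assume q: "q \<in> pts"
   interpret Q: dvr q "unif q" by (rule pts_dvr[OF q])
   show "r1 \<in> q"
   proof (cases "q \<in> Z")
    case True
    thus ?thesis using rM[OF True] unfolding M_iff[OF pts_cp[OF q] h(2)] mmf[OF q] using h(2) by (simp add: field_simps)
   next
    case False
    have "r1 = r0 + (h * h * inverse w) * ?P" unfolding r1_def by (simp add: mult_ac)
    also have "\<dots> \<in> q"
     by (rule Q.add_mem[OF R_pts[OF q r0(1)] Q.mult_mem[OF conjunct2[OF unit[OF q False]] R_pts[OF q PR]]])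
    finally show ?thesis .
   qed
  qed
  from Rm_M(2)[OF inf_cp h(2) this rM[OF Z(3)]] show "x \<in> ?L" using x near1 by blast
 qed
qed

end

section \<open>Sum and total rank of the local indices\<close>

context oriented_section begin

text \<open>Isotropic reduction is applied to a basis of \<open>W\<close> modulo \<open>M'\<close>,
  whose orthogonal complement in \<open>M\<close> is \<open>N\<close>. Points of \<open>Z\<close> at
  which the section does not vanish contribute the empty form.\<close>

lemma index_sum:
 assumes fin: "finite (zeros C E sg)" and b: "\<And>p. p \<in> cp ==> quot_basis sc (N p) (W p) (b p)"
 shows "(\<Sum>p\<in>zeros C E sg. local_index C E N c sg p) = (\<Sum>i<(\<Sum>p\<in>zeros C E sg. length (b p)) div 2. hyperbolic)"
proof -
 obtain h where h: "h \<in> R" "h ~= 0" "\<And>p. p \<in> pts ==> h * nu p \<in> p" using denominator by blast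
 \<comment> \<open>The first part makes \<open>rho_perp\<close> applicable, the second puts
   \<open>N\<close> inside \<open>M\<close> at infinity.\<close>
 define k where "k = g + 1 + nat (- inf.vord (h * nu inf.p))"
 have k: "g + 1 \<le> k" unfolding k_def by simp
 define s where "s = w * inverse h * inverse h"
 have s0: "s ~= 0" unfolding s_def using w_nonzero h(2) by simp
 \<comment> \<open>\<open>Z\<close> must contain every point where \<open>w / h^2\<close> is not a
   unit: elsewhere on the affine part \<open>M\<close> is its own dual.\<close>
 define Z where "Z = insert inf.p (zeros C E sg \<union> {q \<in> cp. \<not> (s \<in> q \<and> inverse s \<in> q)})"
 have Z: "finite Z" "Z \<subseteq> cp" "inf.p \<in> Z" "zeros C E sg \<subseteq> Z"
  unfolding Z_def using fin finite_bad[OF s0] inf_cp by (auto simp: zeros_iff)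
 have unit: "w * inverse h * inverse h \<in> q \<and> h * h * inverse w \<in> q" if "q \<in> pts" "q \<notin> Z" for q
 proof -
  have "s \<in> q \<and> inverse s \<in> q" using that pts_cp unfolding Z_def by blast
  moreover have "inverse s = h * h * inverse w" unfolding s_def by (simp add: mult_ac)
  ultimately show ?thesis unfolding s_def by (simp only: simp_thms)
 qed
 have quo: "nu p / mm h k p \<in> p" if "p \<in> cp" for p
 proof (cases "p = inf.p")
  case False
  hence "p \<in> pts" using that unfolding cp_def by blast
  moreover have "nu p / mm h k p = h * nu p" using False unfolding mm_def by (simp add: divide_inverse mult.commute)
  ultimately show ?thesis using h(3) by simp
 next
  case True
  have nz: "h * nu inf.p ~= 0" "xc ^ k ~= 0" using h(2) N_stalk(1)[OF inf_cp] x_nonzero by simp_all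
  have e: "nu inf.p / mm h k inf.p = h * nu inf.p / xc ^ k" unfolding mm_def by (simp add: divide_inverse mult_ac)
  have "inf.vord (h * nu inf.p / xc ^ k) = inf.vord (h * nu inf.p) + 2 * int k"
   unfolding inf.vord_divide[OF nz] inf.vord_power[OF x_nonzero] vord_x by simp
  hence "inf.vord (h * nu inf.p / xc ^ k) \<ge> 0" unfolding k_def by simp
  thus ?thesis unfolding True e using inf.mem_iff_vord[of "h * nu inf.p / xc ^ k"] nz by simp
 qed
 have NM: "N p \<subseteq> M h k p" and M'W: "M' h k p \<subseteq> W p" if p: "p \<in> cp" for p
 proof -
  interpret P: dvr p "un p" by (rule cp_dvr[OF p])
  note n = N_stalk(1)[OF p] mm_nonzero[OF h(2), of k p] th_nonzero[of p] w_nonzero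
  have "nu p / mm h k p ~= 0" using n by simp
  hence v: "P.vord (mm h k p) \<le> P.vord (nu p)"
   using quo[OF p] P.mem_iff_vord[of "nu p / mm h k p"] P.vord_divide[OF n(1,2)] by simp
  show "N p \<subseteq> M h k p" unfolding N_stalk(2)[OF p] M_def P.principal_ideal_subset[OF n(1,2)] by (rule v)
  have nz: "th p * w * mm h k p ~= 0" "th p * w * nu p ~= 0" "th p * w ~= 0" using n by simp_all
  show "M' h k p \<subseteq> W p"
   unfolding W_dual[OF p] M'_def P.principal_ideal_subset[OF nonzero_imp_inverse_nonzero[OF nz(1)] nonzero_imp_inverse_nonzero[OF nz(2)]]
    P.vord_inverse[OF nz(1)] P.vord_inverse[OF nz(2)] P.vord_mult[OF nz(3) n(1)] P.vord_mult[OF nz(3) n(2)]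
   using v by simp
 qed
 have "M' h k p \<subseteq> M h k p" if "p \<in> Z" for p using NM M'W W_sub Z(2) that by blast
 from lagrangian_M[OF h(1,2) k Z(1-3) unit this]
 obtain L where L: "lagrangian scF (fam Z (M h k)) (fam Z (M' h k)) (\<lambda>x y. \<Sum>p\<in>Z. B p (x p) (y p)) L" by blast
 interpret L: lagrangian scF "fam Z (M h k)" "fam Z (M' h k)" "\<lambda>x y. \<Sum>p\<in>Z. B p (x p) (y p)" L by (rule L)
 let ?B = "\<lambda>x y. \<Sum>p\<in>Z. B p (x p) (y p)"
 have Bf: "bilinear_form sc (N p) (W p) (B p)" if "p \<in> Z" for p using bilinear_form_B Z(2) that by blast
 interpret NB: bilinear_form scF "fam Z N" "fam Z W" ?B by (rule bilinear_form_fam[OF Z(1) Bf])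
 have subM': "vs.subspace (M' h k p)" "vs.subspace (W p)" if "p \<in> Z" for p
  using subspace_principal_cp Z(2) that unfolding M'_def W_def by blast+
 have "\<exists>d. quot_basis sc (W p) (M' h k p) d" if "p \<in> Z" for p
 proof -
  have p: "p \<in> cp" using Z(2) that by blast
  note n = N_stalk(1)[OF p] mm_nonzero[OF h(2), of k p] th_nonzero[of p] w_nonzero
  have n1: "nu p / mm h k p ~= 0" and n2: "inverse (th p * w * nu p) ~= 0" using n by simp_all
  have "nu p / mm h k p * inverse (th p * w * nu p) = inverse (th p * w * mm h k p)" using n by (simp add: field_simps)
  moreover obtain bs where "quot_basis sc p (principal_ideal p (nu p / mm h k p)) bs"
   using finite_quotient_cp[OF p n1 quo[OF p]] by blast
  ultimately show ?thesis using quot_basis_scale[OF p n2 n1] unfolding W_dual[OF p] M'_def by metis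
 qed
 then obtain d where d: "\<And>p. p \<in> Z ==> quot_basis sc (W p) (M' h k p) (d p)" by metis
 obtain ds where ds: "quot_basis scF (fam Z W) (fam Z (M' h k)) ds"
  using quot_basis_fam[OF Z(1), of W "M' h k" d] subM' M'W d Z(2) by blast
 have dsW: "set ds \<subseteq> fam Z W" using ds unfolding quot_basis_def by blast
 have NMf: "fam Z N \<subseteq> fam Z (M h k)" using NM Z(2) unfolding fam_def by blast
 have span: "L.span (fam Z (M' h k) \<union> set ds) = fam Z W"
 proof
  show "fam Z W \<subseteq> L.span (fam Z (M' h k) \<union> set ds)" by (rule L.quot_basis_span[OF ds])
  have "fam Z (M' h k) \<subseteq> fam Z W" using M'W Z(2) unfolding fam_def by blast
  thus "L.span (fam Z (M' h k) \<union> set ds) \<subseteq> fam Z W" by (intro L.span_minimal NB.subW) (use dsW in blast)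
 qed
 \<comment> \<open>Double duality: whatever is orthogonal to \<open>W p\<close>, the dual of
   \<open>N p\<close>, lies in \<open>N p\<close>. Families concentrated at one point reduce this to
   a single \<open>p\<close>.\<close>
 have perp: "{v \<in> fam Z (M h k). \<forall>s\<in>set ds. ?B v s = 0} = fam Z N"
 proof
  show "fam Z N \<subseteq> {v \<in> fam Z (M h k). \<forall>s\<in>set ds. ?B v s = 0}" using NMf NB.rad' dsW by blast
  show "{v \<in> fam Z (M h k). \<forall>s\<in>set ds. ?B v s = 0} \<subseteq> fam Z N"
  proof
   fix v assume v: "v \<in> {v \<in> fam Z (M h k). \<forall>s\<in>set ds. ?B v s = 0}"
   hence vM: "v \<in> fam Z (M h k)" by blast
   have sub: "L.subspace {y \<in> fam Z (M h k). ?B v y = 0}"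
   proof (rule L.subspaceI)
    show "0 \<in> {y \<in> fam Z (M h k). ?B v y = 0}" using L.rad'[OF L.subspace_0[OF L.subW] vM] L.subspace_0[OF L.subV] by blast
   qed (use L.add_right[OF _ _ vM] L.scale_right[OF _ vM] L.subspace_add[OF L.subV] L.subspace_scale[OF L.subV] in auto)
   have "fam Z (M' h k) \<union> set ds \<subseteq> {y \<in> fam Z (M h k). ?B v y = 0}"
    using L.rad'[OF _ vM] L.WV v dsW NB.WV NMf by blast
   hence orth: "?B v y = 0" if "y \<in> fam Z W" for y using L.span_minimal[OF _ sub] span that by blast
   have "v p \<in> N p" if p: "p \<in> Z" for p
   proof -
    have pc: "p \<in> cp" using p Z(2) by blast
    have "B p (v p) y = 0" if y: "y \<in> W p" for y
    proof -
     have "?B v (single p y) = B p (v p) (single p y p) + (\<Sum>q\<in>Z - {p}. B q (v q) (single p y q))"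
      by (rule sum.remove[OF Z(1) p])
     also have "(\<Sum>q\<in>Z - {p}. B q (v q) (single p y q)) = 0"
     proof (rule sum.neutral, rule ballI)
      fix q assume q: "q \<in> Z - {p}"
      have "lg q (0 + 0) = lg q 0 + lg q 0" by (rule lg_add) (use q Z(2) in blast)
      hence "lg q 0 = 0" by (simp only: add_0_left add_cancel_right_right)
      hence "B q (v q) 0 = 0" unfolding B_def by simp
      thus "B q (v q) (single p y q) = 0" using q unfolding single_def by simp
     qed
     finally show ?thesis using orth[OF single_fam[of Z W, OF subM'(2) p y]] unfolding single_def by simp
    qed
    hence "v p \<in> principal_ideal p (inverse (th p * w * inverse (th p * w * nu p)))"
     using dual_iff[OF pc, of "inverse (th p * w * nu p)" "v p"] N_stalk(1)[OF pc] th_nonzero[of p] w_nonzero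
     unfolding W_dual[OF pc] by simp
    moreover have "inverse (th p * w * inverse (th p * w * nu p)) = nu p"
     using N_stalk(1)[OF pc] th_nonzero[of p] w_nonzero by (simp add: field_simps)
    ultimately show ?thesis unfolding N_stalk(2)[OF pc] by (simp only:)
   qed
   thus "v \<in> fam Z N" using vM unfolding fam_def by blast
  qed
 qed
 have "?B s t = 0" if "s \<in> set ds" "t \<in> set ds" for s t using NB.rad dsW NB.WV that by blast
 moreover have "set ds \<subseteq> fam Z (M h k)" using dsW NB.WV NMf by blast
 ultimately obtain L' where L': "lagrangian scF (fam Z N) (fam Z W) ?B L'"
  using L.reduce[of "set ds"] unfolding span perp by blast
 have bZ: "quot_basis sc (N p) (W p) (b p)" if "p \<in> Z" for p using b Z(2) that by blast
 obtain bs where bs: "quot_basis scF (fam Z N) (fam Z W) bs" "length bs = (\<Sum>p\<in>Z. length (b p))"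
  "gw_class (gram ?B bs) = (\<Sum>p\<in>Z. gw_class (gram (B p) (b p)))"
 proof -
  have "vs.subspace (N p)" "W p \<subseteq> N p" if "p \<in> Z" for p
   using bilinear_form.subV[OF Bf[OF that]] bilinear_form.WV[OF Bf[OF that]] by blast+
  from quot_basis_fam[where Z = Z and V = N and W = W and b = b, OF Z(1) this(1) subM'(2) this(2) bZ] that Bf
  show ?thesis by blast
 qed
 have triv: "b p = []" if "p \<in> Z - zeros C E sg" for p
 proof -
  have p: "p \<in> cp" "sg / ee p \<notin> max_ideal p" using that Z(2) zeros_iff by blast+
  interpret P: dvr p "un p" by (rule cp_dvr[OF p(1)])
  note n = N_stalk[OF p(1)] ee_nonzero[OF p(1)] sec(2)
  have q: "sg / ee p ~= 0" "sg / ee p * nu p ~= 0" using n by simp_all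
  hence "P.vord (sg / ee p) = 0" using P.unit_iff_vord sg_stalk[OF p(1)] p(2) by blast
  hence "W p = N p" unfolding W_def n(2) P.principal_ideal_eq[OF q(2) n(1)] P.vord_mult[OF q(1) n(1)] by simp
  hence "quot_basis sc (W p) (W p) (b p)" using b[OF p(1)] by simp
  moreover have s: "vs.subspace (W p)" unfolding W_def by (rule subspace_principal_cp[OF p(1)])
  ultimately have "length (b p) = length ([] :: 'k list)" using vs.quot_basis_length vs.quot_basis_Nil by blast
  thus ?thesis by simp
 qed
 have len: "length bs = (\<Sum>p\<in>zeros C E sg. length (b p))"
  unfolding bs(2) by (rule sum.mono_neutral_right[OF Z(1,4)]) (use triv in simp)
 have "(\<Sum>p\<in>Z. gw_class (gram (B p) (b p))) = (\<Sum>p\<in>zeros C E sg. gw_class (gram (B p) (b p)))"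
  by (rule sum.mono_neutral_right[OF Z(1,4)]) (use triv in "simp add: gram_Nil gw_class_empty")
 also have "\<dots> = (\<Sum>p\<in>zeros C E sg. local_index C E N c sg p)"
  by (rule sum.cong[OF refl], rule local_index_eq(2)[symmetric]) (use b Z(2,4) in blast)+
 finally show ?thesis using lagrangian_hyperbolic[OF two L' bs(1)] bs(3) len by simp
qed

text \<open>Relative to the affine generator, a power of \<open>1/(2y)\<close>, the section is a
  function \<open>s\<close> in \<open>R\<close>, whose affine zeros are counted by its pole order at
  infinity. Adding the order of the section at infinity makes the section cancel, and only the two
  generators remain.\<close>

lemma length_sum:
 assumes fin: "finite (zeros C E sg)" and b: "\<And>p. p \<in> cp ==> quot_basis sc (N p) (W p) (b p)"
  and ee: "\<And>p. p \<in> cp ==> ee p = eg n m p"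
 shows "int (\<Sum>p\<in>zeros C E sg. length (b p)) = int n * int m + int (n choose 2) * (2 * int g - 2)"
proof -
 let ?K = "int (n choose 2)" and ?ep = "inverse (2 * yc) ^ (n choose 2)"
 define s where "s = sg / ?ep"
 have ep0: "?ep ~= 0" using two_k Y_nonzero by simp
 have s0: "s ~= 0" unfolding s_def using sec(2) ep0 by simp
 have sp: "sg / ee p = s" if "p \<in> pts" for p unfolding s_def ee[OF pts_cp[OF that]] eg_pts[OF that] ..
 have sR: "s \<in> R" by (rule R_eq) (use sg_stalk sp pts_cp in metis)
 have len: "length (b p) = length bs" if p: "p \<in> cp" and bs: "quot_basis sc p (principal_ideal p (sg / ee p)) bs" for p bs
 proof -
  note n = N_stalk[OF p] ee_nonzero[OF p] sec(2)
  have "sg / ee p ~= 0" using n by simp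
  from quot_basis_scale[OF p n(1) this bs] have "quot_basis sc (N p) (W p) (map (\<lambda>a. nu p * a) bs)"
   unfolding W_def n(2) .
  from vs.quot_basis_length[OF _ b[OF p] this] show ?thesis using subspace_principal_cp[OF p] unfolding W_def by simp
 qed
 have q: "sg / ee p ~= 0" if "p \<in> cp" for p using ee_nonzero[OF that] sec(2) by simp
 have "\<exists>d. quot_basis sc p (principal_ideal p (sg / ee p)) d" if "p \<in> cp" for p
  by (rule finite_quotient_cp[OF that q[OF that] sg_stalk[OF that]])
 then obtain d where d: "\<And>p. p \<in> cp ==> quot_basis sc p (principal_ideal p (sg / ee p)) (d p)" by metis
 have ld: "length (b p) = length (d p)" if "p \<in> cp" for p by (rule len[OF that d[OF that]])
 define Zf where "Zf = {p. p \<in> pts \<and> s \<in> idl p}"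
 have Zf: "zeros C E sg - {inf.p} = Zf"
  unfolding Zf_def idl_def using zeros_iff sp sR inf_notin_pts unfolding cp_def by auto
 have finZf: "finite Zf" using fin unfolding Zf[symmetric] by simp
 obtain bs where bs: "quot_basis sc R (principal_ideal R s) bs"
  using R_quot[OF sR s0 s_ideal_subspace[OF s_ideal_principal[OF sR]] subspace_R] s_ideal_principal[OF sR]
  unfolding s_ideal_def by blast
 have "length bs = (\<Sum>p | p \<in> pts \<and> s \<in> idl p. length (d p))"
  by (rule length_quot[OF sR s0 bs]) (use d pts_cp sp in metis)
 hence aff: "int (\<Sum>p\<in>Zf. length (d p)) = - inf.vord s" using length_quot_R[OF sR s0 bs] unfolding Zf_def by simp
 \<comment> \<open>The residue field at infinity is \<open>F\<close>, so each further power of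
   \<open>v\<close> adds one dimension.\<close>
 have step: "\<exists>bs. quot_basis sc inf.p (principal_ideal inf.p (v ^ j)) bs \<and> length bs = j" for j
 proof (induction j)
  case 0
  have "quot_basis sc inf.p inf.p []" using vs.quot_basis_Nil inf.subspace_principal[of 1] unfolding inf.principal_ideal_one by blast
  thus ?case by (simp add: inf.principal_ideal_one)
 next
  case (Suc j)
  then obtain bs where bs: "quot_basis sc inf.p (principal_ideal inf.p (v ^ j)) bs" "length bs = j" by blast
  have vj: "v ^ j ~= 0" using v_nonzero by simp
  have "quot_basis sc inf.p (principal_ideal inf.p v) [1]" using quot_basis_inf unfolding inf.max_ideal_eq pi_inf .
  from quot_basis_scale[OF inf_cp vj v_nonzero this]
  have 1: "quot_basis sc (principal_ideal inf.p (v ^ j)) (principal_ideal inf.p (v ^ Suc j)) [v ^ j]" by simp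
  have "principal_ideal inf.p (v ^ Suc j) \<subseteq> principal_ideal inf.p (v ^ j)"
   using v_nonzero by (simp add: inf.principal_ideal_subset inf.vord_mult inf.vord_power vord_v)
  moreover have "principal_ideal inf.p (v ^ j) \<subseteq> inf.p"
   using v_nonzero inf.principal_ideal_subset[of "v ^ j" 1] inf.vord_power[OF v_nonzero, of j] inf.unit_iff_vord[of 1] inf.one_mem inf.one_not_max
   by (simp add: inf.principal_ideal_one vord_v)
  ultimately have "quot_basis sc inf.p (principal_ideal inf.p (v ^ Suc j)) (bs @ [v ^ j])"
   using vs.quot_basis_tower[OF inf.subspace_principal bs(1) 1 _ _ inf.subspace_principal] by blast
  thus ?case using bs(2) by (intro exI[of _ "bs @ [v ^ j]"]) simp
 qed
 have ldi: "int (length (d inf.p)) = inf.vord (sg / ee inf.p)"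
 proof -
  let ?s = "sg / ee inf.p"
  have p: "?s \<in> inf.p" "?s ~= 0" using sg_stalk[OF inf_cp] q[OF inf_cp] by blast+
  have "principal_ideal inf.p ?s = principal_ideal inf.p (v ^ nat (inf.vord ?s))"
   using inf.principal_eq_pi[OF p(2,1)] unfolding pi_inf .
  moreover obtain bs where "quot_basis sc inf.p (principal_ideal inf.p (v ^ nat (inf.vord ?s))) bs" "length bs = nat (inf.vord ?s)"
   using step by blast
  ultimately have "length (d inf.p) = nat (inf.vord ?s)"
   using vs.quot_basis_length[OF inf.subspace_principal d[OF inf_cp]] by metis
  thus ?thesis using p inf.mem_iff_vord by simp
 qed
 have di: "length (d inf.p) = 0" if "inf.p \<notin> zeros C E sg"
 proof -
  have "sg / ee inf.p \<notin> minf" using that zeros_iff inf_cp by blast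
  hence "inf.vord (sg / ee inf.p) = 0" using inf.unit_iff_vord[OF q[OF inf_cp]] sg_stalk[OF inf_cp] by blast
  thus ?thesis using ldi by simp
 qed
 have zc: "zeros C E sg \<subseteq> cp" using zeros_iff by blast
 have "(\<Sum>p\<in>zeros C E sg. length (b p)) = (\<Sum>p\<in>zeros C E sg. length (d p))"
  by (rule sum.cong[OF refl]) (use zc ld in blast)
 also have "\<dots> = (\<Sum>p\<in>insert inf.p (zeros C E sg). length (d p))"
  using fin di by (cases "inf.p \<in> zeros C E sg") (simp_all add: insert_absorb)
 also have "\<dots> = length (d inf.p) + (\<Sum>p\<in>Zf. length (d p))"
  using fin unfolding Zf[symmetric] by (subst sum.insert_remove) simp_all
 finally have "int (\<Sum>p\<in>zeros C E sg. length (b p)) = inf.vord (sg / ee inf.p) - inf.vord s" using ldi aff by simp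
 also have "\<dots> = inf.vord ?ep - inf.vord (ee inf.p)"
  unfolding s_def inf.vord_divide[OF sec(2) ep0] inf.vord_divide[OF sec(2) ee_nonzero[OF inf_cp]] by simp
 also have "inf.vord ?ep = ?K * (2 * int g + 1)"
 proof -
  have nz: "2 * yc ~= 0" "inverse (2 * yc) ~= 0" using two_k Y_nonzero by simp_all
  have "inf.vord 2 = 0" using inf.vord_em[OF two] unfolding em_2 .
  thus ?thesis
   unfolding inf.vord_power[OF nz(2)] inf.vord_inverse[OF nz(1)] inf.vord_mult[OF two_k Y_nonzero] vord_y by simp
 qed
 also have "inf.vord (ee inf.p) = 3 * ?K - int n * int m" unfolding ee[OF inf_cp] by (rule vord_eg_inf)
 finally show ?thesis by (simp add: algebra_simps)
qed

end

context hyp_model begin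

text \<open>An isolated section is nonzero, because the zero section vanishes at infinitely many
  points; \<open>index_sum\<close> and \<open>length_sum\<close> then apply to it, whichever it
  is.\<close>

lemma is_euler_class_hyperbolic:
 assumes E: "\<And>p. p \<in> cp ==> E p = principal_ideal p (eg n m p)" and or: "relative_orientation C E N c"
  and sec: "sg0 ~= 0" "sg0 \<in> H0 C E"
  and gm: "int n * int m + int (n choose 2) * (2 * int g - 2) = int gm"
 shows "is_euler_class C E N c (\<Sum>i<gm div 2. hyperbolic)"
proof -
 have os: "oriented_section em xc yc f g D C Ph E N c (eg n m) sg" if "sg \<in> H0 C E" "sg ~= 0" for sg
  by (unfold_locales) (use E or that eg_nonzero in auto)
 have "finite (zeros C E sg0)"
 proof -
  interpret S: oriented_section em xc yc f g D C Ph E N c "eg n m" sg0 by (rule os[OF sec(2,1)])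
  let ?s = "sg0 / inverse (2 * yc) ^ (n choose 2)"
  have "?s ~= 0" using sec two_k Y_nonzero by simp
  moreover have "zeros C E sg0 \<subseteq> insert inf.p {q \<in> cp. \<not> (?s \<in> q \<and> inverse ?s \<in> q)}"
  proof
   fix p assume p: "p \<in> zeros C E sg0"
   show "p \<in> insert inf.p {q \<in> cp. \<not> (?s \<in> q \<and> inverse ?s \<in> q)}"
   proof (cases "p = inf.p")
    case False
    hence pp: "p \<in> pts" "p \<in> cp" using p S.zeros_iff unfolding cp_def by blast+
    have "?s \<in> max_ideal p" using p S.zeros_iff eg_pts[OF pp(1)] by simp
    thus ?thesis using dvr.max_ideal_iff[OF cp_dvr[OF pp(2)], of ?s] \<open>?s ~= 0\<close> pp(2) by blast
   qed blast
  qed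
  ultimately show ?thesis using finite_bad by (meson finite_insert finite_subset)
 qed
 hence "isolated_section C E sg0" unfolding isolated_section_def using sec by blast
 moreover have "(\<forall>p \<in> zeros C E sg. \<exists>!aa. is_local_index C E N c sg p aa) \<and>
   (\<Sum>p \<in> zeros C E sg. local_index C E N c sg p) = (\<Sum>i<gm div 2. hyperbolic)"
  if "isolated_section C E sg" for sg
 proof -
  have sg: "sg \<in> H0 C E" "finite (zeros C E sg)" using that unfolding isolated_section_def by blast+
  have "sg ~= 0"
  proof
   assume "sg = 0"
   have "pts \<subseteq> zeros C E sg"
   proof
    fix p assume "p \<in> pts"
    hence p: "p \<in> cp" by (rule pts_cp)
    interpret P: dvr p "un p" by (rule cp_dvr[OF p])
    have "tensor max_ideal E p = principal_ideal p (un p * eg n m p)"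
     by (rule P.tensor_principal) (rule P.max_ideal_eq E[OF p])+
    moreover have "0 \<in> principal_ideal p (un p * eg n m p)" using P.principal_submod unfolding submod_closed_def by blast
    ultimately show "p \<in> zeros C E sg" unfolding zeros_def closed_points_eq \<open>sg = 0\<close> using p by blast
   qed
   thus False using sg(2) infinite_pts finite_subset by blast
  qed
  then interpret S: oriented_section em xc yc f g D C Ph E N c "eg n m" sg by (rule os[OF sg(1)])
  obtain b where b: "\<And>p. p \<in> cp ==> quot_basis sc (N p) (S.W p) (b p)" using S.W_basis by metis
  have "p \<in> cp" if "p \<in> zeros C E sg" for p using that S.zeros_iff by blast
  hence "\<forall>p \<in> zeros C E sg. \<exists>!aa. is_local_index C E N c sg p aa" using S.local_index_eq(1) b by blast
  moreover have "(\<Sum>p\<in>zeros C E sg. length (b p)) = gm"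
   using S.length_sum[OF sg(2) b refl] unfolding gm by (simp only: of_nat_eq_iff)
  ultimately show ?thesis using S.index_sum[OF sg(2) b] by (simp only: simp_thms)
 qed
 ultimately show ?thesis unfolding is_euler_class_def by blast
qed

end

section \<open>The inflection class\<close>

context hyp_model begin

text \<open>\<open>Hom(T, E)\<close> is generated on the affine part by a power of
  \<open>1/(2y)\<close> and has degree \<open>gm + 2 g - 2\<close>. Multiplication by the inverse
  power makes it \<open>O(2e infinity)\<close> with \<open>e\<close> half this degree, an integer as
  \<open>gm\<close> is even.\<close>

lemma orientation_exists:
 assumes E: "\<And>p. p \<in> cp ==> E p = principal_ideal p (eg n m p)"
  and gm: "int n * int m + int (n choose 2) * (2 * int g - 2) = int gm" "even gm"
 shows "\<exists>N c. relative_orientation C E N c"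
proof -
 let ?K = "n choose 2"
 define e where "e = gm div 2 + (g - 1)"
 define N where "N p = (if p = inf.p then principal_ideal inf.p (inverse (v ^ e)) else p)" for p
 have ve: "inverse (v ^ e) ~= 0" "v ^ e ~= 0" using v_nonzero by simp_all
 have Npts: "N p = principal_ideal p 1" if "p \<in> pts" for p
  using pts_simps[OF that] dvr.principal_ideal_one[OF pts_dvr[OF that]] unfolding N_def by simp
 have open_pts: "open_subset C pts"
 proof -
  have "cp - pts \<subseteq> {inf.p}" unfolding cp_def by blast
  thus ?thesis unfolding open_subset_def closed_points_eq using finite_subset pts_cp by blast
 qed
 have "line_bundle C N"
  unfolding line_bundle_def closed_points_eq
 proof
  fix p assume "p \<in> cp"
  show "\<exists>U s. open_subset C U \<and> p \<in> U \<and> generates_on N U s"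
  proof (cases "p = inf.p")
   case False
   hence "p \<in> pts" using \<open>p \<in> cp\<close> unfolding cp_def by blast
   moreover have "generates_on N pts 1" unfolding generates_on_def using Npts unfolding principal_ideal_def by simp
   ultimately show ?thesis using open_pts by blast
  next
   case True
   define U where "U = insert inf.p {q \<in> cp. v \<in> q \<and> inverse v \<in> q}"
   have "cp - U \<subseteq> {q \<in> cp. \<not> (v \<in> q \<and> inverse v \<in> q)}" unfolding U_def by blast
   hence "finite (cp - U)" using finite_bad[OF v_nonzero] finite_subset by blast
   hence "open_subset C U" unfolding open_subset_def closed_points_eq U_def using inf_cp by blast
   moreover have "N q = principal_ideal q (inverse (v ^ e))" if "q \<in> U" for q
   proof (cases "q = inf.p")
    case False
    hence q: "q \<in> pts" "q \<in> cp" "v \<in> q" "inverse v \<in> q" using that unfolding U_def cp_def by blast+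
    interpret Q: dvr q "unif q" by (rule pts_dvr[OF q(1)])
    have "v \<notin> max_ideal q" unfolding Q.max_ideal_iff using q(4) v_nonzero by blast
    hence "Q.vord v = 0" using Q.unit_iff_vord[OF v_nonzero] q(3) by (simp only: simp_thms)
    hence "Q.vord (inverse (v ^ e)) = 0" unfolding Q.vord_inverse[OF ve(2)] Q.vord_power[OF v_nonzero] by simp
    moreover have "Q.vord 1 = 0" using Q.unit_iff_vord[of 1] Q.one_mem Q.one_not_max by simp
    ultimately show ?thesis unfolding Npts[OF q(1)] by (subst Q.principal_ideal_eq) (use ve in simp_all)
   qed (simp add: N_def)
   hence "generates_on N U (inverse (v ^ e))" unfolding generates_on_def principal_ideal_def using ve by blast
   ultimately show ?thesis using True unfolding U_def by blast
  qed
 qed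
 moreover have "bundle_iso C (hom_sheaf (tangent C) E) (tensor N N) ((2 * yc) ^ Suc ?K)"
  unfolding bundle_iso_def closed_points_eq
 proof (intro conjI ballI)
  have y: "2 * yc ~= 0" using two_k Y_nonzero by simp
  thus "(2 * yc) ^ Suc ?K ~= 0" by simp
  fix p assume p: "p \<in> cp"
  interpret P: dvr p "un p" by (rule cp_dvr[OF p])
  have "hom_sheaf (tangent C) E p = principal_ideal p (eg n m p / ta p)"
   by (rule P.hom_sheaf_principal) (rule tangent_stalk_cp[OF p] E[OF p] eg_nonzero ta_nonzero)+
  hence im: "(\<lambda>h. (2 * yc) ^ Suc ?K * h) ` hom_sheaf (tangent C) E p
   = principal_ideal p ((2 * yc) ^ Suc ?K * (eg n m p / ta p))" by (simp only: P.image_principal)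
  show "(\<lambda>h. (2 * yc) ^ Suc ?K * h) ` hom_sheaf (tangent C) E p = tensor N N p"
  proof (cases "p = inf.p")
   case False
   hence pp: "p \<in> pts" using p unfolding cp_def by blast
   have "tensor N N p = principal_ideal p (1 * 1)" by (rule P.tensor_principal) (rule Npts[OF pp])+
   moreover have "(2 * yc) ^ Suc ?K * (eg n m p / ta p) = 1 * 1"
   proof -
    have "a ^ Suc j * (inverse a ^ j / a) = 1 * 1" if "a ~= 0" for a :: 'k and j
     using that by (simp add: field_simps)
    from this[OF y] show ?thesis unfolding eg_pts[OF pp] using pts_simps[OF pp] by (simp only:)
   qed
   ultimately show ?thesis unfolding im by (simp only:)
  next
   case True
   have i: "N inf.p = principal_ideal inf.p (inverse (v ^ e))" unfolding N_def by simp
   have t: "tensor N N inf.p = principal_ideal inf.p (inverse (v ^ e) * inverse (v ^ e))"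
    by (rule inf.tensor_principal) (rule i)+
   have nz: "(2 * yc) ^ Suc ?K ~= 0" "eg n m inf.p / ta inf.p ~= 0" "inverse (v ^ e) * inverse (v ^ e) ~= 0"
    using y eg_nonzero ta_nonzero ve by simp_all
   have "inf.vord 2 = 0" using inf.vord_em[OF two] unfolding em_2 .
   hence "inf.vord ((2 * yc) ^ Suc ?K * (eg n m inf.p / ta inf.p))
    = - (int ?K + 1) * (2 * int g + 1) + (3 * int ?K - int n * int m + 3)"
    unfolding inf.vord_mult[OF nz(1,2)] inf.vord_divide[OF eg_nonzero ta_nonzero] inf.vord_power[OF y]
     inf.vord_mult[OF two_k Y_nonzero] vord_y vord_eg_inf vord_ta_inf by (simp add: algebra_simps)
   also have "\<dots> = - (int gm + 2 * int g - 2)" unfolding gm(1)[symmetric] by (simp add: algebra_simps)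
   also have "\<dots> = - (2 * int e)" using gm(2) g_pos unfolding e_def by (auto elim!: evenE simp: of_nat_diff)
   also have "\<dots> = inf.vord (inverse (v ^ e) * inverse (v ^ e))"
    unfolding inf.vord_mult[OF ve(1) ve(1)] inf.vord_inverse[OF ve(2)] inf.vord_power[OF v_nonzero] vord_v by simp
   finally show ?thesis unfolding im unfolding True t using nz by (subst inf.principal_ideal_eq) auto
  qed
 qed
 ultimately show ?thesis unfolding relative_orientation_def by blast
qed

text \<open>The affine generator of \<open>E\<close> is itself a global section: it has no affine
  zeros and vanishes at infinity to order \<open>gm\<close>.\<close>

lemma section_exists:
 assumes E: "\<And>p. p \<in> cp ==> E p = principal_ideal p (eg n m p)"
  and gm: "int n * int m + int (n choose 2) * (2 * int g - 2) = int gm"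
 shows "inverse (2 * yc) ^ (n choose 2) \<in> H0 C E"
proof -
 let ?sg = "inverse (2 * yc) ^ (n choose 2)"
 have y: "2 * yc ~= 0" "inverse (2 * yc) ~= 0" "?sg ~= 0" using two_k Y_nonzero by simp_all
 have "?sg \<in> E p" if p: "p \<in> cp" for p
 proof (cases "p = inf.p")
  case False
  hence pp: "p \<in> pts" using p unfolding cp_def by blast
  have "?sg * 1 \<in> E p" unfolding E[OF p] eg_pts[OF pp] principal_ideal_def using dvr.one_mem[OF cp_dvr[OF p]] by blast
  thus ?thesis by simp
 next
  case True
  have "inf.vord 2 = 0" using inf.vord_em[OF two] unfolding em_2 .
  hence "inf.vord ?sg - inf.vord (eg n m inf.p) = int gm"
   unfolding inf.vord_power[OF y(2)] inf.vord_inverse[OF y(1)] inf.vord_mult[OF two_k Y_nonzero] vord_y vord_eg_inf gm[symmetric]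
   by (simp add: algebra_simps)
  hence "inf.vord (eg n m inf.p) \<le> inf.vord ?sg" by simp
  thus ?thesis unfolding True E[OF inf_cp] inf.principal_ideal_vord[OF eg_nonzero] by (rule disjI2)
 qed
 thus ?thesis unfolding H0_def sections_on_def closed_points_eq by blast
qed

lemma inflection_class:
 assumes L: "L = O_infty C (2 * l)" and n: "n = h0 C L"
 shows "is_inflection_class C L (\<Sum>i < gamma_C g l div 2. hyperbolic)"
  and "bundle_degree C (tensor (tensor_pow L n) (tensor_pow (canonical C) (n choose 2))) = int (gamma_C g l)"
proof -
 have n': "n = 2 * l div 2 + 1 + (2 * l + 1 - 2 * g) div 2" unfolding n L by (rule h0_O_infty)
 note gm = gamma_C_eq[OF g_pos n']
 have E: "inflection_bundle C L p = principal_ideal p (eg n (2 * l) p)" if "p \<in> cp" for p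
  using det_principal_parts_stalk[OF that, of n "2 * l"] unfolding inflection_bundle_def n[symmetric] unfolding L .
 have sg: "inverse (2 * yc) ^ (n choose 2) ~= 0" using two_k Y_nonzero by simp
 show "is_inflection_class C L (\<Sum>i < gamma_C g l div 2. hyperbolic)"
  unfolding is_inflection_class_def
  using orientation_exists[OF E gm gamma_C_even] is_euler_class_hyperbolic[OF E _ sg section_exists[OF E gm] gm] by blast
 show "bundle_degree C (tensor (tensor_pow L n) (tensor_pow (canonical C) (n choose 2))) = int (gamma_C g l)"
  using degree_eg[OF pluecker_stalk] gm unfolding L by simp
qed

end

text \<open>An element of least degree in the ideal of \<open>a\<close> and \<open>b\<close> divides
  both. If it were not constant, it would have a root in the algebraic closure, common to
  both.\<close>

lemma coprime_of_no_common_root: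
 fixes a b :: "'a::field poly"
 assumes "a ~= 0" and root: "\<And>z :: 'a alg_closure. poly (map_poly to_ac a) z = 0 ==> poly (map_poly to_ac b) z ~= 0"
 shows "\<exists>u w. u * a + w * b = 1"
proof -
 define J where "J = {u * a + w * b |u w. True}"
 have "1 * a + 0 * b \<in> J" unfolding J_def by blast
 hence "\<exists>d. d \<in> J \<and> d ~= 0" using assms(1) by auto
 from exists_least_lemma[of "\<lambda>n. \<exists>d. d \<in> J \<and> d ~= 0 \<and> degree d = n"] this
 obtain d where d: "d \<in> J" "d ~= 0" "\<And>d'. d' \<in> J ==> d' ~= 0 ==> degree d \<le> degree d'"
  using ex_has_least_nat[of "\<lambda>d. d \<in> J \<and> d ~= 0" _ degree] by metis
 obtain u w where uw: "d = u * a + w * b" using d(1) unfolding J_def by blast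
 have dvd: "d dvd s" if s: "s \<in> J" for s
 proof (rule ccontr)
  assume "\<not> d dvd s"
  hence nz: "s mod d ~= 0" by (simp add: mod_eq_0_iff_dvd)
  obtain u' w' where "s = u' * a + w' * b" using s unfolding J_def by blast
  hence "s mod d = (u' - s div d * u) * a + (w' - s div d * w) * b"
   unfolding minus_div_mult_eq_mod[symmetric] uw by (simp add: algebra_simps)
  hence "s mod d \<in> J" unfolding J_def by blast
  from d(3)[OF this nz] show False using degree_mod_less[OF d(2), of s] nz by auto
 qed
 have "0 * a + 1 * b \<in> J" unfolding J_def by blast
 hence db: "d dvd b" using dvd by simp
 have da: "d dvd a" using dvd[OF \<open>1 * a + 0 * b \<in> J\<close>] by simp
 have "degree d = 0"
 proof (rule ccontr)
  assume "degree d ~= 0"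
  have "degree (map_poly (to_ac :: 'a => 'a alg_closure) d) = degree d"
   by (rule degree_map_poly) (use \<open>degree d ~= 0\<close> in auto)
  then obtain z :: "'a alg_closure" where z: "ac.ev d z = 0"
   using alg_closed_imp_poly_has_root[of "map_poly to_ac d"] \<open>degree d ~= 0\<close> unfolding ac.ev_def by auto
  obtain a' b' where "a = d * a'" "b = d * b'" using da db by (elim dvdE)
  hence "ac.ev a z = 0" "ac.ev b z = 0" using z by (simp_all add: ac.ev_mult)
  thus False using root unfolding ac.ev_def by blast
 qed
 then obtain e where e: "d = [:e:]" "e ~= 0" using degree_eq_zeroE d(2) by (metis pCons_0_0)
 have "smult (inverse e) u * a + smult (inverse e) w * b = smult (inverse e) d"
  unfolding uw by (simp add: smult_add_right)
 also have "\<dots> = 1" using e by (simp add: one_pCons)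
 finally show ?thesis by blast
qed

lemma hyp_model_exists:
 fixes C :: "('a::field, 'k::field) hyp_curve"
 assumes char: "CHAR('a) ~= 2" and C: "hyperelliptic_curve C"
 shows "\<exists>D Ph. hyp_model (emb C) (xf C) (yf C) (rhs C) (genus C) D C Ph"
proof -
 interpret field_ext "emb C" by unfold_locales (use C in "simp_all add: hyperelliptic_curve_def")
 have ev: "evalp C q h = ev q h" for q h unfolding evalp_def ev_def ..
 have transc: "\<And>q. q ~= 0 ==> ev q (xf C) ~= 0" and Ysq: "yf C ^ 2 = ev (rhs C) (xf C)"
  and gen: "\<And>h. \<exists>a b c. c ~= 0 \<and> h = (ev a (xf C) + ev b (xf C) * yf C) / ev c (xf C)"
  and deg: "degree (rhs C) = 2 * genus C + 1" "1 \<le> genus C"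
  and smooth: "\<And>a b :: 'a alg_closure. b ^ 2 = poly (map_poly to_ac (rhs C)) a ==>
    2 * b ~= 0 \<or> poly (pderiv (map_poly to_ac (rhs C))) a ~= 0"
  using C unfolding hyperelliptic_curve_def ev by blast+
 have two: "(2::'a) ~= 0"
 proof
  assume "(2::'a) = 0"
  hence "(of_nat 2 :: 'a) = 0" by simp
  hence "CHAR('a) dvd 2" by (simp only: of_nat_eq_0_iff_char_dvd)
  hence "CHAR('a) = 1 \<or> CHAR('a) = 2" using two_is_prime_nat prime_nat_iff by blast
  thus False using char CHAR_not_1 by auto
 qed
 \<comment> \<open>Squaring gives \<open>a^2 = b^2 f\<close>, impossible for nonzero
   \<open>b\<close> because \<open>f\<close> has odd degree.\<close>
 have indep: "a = 0 \<and> b = 0" if "ev a (xf C) + ev b (xf C) * yf C = 0" for a b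
 proof -
  have "ev a (xf C) = - (ev b (xf C) * yf C)" using that by (simp add: eq_neg_iff_add_eq_0)
  hence "ev a (xf C) ^ 2 = ev b (xf C) ^ 2 * yf C ^ 2" by (simp add: power_mult_distrib)
  hence "ev (a ^ 2 - b ^ 2 * rhs C) (xf C) = 0" unfolding Ysq by (simp add: ev_diff ev_mult ev_power)
  hence e: "a ^ 2 = b ^ 2 * rhs C" using transc by (metis right_minus_eq)
  have b: "b = 0"
  proof (rule ccontr)
   assume b: "b ~= 0"
   have f0: "rhs C ~= 0" using deg(1) by auto
   hence "a ~= 0" using e b by auto
   hence "2 * degree a = 2 * degree b + (2 * genus C + 1)"
    using arg_cong[OF e, of degree] b f0 by (simp add: degree_mult_eq degree_power_eq deg(1))
   thus False by presburger
  qed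
  thus ?thesis using e by simp
 qed
 interpret chart "emb C" "xf C" "yf C" "rhs C" by unfold_locales (use transc Ysq gen two indep in blast)+
 have "\<exists>u w. u * rhs C + w * pderiv (rhs C) = 1"
 proof (rule coprime_of_no_common_root)
  show "rhs C ~= 0" using deg(1) by auto
  fix z :: "'a alg_closure" assume "poly (map_poly to_ac (rhs C)) z = 0"
  \<comment> \<open>The geometric point \<open>(z, 0)\<close> lies on the curve, and with second
    coordinate zero the Jacobian criterion leaves only this alternative.\<close>
  hence "poly (pderiv (map_poly to_ac (rhs C))) z ~= 0" using smooth[of 0 z] by simp
  moreover have "pderiv (map_poly to_ac (rhs C)) = map_poly (to_ac :: 'a => 'a alg_closure) (pderiv (rhs C))"
   by (rule poly_eqI) (simp add: coeff_pderiv coeff_map_poly del: of_nat_Suc)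
  ultimately show "poly (map_poly to_ac (pderiv (rhs C))) z ~= 0" by simp
 qed
 then interpret affine_curve "emb C" "xf C" "yf C" "rhs C" by unfold_locales
 obtain Ph where Ph: "taylor_hom Ph" "Ph (xf C) = fps_const (xf C) + fps_X" using taylor_hom_exists by blast
 define D where "D = (\<lambda>a. 2 * yf C * fps_nth (Ph a) 1)"
 have "derivation (emb C) D" unfolding D_def by (rule derivation_scale[OF taylor_hom_derivation[OF Ph(1)]])
 moreover have "D (xf C) = 2 * yf C" unfolding D_def Ph(2) by simp
 ultimately have "hyp_model (emb C) (xf C) (yf C) (rhs C) (genus C) D C Ph"
  by unfold_locales (use deg Ph D_def in auto)
 thus ?thesis by blast
qed

theorem corollary2p7:
  fixes C :: "('a::field, 'k::field) hyp_curve" and l :: nat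
  assumes "CHAR('a) \<noteq> 2"
    and "hyperelliptic_curve C"
    and "l \<ge> 1"
    and "finite (inflection_points C (O_infty C (2 * l)))"
  shows "is_inflection_class C (O_infty C (2 * l))
           (\<Sum>i < gamma_C (genus C) l div 2. hyperbolic)
         \<and> even (gamma_C (genus C) l)
         \<and> (let L = O_infty C (2 * l); n = h0 C L in
              bundle_degree C (tensor (tensor_pow L n) (tensor_pow (canonical C) (n choose 2)))
                = int (gamma_C (genus C) l))"
proof -
 obtain D Ph where "hyp_model (emb C) (xf C) (yf C) (rhs C) (genus C) D C Ph"
  using hyp_model_exists[OF assms(1,2)] by blast
 then interpret hyp_model "emb C" "xf C" "yf C" "rhs C" "genus C" D C Ph .
 show ?thesis using inflection_class[OF refl refl, of l] gamma_C_even by (simp add: Let_def)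
qed

end
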